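(* Let $R$ be a semi-semiperfect ring, and let $V_1,\dots,V_k$ be an ordered set of representatives of the isomorphism classes of simple right $R$-modules. For $i=1,\dots,k$, let $P_i$ be a finitely generated projective right $R$-module such that $\Phi(\mathrm{Tr}(P_i))=\{i\}$. For any $J\in\mathcal{T}$ fix a finite set $G_J$ of projective right $R$-modules such that $\overline{G_J}=\{Q/QJ\mid Q\in G_J\}$ generates $V(R/J)$. Let $P$ be a countably generated projective right $R$-module, let $X=\mathrm{inf\text{-}supp}(\dim_\varphi(\langle P\rangle))$, and let $I$ be a trace ideal (that is, $I\in\mathcal{T}$) such that $\Phi(I)=X$. Then $$P\cong \Big(\bigoplus_{i\in X}P_i^{(\omega_0)}\Big)\oplus\Big(\bigoplus_{Q\in G_I}Q^{n_Q}\Big)$$ where, for any $Q\in G_I$, $n_Q\in\mathbb{N}_0$. In particular, $V^*(R)$ is finitely generated by $P_1^{(\omega_0)},\dots,P_k^{(\omega_0)}$ and $\bigcup_{I\in\mathcal{T}}G_I$.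
   Context: Rings are associative with $1$; $J(R)$ is the Jacobson radical. A ring $R$ is semilocal if $R/J(R)$ is semisimple artinian. It is semi-semiperfect if it is semilocal and for any simple right $R$-module $V$ there exist $n_V\in\mathbb{N}=\{1,2,\dots\}$ and a finitely generated projective right $R$-module $P$ such that $P/PJ(R)\cong V^{n_V}$. $V(R)$ (resp. $V^*(R)$) is the commutative monoid of isomorphism classes $\langle P\rangle$ of finitely generated (resp. countably generated) projective right $R$-modules, with addition induced by the direct sum; when modules are said to generate such a monoid, their isomorphism classes are meant. $P^{(\omega_0)}$ is the direct sum of countably infinitely many copies of $P$. $\mathbb{N}_0=\{0,1,2,\dots\}$ and $\mathbb{N}_0^*=\mathbb{N}_0\cup\{\infty\}$ with $\infty+x=x+\infty=\infty$. For $R$ semilocal with simple right modules $V_1,\dots,V_k$ up to isomorphism, fix an onto ring homomorphism $\varphi\colon R\to M_{n_1}(D_1)\times\cdots\times M_{n_k}(D_k)$ with kernel $J(R)$, where the $D_i$ are division rings and $\mathrm{End}_R(V_i)=D_i$. For $P$ a countably generated projective right $R$-module, write $P/PJ(R)\cong V_1^{(I_1)}\oplus\cdots\oplus V_k^{(I_k)}$; then $\dim_\varphi(\langle P\rangle)=(m_1,\dots,m_k)\in(\mathbb{N}_0^* )^k$, where $m_i=|I_i|$ if $I_i$ is finite and $m_i=\infty$ if $I_i$ is infinite. For $\mathbf{x}\in(\mathbb{N}_0^* )^k$, $\mathrm{supp}(\mathbf{x})=\{i\mid x_i\ne 0\}$ and $\mathrm{inf\text{-}supp}(\mathbf{x})=\{i\mid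 x_i=\infty\}$. The trace ideal of a right module $P$ is $\mathrm{Tr}(P)=\sum_{f\in \mathrm{Hom}_R(P,R)}f(P)$. $\mathcal{T}$ is the set of ideals of $R$ that are trace ideals of projective right $R$-modules, and $\Phi\colon\mathcal{T}\to\mathcal{P}(\{1,\dots,k\})$ (the power set) is the injective map given by $\Phi(I)=\mathrm{supp}(\dim_\varphi(\langle P\rangle))$, where $P$ is any countably generated projective right $R$-module with trace ideal $I$. When $R$ is semi-semiperfect, $\Phi$ is a bijection.
   Formalization: The modules in each G_J are assumed countably generated; for arbitrary projective modules the claim fails (R = D×D, J = D×0, G_J = {D^(ℵ₁)×D}, P = D^(ω)×D), and ⟨Q⟩ must lie in V*(R) for the last assertion. *)

theory Defs
  imports
    "HOL-Algebra.Module"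
    "HOL-Algebra.QuotRing"
    "HOL-Algebra.Generated_Groups"
    "HOL-Library.Extended_Nat"
    "HOL-Library.Countable_Set"
begin

text \<open>
  Throughout, a right module over a possibly noncommutative ring \<open>R\<close> is stored in the library
  record \<^type>\<open>module\<close>, with the convention that \<open>a \<odot>\<^bsub>M\<^esub> x\<close> denotes the right action \<open>x a\<close>.
  The library locale \<^locale>\<open>module\<close> (which demands a commutative ring) is not used, but the library
  locale \<^locale>\<open>submodule\<close> is. The ring fields \<open>mult\<close> and \<open>one\<close> of a module record carry no meaning.
\<close>

locale right_module = R?: ring R + M?: abelian_group M for R (structure) and M (structure) +
  assumes act_closed: "\<lbrakk>a \<in> carrier R; x \<in> carrier M\<rbrakk> \<Longrightarrow> a \<odot>\<^bsub>M\<^esub> x \<in> carrier M"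
    and act_add_ring: "\<lbrakk>a \<in> carrier R; b \<in> carrier R; x \<in> carrier M\<rbrakk>
        \<Longrightarrow> (a \<oplus>\<^bsub>R\<^esub> b) \<odot>\<^bsub>M\<^esub> x = a \<odot>\<^bsub>M\<^esub> x \<oplus>\<^bsub>M\<^esub> b \<odot>\<^bsub>M\<^esub> x"
    and act_add: "\<lbrakk>a \<in> carrier R; x \<in> carrier M; y \<in> carrier M\<rbrakk>
        \<Longrightarrow> a \<odot>\<^bsub>M\<^esub> (x \<oplus>\<^bsub>M\<^esub> y) = a \<odot>\<^bsub>M\<^esub> x \<oplus>\<^bsub>M\<^esub> a \<odot>\<^bsub>M\<^esub> y"
    and act_mult: "\<lbrakk>a \<in> carrier R; b \<in> carrier R; x \<in> carrier M\<rbrakk>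
        \<Longrightarrow> (a \<otimes>\<^bsub>R\<^esub> b) \<odot>\<^bsub>M\<^esub> x = b \<odot>\<^bsub>M\<^esub> (a \<odot>\<^bsub>M\<^esub> x)"
    and act_one: "x \<in> carrier M \<Longrightarrow> \<one>\<^bsub>R\<^esub> \<odot>\<^bsub>M\<^esub> x = x"

definition rmod_hom ::
  "('a, 'r) ring_scheme \<Rightarrow> ('a, 'b, 'm) module_scheme \<Rightarrow> ('a, 'c, 'n) module_scheme \<Rightarrow> ('b \<Rightarrow> 'c) set"
  where "rmod_hom R M N = {f \<in> hom (add_monoid M) (add_monoid N).
           \<forall>a\<in>carrier R. \<forall>x\<in>carrier M. f (a \<odot>\<^bsub>M\<^esub> x) = a \<odot>\<^bsub>N\<^esub> f x}"

definition rmod_iso ::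
  "('a, 'r) ring_scheme \<Rightarrow> ('a, 'b, 'm) module_scheme \<Rightarrow> ('a, 'c, 'n) module_scheme \<Rightarrow> bool"
  where "rmod_iso R M N \<longleftrightarrow> (\<exists>f\<in>rmod_hom R M N. bij_betw f (carrier M) (carrier N))"

definition regular :: "('a, 'r) ring_scheme \<Rightarrow> ('a, 'a) module"
  where "regular R = \<lparr>carrier = carrier R, mult = undefined, one = undefined,
           zero = \<zero>\<^bsub>R\<^esub>, add = add R, smult = (\<lambda>a x. x \<otimes>\<^bsub>R\<^esub> a)\<rparr>"


subsection \<open>Direct sums\<close>

definition module_sum ::
  "('a, 'b, 'm) module_scheme \<Rightarrow> ('a, 'c, 'n) module_scheme \<Rightarrow> ('a, 'b \<times> 'c) module"
  where "module_sum M N = \<lparr>carrier = carrier M \<times> carrier N, mult = undefined, one = undefined,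
           zero = (\<zero>\<^bsub>M\<^esub>, \<zero>\<^bsub>N\<^esub>), add = (\<lambda>(x, y) (x', y'). (x \<oplus>\<^bsub>M\<^esub> x', y \<oplus>\<^bsub>N\<^esub> y')),
           smult = (\<lambda>a (x, y). (a \<odot>\<^bsub>M\<^esub> x, a \<odot>\<^bsub>N\<^esub> y))\<rparr>"

definition direct_sum :: "'i set \<Rightarrow> ('i \<Rightarrow> ('a, 'b, 'm) module_scheme) \<Rightarrow> ('a, 'i \<Rightarrow> 'b) module"
  where "direct_sum I M = \<lparr>
           carrier = {f \<in> \<Pi>\<^sub>E i\<in>I. carrier (M i). finite {i \<in> I. f i \<noteq> \<zero>\<^bsub>M i\<^esub>}},
           mult = undefined, one = undefined,
           zero = (\<lambda>i\<in>I. \<zero>\<^bsub>M i\<^esub>), add = (\<lambda>f g. \<lambda>i\<in>I. f i \<oplus>\<^bsub>M i\<^esub> g i),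
           smult = (\<lambda>a f. \<lambda>i\<in>I. a \<odot>\<^bsub>M i\<^esub> f i)\<rparr>"

text \<open>\<open>copies I M\<close> is \<open>M\<^sup>(\<^sup>I\<^sup>)\<close>; thus \<open>copies {..<n} M\<close> is \<open>M\<^sup>n\<close> and \<open>copies (UNIV :: nat set) M\<close> is
  the direct sum of countably infinitely many copies of \<open>M\<close>.\<close>

definition copies :: "'i set \<Rightarrow> ('a, 'b, 'm) module_scheme \<Rightarrow> ('a, 'i \<Rightarrow> 'b) module"
  where "copies I M = direct_sum I (\<lambda>_. M)"


subsection \<open>Quotients\<close>

definition quot_module :: "('a, 'b, 'm) module_scheme \<Rightarrow> 'b set \<Rightarrow> ('a, 'b set) module"
  where "quot_module M N = \<lparr>carrier = a_rcosets\<^bsub>M\<^esub> N, mult = undefined, one = undefined,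
           zero = N, add = set_add M, smult = (\<lambda>a X. \<Union>x\<in>X. N +>\<^bsub>M\<^esub> (a \<odot>\<^bsub>M\<^esub> x))\<rparr>"

definition mod_ideal_prod :: "('a, 'b, 'm) module_scheme \<Rightarrow> 'a set \<Rightarrow> 'b set"
  where "mod_ideal_prod M I = generate (add_monoid M) {a \<odot>\<^bsub>M\<^esub> x |a x. a \<in> I \<and> x \<in> carrier M}"

text \<open>\<open>M/MI\<close>, regarded as a right module over \<open>R/I\<close>.\<close>

definition reduce_mod :: "('a, 'b, 'm) module_scheme \<Rightarrow> 'a set \<Rightarrow> ('a set, 'b set) module"
  where "reduce_mod M I = \<lparr>carrier = a_rcosets\<^bsub>M\<^esub> (mod_ideal_prod M I),
           mult = undefined, one = undefined,
           zero = mod_ideal_prod M I, add = set_add M,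
           smult = (\<lambda>A X. \<Union>a\<in>A. \<Union>x\<in>X. mod_ideal_prod M I +>\<^bsub>M\<^esub> (a \<odot>\<^bsub>M\<^esub> x))\<rparr>"


subsection \<open>Properties of modules\<close>

definition generated_by ::
  "('a, 'r) ring_scheme \<Rightarrow> ('a, 'b, 'm) module_scheme \<Rightarrow> 'b set \<Rightarrow> bool"
  where "generated_by R M S \<longleftrightarrow>
           S \<subseteq> carrier M \<and> (\<forall>N. submodule N R M \<and> S \<subseteq> N \<longrightarrow> N = carrier M)"

definition fin_gen :: "('a, 'r) ring_scheme \<Rightarrow> ('a, 'b, 'm) module_scheme \<Rightarrow> bool"
  where "fin_gen R M \<longleftrightarrow> (\<exists>S. finite S \<and> generated_by R M S)"

definition countably_gen :: "('a, 'r) ring_scheme \<Rightarrow> ('a, 'b, 'm) module_scheme \<Rightarrow> bool"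
  where "countably_gen R M \<longleftrightarrow> (\<exists>S. countable S \<and> generated_by R M S)"

text \<open>Projective means isomorphic to a direct summand of a free module. If \<open>M\<close> is projective, it
  is a direct summand of the free module on \<open>carrier M\<close>, so bounding the types of the basis \<open>B\<close> and
  of the complement \<open>N\<close> loses nothing.\<close>

definition projective :: "('a, 'r) ring_scheme \<Rightarrow> ('a, 'b, 'm) module_scheme \<Rightarrow> bool"
  where "projective R M \<longleftrightarrow> right_module R M \<and>
           (\<exists>(B :: 'b set) (N :: ('a, 'b \<Rightarrow> 'a) module).
              right_module R N \<and> rmod_iso R (module_sum M N) (copies B (regular R)))"

definition simple_module :: "('a, 'r) ring_scheme \<Rightarrow> ('a, 'b, 'm) module_scheme \<Rightarrow> bool"
  where "simple_module R M \<longleftrightarrow> right_module R M \<and> carrier M \<noteq> {\<zero>\<^bsub>M\<^esub>} \<and>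
           (\<forall>N. submodule N R M \<longrightarrow> N = {\<zero>\<^bsub>M\<^esub>} \<or> N = carrier M)"

definition semisimple_module :: "('a, 'r) ring_scheme \<Rightarrow> ('a, 'b, 'm) module_scheme \<Rightarrow> bool"
  where "semisimple_module R M \<longleftrightarrow> right_module R M \<and>
           (\<forall>N. submodule N R M \<longrightarrow>
              (\<exists>N'. submodule N' R M \<and> N \<inter> N' = {\<zero>\<^bsub>M\<^esub>} \<and> N <+>\<^bsub>M\<^esub> N' = carrier M))"

definition artinian_module :: "('a, 'r) ring_scheme \<Rightarrow> ('a, 'b, 'm) module_scheme \<Rightarrow> bool"
  where "artinian_module R M \<longleftrightarrow> right_module R M \<and>
           (\<forall>N :: nat \<Rightarrow> 'b set. (\<forall>j. submodule (N j) R M \<and> N (Suc j) \<subseteq> N j) \<longrightarrow>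
              (\<exists>m. \<forall>j\<ge>m. N j = N m))"


subsection \<open>Jacobson radical, semilocal and semi-semiperfect rings\<close>

definition maximal_right_ideal :: "'a set \<Rightarrow> ('a, 'r) ring_scheme \<Rightarrow> bool"
  where "maximal_right_ideal I R \<longleftrightarrow> submodule I R (regular R) \<and> I \<noteq> carrier R \<and>
           (\<forall>K. submodule K R (regular R) \<and> I \<subseteq> K \<longrightarrow> K = I \<or> K = carrier R)"

text \<open>The intersection with the carrier only matters for the zero ring.\<close>

definition jacobson :: "('a, 'r) ring_scheme \<Rightarrow> 'a set"
  where "jacobson R = carrier R \<inter> \<Inter>{I. maximal_right_ideal I R}"

abbreviation mod_jacobson ::
  "('a, 'r) ring_scheme \<Rightarrow> ('a, 'b, 'm) module_scheme \<Rightarrow> ('a, 'b set) module"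
  where "mod_jacobson R P \<equiv> quot_module P (mod_ideal_prod P (jacobson R))"

definition semisimple_artinian :: "('a, 'r) ring_scheme \<Rightarrow> bool"
  where "semisimple_artinian R \<longleftrightarrow> ring R \<and>
           semisimple_module R (regular R) \<and> artinian_module R (regular R)"

definition semilocal :: "('a, 'r) ring_scheme \<Rightarrow> bool"
  where "semilocal R \<longleftrightarrow> ring R \<and> semisimple_artinian (R Quot jacobson R)"

text \<open>
  Quantification over all modules of some kind is carried out over the modules whose carrier lies
  in the type \<open>nat \<Rightarrow> 'a\<close>, where \<open>'a\<close> is the type of ring elements. Every countably generated
  \<open>R\<close>-module (in particular every simple or finitely generated one) has cardinality at most that of
  \<open>R\<^sup>(\<^sup>\<nat>\<^sup>)\<close>, whose carrier is a set of functions \<open>nat \<Rightarrow> 'a\<close>, and hence has an isomorphic copy there.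
\<close>

type_synonym ('a) univ_module = "('a, nat \<Rightarrow> 'a) module"

definition semi_semiperfect :: "('a, 'r) ring_scheme \<Rightarrow> bool"
  where "semi_semiperfect R \<longleftrightarrow> semilocal R \<and>
           (\<forall>V :: 'a univ_module. simple_module R V \<longrightarrow>
              (\<exists>(n :: nat) (P :: 'a univ_module). n \<ge> 1 \<and> fin_gen R P \<and> projective R P \<and>
                 rmod_iso R (mod_jacobson R P) (copies {..<n} V)))"

definition simple_representatives ::
  "('a, 'r) ring_scheme \<Rightarrow> nat \<Rightarrow> (nat \<Rightarrow> ('a, 'v) module) \<Rightarrow> bool"
  where "simple_representatives R k V \<longleftrightarrow>
           (\<forall>i\<in>{1..k}. simple_module R (V i)) \<and>
           (\<forall>i\<in>{1..k}. \<forall>j\<in>{1..k}. rmod_iso R (V i) (V j) \<longrightarrow> i = j) \<and>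
           (\<forall>S :: 'a univ_module. simple_module R S \<longrightarrow> (\<exists>i\<in>{1..k}. rmod_iso R S (V i)))"


subsection \<open>Dimension vectors\<close>

definition ecard :: "'i set \<Rightarrow> enat"
  where "ecard I = (if finite I then enat (card I) else \<infinity>)"

text \<open>
  Vectors in \<open>(\<nat>\<^sub>0 \<union> {\<infinity>})\<^sup>k\<close> are functions \<open>nat \<Rightarrow> enat\<close> that vanish outside \<open>{1..k}\<close>. The dimension
  vector is meant for countably generated \<open>P\<close>, for which index sets contained in \<open>\<nat>\<close> suffice.
  It depends on \<open>\<phi>\<close> only through the ordering \<open>V 1, \<dots>, V k\<close> of the simple modules.
\<close>

definition dim_vec ::
  "('a, 'r) ring_scheme \<Rightarrow> nat \<Rightarrow> (nat \<Rightarrow> ('a, 'v) module) \<Rightarrow> ('a, 'b, 'm) module_scheme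
     \<Rightarrow> nat \<Rightarrow> enat"
  where "dim_vec R k V P = (THE m. (\<forall>i. i \<notin> {1..k} \<longrightarrow> m i = 0) \<and>
           (\<exists>I :: nat \<Rightarrow> nat set.
              rmod_iso R (mod_jacobson R P) (direct_sum {1..k} (\<lambda>i. copies (I i) (V i))) \<and>
              (\<forall>i\<in>{1..k}. m i = ecard (I i))))"

definition supp :: "(nat \<Rightarrow> enat) \<Rightarrow> nat set"
  where "supp x = {i. x i \<noteq> 0}"

definition inf_supp :: "(nat \<Rightarrow> enat) \<Rightarrow> nat set"
  where "inf_supp x = {i. x i = \<infinity>}"


subsection \<open>Trace ideals\<close>

definition trace_ideal :: "('a, 'r) ring_scheme \<Rightarrow> ('a, 'b, 'm) module_scheme \<Rightarrow> 'a set"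
  where "trace_ideal R P =
           generate (add_monoid R) (\<Union>f\<in>rmod_hom R P (regular R). f ` carrier P)"

text \<open>
  Projective modules that are not countably generated contribute no further ideals: such a module
  is a direct sum of countably generated ones, and at most \<open>max (card R) \<aleph>\<^sub>0\<close> of the summands already
  have the same trace, so a projective module with that trace has a copy in \<open>nat \<Rightarrow> 'a\<close>.
\<close>

definition trace_ideals :: "('a, 'r) ring_scheme \<Rightarrow> 'a set set"
  where "trace_ideals R = {trace_ideal R P |P :: 'a univ_module. projective R P}"

definition Phi ::
  "('a, 'r) ring_scheme \<Rightarrow> nat \<Rightarrow> (nat \<Rightarrow> ('a, 'v) module) \<Rightarrow> 'a set \<Rightarrow> nat set"
  where "Phi R k V I = (THE X. \<exists>P :: 'a univ_module.
           countably_gen R P \<and> projective R P \<and> trace_ideal R P = I \<and> X = supp (dim_vec R k V P))"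


subsection \<open>Monoids of isomorphism classes\<close>

definition iso_class ::
  "('a, 'r) ring_scheme \<Rightarrow> ('a, 'b, 'm) module_scheme \<Rightarrow> 'a univ_module set"
  where "iso_class R P = {M. right_module R M \<and> rmod_iso R M P}"

definition iso_class_add ::
  "('a, 'r) ring_scheme \<Rightarrow> 'a univ_module set \<Rightarrow> 'a univ_module set \<Rightarrow> 'a univ_module set"
  where "iso_class_add R A B =
           {M. right_module R M \<and> (\<exists>P\<in>A. \<exists>Q\<in>B. rmod_iso R M (module_sum P Q))}"

definition V_monoid :: "('a, 'r) ring_scheme \<Rightarrow> 'a univ_module set monoid"
  where "V_monoid R = \<lparr>
           carrier = {iso_class R P |P :: 'a univ_module. fin_gen R P \<and> projective R P},
           mult = iso_class_add R,
           one = {M. right_module R M \<and> carrier M = {\<zero>\<^bsub>M\<^esub>}}\<rparr>"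

definition Vstar_monoid :: "('a, 'r) ring_scheme \<Rightarrow> 'a univ_module set monoid"
  where "Vstar_monoid R = \<lparr>
           carrier = {iso_class R P |P :: 'a univ_module. countably_gen R P \<and> projective R P},
           mult = iso_class_add R,
           one = {M. right_module R M \<and> carrier M = {\<zero>\<^bsub>M\<^esub>}}\<rparr>"

definition monoid_generated_by :: "('c, 'm) monoid_scheme \<Rightarrow> 'c set \<Rightarrow> bool"
  where "monoid_generated_by G S \<longleftrightarrow>
           S \<subseteq> carrier G \<and> (\<forall>H. submonoid H G \<and> S \<subseteq> H \<longrightarrow> H = carrier G)"

end

theory Submission
  imports Defs
begin

text \<open>Write \<open>J\<close> for the Jacobson radical. By a theorem of Prihoda, countably generated projective modules
  with isomorphic radical factors are isomorphic: lifts of the two isomorphisms are mutually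
  inverse modulo \<open>J\<close>, and since linear systems with coefficient matrix \<open>1 - A\<close>, \<open>A\<close> over \<open>J\<close>,
  are solvable, they can be corrected to be inverse on any given finite set, so that a
  back-and-forth construction applies. Hence over a semilocal ring the dimension vector determines
  the module.

  Let \<open>X\<close> be the infinite support of \<open>P\<close> and let \<open>I\<close> be the corresponding trace ideal. For a
  common multiple \<open>N\<close> of the dimensions of the \<open>Ps i\<close>, comparison of dimensions gives
  \<open>P\<^sup>N \<cong> \<Oplus>\<^sub>i (Ps i)\<^sup>(\<^sup>C\<^sup>i\<^sup>)\<close> with \<open>C i\<close> finite for \<open>i \<notin> X\<close>, and the summands with \<open>i \<in> X\<close> vanish modulo \<open>I\<close>.
  So \<open>P/PI\<close> is finitely generated, and some combination \<open>F\<close> of the modules in \<open>G I\<close> satisfies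
  \<open>F/FI \<cong> P/PI\<close>. Then \<open>F\<close> and \<open>P\<close> have the same dimensions outside \<open>X\<close>, because \<open>I\<close> annihilates
  the simple modules \<open>V i\<close> with \<open>i \<notin> X\<close>. Adding infinitely many copies of the \<open>Ps i\<close>,
  \<open>i \<in> X\<close>, to \<open>F\<close> gives the dimension vector of \<open>P\<close>.\<close>

text \<open>The obstacle is that \<open>P\<close> is not finitely generated, so Nakayama's lemma is
  not at hand. Maps are therefore corrected only on the finitely many coordinates that a given
  finite set involves, and the isomorphism is a limit of such corrections. The same finite systems
  show that a projective \<open>K\<close> with \<open>K \<noteq> KI\<close> has a simple quotient
  annihilated by \<open>I\<close>; this is why the \<open>Ps i\<close> with \<open>i \<in> X\<close>
  vanish modulo \<open>I\<close>. The dimension of \<open>Ps i\<close> may exceed 1, so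
  \<open>P\<close> itself need not be a sum of copies of the \<open>Ps i\<close>. The power
  \<open>P\<^sup>N\<close> makes the dimensions divisible, and as \<open>P\<close> is a quotient of
  \<open>P\<^sup>N\<close>, finite generation modulo \<open>I\<close> passes down to
  \<open>P\<close>. Multiplicities are measured by triangular systems of homomorphisms into a simple
  module (\<open>dim_ge\<close>): this refers to no decomposition, passes along surjections and
  compares modules of different types. Quotients modulo an ideal are handled as surjections with
  prescribed kernel (\<open>cover\<close>), which allows modules over \<open>R/I\<close> to be
  compared over \<open>R\<close>.\<close>

lemma right_moduleI:
  fixes R (structure) and M (structure)
  assumes "ring R"
    and add_closed: "\<And>x y. \<lbrakk>x \<in> carrier M; y \<in> carrier M\<rbrakk> \<Longrightarrow> x \<oplus>\<^bsub>M\<^esub> y \<in> carrier M"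
    and zero_closed: "\<zero>\<^bsub>M\<^esub> \<in> carrier M"
    and assoc: "\<And>x y z. \<lbrakk>x \<in> carrier M; y \<in> carrier M; z \<in> carrier M\<rbrakk>
      \<Longrightarrow> (x \<oplus>\<^bsub>M\<^esub> y) \<oplus>\<^bsub>M\<^esub> z = x \<oplus>\<^bsub>M\<^esub> (y \<oplus>\<^bsub>M\<^esub> z)"
    and comm: "\<And>x y. \<lbrakk>x \<in> carrier M; y \<in> carrier M\<rbrakk> \<Longrightarrow> x \<oplus>\<^bsub>M\<^esub> y = y \<oplus>\<^bsub>M\<^esub> x"
    and l_zero: "\<And>x. x \<in> carrier M \<Longrightarrow> \<zero>\<^bsub>M\<^esub> \<oplus>\<^bsub>M\<^esub> x = x"
    and act_closed: "\<And>a x. \<lbrakk>a \<in> carrier R; x \<in> carrier M\<rbrakk> \<Longrightarrow> a \<odot>\<^bsub>M\<^esub> x \<in> carrier M"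
    and act_zero: "\<And>x. x \<in> carrier M \<Longrightarrow> \<zero> \<odot>\<^bsub>M\<^esub> x = \<zero>\<^bsub>M\<^esub>"
    and act_add_ring: "\<And>a b x. \<lbrakk>a \<in> carrier R; b \<in> carrier R; x \<in> carrier M\<rbrakk>
      \<Longrightarrow> (a \<oplus> b) \<odot>\<^bsub>M\<^esub> x = a \<odot>\<^bsub>M\<^esub> x \<oplus>\<^bsub>M\<^esub> b \<odot>\<^bsub>M\<^esub> x"
    and act_add: "\<And>a x y. \<lbrakk>a \<in> carrier R; x \<in> carrier M; y \<in> carrier M\<rbrakk>
      \<Longrightarrow> a \<odot>\<^bsub>M\<^esub> (x \<oplus>\<^bsub>M\<^esub> y) = a \<odot>\<^bsub>M\<^esub> x \<oplus>\<^bsub>M\<^esub> a \<odot>\<^bsub>M\<^esub> y"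
    and act_mult: "\<And>a b x. \<lbrakk>a \<in> carrier R; b \<in> carrier R; x \<in> carrier M\<rbrakk>
      \<Longrightarrow> (a \<otimes> b) \<odot>\<^bsub>M\<^esub> x = b \<odot>\<^bsub>M\<^esub> (a \<odot>\<^bsub>M\<^esub> x)"
    and act_one: "\<And>x. x \<in> carrier M \<Longrightarrow> \<one> \<odot>\<^bsub>M\<^esub> x = x"
  shows "right_module R M"
proof -
  interpret ring R by fact
  have "abelian_group M"
  proof (rule abelian_groupI)
    \<comment> \<open>Inverses are not among the assumptions: \<open>\<ominus> \<one>\<close> acts
      as negation, because the action of zero is zero.\<close>
    fix x assume x: "x \<in> carrier M"
    have "(\<ominus> \<one>) \<odot>\<^bsub>M\<^esub> x \<oplus>\<^bsub>M\<^esub> x = (\<ominus> \<one> \<oplus> \<one>) \<odot>\<^bsub>M\<^esub> x"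
      using x by (simp add: act_add_ring act_one)
    also have "\<dots> = \<zero>\<^bsub>M\<^esub>"
      using x by (simp add: l_neg act_zero)
    finally show "\<exists>y\<in>carrier M. y \<oplus>\<^bsub>M\<^esub> x = \<zero>\<^bsub>M\<^esub>"
      using x act_closed[of "\<ominus> \<one>" x] by auto
  qed (use assms in auto)
  then show ?thesis
    using assms by (intro right_module.intro right_module_axioms.intro) auto
qed

section \<open>Elementary facts on right modules and submodules\<close>

context right_module
begin

lemma act_zero_ring [simp]:
  assumes "x \<in> carrier M" shows "\<zero>\<^bsub>R\<^esub> \<odot>\<^bsub>M\<^esub> x = \<zero>\<^bsub>M\<^esub>"
  by (metis M.add.l_cancel_one R.add.one_closed R.l_zero act_add_ring act_closed assms)

lemma act_zero [simp]:
  assumes "a \<in> carrier R" shows "a \<odot>\<^bsub>M\<^esub> \<zero>\<^bsub>M\<^esub> = \<zero>\<^bsub>M\<^esub>"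
  by (metis M.add.l_cancel_one M.add.one_closed M.l_zero act_add act_closed assms)

lemma act_minus_ring:
  assumes "a \<in> carrier R" "x \<in> carrier M" shows "(\<ominus>\<^bsub>R\<^esub> a) \<odot>\<^bsub>M\<^esub> x = \<ominus>\<^bsub>M\<^esub> (a \<odot>\<^bsub>M\<^esub> x)"
  by (metis M.minus_equality R.a_inv_closed R.l_neg act_add_ring act_closed act_zero_ring assms)

lemma act_minus:
  assumes "a \<in> carrier R" "x \<in> carrier M" shows "a \<odot>\<^bsub>M\<^esub> (\<ominus>\<^bsub>M\<^esub> x) = \<ominus>\<^bsub>M\<^esub> (a \<odot>\<^bsub>M\<^esub> x)"
  by (metis M.a_inv_closed M.l_neg M.minus_equality act_add act_closed act_zero assms)

lemma finsum_act:
  assumes "a \<in> carrier R" "f \<in> A \<rightarrow> carrier M"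
  shows "a \<odot>\<^bsub>M\<^esub> (finsum M f A) = finsum M (\<lambda>i. a \<odot>\<^bsub>M\<^esub> f i) A"
  using assms
proof (induct A rule: infinite_finite_induct)
  case (insert x F)
  then have "finsum M (\<lambda>i. a \<odot>\<^bsub>M\<^esub> f i) (insert x F) = a \<odot>\<^bsub>M\<^esub> f x \<oplus>\<^bsub>M\<^esub> finsum M (\<lambda>i. a \<odot>\<^bsub>M\<^esub> f i) F"
    by (intro M.finsum_insert) (auto simp: Pi_iff intro: act_closed)
  then show ?case using insert by (simp add: act_add Pi_iff)
qed (auto simp: M.finsum_infinite)

text \<open>Closure under negation is automatic, since negation is the action of
  \<open>\<ominus> \<one>\<close>.\<close>

lemma submoduleI:
  assumes "H \<subseteq> carrier M" "\<zero>\<^bsub>M\<^esub> \<in> H"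
    and "\<And>x y. \<lbrakk>x \<in> H; y \<in> H\<rbrakk> \<Longrightarrow> x \<oplus>\<^bsub>M\<^esub> y \<in> H"
    and act: "\<And>a x. \<lbrakk>a \<in> carrier R; x \<in> H\<rbrakk> \<Longrightarrow> a \<odot>\<^bsub>M\<^esub> x \<in> H"
  shows "submodule H R M"
proof -
  have neg: "\<ominus>\<^bsub>M\<^esub> x \<in> H" if "x \<in> H" for x
    using act[of "\<ominus>\<^bsub>R\<^esub> \<one>\<^bsub>R\<^esub>" x] that assms(1) act_minus_ring[of "\<one>\<^bsub>R\<^esub>" x] act_one[of x] by auto
  show ?thesis
    by (rule submodule.intro) (use assms neg in
      \<open>auto intro!: subgroup.intro submodule_axioms.intro simp: a_inv_def\<close>)
qed

lemma
  assumes "submodule H R M"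
  shows submodule_subset: "H \<subseteq> carrier M"
    and submodule_mem: "x \<in> H \<Longrightarrow> x \<in> carrier M"
    and submodule_zero: "\<zero>\<^bsub>M\<^esub> \<in> H"
    and submodule_add: "\<lbrakk>x \<in> H; y \<in> H\<rbrakk> \<Longrightarrow> x \<oplus>\<^bsub>M\<^esub> y \<in> H"
    and submodule_act: "\<lbrakk>a \<in> carrier R; x \<in> H\<rbrakk> \<Longrightarrow> a \<odot>\<^bsub>M\<^esub> x \<in> H"
    and submodule_neg: "x \<in> H \<Longrightarrow> \<ominus>\<^bsub>M\<^esub> x \<in> H"
    and submodule_minus: "\<lbrakk>x \<in> H; y \<in> H\<rbrakk> \<Longrightarrow> x \<ominus>\<^bsub>M\<^esub> y \<in> H"
proof -
  interpret H: submodule H R M by fact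
  show 1: "H \<subseteq> carrier M" "x \<in> H \<Longrightarrow> x \<in> carrier M" "\<zero>\<^bsub>M\<^esub> \<in> H"
    "\<lbrakk>x \<in> H; y \<in> H\<rbrakk> \<Longrightarrow> x \<oplus>\<^bsub>M\<^esub> y \<in> H"
    "\<lbrakk>a \<in> carrier R; x \<in> H\<rbrakk> \<Longrightarrow> a \<odot>\<^bsub>M\<^esub> x \<in> H" for x y
    using H.subset H.mem_carrier H.one_closed H.m_closed H.smult_closed by auto
  show neg: "x \<in> H \<Longrightarrow> \<ominus>\<^bsub>M\<^esub> x \<in> H" for x
    using H.m_inv_closed by (simp add: a_inv_def)
  show "\<lbrakk>x \<in> H; y \<in> H\<rbrakk> \<Longrightarrow> x \<ominus>\<^bsub>M\<^esub> y \<in> H"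
    using 1 neg by (simp add: M.minus_eq)
qed

lemma submodule_finsum:
  assumes H: "submodule H R M" and "\<And>i. i \<in> A \<Longrightarrow> f i \<in> H"
  shows "finsum M f A \<in> H"
  using assms(2)
proof (induct A rule: infinite_finite_induct)
  case (insert x F)
  then show ?case using submodule_mem[OF H] by (simp add: Pi_iff submodule_add[OF H])
qed (auto simp: submodule_zero[OF H] M.finsum_infinite)

lemma submodule_carrier: "submodule (carrier M) R M"
  by (rule submoduleI) (auto intro: act_closed)

lemma submodule_zero_set: "submodule {\<zero>\<^bsub>M\<^esub>} R M"
  by (rule submoduleI) (auto intro: act_closed)

text \<open>Intersecting with the carrier makes the empty family give all of \<open>M\<close>, which
  matters for a ring without maximal right ideals.\<close>

lemma submodule_Inter:
  assumes "\<And>H. H \<in> \<H> \<Longrightarrow> submodule H R M"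
  shows "submodule (carrier M \<inter> \<Inter>\<H>) R M"
  by (rule submoduleI) (auto intro: submodule_zero submodule_add submodule_act act_closed dest: assms)

lemma submodule_cyclic:
  assumes x: "x \<in> carrier M"
  shows "submodule ((\<lambda>a. a \<odot>\<^bsub>M\<^esub> x) ` carrier R) R M"
proof (rule submoduleI)
  show "\<zero>\<^bsub>M\<^esub> \<in> (\<lambda>a. a \<odot>\<^bsub>M\<^esub> x) ` carrier R"
    using x by (intro image_eqI[of _ _ "\<zero>\<^bsub>R\<^esub>"]) auto
next
  fix y z assume "y \<in> (\<lambda>a. a \<odot>\<^bsub>M\<^esub> x) ` carrier R" "z \<in> (\<lambda>a. a \<odot>\<^bsub>M\<^esub> x) ` carrier R"
  then obtain a b where "a \<in> carrier R" "b \<in> carrier R" "y = a \<odot>\<^bsub>M\<^esub> x" "z = b \<odot>\<^bsub>M\<^esub> x" by auto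
  then show "y \<oplus>\<^bsub>M\<^esub> z \<in> (\<lambda>a. a \<odot>\<^bsub>M\<^esub> x) ` carrier R"
    using x by (intro image_eqI[of _ _ "a \<oplus>\<^bsub>R\<^esub> b"]) (auto simp: act_add_ring)
next
  fix c y assume "c \<in> carrier R" "y \<in> (\<lambda>a. a \<odot>\<^bsub>M\<^esub> x) ` carrier R"
  then obtain a where "a \<in> carrier R" "y = a \<odot>\<^bsub>M\<^esub> x" by auto
  then show "c \<odot>\<^bsub>M\<^esub> y \<in> (\<lambda>a. a \<odot>\<^bsub>M\<^esub> x) ` carrier R"
    using x \<open>c \<in> carrier R\<close> by (intro image_eqI[of _ _ "a \<otimes>\<^bsub>R\<^esub> c"]) (auto simp: act_mult)
qed (auto intro: x act_closed)

lemma submodule_sum: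
  assumes H: "submodule H R M" and K: "submodule K R M"
  shows "submodule {x \<oplus>\<^bsub>M\<^esub> y |x y. x \<in> H \<and> y \<in> K} R M"
proof (rule submoduleI)
  show "\<zero>\<^bsub>M\<^esub> \<in> {x \<oplus>\<^bsub>M\<^esub> y |x y. x \<in> H \<and> y \<in> K}"
    using submodule_zero[OF H] submodule_zero[OF K] by (auto intro!: exI[of _ "\<zero>\<^bsub>M\<^esub>"])
next
  fix u v assume "u \<in> {x \<oplus>\<^bsub>M\<^esub> y |x y. x \<in> H \<and> y \<in> K}" "v \<in> {x \<oplus>\<^bsub>M\<^esub> y |x y. x \<in> H \<and> y \<in> K}"
  then obtain x y x' y' where *: "u = x \<oplus>\<^bsub>M\<^esub> y" "v = x' \<oplus>\<^bsub>M\<^esub> y'" "x \<in> H" "y \<in> K" "x' \<in> H" "y' \<in> K" by auto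
  then have "u \<oplus>\<^bsub>M\<^esub> v = (x \<oplus>\<^bsub>M\<^esub> x') \<oplus>\<^bsub>M\<^esub> (y \<oplus>\<^bsub>M\<^esub> y')"
    using submodule_mem[OF H] submodule_mem[OF K] by (simp add: M.a_ac)
  then show "u \<oplus>\<^bsub>M\<^esub> v \<in> {x \<oplus>\<^bsub>M\<^esub> y |x y. x \<in> H \<and> y \<in> K}"
    using submodule_add[OF H *(3,5)] submodule_add[OF K *(4,6)] by blast
next
  fix a u assume a: "a \<in> carrier R" and "u \<in> {x \<oplus>\<^bsub>M\<^esub> y |x y. x \<in> H \<and> y \<in> K}"
  then obtain x y where *: "u = x \<oplus>\<^bsub>M\<^esub> y" "x \<in> H" "y \<in> K" by auto
  then have "a \<odot>\<^bsub>M\<^esub> u = a \<odot>\<^bsub>M\<^esub> x \<oplus>\<^bsub>M\<^esub> a \<odot>\<^bsub>M\<^esub> y"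
    using a submodule_mem[OF H] submodule_mem[OF K] by (simp add: act_add)
  then show "a \<odot>\<^bsub>M\<^esub> u \<in> {x \<oplus>\<^bsub>M\<^esub> y |x y. x \<in> H \<and> y \<in> K}"
    using submodule_act[OF H a *(2)] submodule_act[OF K a *(3)] by blast
qed (use submodule_mem[OF H] submodule_mem[OF K] in auto)

lemma right_module_submodule:
  assumes H: "submodule H R M" shows "right_module R (M\<lparr>carrier := H\<rparr>)"
  using submodule_mem[OF H] submodule_zero[OF H] submodule_add[OF H] submodule_act[OF H]
  by (intro right_moduleI)
    (auto simp: M.a_assoc act_add act_add_ring act_mult act_one R.ring_axioms intro: M.a_comm)

lemma diff_eq_zero_iff:
  assumes "x \<in> carrier M" "y \<in> carrier M" shows "x \<ominus>\<^bsub>M\<^esub> y = \<zero>\<^bsub>M\<^esub> \<longleftrightarrow> x = y"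
proof
  assume "x \<ominus>\<^bsub>M\<^esub> y = \<zero>\<^bsub>M\<^esub>"
  then have "(x \<ominus>\<^bsub>M\<^esub> y) \<oplus>\<^bsub>M\<^esub> y = y" using assms by simp
  then show "x = y" using assms by (simp add: M.minus_eq M.a_assoc M.l_neg)
qed (use assms in \<open>simp add: M.minus_eq M.r_neg\<close>)

lemma diff_add_cancel:
  assumes "x \<in> carrier M" "y \<in> carrier M" shows "(x \<ominus>\<^bsub>M\<^esub> y) \<oplus>\<^bsub>M\<^esub> y = x"
  using assms by (simp add: M.minus_eq M.a_assoc M.l_neg)

end

subsection \<open>Homomorphisms\<close>

lemma rmod_homI:
  assumes "\<And>x. x \<in> carrier M \<Longrightarrow> f x \<in> carrier N"
    and "\<And>x y. \<lbrakk>x \<in> carrier M; y \<in> carrier M\<rbrakk> \<Longrightarrow> f (x \<oplus>\<^bsub>M\<^esub> y) = f x \<oplus>\<^bsub>N\<^esub> f y"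
    and "\<And>a x. \<lbrakk>a \<in> carrier R; x \<in> carrier M\<rbrakk> \<Longrightarrow> f (a \<odot>\<^bsub>M\<^esub> x) = a \<odot>\<^bsub>N\<^esub> f x"
  shows "f \<in> rmod_hom R M N"
  using assms by (auto simp: rmod_hom_def hom_def)

lemma rmod_hom_closed: "\<lbrakk>f \<in> rmod_hom R M N; x \<in> carrier M\<rbrakk> \<Longrightarrow> f x \<in> carrier N"
  by (auto simp: rmod_hom_def hom_def)

lemma rmod_hom_add:
  "\<lbrakk>f \<in> rmod_hom R M N; x \<in> carrier M; y \<in> carrier M\<rbrakk> \<Longrightarrow> f (x \<oplus>\<^bsub>M\<^esub> y) = f x \<oplus>\<^bsub>N\<^esub> f y"
  by (auto simp: rmod_hom_def hom_def)

lemma rmod_hom_act: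
  "\<lbrakk>f \<in> rmod_hom R M N; a \<in> carrier R; x \<in> carrier M\<rbrakk> \<Longrightarrow> f (a \<odot>\<^bsub>M\<^esub> x) = a \<odot>\<^bsub>N\<^esub> f x"
  by (auto simp: rmod_hom_def)

locale rmod_morphism = M: right_module R M + N: right_module R N
  for R :: "('a, 'r) ring_scheme" and M :: "('a, 'b, 'm) module_scheme"
    and N :: "('a, 'c, 'n) module_scheme" +
  fixes f assumes hom: "f \<in> rmod_hom R M N"
begin

lemma closed [simp, intro]: "x \<in> carrier M \<Longrightarrow> f x \<in> carrier N"
  by (rule rmod_hom_closed[OF hom])

lemma add: "\<lbrakk>x \<in> carrier M; y \<in> carrier M\<rbrakk> \<Longrightarrow> f (x \<oplus>\<^bsub>M\<^esub> y) = f x \<oplus>\<^bsub>N\<^esub> f y"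
  by (rule rmod_hom_add[OF hom])

lemma act: "\<lbrakk>a \<in> carrier R; x \<in> carrier M\<rbrakk> \<Longrightarrow> f (a \<odot>\<^bsub>M\<^esub> x) = a \<odot>\<^bsub>N\<^esub> f x"
  by (rule rmod_hom_act[OF hom])

lemma zero [simp]: "f \<zero>\<^bsub>M\<^esub> = \<zero>\<^bsub>N\<^esub>"
  by (metis M.M.zero_closed M.R.zero_closed M.act_zero_ring N.act_zero_ring act closed)

lemma neg: "x \<in> carrier M \<Longrightarrow> f (\<ominus>\<^bsub>M\<^esub> x) = \<ominus>\<^bsub>N\<^esub> f x"
  by (metis M.M.add.inv_closed M.M.l_neg N.M.minus_equality add closed zero)

lemma minus: "\<lbrakk>x \<in> carrier M; y \<in> carrier M\<rbrakk> \<Longrightarrow> f (x \<ominus>\<^bsub>M\<^esub> y) = f x \<ominus>\<^bsub>N\<^esub> f y"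
  by (simp add: M.M.minus_eq N.M.minus_eq add neg)

lemma finsum: "g \<in> A \<rightarrow> carrier M \<Longrightarrow> f (finsum M g A) = finsum N (\<lambda>i. f (g i)) A"
proof (induct A rule: infinite_finite_induct)
  case (insert x F)
  then have "finsum N (\<lambda>i. f (g i)) (insert x F) = f (g x) \<oplus>\<^bsub>N\<^esub> finsum N (\<lambda>i. f (g i)) F"
    by (intro N.M.finsum_insert) (auto simp: Pi_iff)
  then show ?case using insert by (simp add: add Pi_iff)
qed (auto simp: M.M.finsum_infinite N.M.finsum_infinite)

lemma submodule_vimage:
  assumes K: "submodule K R N" shows "submodule {x \<in> carrier M. f x \<in> K} R M"
  by (rule M.submoduleI)
    (auto simp: add act N.submodule_zero[OF K] intro: M.act_closed N.submodule_add[OF K] N.submodule_act[OF K])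

lemma submodule_kernel: "submodule {x \<in> carrier M. f x = \<zero>\<^bsub>N\<^esub>} R M"
  using submodule_vimage[OF N.submodule_zero_set] by simp

lemma submodule_image:
  assumes H: "submodule H R M" shows "submodule (f ` H) R N"
proof (rule N.submoduleI)
  show "f ` H \<subseteq> carrier N" using M.submodule_mem[OF H] by auto
  show "\<zero>\<^bsub>N\<^esub> \<in> f ` H" using M.submodule_zero[OF H] by (intro image_eqI[of _ _ "\<zero>\<^bsub>M\<^esub>"]) auto
next
  fix x y assume "x \<in> f ` H" "y \<in> f ` H"
  then obtain u v where "u \<in> H" "v \<in> H" "x = f u" "y = f v" by auto
  then show "x \<oplus>\<^bsub>N\<^esub> y \<in> f ` H"
    using M.submodule_mem[OF H] M.submodule_add[OF H] by (intro image_eqI[of _ _ "u \<oplus>\<^bsub>M\<^esub> v"]) (auto simp: add)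
next
  fix a x assume "a \<in> carrier R" "x \<in> f ` H"
  then obtain u where "u \<in> H" "x = f u" by auto
  then show "a \<odot>\<^bsub>N\<^esub> x \<in> f ` H"
    using M.submodule_mem[OF H] M.submodule_act[OF H] \<open>a \<in> carrier R\<close>
    by (intro image_eqI[of _ _ "a \<odot>\<^bsub>M\<^esub> u"]) (auto simp: act)
qed

lemma inj_iff: "inj_on f (carrier M) \<longleftrightarrow> (\<forall>x\<in>carrier M. f x = \<zero>\<^bsub>N\<^esub> \<longrightarrow> x = \<zero>\<^bsub>M\<^esub>)"
proof
  assume "inj_on f (carrier M)"
  then show "\<forall>x\<in>carrier M. f x = \<zero>\<^bsub>N\<^esub> \<longrightarrow> x = \<zero>\<^bsub>M\<^esub>" by (metis M.M.zero_closed inj_onD zero)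
next
  assume *: "\<forall>x\<in>carrier M. f x = \<zero>\<^bsub>N\<^esub> \<longrightarrow> x = \<zero>\<^bsub>M\<^esub>"
  show "inj_on f (carrier M)"
  proof (rule inj_onI)
    fix x y assume xy: "x \<in> carrier M" "y \<in> carrier M" "f x = f y"
    then have "f (x \<ominus>\<^bsub>M\<^esub> y) = \<zero>\<^bsub>N\<^esub>"
      by (simp add: minus) (use N.diff_eq_zero_iff closed in blast)
    then show "x = y" using xy * M.diff_eq_zero_iff M.M.minus_closed by blast
  qed
qed

end

lemma rmod_morphismI:
  "\<lbrakk>right_module R M; right_module R N; f \<in> rmod_hom R M N\<rbrakk> \<Longrightarrow> rmod_morphism R M N f"
  by (simp add: rmod_morphism_def rmod_morphism_axioms_def)

lemma rmod_hom_comp: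
  "\<lbrakk>f \<in> rmod_hom R L M; g \<in> rmod_hom R M N\<rbrakk> \<Longrightarrow> (\<lambda>x. g (f x)) \<in> rmod_hom R L N"
  by (auto simp: rmod_hom_def hom_def Pi_iff)

lemma rmod_hom_id: "(\<lambda>x. x) \<in> rmod_hom R M M"
  by (auto simp: rmod_hom_def hom_def)

lemma rmod_hom_zero:
  "right_module R N \<Longrightarrow> (\<lambda>x. \<zero>\<^bsub>N\<^esub>) \<in> rmod_hom R M N"
proof -
  assume "right_module R N"
  then interpret N: right_module R N .
  show ?thesis by (rule rmod_homI) auto
qed

lemma rmod_hom_plus:
  assumes "right_module R N" "f \<in> rmod_hom R M N" "g \<in> rmod_hom R M N"
  shows "(\<lambda>x. f x \<oplus>\<^bsub>N\<^esub> g x) \<in> rmod_hom R M N"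
proof -
  interpret N: right_module R N by fact
  show ?thesis
    using assms(2,3)[THEN rmod_hom_closed] assms(2,3)[THEN rmod_hom_add] assms(2,3)[THEN rmod_hom_act]
    by (intro rmod_homI) (auto simp: N.M.a_ac N.act_add)
qed

lemma rmod_hom_minus:
  assumes "right_module R N" "f \<in> rmod_hom R M N" "g \<in> rmod_hom R M N"
  shows "(\<lambda>x. f x \<ominus>\<^bsub>N\<^esub> g x) \<in> rmod_hom R M N"
proof -
  interpret N: right_module R N by fact
  note g = rmod_hom_closed[OF assms(3)] rmod_hom_add[OF assms(3)] rmod_hom_act[OF assms(3)]
  have "(\<lambda>x. \<ominus>\<^bsub>N\<^esub> g x) \<in> rmod_hom R M N"
    by (rule rmod_homI) (simp_all add: g N.M.minus_add N.act_minus)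
  from rmod_hom_plus[OF assms(1,2) this] show ?thesis
    by (simp add: N.M.minus_eq)
qed

text \<open>Values off the carrier are arbitrary in \<open>rmod_hom\<close>, so maps have to be
  compared on the carrier only.\<close>

lemma rmod_hom_cong:
  assumes "f \<in> rmod_hom R M N" "right_module R M" "\<And>x. x \<in> carrier M \<Longrightarrow> g x = f x"
  shows "g \<in> rmod_hom R M N"
proof -
  interpret M: right_module R M by fact
  show ?thesis
    by (rule rmod_homI)
      (simp_all add: assms(3) M.act_closed rmod_hom_closed[OF assms(1)] rmod_hom_add[OF assms(1)]
        rmod_hom_act[OF assms(1)])
qed

text \<open>An infinite index set is harmless: \<open>finsum\<close> is then zero by convention, and
  the zero map is a homomorphism.\<close>

lemma rmod_hom_finsum:
  assumes "right_module R N" and M: "right_module R M" and "\<And>i. i \<in> A \<Longrightarrow> f i \<in> rmod_hom R M N"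
  shows "(\<lambda>x. finsum N (\<lambda>i. f i x) A) \<in> rmod_hom R M N"
proof -
  interpret N: right_module R N by fact
  show ?thesis using assms(3)
  proof (induct A rule: infinite_finite_induct)
    case (insert y F)
    have "(\<lambda>x. f y x \<oplus>\<^bsub>N\<^esub> finsum N (\<lambda>i. f i x) F) \<in> rmod_hom R M N"
      using insert by (intro rmod_hom_plus[OF assms(1)]) auto
    moreover have "finsum N (\<lambda>i. f i x) (insert y F) = f y x \<oplus>\<^bsub>N\<^esub> finsum N (\<lambda>i. f i x) F" if "x \<in> carrier M" for x
      using insert(1,2) that rmod_hom_closed[OF insert(4)] by (intro N.M.finsum_insert) (auto simp: Pi_iff)
    ultimately show ?case by (rule rmod_hom_cong[OF _ M])
  qed (auto simp: N.M.finsum_infinite intro: rmod_hom_zero assms)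
qed

lemma rmod_hom_inv:
  assumes "f \<in> rmod_hom R M N" "bij_betw f (carrier M) (carrier N)" "right_module R M"
  shows "inv_into (carrier M) f \<in> rmod_hom R N M"
proof -
  interpret M: right_module R M by fact
  have inj: "inj_on f (carrier M)" and im: "f ` carrier M = carrier N"
    using assms(2) by (auto simp: bij_betw_def)
  have c: "\<And>y. y \<in> carrier N \<Longrightarrow> inv_into (carrier M) f y \<in> carrier M"
    "\<And>y. y \<in> carrier N \<Longrightarrow> f (inv_into (carrier M) f y) = y"
    using im by (auto simp: inv_into_into f_inv_into_f)
  show ?thesis
    by (rule rmod_homI; intro inv_into_f_eq inj c)
      (auto simp: c rmod_hom_add[OF assms(1)] rmod_hom_act[OF assms(1)] intro: M.act_closed)
qed

lemma rmod_iso_refl: "rmod_iso R M M"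
  unfolding rmod_iso_def by (auto intro!: bexI[OF _ rmod_hom_id] simp: bij_betw_def)

lemma rmod_iso_sym: "\<lbrakk>rmod_iso R M N; right_module R M\<rbrakk> \<Longrightarrow> rmod_iso R N M"
  unfolding rmod_iso_def by (auto intro!: bexI[OF _ rmod_hom_inv] bij_betw_inv_into)

lemma rmod_iso_trans: "\<lbrakk>rmod_iso R L M; rmod_iso R M N\<rbrakk> \<Longrightarrow> rmod_iso R L N"
proof -
  assume "rmod_iso R L M" "rmod_iso R M N"
  then obtain f g where *: "f \<in> rmod_hom R L M" "bij_betw f (carrier L) (carrier M)"
    "g \<in> rmod_hom R M N" "bij_betw g (carrier M) (carrier N)"
    unfolding rmod_iso_def by auto
  show ?thesis
    unfolding rmod_iso_def
    by (intro bexI[OF _ rmod_hom_comp[OF *(1,3)]] bij_betw_trans[OF *(2,4), unfolded comp_def])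
qed

lemma rmod_isoI:
  assumes "f \<in> rmod_hom R M N" "g \<in> rmod_hom R N M"
    and "\<And>x. x \<in> carrier M \<Longrightarrow> g (f x) = x" "\<And>y. y \<in> carrier N \<Longrightarrow> f (g y) = y"
  shows "rmod_iso R M N"
  unfolding rmod_iso_def
  by (intro bexI[OF _ assms(1)] bij_betw_byWitness[where f' = g])
    (auto simp: assms intro: rmod_hom_closed[OF assms(1)] rmod_hom_closed[OF assms(2)])

lemma rmod_isoE:
  assumes "rmod_iso R M N" "right_module R M"
  obtains f g where "f \<in> rmod_hom R M N" "g \<in> rmod_hom R N M"
    "\<And>x. x \<in> carrier M \<Longrightarrow> g (f x) = x" "\<And>y. y \<in> carrier N \<Longrightarrow> f (g y) = y"
proof -
  from assms obtain f where f: "f \<in> rmod_hom R M N" "bij_betw f (carrier M) (carrier N)"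
    unfolding rmod_iso_def by auto
  show ?thesis
    by (rule that[OF f(1) rmod_hom_inv[OF f assms(2)]])
      (use f(2) in \<open>auto simp: bij_betw_def f_inv_into_f\<close>)
qed

lemma generated_byD:
  "\<lbrakk>generated_by R M S; submodule H R M; S \<subseteq> H; x \<in> carrier M\<rbrakk> \<Longrightarrow> x \<in> H"
  unfolding generated_by_def by blast

text \<open>A submodule containing the image of \<open>S\<close> has a preimage that contains
  \<open>S\<close> and is therefore everything.\<close>

lemma generated_by_image:
  assumes "right_module R M" "right_module R N" "f \<in> rmod_hom R M N" "f ` carrier M = carrier N"
    and S: "generated_by R M S"
  shows "generated_by R N (f ` S)"
proof -
  interpret rmod_morphism R M N f using assms by (simp add: rmod_morphismI)
  have "H = carrier N" if H: "submodule H R N" "f ` S \<subseteq> H" for H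
  proof -
    have "S \<subseteq> {x \<in> carrier M. f x \<in> H}" using H S by (auto simp: generated_by_def)
    then have "carrier M = {x \<in> carrier M. f x \<in> H}"
      using submodule_vimage[OF H(1)] S unfolding generated_by_def by metis
    then have "f ` carrier M \<subseteq> H" by blast
    then have "carrier N \<subseteq> H" using assms(4) by simp
    then show ?thesis using N.submodule_subset[OF H(1)] by auto
  qed
  then show ?thesis using S by (auto simp: generated_by_def)
qed

lemma fin_gen_image:
  assumes "right_module R M" "right_module R N" "f \<in> rmod_hom R M N" "f ` carrier M = carrier N"
    and "fin_gen R M"
  shows "fin_gen R N"
  using assms generated_by_image[OF assms(1-4)] unfolding fin_gen_def by blast

lemma countably_gen_image:
  assumes "right_module R M" "right_module R N" "f \<in> rmod_hom R M N" "f ` carrier M = carrier N"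
    and "countably_gen R M"
  shows "countably_gen R N"
  using assms generated_by_image[OF assms(1-4)] unfolding countably_gen_def by blast

subsection \<open>Direct sums\<close>

lemma regular_simps [simp]:
  "carrier (regular R) = carrier R" "add (regular R) = add R" "zero (regular R) = zero R"
  "smult (regular R) a x = x \<otimes>\<^bsub>R\<^esub> a"
  by (simp_all add: regular_def)

lemma direct_sum_simps [simp]:
  "add (direct_sum I M) f g = (\<lambda>i\<in>I. f i \<oplus>\<^bsub>M i\<^esub> g i)"
  "zero (direct_sum I M) = (\<lambda>i\<in>I. \<zero>\<^bsub>M i\<^esub>)"
  "smult (direct_sum I M) a f = (\<lambda>i\<in>I. a \<odot>\<^bsub>M i\<^esub> f i)"
  by (simp_all add: direct_sum_def)

lemma direct_sum_carrier:
  "f \<in> carrier (direct_sum I M) \<longleftrightarrow>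
     f \<in> (\<Pi>\<^sub>E i\<in>I. carrier (M i)) \<and> finite {i \<in> I. f i \<noteq> \<zero>\<^bsub>M i\<^esub>}"
  by (simp add: direct_sum_def)

lemma direct_sum_closed: "\<lbrakk>f \<in> carrier (direct_sum I M); i \<in> I\<rbrakk> \<Longrightarrow> f i \<in> carrier (M i)"
  by (auto simp: direct_sum_carrier)

lemma direct_sum_finite: "f \<in> carrier (direct_sum I M) \<Longrightarrow> finite {i \<in> I. f i \<noteq> \<zero>\<^bsub>M i\<^esub>}"
  by (simp add: direct_sum_carrier)

lemma direct_sum_eqI:
  "\<lbrakk>f \<in> carrier (direct_sum I M); g \<in> carrier (direct_sum I M); \<And>i. i \<in> I \<Longrightarrow> f i = g i\<rbrakk> \<Longrightarrow> f = g"
  by (auto simp: direct_sum_carrier intro: PiE_ext)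

lemma direct_sumI:
  "\<lbrakk>f \<in> extensional I; \<And>i. i \<in> I \<Longrightarrow> f i \<in> carrier (M i); finite A; \<And>i. i \<in> I - A \<Longrightarrow> f i = \<zero>\<^bsub>M i\<^esub>\<rbrakk>
     \<Longrightarrow> f \<in> carrier (direct_sum I M)"
  unfolding direct_sum_carrier PiE_iff by (auto intro: finite_subset[of _ A])

lemma right_module_regular: "ring R \<Longrightarrow> right_module R (regular R)"
proof -
  assume "ring R"
  then interpret ring R .
  show ?thesis
    by (rule right_moduleI) (auto simp: ring_axioms a_assoc m_assoc l_distr r_distr intro: a_comm)
qed

lemma right_module_direct_sum:
  assumes "ring R" and M: "\<And>i. i \<in> I \<Longrightarrow> right_module R (M i)"
  shows "right_module R (direct_sum I M)"
proof -
  interpret R: ring R by fact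
  have zero: "\<zero>\<^bsub>M i\<^esub> \<in> carrier (M i)" "\<zero>\<^bsub>M i\<^esub> \<oplus>\<^bsub>M i\<^esub> \<zero>\<^bsub>M i\<^esub> = \<zero>\<^bsub>M i\<^esub>"
    "a \<in> carrier R \<Longrightarrow> a \<odot>\<^bsub>M i\<^esub> \<zero>\<^bsub>M i\<^esub> = \<zero>\<^bsub>M i\<^esub>"
    "x \<in> carrier (M i) \<Longrightarrow> \<zero>\<^bsub>M i\<^esub> \<oplus>\<^bsub>M i\<^esub> x = x"
    "x \<in> carrier (M i) \<Longrightarrow> \<zero>\<^bsub>R\<^esub> \<odot>\<^bsub>M i\<^esub> x = \<zero>\<^bsub>M i\<^esub>"
    "x \<in> carrier (M i) \<Longrightarrow> \<one>\<^bsub>R\<^esub> \<odot>\<^bsub>M i\<^esub> x = x"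
    "\<lbrakk>x \<in> carrier (M i); y \<in> carrier (M i)\<rbrakk> \<Longrightarrow> x \<oplus>\<^bsub>M i\<^esub> y \<in> carrier (M i)"
    "\<lbrakk>a \<in> carrier R; x \<in> carrier (M i)\<rbrakk> \<Longrightarrow> a \<odot>\<^bsub>M i\<^esub> x \<in> carrier (M i)" if "i \<in> I" for i a x y
  proof -
    interpret right_module R "M i" using M that .
    show "\<zero>\<^bsub>M i\<^esub> \<in> carrier (M i)" "\<zero>\<^bsub>M i\<^esub> \<oplus>\<^bsub>M i\<^esub> \<zero>\<^bsub>M i\<^esub> = \<zero>\<^bsub>M i\<^esub>"
      "a \<in> carrier R \<Longrightarrow> a \<odot>\<^bsub>M i\<^esub> \<zero>\<^bsub>M i\<^esub> = \<zero>\<^bsub>M i\<^esub>"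
      "x \<in> carrier (M i) \<Longrightarrow> \<zero>\<^bsub>M i\<^esub> \<oplus>\<^bsub>M i\<^esub> x = x"
      "x \<in> carrier (M i) \<Longrightarrow> \<zero>\<^bsub>R\<^esub> \<odot>\<^bsub>M i\<^esub> x = \<zero>\<^bsub>M i\<^esub>"
      "x \<in> carrier (M i) \<Longrightarrow> \<one>\<^bsub>R\<^esub> \<odot>\<^bsub>M i\<^esub> x = x"
      "\<lbrakk>x \<in> carrier (M i); y \<in> carrier (M i)\<rbrakk> \<Longrightarrow> x \<oplus>\<^bsub>M i\<^esub> y \<in> carrier (M i)"
      "\<lbrakk>a \<in> carrier R; x \<in> carrier (M i)\<rbrakk> \<Longrightarrow> a \<odot>\<^bsub>M i\<^esub> x \<in> carrier (M i)"
      by (auto simp: act_one intro: act_closed)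
  qed
  note c = direct_sum_closed[of _ I M]
  show ?thesis
  proof (rule right_moduleI)
    fix f g assume f: "f \<in> carrier (direct_sum I M)" and g: "g \<in> carrier (direct_sum I M)"
    show "f \<oplus>\<^bsub>direct_sum I M\<^esub> g \<in> carrier (direct_sum I M)"
      by (rule direct_sumI[where A = "{i \<in> I. f i \<noteq> \<zero>\<^bsub>M i\<^esub>} \<union> {i \<in> I. g i \<noteq> \<zero>\<^bsub>M i\<^esub>}"])
        (use f g in \<open>auto simp: direct_sum_finite zero c\<close>)
  next
    fix f a assume f: "f \<in> carrier (direct_sum I M)" and a: "a \<in> carrier R"
    show "a \<odot>\<^bsub>direct_sum I M\<^esub> f \<in> carrier (direct_sum I M)"
      by (rule direct_sumI[where A = "{i \<in> I. f i \<noteq> \<zero>\<^bsub>M i\<^esub>}"])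
        (use f a in \<open>auto simp: direct_sum_finite zero c\<close>)
  next
    show "\<zero>\<^bsub>direct_sum I M\<^esub> \<in> carrier (direct_sum I M)"
      by (rule direct_sumI[where A = "{}"]) (auto simp: zero)
  next
    fix f g h assume "f \<in> carrier (direct_sum I M)" "g \<in> carrier (direct_sum I M)" "h \<in> carrier (direct_sum I M)"
    then have "(f i \<oplus>\<^bsub>M i\<^esub> g i) \<oplus>\<^bsub>M i\<^esub> h i = f i \<oplus>\<^bsub>M i\<^esub> (g i \<oplus>\<^bsub>M i\<^esub> h i)" if "i \<in> I" for i
    proof -
      interpret right_module R "M i" using M that .
      show ?thesis using \<open>f \<in> _\<close> \<open>g \<in> _\<close> \<open>h \<in> _\<close> that by (simp add: c a_assoc)
    qed
    then show "f \<oplus>\<^bsub>direct_sum I M\<^esub> g \<oplus>\<^bsub>direct_sum I M\<^esub> h = f \<oplus>\<^bsub>direct_sum I M\<^esub> (g \<oplus>\<^bsub>direct_sum I M\<^esub> h)"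
      by (auto simp: fun_eq_iff restrict_def)
  next
    fix f g assume "f \<in> carrier (direct_sum I M)" "g \<in> carrier (direct_sum I M)"
    then have "f i \<oplus>\<^bsub>M i\<^esub> g i = g i \<oplus>\<^bsub>M i\<^esub> f i" if "i \<in> I" for i
    proof -
      interpret right_module R "M i" using M that .
      show ?thesis using \<open>f \<in> _\<close> \<open>g \<in> _\<close> that by (simp add: c a_comm)
    qed
    then show "f \<oplus>\<^bsub>direct_sum I M\<^esub> g = g \<oplus>\<^bsub>direct_sum I M\<^esub> f"
      by (auto simp: fun_eq_iff restrict_def)
  next
    fix f assume f: "f \<in> carrier (direct_sum I M)"
    then have e: "f \<in> extensional I" by (auto simp: direct_sum_carrier PiE_iff)
    show "\<zero>\<^bsub>direct_sum I M\<^esub> \<oplus>\<^bsub>direct_sum I M\<^esub> f = f"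
      by (rule extensionalityI[OF _ e]) (use f in \<open>auto simp: c zero\<close>)
    show "\<one>\<^bsub>R\<^esub> \<odot>\<^bsub>direct_sum I M\<^esub> f = f"
      by (rule extensionalityI[OF _ e]) (use f in \<open>auto simp: c zero\<close>)
    show "\<zero>\<^bsub>R\<^esub> \<odot>\<^bsub>direct_sum I M\<^esub> f = \<zero>\<^bsub>direct_sum I M\<^esub>"
      using f by (auto simp: fun_eq_iff restrict_def c zero)
  next
    fix a b f assume ab: "a \<in> carrier R" "b \<in> carrier R" and f: "f \<in> carrier (direct_sum I M)"
    have *: "(a \<oplus>\<^bsub>R\<^esub> b) \<odot>\<^bsub>M i\<^esub> f i = a \<odot>\<^bsub>M i\<^esub> f i \<oplus>\<^bsub>M i\<^esub> b \<odot>\<^bsub>M i\<^esub> f i"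
      "(a \<otimes>\<^bsub>R\<^esub> b) \<odot>\<^bsub>M i\<^esub> f i = b \<odot>\<^bsub>M i\<^esub> (a \<odot>\<^bsub>M i\<^esub> f i)" if "i \<in> I" for i
      using right_module.act_add_ring[OF M[OF that] ab c[OF f that]]
        right_module.act_mult[OF M[OF that] ab c[OF f that]] by auto
    then show "(a \<oplus>\<^bsub>R\<^esub> b) \<odot>\<^bsub>direct_sum I M\<^esub> f = a \<odot>\<^bsub>direct_sum I M\<^esub> f \<oplus>\<^bsub>direct_sum I M\<^esub> b \<odot>\<^bsub>direct_sum I M\<^esub> f"
      by (auto simp: fun_eq_iff restrict_def)
    show "(a \<otimes>\<^bsub>R\<^esub> b) \<odot>\<^bsub>direct_sum I M\<^esub> f = b \<odot>\<^bsub>direct_sum I M\<^esub> (a \<odot>\<^bsub>direct_sum I M\<^esub> f)"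
      using * by (auto simp: fun_eq_iff restrict_def)
  next
    fix a f g assume a: "a \<in> carrier R" and fg: "f \<in> carrier (direct_sum I M)" "g \<in> carrier (direct_sum I M)"
    have "a \<odot>\<^bsub>M i\<^esub> (f i \<oplus>\<^bsub>M i\<^esub> g i) = a \<odot>\<^bsub>M i\<^esub> f i \<oplus>\<^bsub>M i\<^esub> a \<odot>\<^bsub>M i\<^esub> g i" if "i \<in> I" for i
      using right_module.act_add[OF M[OF that] a c[OF fg(1) that] c[OF fg(2) that]] .
    then show "a \<odot>\<^bsub>direct_sum I M\<^esub> (f \<oplus>\<^bsub>direct_sum I M\<^esub> g) = a \<odot>\<^bsub>direct_sum I M\<^esub> f \<oplus>\<^bsub>direct_sum I M\<^esub> a \<odot>\<^bsub>direct_sum I M\<^esub> g"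
      by (auto simp: fun_eq_iff restrict_def)
  qed (rule assms)
qed

lemma module_sum_simps [simp]:
  "carrier (module_sum M N) = carrier M \<times> carrier N"
  "add (module_sum M N) p q = (fst p \<oplus>\<^bsub>M\<^esub> fst q, snd p \<oplus>\<^bsub>N\<^esub> snd q)"
  "zero (module_sum M N) = (\<zero>\<^bsub>M\<^esub>, \<zero>\<^bsub>N\<^esub>)"
  "smult (module_sum M N) a p = (a \<odot>\<^bsub>M\<^esub> fst p, a \<odot>\<^bsub>N\<^esub> snd p)"
  by (simp_all add: module_sum_def split_beta)

lemma right_module_module_sum:
  assumes "right_module R M" "right_module R N"
  shows "right_module R (module_sum M N)"
proof -
  interpret M: right_module R M by fact
  interpret N: right_module R N by fact
  show ?thesis
    by (rule right_moduleI)
      (auto simp: M.R.ring_axioms M.M.a_assoc N.M.a_assoc M.act_add M.act_add_ring M.act_mult M.act_one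
        N.act_add N.act_add_ring N.act_mult N.act_one
        intro: M.act_closed N.act_closed M.M.a_comm N.M.a_comm)
qed

lemma rmod_hom_fst: "fst \<in> rmod_hom R (module_sum M N) M"
  and rmod_hom_snd: "snd \<in> rmod_hom R (module_sum M N) N"
  by (auto intro: rmod_homI)

lemma rmod_hom_Pair:
  "\<lbrakk>f \<in> rmod_hom R L M; g \<in> rmod_hom R L N\<rbrakk> \<Longrightarrow> (\<lambda>x. (f x, g x)) \<in> rmod_hom R L (module_sum M N)"
  by (auto simp: rmod_hom_def hom_def Pi_iff)

lemma rmod_hom_inl:
  assumes "right_module R M" "right_module R N"
  shows "(\<lambda>x. (x, \<zero>\<^bsub>N\<^esub>)) \<in> rmod_hom R M (module_sum M N)"
  by (rule rmod_hom_Pair[OF rmod_hom_id rmod_hom_zero[OF assms(2)]])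

lemma rmod_hom_inr:
  assumes "right_module R M" "right_module R N"
  shows "(\<lambda>x. (\<zero>\<^bsub>M\<^esub>, x)) \<in> rmod_hom R N (module_sum M N)"
  by (rule rmod_hom_Pair[OF rmod_hom_zero[OF assms(1)] rmod_hom_id])

lemma rmod_hom_proj: "i \<in> I \<Longrightarrow> (\<lambda>f. f i) \<in> rmod_hom R (direct_sum I M) (M i)"
  by (auto intro!: rmod_homI simp: direct_sum_closed)

lemma rmod_hom_direct_sum_map:
  assumes "\<And>i. i \<in> I \<Longrightarrow> right_module R (M i)" "\<And>i. i \<in> I \<Longrightarrow> right_module R (N i)"
    "\<And>i. i \<in> I \<Longrightarrow> u i \<in> rmod_hom R (M i) (N i)"
  shows "(\<lambda>f. \<lambda>i\<in>I. u i (f i)) \<in> rmod_hom R (direct_sum I M) (direct_sum I N)"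
proof (rule rmod_homI)
  have z: "u i \<zero>\<^bsub>M i\<^esub> = \<zero>\<^bsub>N i\<^esub>" if "i \<in> I" for i
    using rmod_morphism.zero[OF rmod_morphismI] assms that by blast
  fix f assume f: "f \<in> carrier (direct_sum I M)"
  show "(\<lambda>i\<in>I. u i (f i)) \<in> carrier (direct_sum I N)"
    by (rule direct_sumI[where A = "{i \<in> I. f i \<noteq> \<zero>\<^bsub>M i\<^esub>}"])
      (use f z in \<open>auto simp: direct_sum_finite direct_sum_closed intro!: rmod_hom_closed[OF assms(3)]\<close>)
next
  fix f g assume *: "f \<in> carrier (direct_sum I M)" "g \<in> carrier (direct_sum I M)"
  show "(\<lambda>i\<in>I. u i ((f \<oplus>\<^bsub>direct_sum I M\<^esub> g) i)) =
     (\<lambda>i\<in>I. u i (f i)) \<oplus>\<^bsub>direct_sum I N\<^esub> (\<lambda>i\<in>I. u i (g i))"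
    using * by (auto simp: fun_eq_iff restrict_def direct_sum_closed rmod_hom_add[OF assms(3)])
next
  fix a f assume *: "a \<in> carrier R" "f \<in> carrier (direct_sum I M)"
  show "(\<lambda>i\<in>I. u i ((a \<odot>\<^bsub>direct_sum I M\<^esub> f) i)) = a \<odot>\<^bsub>direct_sum I N\<^esub> (\<lambda>i\<in>I. u i (f i))"
    using * by (auto simp: fun_eq_iff restrict_def direct_sum_closed rmod_hom_act[OF assms(3)])
qed

text \<open>The canonical injection of the summand \<open>M i\<close>. It is extensional, like all
  elements of the direct sum.\<close>

definition ds_single :: "'i set \<Rightarrow> ('i \<Rightarrow> ('a, 'b, 'm) module_scheme) \<Rightarrow> 'i \<Rightarrow> 'b \<Rightarrow> 'i \<Rightarrow> 'b"
  where "ds_single I M i x = (\<lambda>j\<in>I. if j = i then x else \<zero>\<^bsub>M j\<^esub>)"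

lemma ds_single_apply: "j \<in> I \<Longrightarrow> ds_single I M i x j = (if j = i then x else \<zero>\<^bsub>M j\<^esub>)"
  by (simp add: ds_single_def)

lemma rmod_hom_ds_single:
  assumes M: "\<And>i. i \<in> I \<Longrightarrow> right_module R (M i)" and i: "i \<in> I"
  shows "ds_single I M i \<in> rmod_hom R (M i) (direct_sum I M)"
proof (rule rmod_homI)
  have z: "\<zero>\<^bsub>M j\<^esub> \<in> carrier (M j)" "\<zero>\<^bsub>M j\<^esub> \<oplus>\<^bsub>M j\<^esub> \<zero>\<^bsub>M j\<^esub> = \<zero>\<^bsub>M j\<^esub>"
    "a \<in> carrier R \<Longrightarrow> a \<odot>\<^bsub>M j\<^esub> \<zero>\<^bsub>M j\<^esub> = \<zero>\<^bsub>M j\<^esub>" if "j \<in> I" for j a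
  proof -
    interpret right_module R "M j" using M that .
    show "\<zero>\<^bsub>M j\<^esub> \<in> carrier (M j)" "\<zero>\<^bsub>M j\<^esub> \<oplus>\<^bsub>M j\<^esub> \<zero>\<^bsub>M j\<^esub> = \<zero>\<^bsub>M j\<^esub>"
     "a \<in> carrier R \<Longrightarrow> a \<odot>\<^bsub>M j\<^esub> \<zero>\<^bsub>M j\<^esub> = \<zero>\<^bsub>M j\<^esub>" by auto
  qed
  show "ds_single I M i x \<in> carrier (direct_sum I M)" if "x \<in> carrier (M i)" for x
    by (rule direct_sumI[where A = "{i}"]) (use that z in \<open>auto simp: ds_single_def\<close>)
  show "ds_single I M i (x \<oplus>\<^bsub>M i\<^esub> y) = ds_single I M i x \<oplus>\<^bsub>direct_sum I M\<^esub> ds_single I M i y" for x y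
    using z by (auto simp: ds_single_def fun_eq_iff restrict_def)
  show "ds_single I M i (a \<odot>\<^bsub>M i\<^esub> x) = a \<odot>\<^bsub>direct_sum I M\<^esub> ds_single I M i x" if "a \<in> carrier R" for a x
    using z that by (auto simp: ds_single_def fun_eq_iff restrict_def)
qed

text \<open>Evaluation at \<open>j\<close> is a homomorphism, and only the term with index
  \<open>j\<close> survives it.\<close>

lemma direct_sum_eq_finsum:
  assumes "ring R" and M: "\<And>i. i \<in> I \<Longrightarrow> right_module R (M i)" and f: "f \<in> carrier (direct_sum I M)"
  shows "f = finsum (direct_sum I M) (\<lambda>i. ds_single I M i (f i)) {i \<in> I. f i \<noteq> \<zero>\<^bsub>M i\<^esub>}"
    (is "f = finsum ?D ?g ?A")
proof -
  interpret D: right_module R ?D by (rule right_module_direct_sum[OF assms(1) M])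
  have g: "?g \<in> ?A \<rightarrow> carrier ?D"
    using rmod_hom_closed[OF rmod_hom_ds_single[where I = I and M = M, OF M]] direct_sum_closed[OF f] by auto
  have "f j = finsum ?D ?g ?A j" if j: "j \<in> I" for j
  proof -
    interpret Mj: right_module R "M j" using M j .
    interpret rmod_morphism R ?D "M j" "\<lambda>f. f j"
      by (rule rmod_morphismI[OF D.right_module_axioms M[OF j] rmod_hom_proj[OF j]])
    have fin: "finite ?A" by (rule direct_sum_finite[OF f])
    have "finsum ?D ?g ?A j = finsum (M j) (\<lambda>i. ds_single I M i (f i) j) ?A"
      using finsum[OF g] .
    also have "\<dots> = finsum (M j) (\<lambda>i. f j) ({j} \<inter> ?A)"
      by (rule Mj.M.add.finprod_mono_neutral_cong_right) (use fin j direct_sum_closed[OF f] in \<open>auto simp: ds_single_apply\<close>)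
    also have "\<dots> = f j"
      using direct_sum_closed[OF f j] by (cases "j \<in> ?A") (use j in auto)
    finally show ?thesis ..
  qed
  then show ?thesis
    by (intro direct_sum_eqI[OF f D.M.finsum_closed[OF g]])
qed

text \<open>Serves as an induction principle: a property that defines a submodule has to be checked
  on single components only, because every element is a finite sum of these.\<close>

lemma direct_sum_submodule_eq:
  assumes "ring R" and M: "\<And>i. i \<in> I \<Longrightarrow> right_module R (M i)"
    and H: "submodule H R (direct_sum I M)"
    and "\<And>i x. \<lbrakk>i \<in> I; x \<in> carrier (M i)\<rbrakk> \<Longrightarrow> ds_single I M i x \<in> H"
  shows "f \<in> carrier (direct_sum I M) \<Longrightarrow> f \<in> H"
proof -
  assume f: "f \<in> carrier (direct_sum I M)"
  interpret D: right_module R "direct_sum I M" by (rule right_module_direct_sum[OF assms(1) M])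
  show "f \<in> H"
    by (subst direct_sum_eq_finsum[OF assms(1) M f], assumption, rule D.submodule_finsum[OF H])
      (use assms(4) direct_sum_closed[OF f] in auto)
qed

text \<open>The map out of the direct sum given by its universal property. Summing over the nonzero
  values keeps the sum finite although \<open>I\<close> may be infinite.\<close>

definition ds_sum :: "('a, 'c, 'n) module_scheme \<Rightarrow> 'i set \<Rightarrow> ('i \<Rightarrow> 'b \<Rightarrow> 'c) \<Rightarrow> ('i \<Rightarrow> 'b) \<Rightarrow> 'c"
  where "ds_sum N I u f = finsum N (\<lambda>i. u i (f i)) {i \<in> I. u i (f i) \<noteq> \<zero>\<^bsub>N\<^esub>}"

text \<open>Admits any finite index set outside of which the terms vanish, so that several values of
  \<open>ds_sum\<close> can be computed over one common set.\<close>

lemma ds_sum_eq: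
  assumes N: "right_module R N" and "finite A" "A \<subseteq> I"
    "\<And>i. i \<in> I - A \<Longrightarrow> u i (f i) = \<zero>\<^bsub>N\<^esub>" "\<And>i. i \<in> A \<Longrightarrow> u i (f i) \<in> carrier N"
  shows "ds_sum N I u f = finsum N (\<lambda>i. u i (f i)) A"
proof -
  interpret N: right_module R N by fact
  show ?thesis unfolding ds_sum_def
    by (rule N.M.add.finprod_mono_neutral_cong_left) (use assms in auto)
qed

lemma rmod_hom_ds_sum:
  assumes "ring R" and M: "\<And>i. i \<in> I \<Longrightarrow> right_module R (M i)" and N: "right_module R N"
    and u: "\<And>i. i \<in> I \<Longrightarrow> u i \<in> rmod_hom R (M i) N"
  shows "ds_sum N I u \<in> rmod_hom R (direct_sum I M) N"
proof -
  interpret N: right_module R N by fact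
  have u0: "u i \<zero>\<^bsub>M i\<^esub> = \<zero>\<^bsub>N\<^esub>" if "i \<in> I" for i
    using rmod_morphism.zero[OF rmod_morphismI[OF M[OF that] N u[OF that]]] .
  have am0: "a \<odot>\<^bsub>M i\<^esub> \<zero>\<^bsub>M i\<^esub> = \<zero>\<^bsub>M i\<^esub>" if "i \<in> I" "a \<in> carrier R" for a i
    using right_module.act_zero[OF M] that by simp
  have mz: "\<zero>\<^bsub>M i\<^esub> \<oplus>\<^bsub>M i\<^esub> \<zero>\<^bsub>M i\<^esub> = \<zero>\<^bsub>M i\<^esub>" if "i \<in> I" for i
  proof -
    interpret right_module R "M i" using M that .
    show ?thesis by simp
  qed
  have uc: "u i (f i) \<in> carrier N" if "f \<in> carrier (direct_sum I M)" "i \<in> I" for f i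
    using rmod_hom_closed[OF u[OF that(2)] direct_sum_closed[OF that]] .
  show ?thesis
  proof (rule rmod_homI)
    fix f assume f: "f \<in> carrier (direct_sum I M)"
    show "ds_sum N I u f \<in> carrier N"
      unfolding ds_sum_def by (rule N.M.finsum_closed) (use uc[OF f] in auto)
    fix a assume a: "a \<in> carrier R"
    let ?A = "{i \<in> I. f i \<noteq> \<zero>\<^bsub>M i\<^esub>}"
    have "ds_sum N I u (a \<odot>\<^bsub>direct_sum I M\<^esub> f) = finsum N (\<lambda>i. u i ((a \<odot>\<^bsub>direct_sum I M\<^esub> f) i)) ?A"
      by (rule ds_sum_eq[OF N])
        (use u0 f a am0 in \<open>auto simp: direct_sum_finite rmod_hom_act[OF u] uc direct_sum_closed intro!: N.act_closed\<close>)
    also have "\<dots> = finsum N (\<lambda>i. a \<odot>\<^bsub>N\<^esub> u i (f i)) ?A"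
      by (rule N.M.finsum_cong')
        (use f a in \<open>auto simp: rmod_hom_act[OF u] uc direct_sum_closed intro!: N.act_closed\<close>)
    also have "\<dots> = a \<odot>\<^bsub>N\<^esub> finsum N (\<lambda>i. u i (f i)) ?A"
      by (rule N.finsum_act[symmetric]) (use f a in \<open>auto simp: uc\<close>)
    also have "finsum N (\<lambda>i. u i (f i)) ?A = ds_sum N I u f"
      by (rule ds_sum_eq[OF N, symmetric]) (use u0 f in \<open>auto simp: direct_sum_finite uc\<close>)
    finally show "ds_sum N I u (a \<odot>\<^bsub>direct_sum I M\<^esub> f) = a \<odot>\<^bsub>N\<^esub> ds_sum N I u f" .
  next
    fix f g assume f: "f \<in> carrier (direct_sum I M)" and g: "g \<in> carrier (direct_sum I M)"
    \<comment> \<open>The union of the two supports is a common index set for the sums belonging to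
      \<open>f\<close>, to \<open>g\<close> and to \<open>f\<close> plus \<open>g\<close>.\<close>
    let ?A = "{i \<in> I. f i \<noteq> \<zero>\<^bsub>M i\<^esub>} \<union> {i \<in> I. g i \<noteq> \<zero>\<^bsub>M i\<^esub>}"
    have fin: "finite ?A" using f g by (simp add: direct_sum_finite)
    have "ds_sum N I u (f \<oplus>\<^bsub>direct_sum I M\<^esub> g) = finsum N (\<lambda>i. u i ((f \<oplus>\<^bsub>direct_sum I M\<^esub> g) i)) ?A"
      by (rule ds_sum_eq[OF N fin]) (use u0 f g mz in \<open>auto simp: rmod_hom_add[OF u] uc direct_sum_closed\<close>)
    also have "\<dots> = finsum N (\<lambda>i. u i (f i) \<oplus>\<^bsub>N\<^esub> u i (g i)) ?A"
      by (rule N.M.finsum_cong') (use f g in \<open>auto simp: rmod_hom_add[OF u] uc direct_sum_closed\<close>)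
    also have "\<dots> = finsum N (\<lambda>i. u i (f i)) ?A \<oplus>\<^bsub>N\<^esub> finsum N (\<lambda>i. u i (g i)) ?A"
      by (rule N.M.finsum_addf) (use f g in \<open>auto simp: uc\<close>)
    also have "finsum N (\<lambda>i. u i (f i)) ?A = ds_sum N I u f"
      by (rule ds_sum_eq[OF N fin, symmetric]) (use u0 f in \<open>auto simp: uc\<close>)
    also have "finsum N (\<lambda>i. u i (g i)) ?A = ds_sum N I u g"
      by (rule ds_sum_eq[OF N fin, symmetric]) (use u0 g in \<open>auto simp: uc\<close>)
    finally show "ds_sum N I u (f \<oplus>\<^bsub>direct_sum I M\<^esub> g) = ds_sum N I u f \<oplus>\<^bsub>N\<^esub> ds_sum N I u g" .
  qed
qed

lemma ds_sum_single:
  assumes M: "\<And>i. i \<in> I \<Longrightarrow> right_module R (M i)" and N: "right_module R N"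
    and u: "\<And>i. i \<in> I \<Longrightarrow> u i \<in> rmod_hom R (M i) N" and i: "i \<in> I" and x: "x \<in> carrier (M i)"
  shows "ds_sum N I u (ds_single I M i x) = u i x"
proof -
  interpret N: right_module R N by fact
  have u0: "u i \<zero>\<^bsub>M i\<^esub> = \<zero>\<^bsub>N\<^esub>" if "i \<in> I" for i
    using rmod_morphism.zero[OF rmod_morphismI[OF M[OF that] N u[OF that]]] .
  have "ds_sum N I u (ds_single I M i x) = finsum N (\<lambda>j. u j (ds_single I M i x j)) {i}"
    by (rule ds_sum_eq[OF N]) (use i x u0 in \<open>auto simp: ds_single_apply intro: rmod_hom_closed[OF u]\<close>)
  then show ?thesis using i x by (simp add: ds_single_apply rmod_hom_closed[OF u])
qed

text \<open>The injected generators of all summands form a countable set. A submodule containing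
  them has full preimage in each summand.\<close>

lemma countably_gen_direct_sum:
  assumes "ring R" and M: "\<And>i. i \<in> I \<Longrightarrow> right_module R (M i)" and "countable I"
    and cg: "\<And>i. i \<in> I \<Longrightarrow> countably_gen R (M i)"
  shows "countably_gen R (direct_sum I M)"
proof -
  obtain S where S: "\<And>i. i \<in> I \<Longrightarrow> countable (S i)" "\<And>i. i \<in> I \<Longrightarrow> generated_by R (M i) (S i)"
    using cg unfolding countably_gen_def by metis
  let ?S = "\<Union>i\<in>I. ds_single I M i ` S i"
  interpret D: right_module R "direct_sum I M" by (rule right_module_direct_sum[OF assms(1) M])
  have "?S \<subseteq> carrier (direct_sum I M)"
    using S(2) rmod_hom_closed[OF rmod_hom_ds_single[where I = I and M = M, OF M]] by (fastforce simp: generated_by_def)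
  moreover have "H = carrier (direct_sum I M)" if H: "submodule H R (direct_sum I M)" "?S \<subseteq> H" for H
  proof -
    have "ds_single I M i x \<in> H" if ix: "i \<in> I" "x \<in> carrier (M i)" for i x
    proof -
      interpret rmod_morphism R "M i" "direct_sum I M" "ds_single I M i"
        by (rule rmod_morphismI[OF M[OF ix(1)] D.right_module_axioms rmod_hom_ds_single[where I = I and M = M, OF M ix(1)]])
      have "S i \<subseteq> {x \<in> carrier (M i). ds_single I M i x \<in> H}"
        using S(2)[OF ix(1)] H ix by (auto simp: generated_by_def)
      from generated_byD[OF S(2)[OF ix(1)] submodule_vimage[OF H(1)] this ix(2)] show ?thesis by auto
    qed
    from direct_sum_submodule_eq[OF assms(1) M H(1) this] show ?thesis
      using D.submodule_subset[OF H(1)] by auto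
  qed
  ultimately have "generated_by R (direct_sum I M) ?S" by (auto simp: generated_by_def)
  moreover have "countable ?S" using S(1) assms(3) by auto
  ultimately show ?thesis unfolding countably_gen_def by blast
qed

lemma generated_byI:
  assumes "S \<subseteq> carrier M"
    and "\<And>H x. \<lbrakk>submodule H R M; S \<subseteq> H; x \<in> carrier M\<rbrakk> \<Longrightarrow> x \<in> H"
  shows "generated_by R M S"
proof -
  have "H \<subseteq> carrier M" if "submodule H R M" for H
    using subgroup.subset[OF submodule.axioms(1)[OF that]] by simp
  then show ?thesis using assms unfolding generated_by_def by blast
qed

lemma generated_by_module_sum:
  assumes M: "right_module R M" and N: "right_module R N"
    and S: "generated_by R M S" and T: "generated_by R N T"
  shows "generated_by R (module_sum M N) ((\<lambda>x. (x, \<zero>\<^bsub>N\<^esub>)) ` S \<union> (\<lambda>y. (\<zero>\<^bsub>M\<^esub>, y)) ` T)"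
proof -
  interpret M: right_module R M by fact
  interpret N: right_module R N by fact
  interpret D: right_module R "module_sum M N" by (rule right_module_module_sum[OF M N])
  interpret i: rmod_morphism R M "module_sum M N" "\<lambda>x. (x, \<zero>\<^bsub>N\<^esub>)"
    by (rule rmod_morphismI[OF M D.right_module_axioms rmod_hom_inl[OF M N]])
  interpret j: rmod_morphism R N "module_sum M N" "\<lambda>y. (\<zero>\<^bsub>M\<^esub>, y)"
    by (rule rmod_morphismI[OF N D.right_module_axioms rmod_hom_inr[OF M N]])
  have "p \<in> H" if H: "submodule H R (module_sum M N)"
      "(\<lambda>x. (x, \<zero>\<^bsub>N\<^esub>)) ` S \<union> (\<lambda>y. (\<zero>\<^bsub>M\<^esub>, y)) ` T \<subseteq> H" and p: "p \<in> carrier (module_sum M N)" for H p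
  proof -
    have "fst p \<in> {x \<in> carrier M. (x, \<zero>\<^bsub>N\<^esub>) \<in> H}"
      by (rule generated_byD[OF S i.submodule_vimage[OF H(1)]]) (use p H(2) S in \<open>auto simp: generated_by_def\<close>)
    moreover have "snd p \<in> {x \<in> carrier N. (\<zero>\<^bsub>M\<^esub>, x) \<in> H}"
      by (rule generated_byD[OF T j.submodule_vimage[OF H(1)]]) (use p H(2) T in \<open>auto simp: generated_by_def\<close>)
    ultimately have "(fst p, \<zero>\<^bsub>N\<^esub>) \<oplus>\<^bsub>module_sum M N\<^esub> (\<zero>\<^bsub>M\<^esub>, snd p) \<in> H"
      using D.submodule_add[OF H(1)] by blast
    then show ?thesis using p by auto
  qed
  moreover have "(\<lambda>x. (x, \<zero>\<^bsub>N\<^esub>)) ` S \<union> (\<lambda>y. (\<zero>\<^bsub>M\<^esub>, y)) ` T \<subseteq> carrier (module_sum M N)"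
    using S T by (auto simp: generated_by_def)
  ultimately show ?thesis by (intro generated_byI) auto
qed

lemma countably_gen_module_sum:
  assumes "right_module R M" "right_module R N" "countably_gen R M" "countably_gen R N"
  shows "countably_gen R (module_sum M N)"
  using assms generated_by_module_sum[OF assms(1,2)] unfolding countably_gen_def
  by (meson countable_Un countable_image)

lemma fin_gen_module_sum:
  assumes "right_module R M" "right_module R N" "fin_gen R M" "fin_gen R N"
  shows "fin_gen R (module_sum M N)"
  using assms generated_by_module_sum[OF assms(1,2)] unfolding fin_gen_def
  by (meson finite_UnI finite_imageI)

lemma fin_gen_imp_countably_gen: "fin_gen R M \<Longrightarrow> countably_gen R M"
  unfolding fin_gen_def countably_gen_def by (blast intro: countable_finite)

subsection \<open>Quotients\<close>

context right_module
begin

lemma abelian_subgroup: "submodule H R M \<Longrightarrow> abelian_subgroup H M"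
  by (intro abelian_subgroupI3) (auto intro: additive_subgroup.intro submodule.axioms(1) M.abelian_group_axioms)

lemma coset_eq_iff:
  assumes H: "submodule H R M" and "x \<in> carrier M" "y \<in> carrier M"
  shows "H +>\<^bsub>M\<^esub> x = H +>\<^bsub>M\<^esub> y \<longleftrightarrow> x \<ominus>\<^bsub>M\<^esub> y \<in> H"
proof -
  interpret H: abelian_subgroup H M by (rule abelian_subgroup[OF H])
  have "x \<ominus>\<^bsub>M\<^esub> y \<in> H \<longleftrightarrow> x \<in> H +>\<^bsub>M\<^esub> y"
    using assms by (simp add: H.a_rcos_module M.minus_eq)
  then show ?thesis
    using assms H.a_repr_independence'[of x y] H.a_rcos_self[of x] by auto
qed

lemma coset_zero:
  assumes H: "submodule H R M" shows "H +>\<^bsub>M\<^esub> \<zero>\<^bsub>M\<^esub> = H"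
  using submodule_subset[OF H] by simp

lemma coset_eq_self_iff:
  assumes H: "submodule H R M" and "x \<in> carrier M"
  shows "H +>\<^bsub>M\<^esub> x = H \<longleftrightarrow> x \<in> H"
  using coset_eq_iff[OF H assms(2), of "\<zero>\<^bsub>M\<^esub>"] M.minus_equality[of "\<zero>\<^bsub>M\<^esub>" "\<zero>\<^bsub>M\<^esub>"] assms
  by (simp add: coset_zero[OF H] M.minus_eq)

lemma quot_module_carrier: "carrier (quot_module M H) = (\<lambda>x. H +>\<^bsub>M\<^esub> x) ` carrier M"
  by (auto simp: quot_module_def A_RCOSETS_def')

lemma quot_module_zero: "zero (quot_module M H) = H"
  by (simp add: quot_module_def)

lemma quot_module_add:
  assumes H: "submodule H R M" and "x \<in> carrier M" "y \<in> carrier M"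
  shows "(H +>\<^bsub>M\<^esub> x) \<oplus>\<^bsub>quot_module M H\<^esub> (H +>\<^bsub>M\<^esub> y) = H +>\<^bsub>M\<^esub> (x \<oplus>\<^bsub>M\<^esub> y)"
proof -
  interpret H: abelian_subgroup H M by (rule abelian_subgroup[OF H])
  show ?thesis using assms by (simp add: quot_module_def H.a_rcos_sum)
qed

text \<open>The action on a coset is defined as a union over its representatives. All members of
  that union are the same coset, as representatives differ by elements of \<open>H\<close>.\<close>

lemma quot_module_act:
  assumes H: "submodule H R M" and a: "a \<in> carrier R" and x: "x \<in> carrier M"
  shows "a \<odot>\<^bsub>quot_module M H\<^esub> (H +>\<^bsub>M\<^esub> x) = H +>\<^bsub>M\<^esub> (a \<odot>\<^bsub>M\<^esub> x)"
proof -
  interpret H: abelian_subgroup H M by (rule abelian_subgroup[OF H])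
  have "H +>\<^bsub>M\<^esub> (a \<odot>\<^bsub>M\<^esub> z) = H +>\<^bsub>M\<^esub> (a \<odot>\<^bsub>M\<^esub> x)" if z: "z \<in> H +>\<^bsub>M\<^esub> x" for z
  proof -
    have zc: "z \<in> carrier M" using H.a_elemrcos_carrier x z by blast
    have "z \<ominus>\<^bsub>M\<^esub> x \<in> H" using z x zc by (simp add: H.a_rcos_module M.minus_eq)
    then have "a \<odot>\<^bsub>M\<^esub> (z \<ominus>\<^bsub>M\<^esub> x) \<in> H" by (rule submodule_act[OF H a])
    then have "a \<odot>\<^bsub>M\<^esub> z \<ominus>\<^bsub>M\<^esub> a \<odot>\<^bsub>M\<^esub> x \<in> H"
      using a x zc by (simp add: M.minus_eq act_add act_minus)
    then show ?thesis using coset_eq_iff[OF H act_closed act_closed] a x zc by blast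
  qed
  then have "(\<Union>z\<in>H +>\<^bsub>M\<^esub> x. H +>\<^bsub>M\<^esub> (a \<odot>\<^bsub>M\<^esub> z)) = (\<Union>z\<in>H +>\<^bsub>M\<^esub> x. H +>\<^bsub>M\<^esub> (a \<odot>\<^bsub>M\<^esub> x))"
    by (rule SUP_cong[OF refl])
  moreover have "x \<in> H +>\<^bsub>M\<^esub> x" using H.a_rcos_self x .
  ultimately show ?thesis unfolding quot_module_def by (simp, blast)
qed

lemma right_module_quot_module:
  assumes H: "submodule H R M" shows "right_module R (quot_module M H)"
proof -
  have z: "zero (quot_module M H) = H +>\<^bsub>M\<^esub> \<zero>\<^bsub>M\<^esub>" by (simp add: quot_module_zero coset_zero[OF H])
  have comm: "H +>\<^bsub>M\<^esub> (x \<oplus>\<^bsub>M\<^esub> y) = H +>\<^bsub>M\<^esub> (y \<oplus>\<^bsub>M\<^esub> x)" if "x \<in> carrier M" "y \<in> carrier M" for x y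
    using that by (simp add: M.a_comm)
  show ?thesis
  proof (rule right_moduleI)
    fix X Y assume "X \<in> carrier (quot_module M H)" "Y \<in> carrier (quot_module M H)"
    then obtain x y where "x \<in> carrier M" "y \<in> carrier M" "X = H +>\<^bsub>M\<^esub> x" "Y = H +>\<^bsub>M\<^esub> y"
      unfolding quot_module_carrier by blast
    then show "X \<oplus>\<^bsub>quot_module M H\<^esub> Y = Y \<oplus>\<^bsub>quot_module M H\<^esub> X"
      using comm[of x y] by (simp add: quot_module_add[OF H])
  qed (auto simp: z quot_module_carrier quot_module_add[OF H] quot_module_act[OF H] R.ring_axioms M.a_assoc
         act_closed act_add act_add_ring act_mult act_one)
qed

lemma rmod_hom_quot:
  assumes H: "submodule H R M" shows "(\<lambda>x. H +>\<^bsub>M\<^esub> x) \<in> rmod_hom R M (quot_module M H)"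
  by (rule rmod_homI) (auto simp: quot_module_carrier quot_module_add[OF H] quot_module_act[OF H])

text \<open>If the generating set is stable under the action, then so is the additive subgroup it
  generates. This applies to \<open>mod_ideal_prod\<close>, which is defined as an additive
  closure.\<close>

lemma submodule_generate:
  assumes "S \<subseteq> carrier M" "\<And>a x. \<lbrakk>a \<in> carrier R; x \<in> S\<rbrakk> \<Longrightarrow> a \<odot>\<^bsub>M\<^esub> x \<in> S"
  shows "submodule (generate (add_monoid M) S) R M"
proof -
  have sub: "subgroup (generate (add_monoid M) S) (add_monoid M)"
    using M.add.generate_is_subgroup assms(1) by simp
  interpret G: additive_subgroup "generate (add_monoid M) S" M using sub by (rule additive_subgroup.intro)
  have "a \<odot>\<^bsub>M\<^esub> x \<in> generate (add_monoid M) S" if "a \<in> carrier R" "x \<in> generate (add_monoid M) S" for a x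
    using that(2)
  proof induct
    case one
    then show ?case using that(1) by simp
  next
    case (incl h)
    then show ?case using assms(2)[OF that(1)] by (simp add: generate.incl)
  next
    case (inv h)
    then have "a \<odot>\<^bsub>M\<^esub> (\<ominus>\<^bsub>M\<^esub> h) = \<ominus>\<^bsub>M\<^esub> (a \<odot>\<^bsub>M\<^esub> h)" using assms(1) that(1) by (auto simp: act_minus)
    moreover have "a \<odot>\<^bsub>M\<^esub> h \<in> generate (add_monoid M) S"
      using inv assms(2)[OF that(1)] by (simp add: generate.incl)
    ultimately show ?case using G.a_inv_closed by (metis a_inv_def)
  next
    case (eng h1 h2)
    then have "a \<odot>\<^bsub>M\<^esub> (h1 \<oplus>\<^bsub>M\<^esub> h2) = a \<odot>\<^bsub>M\<^esub> h1 \<oplus>\<^bsub>M\<^esub> a \<odot>\<^bsub>M\<^esub> h2"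
      using that(1) G.a_subset by (auto intro!: act_add)
    then show ?case using eng by simp
  qed
  then show ?thesis
    by (intro submoduleI) (use G.a_subset in auto)
qed

end

locale module_ideal = right_module R M + I: ideal I R for R (structure) and M (structure) and I
begin

lemma submodule_mod_ideal_prod: "submodule (mod_ideal_prod M I) R M"
  unfolding mod_ideal_prod_def
proof (rule submodule_generate)
  show "{a \<odot>\<^bsub>M\<^esub> x |a x. a \<in> I \<and> x \<in> carrier M} \<subseteq> carrier M"
    using I.a_Hcarr by (auto intro: act_closed)
next
  fix b y assume b: "b \<in> carrier R" and "y \<in> {a \<odot>\<^bsub>M\<^esub> x |a x. a \<in> I \<and> x \<in> carrier M}"
  then obtain a x where ax: "a \<in> I" "x \<in> carrier M" "y = a \<odot>\<^bsub>M\<^esub> x" by auto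
  then have "b \<odot>\<^bsub>M\<^esub> y = (a \<otimes>\<^bsub>R\<^esub> b) \<odot>\<^bsub>M\<^esub> x" using b I.a_Hcarr by (simp add: act_mult)
  moreover have "a \<otimes>\<^bsub>R\<^esub> b \<in> I" using ax b I.I_r_closed by simp
  ultimately show "b \<odot>\<^bsub>M\<^esub> y \<in> {a \<odot>\<^bsub>M\<^esub> x |a x. a \<in> I \<and> x \<in> carrier M}" using ax by blast
qed

lemma act_mem_mod_ideal_prod: "\<lbrakk>a \<in> I; x \<in> carrier M\<rbrakk> \<Longrightarrow> a \<odot>\<^bsub>M\<^esub> x \<in> mod_ideal_prod M I"
  unfolding mod_ideal_prod_def by (blast intro: generate.incl)

text \<open>The induction principle for elements of \<open>MI\<close>.\<close>

lemma mod_ideal_prod_least: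
  assumes H: "submodule H R M" and "\<And>a x. \<lbrakk>a \<in> I; x \<in> carrier M\<rbrakk> \<Longrightarrow> a \<odot>\<^bsub>M\<^esub> x \<in> H"
  shows "mod_ideal_prod M I \<subseteq> H"
  unfolding mod_ideal_prod_def
  by (rule M.add.generate_subgroup_incl) (use assms submodule.axioms(1)[OF H] in auto)

end

lemma rmod_hom_mod_ideal_prod:
  assumes "right_module R M" "right_module R N" "ideal I R" and f: "f \<in> rmod_hom R M N"
    and x: "x \<in> mod_ideal_prod M I"
  shows "f x \<in> mod_ideal_prod N I"
proof -
  interpret M: module_ideal R M I by (intro module_ideal.intro assms)
  interpret N: module_ideal R N I by (intro module_ideal.intro assms)
  interpret rmod_morphism R M N f by (rule rmod_morphismI[OF assms(1,2) f])
  have "mod_ideal_prod M I \<subseteq> {x \<in> carrier M. f x \<in> mod_ideal_prod N I}"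
    by (rule M.mod_ideal_prod_least[OF submodule_vimage[OF N.submodule_mod_ideal_prod]])
      (auto simp: act M.I.a_Hcarr intro!: M.act_closed N.act_mem_mod_ideal_prod)
  then show ?thesis using x by auto
qed

subsection \<open>Dual bases\<close>

text \<open>The data of the dual basis lemma, which characterises projectivity. The index type is
  independent of the module; this makes sets of naturals and disjoint unions available as index
  sets.\<close>

locale dual_basis = right_module R M
  for R :: "('a, 'r) ring_scheme" and M :: "('a, 'b, 'm) module_scheme" +
  fixes B :: "'i set" and y :: "'i \<Rightarrow> 'b" and \<phi> :: "'i \<Rightarrow> 'b \<Rightarrow> 'a"
  assumes y_closed: "b \<in> B \<Longrightarrow> y b \<in> carrier M"
    and \<phi>_hom: "b \<in> B \<Longrightarrow> \<phi> b \<in> rmod_hom R M (regular R)"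
    and finite_support: "x \<in> carrier M \<Longrightarrow> finite {b \<in> B. \<phi> b x \<noteq> \<zero>\<^bsub>R\<^esub>}"
    and expand: "x \<in> carrier M \<Longrightarrow>
      finsum M (\<lambda>b. \<phi> b x \<odot>\<^bsub>M\<^esub> y b) {b \<in> B. \<phi> b x \<noteq> \<zero>\<^bsub>R\<^esub>} = x"
begin

lemma \<phi>_closed: "\<lbrakk>b \<in> B; x \<in> carrier M\<rbrakk> \<Longrightarrow> \<phi> b x \<in> carrier R"
  using rmod_hom_closed[OF \<phi>_hom] by simp

lemma expand_superset:
  assumes "x \<in> carrier M" "finite A" "A \<subseteq> B" "\<And>b. b \<in> B - A \<Longrightarrow> \<phi> b x = \<zero>\<^bsub>R\<^esub>"
  shows "finsum M (\<lambda>b. \<phi> b x \<odot>\<^bsub>M\<^esub> y b) A = x"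
proof -
  have "finsum M (\<lambda>b. \<phi> b x \<odot>\<^bsub>M\<^esub> y b) A = finsum M (\<lambda>b. \<phi> b x \<odot>\<^bsub>M\<^esub> y b) {b \<in> B. \<phi> b x \<noteq> \<zero>\<^bsub>R\<^esub>}"
    by (rule M.add.finprod_mono_neutral_cong_right)
      (use assms y_closed in \<open>auto intro!: act_closed \<phi>_closed\<close>)
  then show ?thesis using expand[OF assms(1)] by simp
qed

lemma generated_by_y: "generated_by R M (y ` B)"
proof (rule generated_byI)
  fix H x assume H: "submodule H R M" "y ` B \<subseteq> H" and x: "x \<in> carrier M"
  have "finsum M (\<lambda>b. \<phi> b x \<odot>\<^bsub>M\<^esub> y b) {b \<in> B. \<phi> b x \<noteq> \<zero>\<^bsub>R\<^esub>} \<in> H"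
    by (rule submodule_finsum[OF H(1)]) (use H x in \<open>auto intro!: submodule_act[OF H(1)] \<phi>_closed\<close>)
  then show "x \<in> H" using expand[OF x] by simp
qed (use y_closed in auto)

end

lemma rmod_hom_act_element:
  assumes "right_module R M" "x \<in> carrier M"
  shows "(\<lambda>r. r \<odot>\<^bsub>M\<^esub> x) \<in> rmod_hom R (regular R) M"
proof -
  interpret right_module R M by fact
  show ?thesis using assms(2) by (intro rmod_homI) (auto simp: act_add_ring act_mult intro: act_closed)
qed

text \<open>The functionals are the coordinates of the embedding \<open>i\<close>, and the vectors
  are the images of the standard basis under \<open>p\<close>.\<close>

lemma dual_basis_retract_free:
  assumes M: "right_module R M" and i: "i \<in> rmod_hom R M (copies B (regular R))"
    and p: "p \<in> rmod_hom R (copies B (regular R)) M" and pi: "\<And>x. x \<in> carrier M \<Longrightarrow> p (i x) = x"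
  shows "dual_basis R M B (\<lambda>b. p (ds_single B (\<lambda>_. regular R) b \<one>\<^bsub>R\<^esub>)) (\<lambda>b x. i x b)"
proof -
  interpret M: right_module R M by fact
  let ?F = "copies B (regular R)"
  let ?e = "\<lambda>b. ds_single B (\<lambda>_. regular R) b"
  have reg: "right_module R (regular R)" using right_module_regular M.R.ring_axioms .
  have F: "right_module R ?F"
    unfolding copies_def by (rule right_module_direct_sum[OF M.R.ring_axioms reg])
  have e: "?e b \<in> rmod_hom R (regular R) ?F" if "b \<in> B" for b
    unfolding copies_def by (rule rmod_hom_ds_single[OF reg that])
  interpret p: rmod_morphism R ?F M p by (rule rmod_morphismI[OF F M p])
  have ic: "i x \<in> carrier ?F" if "x \<in> carrier M" for x using rmod_hom_closed[OF i that] .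
  have ir: "i x b \<in> carrier R" if "x \<in> carrier M" "b \<in> B" for x b
    using direct_sum_closed[OF ic[OF that(1), unfolded copies_def] that(2)] by simp
  show ?thesis
  proof (intro dual_basis.intro[OF M] dual_basis_axioms.intro)
    fix b assume b: "b \<in> B"
    show "p (?e b \<one>\<^bsub>R\<^esub>) \<in> carrier M" using rmod_hom_closed[OF e[OF b]] by simp
    show "(\<lambda>x. i x b) \<in> rmod_hom R M (regular R)"
      using rmod_hom_comp[OF i[unfolded copies_def] rmod_hom_proj[OF b]] .
  next
    fix x assume x: "x \<in> carrier M"
    show "finite {b \<in> B. i x b \<noteq> \<zero>\<^bsub>R\<^esub>}"
      using direct_sum_finite[OF ic[OF x, unfolded copies_def]] by simp
    have "x = p (finsum ?F (\<lambda>b. ?e b (i x b)) {b \<in> B. i x b \<noteq> \<zero>\<^bsub>R\<^esub>})"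
      using pi[OF x] direct_sum_eq_finsum[OF M.R.ring_axioms reg ic[OF x, unfolded copies_def]]
      by (simp add: copies_def)
    also have "\<dots> = finsum M (\<lambda>b. p (?e b (i x b))) {b \<in> B. i x b \<noteq> \<zero>\<^bsub>R\<^esub>}"
      by (rule p.finsum) (use ir[OF x] rmod_hom_closed[OF e] in auto)
    also have "\<dots> = finsum M (\<lambda>b. i x b \<odot>\<^bsub>M\<^esub> p (?e b \<one>\<^bsub>R\<^esub>)) {b \<in> B. i x b \<noteq> \<zero>\<^bsub>R\<^esub>}"
    proof (rule M.M.finsum_cong'[OF refl])
      fix b assume "b \<in> {b \<in> B. i x b \<noteq> \<zero>\<^bsub>R\<^esub>}"
      then have b: "b \<in> B" by simp
      have "?e b (i x b) = i x b \<odot>\<^bsub>?F\<^esub> ?e b \<one>\<^bsub>R\<^esub>"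
        using rmod_hom_act[OF e[OF b] ir[OF x b], of "\<one>\<^bsub>R\<^esub>"] ir[OF x b] by simp
      then show "p (?e b (i x b)) = i x b \<odot>\<^bsub>M\<^esub> p (?e b \<one>\<^bsub>R\<^esub>)"
        using p.act[OF ir[OF x b] rmod_hom_closed[OF e[OF b]], of "\<one>\<^bsub>R\<^esub>"] by simp
    qed (use ir[OF x] rmod_hom_closed[OF e] in \<open>auto intro!: M.act_closed\<close>)
    finally show "finsum M (\<lambda>b. i x b \<odot>\<^bsub>M\<^esub> p (?e b \<one>\<^bsub>R\<^esub>)) {b \<in> B. i x b \<noteq> \<zero>\<^bsub>R\<^esub>} = x" ..
  qed
qed

lemma projective_imp_dual_basis:
  fixes M :: "('a, 'b, 'm) module_scheme"
  assumes "projective R M"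
  shows "\<exists>(B :: 'b set) y \<phi>. dual_basis R M B y \<phi>"
proof -
  from assms obtain B :: "'b set" and N :: "('a, 'b \<Rightarrow> 'a) module" where
    M: "right_module R M" and N: "right_module R N" and iso: "rmod_iso R (module_sum M N) (copies B (regular R))"
    unfolding projective_def by blast
  from rmod_isoE[OF iso right_module_module_sum[OF M N]] obtain f g where
    f: "f \<in> rmod_hom R (module_sum M N) (copies B (regular R))" and
    g: "g \<in> rmod_hom R (copies B (regular R)) (module_sum M N)" and
    gf: "\<And>x. x \<in> carrier (module_sum M N) \<Longrightarrow> g (f x) = x" by metis
  interpret N: right_module R N by (rule N)
  show ?thesis
    using dual_basis_retract_free[OF M rmod_hom_comp[OF rmod_hom_inl[OF M N] f] rmod_hom_comp[OF g rmod_hom_fst]] gf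
    by fastforce
qed

section \<open>Lifting property, projectivity and change of the dual basis\<close>

context dual_basis
begin

text \<open>Choose preimages \<open>q b\<close> of the elements \<open>u (y b)\<close>. The map with
  coordinates \<open>\<phi> b\<close> and vectors \<open>q b\<close> then lifts \<open>u\<close>, by
  the expansion of \<open>x\<close> in the dual basis.\<close>

lemma lifting:
  assumes N: "right_module R N" and Q: "right_module R Q"
    and u: "u \<in> rmod_hom R M Q" and v: "v \<in> rmod_hom R N Q" and surj: "v ` carrier N = carrier Q"
  obtains f where "f \<in> rmod_hom R M N" "\<And>x. x \<in> carrier M \<Longrightarrow> v (f x) = u x"
proof -
  interpret u: rmod_morphism R M Q u by (rule rmod_morphismI[OF right_module_axioms Q u])
  interpret v: rmod_morphism R N Q v by (rule rmod_morphismI[OF N Q v])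
  have "\<forall>b\<in>B. \<exists>q\<in>carrier N. v q = u (y b)"
    using surj y_closed u.closed by (metis imageE)
  then obtain q where q: "\<And>b. b \<in> B \<Longrightarrow> q b \<in> carrier N" "\<And>b. b \<in> B \<Longrightarrow> v (q b) = u (y b)" by metis
  let ?i = "\<lambda>x. \<lambda>b\<in>B. \<phi> b x"
  let ?f = "\<lambda>x. ds_sum N B (\<lambda>b r. r \<odot>\<^bsub>N\<^esub> q b) (?i x)"
  have i: "?i \<in> rmod_hom R M (direct_sum B (\<lambda>_. regular R))"
  proof (rule rmod_homI)
    fix x assume x: "x \<in> carrier M"
    show "?i x \<in> carrier (direct_sum B (\<lambda>_. regular R))"
      by (rule direct_sumI[OF _ _ finite_support[OF x]]) (use x \<phi>_closed in auto)
  next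
    fix x z assume "x \<in> carrier M" "z \<in> carrier M"
    then show "?i (x \<oplus>\<^bsub>M\<^esub> z) = ?i x \<oplus>\<^bsub>direct_sum B (\<lambda>_. regular R)\<^esub> ?i z"
      by (auto simp: fun_eq_iff restrict_def rmod_hom_add[OF \<phi>_hom])
  next
    fix a x assume "a \<in> carrier R" "x \<in> carrier M"
    then show "?i (a \<odot>\<^bsub>M\<^esub> x) = a \<odot>\<^bsub>direct_sum B (\<lambda>_. regular R)\<^esub> ?i x"
      by (auto simp: fun_eq_iff restrict_def rmod_hom_act[OF \<phi>_hom])
  qed
  have "?f \<in> rmod_hom R M N"
    by (rule rmod_hom_comp[OF i rmod_hom_ds_sum])
      (use q N R.ring_axioms in \<open>auto intro: right_module_regular rmod_hom_act_element\<close>)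
  moreover have "v (?f x) = u x" if x: "x \<in> carrier M" for x
  proof -
    let ?A = "{b \<in> B. \<phi> b x \<noteq> \<zero>\<^bsub>R\<^esub>}"
    have "?f x = finsum N (\<lambda>b. ?i x b \<odot>\<^bsub>N\<^esub> q b) ?A"
      by (rule ds_sum_eq[OF N finite_support[OF x]]) (use q x in \<open>auto intro!: v.M.act_closed \<phi>_closed\<close>)
    also have "\<dots> = finsum N (\<lambda>b. \<phi> b x \<odot>\<^bsub>N\<^esub> q b) ?A"
      by (rule v.M.M.finsum_cong') (use q x in \<open>auto intro!: v.M.act_closed \<phi>_closed\<close>)
    also have "v \<dots> = finsum Q (\<lambda>b. v (\<phi> b x \<odot>\<^bsub>N\<^esub> q b)) ?A"
      by (rule v.finsum) (use q x in \<open>auto intro!: v.M.act_closed \<phi>_closed\<close>)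
    also have "\<dots> = finsum Q (\<lambda>b. u (\<phi> b x \<odot>\<^bsub>M\<^esub> y b)) ?A"
      by (rule u.N.M.finsum_cong'[OF refl])
        (use q x y_closed \<phi>_closed in \<open>auto simp: u.act v.act intro!: u.closed act_closed\<close>)
    also have "\<dots> = u (finsum M (\<lambda>b. \<phi> b x \<odot>\<^bsub>M\<^esub> y b) ?A)"
      by (rule u.finsum[symmetric]) (use x y_closed \<phi>_closed in \<open>auto intro!: act_closed\<close>)
    finally show ?thesis using expand[OF x] by simp
  qed
  ultimately show ?thesis using that by blast
qed

text \<open>Returns from an arbitrary index type to the types fixed in the definition of
  projectivity: the module is a quotient of the free module on its own carrier, and lifting the
  identity splits the quotient map.\<close>

lemma projective: "projective R M"
proof -
  let ?F = "copies (carrier M) (regular R)"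
  let ?p = "ds_sum M (carrier M) (\<lambda>m r. r \<odot>\<^bsub>M\<^esub> m)"
  have reg: "right_module R (regular R)" by (rule right_module_regular[OF R.ring_axioms])
  have F: "right_module R ?F" unfolding copies_def by (rule right_module_direct_sum[OF R.ring_axioms reg])
  have p: "?p \<in> rmod_hom R ?F M" unfolding copies_def
    by (rule rmod_hom_ds_sum[OF R.ring_axioms reg right_module_axioms rmod_hom_act_element[OF right_module_axioms]])
  interpret F: right_module R ?F by (rule F)
  interpret p: rmod_morphism R ?F M ?p by (rule rmod_morphismI[OF F right_module_axioms p])
  have "m \<in> ?p ` carrier ?F" if m: "m \<in> carrier M" for m
  proof (rule image_eqI)
    show "ds_single (carrier M) (\<lambda>_. regular R) m \<one>\<^bsub>R\<^esub> \<in> carrier ?F"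
      unfolding copies_def by (rule rmod_hom_closed[OF rmod_hom_ds_single[OF reg m]]) simp
    have "?p (ds_single (carrier M) (\<lambda>_. regular R) m \<one>\<^bsub>R\<^esub>) = \<one>\<^bsub>R\<^esub> \<odot>\<^bsub>M\<^esub> m"
      by (rule ds_sum_single[OF reg right_module_axioms rmod_hom_act_element[OF right_module_axioms] m]) simp_all
    then show "m = ?p (ds_single (carrier M) (\<lambda>_. regular R) m \<one>\<^bsub>R\<^esub>)"
      using act_one[OF m] by simp
  qed
  then have surj: "?p ` carrier ?F = carrier M" by auto
  obtain s where s: "s \<in> rmod_hom R M ?F" and ps: "\<And>x. x \<in> carrier M \<Longrightarrow> ?p (s x) = x"
    using lifting[OF F right_module_axioms rmod_hom_id p surj] by blast
  interpret s: rmod_morphism R M ?F s by (rule rmod_morphismI[OF right_module_axioms F s])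
  \<comment> \<open>The complement is the kernel of the projection. Its elements are functions on
    the type of \<open>M\<close>, as the definition of projectivity asks.\<close>
  define N where "N = ?F\<lparr>carrier := {x \<in> carrier ?F. ?p x = \<zero>\<^bsub>M\<^esub>}\<rparr>"
  have N: "right_module R N"
    unfolding N_def by (rule F.right_module_submodule[OF p.submodule_kernel])
  have Ns: "carrier N = {x \<in> carrier ?F. ?p x = \<zero>\<^bsub>M\<^esub>}" "add N = add ?F" "smult N = smult ?F"
    by (simp_all add: N_def)
  have iN: "(\<lambda>x. x) \<in> rmod_hom R N ?F"
    by (rule rmod_homI) (simp_all add: Ns)
  have f: "(\<lambda>z. s (fst z) \<oplus>\<^bsub>?F\<^esub> snd z) \<in> rmod_hom R (module_sum M N) ?F"
    by (rule rmod_hom_plus[OF F rmod_hom_comp[OF rmod_hom_fst s] rmod_hom_comp[OF rmod_hom_snd iN]])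
  have d: "(\<lambda>z. z \<ominus>\<^bsub>?F\<^esub> s (?p z)) \<in> rmod_hom R ?F ?F"
    by (rule rmod_hom_minus[OF F rmod_hom_id rmod_hom_comp[OF p s]])
  have "(\<lambda>z. z \<ominus>\<^bsub>?F\<^esub> s (?p z)) \<in> rmod_hom R ?F N"
    by (rule rmod_homI)
      (auto simp: Ns p.minus ps M.r_neg M.minus_eq rmod_hom_add[OF d] rmod_hom_act[OF d])
  then have g: "(\<lambda>z. (?p z, z \<ominus>\<^bsub>?F\<^esub> s (?p z))) \<in> rmod_hom R ?F (module_sum M N)"
    by (rule rmod_hom_Pair[OF p])
  have "rmod_iso R (module_sum M N) ?F"
  proof (rule rmod_isoI[OF f g])
    fix z assume "z \<in> carrier (module_sum M N)"
    then have z: "fst z \<in> carrier M" "snd z \<in> carrier ?F" "?p (snd z) = \<zero>\<^bsub>M\<^esub>" by (auto simp: Ns)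
    then have 1: "?p (s (fst z) \<oplus>\<^bsub>?F\<^esub> snd z) = fst z" by (simp add: p.add ps)
    have 2: "(s (fst z) \<oplus>\<^bsub>?F\<^esub> snd z) \<ominus>\<^bsub>?F\<^esub> s (fst z) = snd z"
      using z by (simp add: F.M.minus_eq F.M.a_ac F.M.r_neg s.closed)
    show "(?p (s (fst z) \<oplus>\<^bsub>?F\<^esub> snd z), (s (fst z) \<oplus>\<^bsub>?F\<^esub> snd z) \<ominus>\<^bsub>?F\<^esub> s (?p (s (fst z) \<oplus>\<^bsub>?F\<^esub> snd z))) = z"
      unfolding 1 2 by simp
  next
    fix z assume z: "z \<in> carrier ?F"
    then show "s (fst (?p z, z \<ominus>\<^bsub>?F\<^esub> s (?p z))) \<oplus>\<^bsub>?F\<^esub> snd (?p z, z \<ominus>\<^bsub>?F\<^esub> s (?p z)) = z"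
      using F.diff_add_cancel[of z "s (?p z)"] by (simp add: F.M.a_comm p.closed s.closed)
  qed
  then show ?thesis
    unfolding projective_def using right_module_axioms N by blast
qed

lemma restrict_index:
  assumes "B0 \<subseteq> B" "\<And>b x. \<lbrakk>b \<in> B - B0; x \<in> carrier M\<rbrakk> \<Longrightarrow> \<phi> b x = \<zero>\<^bsub>R\<^esub>"
  shows "dual_basis R M B0 y \<phi>"
proof (intro dual_basis.intro[OF right_module_axioms] dual_basis_axioms.intro)
  fix x assume x: "x \<in> carrier M"
  have "{b \<in> B0. \<phi> b x \<noteq> \<zero>\<^bsub>R\<^esub>} = {b \<in> B. \<phi> b x \<noteq> \<zero>\<^bsub>R\<^esub>}" using assms x by blast
  then show "finite {b \<in> B0. \<phi> b x \<noteq> \<zero>\<^bsub>R\<^esub>}"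
    "finsum M (\<lambda>b. \<phi> b x \<odot>\<^bsub>M\<^esub> y b) {b \<in> B0. \<phi> b x \<noteq> \<zero>\<^bsub>R\<^esub>} = x"
    using finite_support[OF x] expand[OF x] by simp_all
qed (use assms(1) y_closed \<phi>_hom in auto)

lemma reindex:
  assumes h: "bij_betw h C B"
  shows "dual_basis R M C (\<lambda>c. y (h c)) (\<lambda>c. \<phi> (h c))"
proof -
  have inj: "inj_on h C" and im: "h ` C = B" using h by (auto simp: bij_betw_def)
  show ?thesis
  proof (intro dual_basis.intro[OF right_module_axioms] dual_basis_axioms.intro)
    fix x assume x: "x \<in> carrier M"
    let ?A = "{c \<in> C. \<phi> (h c) x \<noteq> \<zero>\<^bsub>R\<^esub>}"
    have A: "h ` ?A = {b \<in> B. \<phi> b x \<noteq> \<zero>\<^bsub>R\<^esub>}" using im by auto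
    have injA: "inj_on h ?A" using inj by (auto intro: inj_on_subset)
    show "finite ?A" using finite_support[OF x] finite_image_iff[OF injA] unfolding A by simp
    have "finsum M (\<lambda>b. \<phi> b x \<odot>\<^bsub>M\<^esub> y b) (h ` ?A) = finsum M (\<lambda>c. \<phi> (h c) x \<odot>\<^bsub>M\<^esub> y (h c)) ?A"
      by (rule M.add.finprod_reindex[OF _ injA]) (use im x y_closed in \<open>auto intro!: act_closed \<phi>_closed\<close>)
    then show "finsum M (\<lambda>c. \<phi> (h c) x \<odot>\<^bsub>M\<^esub> y (h c)) ?A = x" using A expand[OF x] by simp
  qed (use im y_closed \<phi>_hom in auto)
qed

text \<open>The kernel of a functional is a submodule, so vanishing on generators is enough.\<close>

lemma support_generated:
  assumes S: "generated_by R M S" and b: "b \<in> B" and 0: "\<And>s. s \<in> S \<Longrightarrow> \<phi> b s = \<zero>\<^bsub>R\<^esub>" and x: "x \<in> carrier M"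
  shows "\<phi> b x = \<zero>\<^bsub>R\<^esub>"
proof -
  interpret rmod_morphism R M "regular R" "\<phi> b"
    by (rule rmod_morphismI[OF right_module_axioms right_module_regular[OF R.ring_axioms] \<phi>_hom[OF b]])
  have "x \<in> {x \<in> carrier M. \<phi> b x = \<zero>\<^bsub>regular R\<^esub>}"
    by (rule generated_byD[OF S submodule_kernel]) (use 0 x S in \<open>auto simp: generated_by_def\<close>)
  then show ?thesis by simp
qed

lemma retract:
  assumes N: "right_module R N" and i: "i \<in> rmod_hom R N M" and p: "p \<in> rmod_hom R M N"
    and pi: "\<And>x. x \<in> carrier N \<Longrightarrow> p (i x) = x"
  shows "dual_basis R N B (\<lambda>b. p (y b)) (\<lambda>b x. \<phi> b (i x))"
proof -
  interpret p: rmod_morphism R M N p by (rule rmod_morphismI[OF right_module_axioms N p])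
  show ?thesis
  proof (intro dual_basis.intro[OF N] dual_basis_axioms.intro)
    fix x assume x: "x \<in> carrier N"
    then have ix: "i x \<in> carrier M" by (rule rmod_hom_closed[OF i])
    let ?A = "{b \<in> B. \<phi> b (i x) \<noteq> \<zero>\<^bsub>R\<^esub>}"
    show "finite ?A" using finite_support[OF ix] .
    have "x = finsum N (\<lambda>b. p (\<phi> b (i x) \<odot>\<^bsub>M\<^esub> y b)) ?A"
      using p.finsum[of "\<lambda>b. \<phi> b (i x) \<odot>\<^bsub>M\<^esub> y b" ?A] expand[OF ix] pi[OF x] y_closed \<phi>_closed ix
      by (auto simp: Pi_iff intro!: act_closed)
    also have "\<dots> = finsum N (\<lambda>b. \<phi> b (i x) \<odot>\<^bsub>N\<^esub> p (y b)) ?A"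
      by (rule p.N.M.finsum_cong') (use y_closed \<phi>_closed ix in \<open>auto simp: p.act intro!: p.N.act_closed\<close>)
    finally show "finsum N (\<lambda>b. \<phi> b (i x) \<odot>\<^bsub>N\<^esub> p (y b)) ?A = x" ..
  qed (use y_closed rmod_hom_comp[OF i \<phi>_hom] in auto)
qed

end

text \<open>Each of countably many generators has finitely many nonzero coordinates, and a
  functional that vanishes on all generators is zero. So countably many indices remain, and these
  can be numbered.\<close>

lemma dual_basis_countable_index:
  assumes "dual_basis R M B y \<phi>" and cg: "countably_gen R M"
  shows "\<exists>(C :: nat set) z \<psi>. dual_basis R M C z \<psi>"
proof -
  interpret dual_basis R M B y \<phi> by fact
  obtain S where S: "countable S" "generated_by R M S" using cg unfolding countably_gen_def by blast
  define B0 where "B0 = (\<Union>s\<in>S. {b \<in> B. \<phi> b s \<noteq> \<zero>\<^bsub>R\<^esub>})"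
  have "countable B0"
    unfolding B0_def using S finite_support by (intro countable_UN) (auto simp: generated_by_def intro: countable_finite)
  then have bij: "bij_betw (inv_into B0 (to_nat_on B0)) (to_nat_on B0 ` B0) B0"
    by (intro bij_betw_inv_into) (simp add: inj_on_imp_bij_betw inj_on_to_nat_on)
  interpret B0: dual_basis R M B0 y \<phi>
    by (rule restrict_index) (use support_generated[OF S(2)] in \<open>auto simp: B0_def\<close>)
  show ?thesis using B0.reindex[OF bij] by blast
qed

lemma projective_countable_dual_basis:
  "\<lbrakk>projective R M; countably_gen R M\<rbrakk> \<Longrightarrow> \<exists>(C :: nat set) z \<psi>. dual_basis R M C z \<psi>"
  using projective_imp_dual_basis dual_basis_countable_index by blast

lemma projective_right_module: "projective R M \<Longrightarrow> right_module R M"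
  by (simp add: projective_def)

text \<open>The dual bases of the summands are put side by side, and the expansion is verified in
  each summand.\<close>

lemma dual_basis_direct_sum:
  assumes "ring R" and db: "\<And>i. i \<in> I \<Longrightarrow> dual_basis R (M i) (B i) (y i) (\<phi> i)"
  shows "dual_basis R (direct_sum I M) (Sigma I B) (\<lambda>(i, b). ds_single I M i (y i b)) (\<lambda>(i, b) f. \<phi> i b (f i))"
proof -
  have M: "right_module R (M i)" if "i \<in> I" for i using db[OF that] by (simp add: dual_basis_def)
  let ?D = "direct_sum I M"
  have D: "right_module R ?D" by (rule right_module_direct_sum[OF assms(1) M])
  interpret D: right_module R ?D by (rule D)
  have s: "ds_single I M i \<in> rmod_hom R (M i) ?D" if "i \<in> I" for i by (rule rmod_hom_ds_single[OF M that])
  have \<phi>0: "\<phi> i b \<zero>\<^bsub>M i\<^esub> = \<zero>\<^bsub>R\<^esub>" if "i \<in> I" "b \<in> B i" for i b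
  proof -
    interpret dual_basis R "M i" "B i" "y i" "\<phi> i" using db that by blast
    show ?thesis
      using rmod_morphism.zero[OF rmod_morphismI[OF M right_module_regular \<phi>_hom]] that assms(1) by simp
  qed
  show ?thesis
  proof (intro dual_basis.intro[OF D] dual_basis_axioms.intro)
    fix p assume "p \<in> Sigma I B"
    then obtain i b where p: "p = (i, b)" and ib: "i \<in> I" "b \<in> B i" by auto
    interpret dual_basis R "M i" "B i" "y i" "\<phi> i" using db ib by blast
    show "(case p of (i, b) \<Rightarrow> ds_single I M i (y i b)) \<in> carrier ?D"
      using rmod_hom_closed[OF s[OF ib(1)] y_closed[OF ib(2)]] by (simp add: p)
    show "(case p of (i, b) \<Rightarrow> \<lambda>f. \<phi> i b (f i)) \<in> rmod_hom R ?D (regular R)"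
      unfolding p prod.case by (rule rmod_hom_comp[OF rmod_hom_proj[where M = M, OF ib(1)] \<phi>_hom[OF ib(2)]])
  next
    fix f assume f: "f \<in> carrier ?D"
    define S where "S = {p \<in> Sigma I B. (case p of (i, b) \<Rightarrow> \<lambda>f. \<phi> i b (f i)) f \<noteq> \<zero>\<^bsub>R\<^esub>}"
    have S: "S = (SIGMA i:{i \<in> I. f i \<noteq> \<zero>\<^bsub>M i\<^esub>}. {b \<in> B i. \<phi> i b (f i) \<noteq> \<zero>\<^bsub>R\<^esub>})"
      using \<phi>0 by (auto simp: S_def)
    have fin: "finite {b \<in> B i. \<phi> i b (f i) \<noteq> \<zero>\<^bsub>R\<^esub>}" if "i \<in> I" for i
      using dual_basis.finite_support[OF db[OF that] direct_sum_closed[OF f that]] .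
    have "finite S" unfolding S
      by (rule finite_SigmaI) (use direct_sum_finite[OF f] fin in auto)
    then show "finite {p \<in> Sigma I B. (case p of (i, b) \<Rightarrow> \<lambda>f. \<phi> i b (f i)) f \<noteq> \<zero>\<^bsub>R\<^esub>}"
      by (simp add: S_def)
    let ?g = "\<lambda>p. (case p of (i, b) \<Rightarrow> \<lambda>f. \<phi> i b (f i)) f \<odot>\<^bsub>?D\<^esub> (case p of (i, b) \<Rightarrow> ds_single I M i (y i b))"
    have g: "?g \<in> S \<rightarrow> carrier ?D"
    proof
      fix p assume "p \<in> S"
      then obtain i b where p: "p = (i, b)" "i \<in> I" "b \<in> B i" by (auto simp: S_def)
      interpret dual_basis R "M i" "B i" "y i" "\<phi> i" using db p by blast
      show "?g p \<in> carrier ?D"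
        using p \<phi>_closed[OF p(3) direct_sum_closed[OF f p(2)]] rmod_hom_closed[OF s[OF p(2)] y_closed[OF p(3)]]
        by (simp add: D.act_closed del: direct_sum_simps)
    qed
    have "finsum ?D ?g S j = f j" if j: "j \<in> I" for j
    proof -
      interpret dual_basis R "M j" "B j" "y j" "\<phi> j" using db j by blast
      interpret pr: rmod_morphism R ?D "M j" "\<lambda>f. f j"
        by (rule rmod_morphismI[OF D right_module_axioms rmod_hom_proj[OF j]])
      let ?A = "{b \<in> B j. \<phi> j b (f j) \<noteq> \<zero>\<^bsub>R\<^esub>}"
      \<comment> \<open>In coordinate \<open>j\<close> only pairs with first entry \<open>j\<close>
        contribute, which reduces the sum to the expansion inside \<open>M j\<close>.\<close>
      have gj: "?g (i, b) j = (if i = j then \<phi> j b (f j) \<odot>\<^bsub>M j\<^esub> y j b else \<zero>\<^bsub>M j\<^esub>)"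
        if "i \<in> I" "b \<in> B i" for i b
      proof -
        interpret i: dual_basis R "M i" "B i" "y i" "\<phi> i" using db that by blast
        show ?thesis using j that i.\<phi>_closed[OF that(2) direct_sum_closed[OF f that(1)]]
          by (auto simp: ds_single_apply)
      qed
      have "finsum ?D ?g S j = finsum (M j) (\<lambda>p. ?g p j) S" using pr.finsum[OF g] .
      also have "\<dots> = finsum (M j) (\<lambda>p. ?g p j) (Pair j ` ?A)"
      proof (rule M.add.finprod_mono_neutral_cong_right[OF \<open>finite S\<close>])
        show "Pair j ` ?A \<subseteq> S" using j \<phi>0 by (auto simp: S_def)
        show "?g p j = \<zero>\<^bsub>M j\<^esub>" if "p \<in> S - Pair j ` ?A" for p
        proof -
          from that obtain i b where p: "p = (i, b)" "i \<in> I" "b \<in> B i" "\<phi> i b (f i) \<noteq> \<zero>\<^bsub>R\<^esub>" by (auto simp: S_def)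
          then have "i \<noteq> j" using that by auto
          then show ?thesis using gj[OF p(2,3)] p(1) by simp
        qed
        show "(\<lambda>p. ?g p j) \<in> S \<rightarrow> carrier (M j)" using pr.closed g by blast
      qed simp
      also have "\<dots> = finsum (M j) (\<lambda>b. ?g (j, b) j) ?A"
        by (rule M.add.finprod_reindex)
          (use gj j y_closed \<phi>_closed direct_sum_closed[OF f] in \<open>auto simp: inj_on_def ds_single_apply intro!: act_closed\<close>)
      also have "\<dots> = finsum (M j) (\<lambda>b. \<phi> j b (f j) \<odot>\<^bsub>M j\<^esub> y j b) ?A"
        by (rule M.finsum_cong')
          (use gj j y_closed \<phi>_closed direct_sum_closed[OF f] in \<open>auto simp: ds_single_apply intro!: act_closed\<close>)
      also have "\<dots> = f j" using expand[OF direct_sum_closed[OF f j]] .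
      finally show ?thesis .
    qed
    then have "finsum ?D ?g S = f"
      by (intro direct_sum_eqI[OF D.M.finsum_closed[OF g] f])
    then show "finsum ?D ?g {p \<in> Sigma I B. (case p of (i, b) \<Rightarrow> \<lambda>f. \<phi> i b (f i)) f \<noteq> \<zero>\<^bsub>R\<^esub>} = f"
      by (simp only: S_def)
  qed
qed

lemma projective_direct_sum:
  fixes M :: "'i \<Rightarrow> ('a, 'b, 'm) module_scheme"
  assumes "ring R" and P: "\<And>i. i \<in> I \<Longrightarrow> projective R (M i)"
  shows "projective R (direct_sum I M)"
proof -
  obtain B :: "'i \<Rightarrow> 'b set" and y \<phi> where "\<And>i. i \<in> I \<Longrightarrow> dual_basis R (M i) (B i) (y i) (\<phi> i)"
    using projective_imp_dual_basis[OF P] by metis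
  from dual_basis.projective[OF dual_basis_direct_sum[OF assms(1) this]] show ?thesis .
qed

lemma projective_copies: "\<lbrakk>ring R; projective R M\<rbrakk> \<Longrightarrow> projective R (copies I M)"
  unfolding copies_def by (rule projective_direct_sum)

lemma projective_retract:
  fixes M :: "('a, 'b, 'm) module_scheme"
  assumes "projective R M" "right_module R N" "i \<in> rmod_hom R N M" "p \<in> rmod_hom R M N"
    "\<And>x. x \<in> carrier N \<Longrightarrow> p (i x) = x"
  shows "projective R N"
proof -
  obtain B :: "'b set" and y \<phi> where "dual_basis R M B y \<phi>" using projective_imp_dual_basis[OF assms(1)] by blast
  from dual_basis.projective[OF dual_basis.retract[OF this assms(2-5)]] show ?thesis by blast
qed

lemma projective_iso:
  assumes "projective R M" "rmod_iso R M N" "right_module R N"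
  shows "projective R N"
  using rmod_isoE[OF assms(2) projective_right_module[OF assms(1)]] projective_retract[OF assms(1,3)] by metis

lemma projective_module_sum:
  fixes M :: "('a, 'b, 'm) module_scheme" and N :: "('a, 'c, 'n) module_scheme"
  assumes M: "projective R M" and N: "projective R N"
  shows "projective R (module_sum M N)"
proof -
  obtain B :: "'b set" and y \<phi> where "dual_basis R M B y \<phi>" using projective_imp_dual_basis[OF M] by blast
  then interpret M: dual_basis R M B y \<phi> .
  obtain C :: "'c set" and z \<psi> where "dual_basis R N C z \<psi>" using projective_imp_dual_basis[OF N] by blast
  then interpret N: dual_basis R N C z \<psi> .
  let ?D = "module_sum M N"
  note M' = M.right_module_axioms and N' = N.right_module_axioms
  have D: "right_module R ?D" by (rule right_module_module_sum[OF M' N'])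
  interpret D: right_module R ?D by (rule D)
  interpret f: rmod_morphism R ?D M fst by (rule rmod_morphismI[OF D M' rmod_hom_fst])
  interpret s: rmod_morphism R ?D N snd by (rule rmod_morphismI[OF D N' rmod_hom_snd])
  let ?y = "case_sum (\<lambda>b. (y b, \<zero>\<^bsub>N\<^esub>)) (\<lambda>c. (\<zero>\<^bsub>M\<^esub>, z c))"
  let ?\<phi> = "case_sum (\<lambda>b p. \<phi> b (fst p)) (\<lambda>c p. \<psi> c (snd p))"
  let ?B = "Inl ` B \<union> Inr ` C"
  have "dual_basis R ?D ?B ?y ?\<phi>"
  proof (intro dual_basis.intro[OF D] dual_basis_axioms.intro)
    fix b assume "b \<in> ?B"
    then show "?y b \<in> carrier ?D" by (auto intro: M.y_closed N.y_closed)
    show "?\<phi> b \<in> rmod_hom R ?D (regular R)"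
      using \<open>b \<in> ?B\<close> rmod_hom_comp[OF rmod_hom_fst M.\<phi>_hom] rmod_hom_comp[OF rmod_hom_snd N.\<phi>_hom]
      by auto
  next
    fix p assume "p \<in> carrier ?D"
    then have p: "fst p \<in> carrier M" "snd p \<in> carrier N" by auto
    let ?A1 = "{b \<in> B. \<phi> b (fst p) \<noteq> \<zero>\<^bsub>R\<^esub>}" and ?A2 = "{c \<in> C. \<psi> c (snd p) \<noteq> \<zero>\<^bsub>R\<^esub>}"
    have A: "{b \<in> ?B. ?\<phi> b p \<noteq> \<zero>\<^bsub>R\<^esub>} = Inl ` ?A1 \<union> Inr ` ?A2" by auto
    have fin: "finite ?A1" "finite ?A2" using M.finite_support N.finite_support p by auto
    then show "finite {b \<in> ?B. ?\<phi> b p \<noteq> \<zero>\<^bsub>R\<^esub>}" unfolding A by simp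
    let ?g = "\<lambda>b. ?\<phi> b p \<odot>\<^bsub>?D\<^esub> ?y b"
    have g: "?g \<in> Inl ` ?A1 \<union> Inr ` ?A2 \<rightarrow> carrier ?D"
      using p by (auto intro!: M.act_closed N.act_closed simp: M.\<phi>_closed N.\<phi>_closed M.y_closed N.y_closed)
    have "fst (finsum ?D ?g (Inl ` ?A1 \<union> Inr ` ?A2)) = finsum M (\<lambda>b. fst (?g b)) (Inl ` ?A1 \<union> Inr ` ?A2)"
      using f.finsum[OF g] .
    also have "\<dots> = finsum M (\<lambda>b. fst (?g b)) (Inl ` ?A1)"
      by (rule M.M.add.finprod_mono_neutral_cong_right)
        (use fin p in \<open>auto intro!: M.act_closed simp: M.\<phi>_closed N.\<phi>_closed M.y_closed\<close>)
    also have "\<dots> = finsum M (\<lambda>b. fst (?g (Inl b))) ?A1"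
      by (rule M.M.add.finprod_reindex)
        (use p in \<open>auto intro!: M.act_closed simp: M.\<phi>_closed M.y_closed\<close>)
    also have "\<dots> = fst p" using M.expand[OF p(1)] by simp
    finally have 1: "fst (finsum ?D ?g (Inl ` ?A1 \<union> Inr ` ?A2)) = fst p" .
    have "snd (finsum ?D ?g (Inl ` ?A1 \<union> Inr ` ?A2)) = finsum N (\<lambda>b. snd (?g b)) (Inl ` ?A1 \<union> Inr ` ?A2)"
      using s.finsum[OF g] .
    also have "\<dots> = finsum N (\<lambda>b. snd (?g b)) (Inr ` ?A2)"
      by (rule N.M.add.finprod_mono_neutral_cong_right)
        (use fin p in \<open>auto intro!: N.act_closed simp: M.\<phi>_closed N.\<phi>_closed N.y_closed\<close>)
    also have "\<dots> = finsum N (\<lambda>b. snd (?g (Inr b))) ?A2"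
      by (rule N.M.add.finprod_reindex)
        (use p in \<open>auto intro!: N.act_closed simp: N.\<phi>_closed N.y_closed\<close>)
    also have "\<dots> = snd p" using N.expand[OF p(2)] by simp
    finally show "finsum ?D ?g {b \<in> ?B. ?\<phi> b p \<noteq> \<zero>\<^bsub>R\<^esub>} = p"
      using 1 unfolding A by (rule_tac prod_eqI) simp_all
  qed
  then show ?thesis by (rule dual_basis.projective)
qed

subsection \<open>Copies in the universal type\<close>

text \<open>The structure is carried over along an encoding \<open>c\<close> with left inverse
  \<open>p\<close> on the carrier: the new operations decode, compute and encode again.\<close>

lemma transport_module:
  fixes M :: "('a, 'b, 'm) module_scheme" and c :: "'b \<Rightarrow> 'd"
  assumes M: "right_module R M" and pc: "\<And>x. x \<in> carrier M \<Longrightarrow> p (c x) = x"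
  shows "\<exists>M' :: ('a, 'd) module. right_module R M' \<and> rmod_iso R M' M"
proof -
  interpret M: right_module R M by fact
  define M' :: "('a, 'd) module" where "M' = \<lparr>carrier = c ` carrier M, mult = undefined, one = undefined,
    zero = c \<zero>\<^bsub>M\<^esub>, add = (\<lambda>u v. c (p u \<oplus>\<^bsub>M\<^esub> p v)), smult = (\<lambda>a u. c (a \<odot>\<^bsub>M\<^esub> p u))\<rparr>"
  have s: "carrier M' = c ` carrier M" "zero M' = c \<zero>\<^bsub>M\<^esub>" "add M' = (\<lambda>u v. c (p u \<oplus>\<^bsub>M\<^esub> p v))"
    "smult M' = (\<lambda>a u. c (a \<odot>\<^bsub>M\<^esub> p u))" by (simp_all add: M'_def)
  have comm: "c (x \<oplus>\<^bsub>M\<^esub> y) = c (y \<oplus>\<^bsub>M\<^esub> x)" if "x \<in> carrier M" "y \<in> carrier M" for x y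
    using that by (simp add: M.M.a_comm)
  have "right_module R M'"
    by (rule right_moduleI)
      (auto simp: s pc M.R.ring_axioms M.act_closed M.M.a_assoc M.act_one M.act_add M.act_add_ring M.act_mult comm)
  moreover have "rmod_iso R M' M"
    by (rule rmod_isoI[of p _ _ _ c]) (auto intro!: rmod_homI simp: s pc M.act_closed)
  ultimately show ?thesis by blast
qed

text \<open>A countably generated module is a quotient of the free module on the natural numbers,
  whose elements have type \<open>nat \<Rightarrow> 'a\<close>. Choosing a preimage of each element
  encodes the module in that type.\<close>

lemma countably_gen_univ_copy:
  fixes M :: "('a, 'b, 'm) module_scheme"
  assumes M: "right_module R M" and "countably_gen R M"
  shows "\<exists>M' :: 'a univ_module. right_module R M' \<and> rmod_iso R M' M"
proof -
  interpret M: right_module R M by fact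
  obtain S where S: "countable S" "generated_by R M S" using assms(2) unfolding countably_gen_def by blast
  \<comment> \<open>Zero is added so that the set to be enumerated is nonempty.\<close>
  define s where "s = from_nat_into (insert \<zero>\<^bsub>M\<^esub> S)"
  have rs: "range s = insert \<zero>\<^bsub>M\<^esub> S" unfolding s_def by (rule range_from_nat_into) (use S in auto)
  then have sc': "s n \<in> insert \<zero>\<^bsub>M\<^esub> S" for n by blast
  have sc: "s n \<in> carrier M" for n using sc'[of n] S(2) by (auto simp: generated_by_def)
  let ?F = "direct_sum (UNIV :: nat set) (\<lambda>_. regular R)"
  let ?p = "ds_sum M (UNIV :: nat set) (\<lambda>n r. r \<odot>\<^bsub>M\<^esub> s n)"
  have reg: "right_module R (regular R)" by (rule right_module_regular[OF M.R.ring_axioms])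
  have F: "right_module R ?F" by (rule right_module_direct_sum[OF M.R.ring_axioms reg])
  have p: "?p \<in> rmod_hom R ?F M"
    by (rule rmod_hom_ds_sum[OF M.R.ring_axioms reg M rmod_hom_act_element[OF M sc]])
  interpret F: right_module R ?F by (rule F)
  interpret p: rmod_morphism R ?F M ?p by (rule rmod_morphismI[OF F M p])
  have "S \<subseteq> ?p ` carrier ?F"
  proof
    fix x assume "x \<in> S"
    then obtain n where n: "s n = x" using rs by (metis imageE insertI2)
    have "?p (ds_single UNIV (\<lambda>_. regular R) n \<one>\<^bsub>R\<^esub>) = \<one>\<^bsub>R\<^esub> \<odot>\<^bsub>M\<^esub> s n"
      by (rule ds_sum_single[OF reg M rmod_hom_act_element[OF M sc]]) simp_all
    then have "x = ?p (ds_single UNIV (\<lambda>_. regular R) n \<one>\<^bsub>R\<^esub>)" using M.act_one[OF sc, of n] n by simp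
    moreover have "ds_single UNIV (\<lambda>_. regular R) n \<one>\<^bsub>R\<^esub> \<in> carrier ?F"
      by (rule rmod_hom_closed[OF rmod_hom_ds_single[OF reg]]) simp_all
    ultimately show "x \<in> ?p ` carrier ?F" by blast
  qed
  then have surj: "x \<in> ?p ` carrier ?F" if "x \<in> carrier M" for x
    using generated_byD[OF S(2) p.submodule_image[OF F.submodule_carrier] _ that] by blast
  show ?thesis
    by (rule transport_module[OF M, of ?p "inv_into (carrier ?F) ?p"]) (rule f_inv_into_f[OF surj])
qed

subsection \<open>The Jacobson radical\<close>

text \<open>Zorn's lemma for submodules that contain \<open>L\<close> but not \<open>a\<close>. The
  result need not be a maximal submodule. In the regular module it is one if \<open>a\<close> is the
  unit; for general \<open>a\<close> it serves to separate \<open>a\<close> from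
  \<open>L\<close>.\<close>

lemma (in right_module) submodule_maximal_avoiding:
  assumes L: "submodule L R M" "a \<notin> L"
  obtains N where "submodule N R M" "L \<subseteq> N" "a \<notin> N"
    "\<And>K. \<lbrakk>submodule K R M; N \<subseteq> K; N \<noteq> K\<rbrakk> \<Longrightarrow> a \<in> K"
proof -
  let ?A = "{N. submodule N R M \<and> L \<subseteq> N \<and> a \<notin> N}"
  have "\<exists>U\<in>?A. \<forall>X\<in>C. X \<subseteq> U" if C: "subset.chain ?A C" for C
  proof (cases "C = {}")
    case True
    then show ?thesis using L by blast
  next
    case False
    then obtain K0 where K0: "K0 \<in> C" by blast
    have sub: "submodule K R M" "L \<subseteq> K" "a \<notin> K" if "K \<in> C" for K
      using C that by (auto simp: subset.chain_def)
    have "submodule (\<Union>C) R M"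
    proof (rule submoduleI)
      show "\<Union>C \<subseteq> carrier M" using submodule_subset[OF sub(1)] by blast
      show "\<zero>\<^bsub>M\<^esub> \<in> \<Union>C" using submodule_zero[OF sub(1)[OF K0]] K0 by blast
    next
      fix x y assume "x \<in> \<Union>C" "y \<in> \<Union>C"
      then obtain K1 K2 where K: "K1 \<in> C" "K2 \<in> C" "x \<in> K1" "y \<in> K2" by blast
      then have "K1 \<subseteq> K2 \<or> K2 \<subseteq> K1" using C by (auto simp: subset.chain_def)
      then show "x \<oplus>\<^bsub>M\<^esub> y \<in> \<Union>C"
        using K submodule_add[OF sub(1)[OF K(1)], of x y] submodule_add[OF sub(1)[OF K(2)], of x y] by blast
    next
      fix r x assume "r \<in> carrier R" "x \<in> \<Union>C"
      then show "r \<odot>\<^bsub>M\<^esub> x \<in> \<Union>C" using submodule_act[OF sub(1)] by blast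
    qed
    then show ?thesis using sub K0 by blast
  qed
  from subset_Zorn[OF this] obtain N where N: "N \<in> ?A" "\<forall>X\<in>?A. N \<subseteq> X \<longrightarrow> X = N" by blast
  then have "submodule N R M" "L \<subseteq> N" "a \<notin> N" by auto
  moreover have "a \<in> K" if "submodule K R M" "N \<subseteq> K" "N \<noteq> K" for K
    using N that by blast
  ultimately show ?thesis by (rule that)
qed

context ring
begin

lemma reg: "right_module R (regular R)"
  by (rule right_module_regular[OF ring_axioms])

lemma
  assumes K: "submodule K R (regular R)"
  shows right_ideal_mem: "x \<in> K \<Longrightarrow> x \<in> carrier R"
    and right_ideal_zero: "\<zero> \<in> K"
    and right_ideal_add: "\<lbrakk>x \<in> K; y \<in> K\<rbrakk> \<Longrightarrow> x \<oplus> y \<in> K"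
    and right_ideal_mult: "\<lbrakk>x \<in> K; a \<in> carrier R\<rbrakk> \<Longrightarrow> x \<otimes> a \<in> K"
    and right_ideal_neg: "x \<in> K \<Longrightarrow> \<ominus> x \<in> K"
    and right_ideal_one: "\<one> \<in> K \<Longrightarrow> K = carrier R"
proof -
  interpret reg: right_module R "regular R" by (rule reg)
  have 1: "x \<in> K \<Longrightarrow> x \<in> carrier R" "\<zero> \<in> K" "\<lbrakk>x \<in> K; y \<in> K\<rbrakk> \<Longrightarrow> x \<oplus> y \<in> K"
    "\<lbrakk>x \<in> K; a \<in> carrier R\<rbrakk> \<Longrightarrow> x \<otimes> a \<in> K" for x y a
    using reg.submodule_mem[OF K] reg.submodule_zero[OF K] reg.submodule_add[OF K] reg.submodule_act[OF K]
    by auto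
  show "x \<in> K \<Longrightarrow> x \<in> carrier R" by (rule 1)
  show "\<zero> \<in> K" by (rule 1)
  show "\<lbrakk>x \<in> K; y \<in> K\<rbrakk> \<Longrightarrow> x \<oplus> y \<in> K" by (rule 1)
  show "\<lbrakk>x \<in> K; a \<in> carrier R\<rbrakk> \<Longrightarrow> x \<otimes> a \<in> K" by (rule 1)
  show "\<ominus> x \<in> K" if "x \<in> K"
    using 1(4)[OF that, of "\<ominus> \<one>"] 1(1)[OF that] by (simp add: r_minus)
  show "K = carrier R" if "\<one> \<in> K"
  proof
    show "K \<subseteq> carrier R" using 1(1) by blast
    show "carrier R \<subseteq> K"
    proof
      fix a assume "a \<in> carrier R"
      then show "a \<in> K" using 1(4)[OF that, of a] by simp
    qed
  qed
qed

lemma right_idealI: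
  assumes "K \<subseteq> carrier R" "\<zero> \<in> K" "\<And>x y. \<lbrakk>x \<in> K; y \<in> K\<rbrakk> \<Longrightarrow> x \<oplus> y \<in> K"
    "\<And>x a. \<lbrakk>x \<in> K; a \<in> carrier R\<rbrakk> \<Longrightarrow> x \<otimes> a \<in> K"
  shows "submodule K R (regular R)"
  by (rule right_module.submoduleI[OF reg]) (use assms in auto)

lemma ideal_right_ideal: "ideal I R \<Longrightarrow> submodule I R (regular R)"
proof -
  assume "ideal I R"
  then interpret ideal I R .
  show ?thesis by (rule right_idealI) (auto intro: I_r_closed a_Hcarr)
qed

lemma finsum_regular: "finsum (regular R) f A = finsum R f A"
  by (simp add: finsum_def finprod_def)

lemma right_ideal_principal: "x \<in> carrier R \<Longrightarrow> submodule ((\<lambda>a. x \<otimes> a) ` carrier R) R (regular R)"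
  using right_module.submodule_cyclic[OF reg, of x] by simp

lemma right_ideal_sum:
  assumes "submodule H R (regular R)" "submodule K R (regular R)"
  shows "submodule {x \<oplus> y |x y. x \<in> H \<and> y \<in> K} R (regular R)"
  using right_module.submodule_sum[OF reg assms] by simp

lemma right_ideal_sum_upper:
  assumes H: "submodule H R (regular R)" and K: "submodule K R (regular R)"
  shows "H \<subseteq> {x \<oplus> y |x y. x \<in> H \<and> y \<in> K}" "K \<subseteq> {x \<oplus> y |x y. x \<in> H \<and> y \<in> K}"
proof -
  show "H \<subseteq> {x \<oplus> y |x y. x \<in> H \<and> y \<in> K}"
  proof
    fix h assume h: "h \<in> H"
    then have "h = h \<oplus> \<zero>" using right_ideal_mem[OF H] by simp
    then show "h \<in> {x \<oplus> y |x y. x \<in> H \<and> y \<in> K}" using h right_ideal_zero[OF K] by blast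
  qed
  show "K \<subseteq> {x \<oplus> y |x y. x \<in> H \<and> y \<in> K}"
  proof
    fix h assume h: "h \<in> K"
    then have "h = \<zero> \<oplus> h" using right_ideal_mem[OF K] by simp
    then show "h \<in> {x \<oplus> y |x y. x \<in> H \<and> y \<in> K}" using h right_ideal_zero[OF H] by blast
  qed
qed

lemma maximal_right_ideal_avoiding_one:
  assumes L: "submodule L R (regular R)" "\<one> \<notin> L"
  obtains N where "maximal_right_ideal N R" "L \<subseteq> N"
proof -
  obtain N where N: "submodule N R (regular R)" "L \<subseteq> N" "\<one> \<notin> N"
    "\<And>K. \<lbrakk>submodule K R (regular R); N \<subseteq> K; N \<noteq> K\<rbrakk> \<Longrightarrow> \<one> \<in> K"
    using right_module.submodule_maximal_avoiding[OF reg L] by metis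
  have "maximal_right_ideal N R"
    unfolding maximal_right_ideal_def using N right_ideal_one by blast
  then show ?thesis using N(2) by (rule that)
qed

lemma right_ideal_jacobson: "submodule (jacobson R) R (regular R)"
  unfolding jacobson_def
  using right_module.submodule_Inter[OF reg, of "{I. maximal_right_ideal I R}"]
  by (simp add: maximal_right_ideal_def)

text \<open>Otherwise the right ideal generated by \<open>\<one> \<ominus> x\<close> would lie in a
  maximal right ideal, which also contains \<open>x\<close> and hence one.\<close>

lemma jacobson_one_minus_right_inverse:
  assumes x: "x \<in> jacobson R"
  shows "\<exists>u\<in>carrier R. (\<one> \<ominus> x) \<otimes> u = \<one>"
proof (rule ccontr)
  have xc: "x \<in> carrier R" using right_ideal_mem[OF right_ideal_jacobson x] .
  let ?K = "(\<lambda>a. (\<one> \<ominus> x) \<otimes> a) ` carrier R"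
  assume "\<not> ?thesis"
  then have 1: "\<one> \<notin> ?K" by force
  have K: "submodule ?K R (regular R)" using xc by (intro right_ideal_principal) simp
  obtain N where N: "maximal_right_ideal N R" "?K \<subseteq> N"
    using maximal_right_ideal_avoiding_one[OF K 1] .
  then have N': "submodule N R (regular R)" by (simp add: maximal_right_ideal_def)
  have "x \<in> N" using x N(1) by (auto simp: jacobson_def)
  moreover have "(\<one> \<ominus> x) \<otimes> \<one> \<in> ?K" by blast
  then have "\<one> \<ominus> x \<in> N" using N(2) xc by auto
  ultimately have "(\<one> \<ominus> x) \<oplus> x \<in> N" using right_ideal_add[OF N'] by blast
  then have "\<one> \<in> N" using xc by (simp add: minus_eq a_assoc l_neg)
  then show False using right_ideal_one[OF N'] N(1) by (simp add: maximal_right_ideal_def)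
qed

text \<open>If a maximal right ideal \<open>N\<close> misses \<open>x\<close>, then
  \<open>\<one> = n \<oplus> x \<otimes> r\<close> with \<open>n \<in> N\<close>, and the right
  invertible element \<open>n\<close> puts one into \<open>N\<close>.\<close>

lemma mem_jacobsonI:
  assumes x: "x \<in> carrier R" and inv: "\<And>r. r \<in> carrier R \<Longrightarrow> \<exists>u\<in>carrier R. (\<one> \<ominus> x \<otimes> r) \<otimes> u = \<one>"
  shows "x \<in> jacobson R"
proof -
  have "x \<in> N" if N: "maximal_right_ideal N R" for N
  proof (rule ccontr)
    assume xN: "x \<notin> N"
    have N': "submodule N R (regular R)" using N by (simp add: maximal_right_ideal_def)
    let ?P = "(\<lambda>a. x \<otimes> a) ` carrier R"
    let ?K = "{n \<oplus> p |n p. n \<in> N \<and> p \<in> ?P}"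
    have P: "submodule ?P R (regular R)" using right_ideal_principal[OF x] .
    have K: "submodule ?K R (regular R)" by (rule right_ideal_sum[OF N' P])
    have "N \<subseteq> ?K" "?P \<subseteq> ?K" using right_ideal_sum_upper[OF N' P] by blast+
    moreover have "x \<otimes> \<one> \<in> ?P" by blast
    then have "x \<in> ?P" using x by simp
    then have "x \<in> ?K" using \<open>?P \<subseteq> ?K\<close> by blast
    ultimately have "?K = carrier R" using N K xN unfolding maximal_right_ideal_def by blast
    then obtain n r where n: "n \<in> N" "r \<in> carrier R" "\<one> = n \<oplus> x \<otimes> r" using one_closed by blast
    then have "\<one> \<ominus> x \<otimes> r = n"
      using x right_ideal_mem[OF N' n(1)] by (simp add: minus_eq a_assoc r_neg)
    then obtain u where "u \<in> carrier R" "n \<otimes> u = \<one>" using inv[OF n(2)] by auto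
    then have "\<one> \<in> N" using right_ideal_mult[OF N' n(1)] by metis
    then show False using right_ideal_one[OF N'] N by (simp add: maximal_right_ideal_def)
  qed
  then show ?thesis using x by (auto simp: jacobson_def)
qed

text \<open>The classical formula behind the left-right symmetry of the radical. It is suggested by
  the formal geometric series \<open>1 + ba + baba + ...\<close>: between the outer \<open>b\<close>
  and \<open>a\<close> stands the series for the inverse of \<open>1 - ab\<close>.\<close>

lemma one_minus_swap_right_inverse:
  assumes a: "a \<in> carrier R" and b: "b \<in> carrier R" and c: "c \<in> carrier R" and e: "(\<one> \<ominus> a \<otimes> b) \<otimes> c = \<one>"
  shows "(\<one> \<ominus> b \<otimes> a) \<otimes> (\<one> \<oplus> b \<otimes> c \<otimes> a) = \<one>"
proof -
  have abc: "a \<otimes> b \<otimes> c = c \<ominus> \<one>"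
  proof -
    have "c \<ominus> a \<otimes> b \<otimes> c = \<one>" using e a b c by (simp add: minus_eq l_distr l_minus)
    then have "c = \<one> \<oplus> a \<otimes> b \<otimes> c" using a b c
      by (metis a_comm add.inv_solve_right' m_closed minus_eq one_closed)
    then show ?thesis using a b c
      by (metis a_comm add.inv_solve_right m_closed minus_eq one_closed)
  qed
  have "(\<one> \<ominus> b \<otimes> a) \<otimes> (\<one> \<oplus> b \<otimes> c \<otimes> a) = \<one> \<oplus> b \<otimes> c \<otimes> a \<ominus> b \<otimes> a \<ominus> b \<otimes> (a \<otimes> b \<otimes> c) \<otimes> a"
    using a b c by (simp add: minus_eq l_distr r_distr l_minus m_assoc minus_add a_ac)
  also have "\<dots> = \<one> \<oplus> b \<otimes> c \<otimes> a \<ominus> b \<otimes> a \<ominus> (b \<otimes> c \<otimes> a \<ominus> b \<otimes> a)"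
    unfolding abc using a b c by (simp add: minus_eq l_distr r_distr l_minus r_minus m_assoc)
  also have "\<dots> = \<one>"
  proof -
    have d: "\<one> \<oplus> d \<ominus> d = \<one>" if "d \<in> carrier R" for d
      using that by (simp add: minus_eq a_assoc r_neg)
    have "\<one> \<oplus> p \<ominus> q \<ominus> (p \<ominus> q) = \<one>" if "p \<in> carrier R" "q \<in> carrier R" for p q
      using d[of "p \<ominus> q"] that by (simp add: minus_eq a_assoc)
    then show ?thesis using a b c by simp
  qed
  finally show ?thesis .
qed

text \<open>The point is closure under left multiplication. By the swap formula a right inverse of
  \<open>\<one> \<ominus> a \<otimes> r \<otimes> x\<close>, which exists because \<open>a\<close>
  stands on the left, gives one of
  \<open>\<one> \<ominus> x \<otimes> a \<otimes> r\<close>.\<close>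

lemma ideal_jacobson: "ideal (jacobson R) R"
proof (rule idealI)
  show "ring R" by (rule ring_axioms)
  show "subgroup (jacobson R) (add_monoid R)"
    using submodule.axioms(1)[OF right_ideal_jacobson]
    by (simp add: subgroup_def m_inv_def)
  fix a x assume a: "a \<in> jacobson R" and x: "x \<in> carrier R"
  have ac: "a \<in> carrier R" using right_ideal_mem[OF right_ideal_jacobson a] .
  show "a \<otimes> x \<in> jacobson R" using right_ideal_mult[OF right_ideal_jacobson a x] .
  show "x \<otimes> a \<in> jacobson R"
  proof (rule mem_jacobsonI)
    fix r assume r: "r \<in> carrier R"
    have "a \<otimes> (r \<otimes> x) \<in> jacobson R" using right_ideal_mult[OF right_ideal_jacobson a] r x by simp
    then obtain u where u: "u \<in> carrier R" "(\<one> \<ominus> (a \<otimes> r) \<otimes> x) \<otimes> u = \<one>"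
      using jacobson_one_minus_right_inverse ac r x by (auto simp: m_assoc)
    have "(\<one> \<ominus> x \<otimes> (a \<otimes> r)) \<otimes> (\<one> \<oplus> x \<otimes> u \<otimes> (a \<otimes> r)) = \<one>"
      using one_minus_swap_right_inverse[OF _ x u(1) u(2)] ac r by simp
    then show "\<exists>u\<in>carrier R. (\<one> \<ominus> x \<otimes> a \<otimes> r) \<otimes> u = \<one>"
      using ac x r u(1) by (intro bexI[of _ "\<one> \<oplus> x \<otimes> u \<otimes> (a \<otimes> r)"]) (simp_all add: m_assoc)
  qed (use ac x in simp)
qed

text \<open>The right inverse \<open>u\<close> equals \<open>\<one> \<oplus> x \<otimes> u\<close>,
  so it is again one minus an element of the radical and has a right inverse of its own. Hence
  \<open>u\<close> is a two-sided inverse.\<close>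

lemma jacobson_one_minus_inverse:
  assumes x: "x \<in> jacobson R"
  obtains u where "u \<in> carrier R" "u = \<one> \<oplus> u \<otimes> x" "u \<otimes> (\<one> \<ominus> x) = \<one>"
proof -
  interpret J: ideal "jacobson R" R by (rule ideal_jacobson)
  have xc: "x \<in> carrier R" using J.a_Hcarr x .
  obtain u where u: "u \<in> carrier R" "(\<one> \<ominus> x) \<otimes> u = \<one>" using jacobson_one_minus_right_inverse[OF x] by blast
  have "\<ominus> (x \<otimes> u) \<in> jacobson R" using x u(1) J.I_r_closed by blast
  then obtain v where v: "v \<in> carrier R" "(\<one> \<ominus> (\<ominus> (x \<otimes> u))) \<otimes> v = \<one>"
    using jacobson_one_minus_right_inverse by blast
  have "u \<ominus> x \<otimes> u = \<one>" using u xc by (simp add: minus_eq l_distr l_minus)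
  then have "(u \<ominus> x \<otimes> u) \<oplus> x \<otimes> u = \<one> \<oplus> x \<otimes> u" by simp
  then have "u = \<one> \<oplus> x \<otimes> u" using u(1) xc by (simp add: minus_eq a_assoc l_neg)
  then have uv: "u \<otimes> v = \<one>" using v xc u(1) by (simp add: minus_eq)
  have "v = (\<one> \<ominus> x) \<otimes> u \<otimes> v" using u v by simp
  also have "\<dots> = \<one> \<ominus> x" using u(1) v(1) xc uv by (simp add: m_assoc)
  finally have inv: "u \<otimes> (\<one> \<ominus> x) = \<one>" using uv by simp
  then have "u \<ominus> u \<otimes> x = \<one>" using u xc by (simp add: minus_eq r_distr r_minus)
  then have "(u \<ominus> u \<otimes> x) \<oplus> u \<otimes> x = \<one> \<oplus> u \<otimes> x" by simp
  then have "u = \<one> \<oplus> u \<otimes> x" using u(1) xc by (simp add: minus_eq a_assoc l_neg)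
  then show ?thesis using inv u(1) that by blast
qed

text \<open>Modulo \<open>I\<close> this is a homogeneous system with matrix \<open>1 - A\<close>,
  where \<open>A\<close> has entries in the radical, so all unknowns vanish. It replaces Nakayama's
  lemma for modules without finite generation. One unknown is eliminated at a time.\<close>

lemma jacobson_column_elimination:
  assumes "finite N" and I: "ideal I R"
    and "\<And>b c. \<lbrakk>b \<in> N; c \<in> N\<rbrakk> \<Longrightarrow> A b c \<in> jacobson R" "\<And>b. b \<in> N \<Longrightarrow> r b \<in> carrier R"
    and "\<And>b. b \<in> N \<Longrightarrow> i b \<in> I" "\<And>b. b \<in> N \<Longrightarrow> r b = i b \<oplus> finsum R (\<lambda>c. A b c \<otimes> r c) N"
    and "b \<in> N"
  shows "r b \<in> I"
  using assms(1,3-)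
proof (induct N arbitrary: A i b)
  case (insert n N)
  interpret I: ideal I R by (rule I)
  interpret J: ideal "jacobson R" R by (rule ideal_jacobson)
  have Ac: "A b c \<in> carrier R" if "b \<in> insert n N" "c \<in> insert n N" for b c
    using insert.prems(1)[OF that] J.a_Hcarr by blast
  have rc: "r b \<in> carrier R" if "b \<in> insert n N" for b using insert.prems(2)[OF that] .
  have ic: "i b \<in> carrier R" if "b \<in> insert n N" for b using insert.prems(3)[OF that] I.a_Hcarr by blast
  obtain u where u: "u \<in> carrier R" "u = \<one> \<oplus> u \<otimes> A n n" "u \<otimes> (\<one> \<ominus> A n n) = \<one>"
    using jacobson_one_minus_inverse[OF insert.prems(1)[of n n]] by auto
  define s where "s b = finsum R (\<lambda>c. A b c \<otimes> r c) N" for b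
  have sc: "s b \<in> carrier R" if "b \<in> insert n N" for b
    unfolding s_def by (rule finsum_closed) (use that Ac rc in auto)
  have e: "r b = i b \<oplus> (A b n \<otimes> r n \<oplus> s b)" if "b \<in> insert n N" for b
  proof -
    have "finsum R (\<lambda>c. A b c \<otimes> r c) (insert n N) = A b n \<otimes> r n \<oplus> s b"
      unfolding s_def by (rule finsum_insert) (use insert.hyps that Ac rc in auto)
    then show ?thesis using insert.prems(4)[OF that] by simp
  qed
  note n = insertI1[of n N]
  have rn: "r n = u \<otimes> (i n \<oplus> s n)"
  proof -
    have "r n \<ominus> A n n \<otimes> r n = i n \<oplus> s n"
    proof -
      have "r n = (i n \<oplus> s n) \<oplus> A n n \<otimes> r n"
        using e[OF n] Ac[OF n n] rc[OF n] ic[OF n] sc[OF n] by (simp add: a_ac)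
      then show ?thesis
        using Ac[OF n n] rc[OF n] ic[OF n] sc[OF n]
        by (metis add.inv_solve_right' add.m_closed m_closed minus_eq)
    qed
    moreover have "u \<otimes> (r n \<ominus> A n n \<otimes> r n) = (u \<otimes> (\<one> \<ominus> A n n)) \<otimes> r n"
      using u(1) Ac[OF n n] rc[OF n] by (simp add: minus_eq r_distr l_distr m_assoc l_minus r_minus)
    ultimately show ?thesis using u(3) rc[OF n] by simp
  qed
  \<comment> \<open>The coefficients after \<open>r n = u \<otimes> (i n \<oplus> s n)\<close> has
    been substituted into the other equations. They stay in the radical, because it is an
    ideal.\<close>
  define A' where "A' b c = A b c \<oplus> A b n \<otimes> u \<otimes> A n c" for b c
  define i' where "i' b = i b \<oplus> A b n \<otimes> u \<otimes> i n" for b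
  have IH: "r b \<in> I" if b: "b \<in> N" for b
  proof (rule insert.hyps(3)[where A = A' and i = i', OF _ _ _ _ b])
    show "A' b c \<in> jacobson R" if "b \<in> N" "c \<in> N" for b c
      unfolding A'_def using that insert.prems(1) u(1) Ac
      by (intro J.a_closed J.I_r_closed) auto
    show "i' b \<in> I" if "b \<in> N" for b
      unfolding i'_def using that insert.prems(3) u(1) Ac by (intro I.a_closed I.I_l_closed) auto
    fix b assume b: "b \<in> N"
    then have b': "b \<in> insert n N" by simp
    have "finsum R (\<lambda>c. A' b c \<otimes> r c) N = finsum R (\<lambda>c. A b c \<otimes> r c \<oplus> A b n \<otimes> u \<otimes> (A n c \<otimes> r c)) N"
      by (rule finsum_cong') (use b Ac rc u(1) in \<open>auto simp: A'_def l_distr m_assoc\<close>)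
    also have "\<dots> = s b \<oplus> finsum R (\<lambda>c. A b n \<otimes> u \<otimes> (A n c \<otimes> r c)) N"
      unfolding s_def by (rule finsum_addf) (use b Ac rc u(1) in auto)
    also have "finsum R (\<lambda>c. A b n \<otimes> u \<otimes> (A n c \<otimes> r c)) N = A b n \<otimes> u \<otimes> s n"
      unfolding s_def by (rule finsum_rdistr[symmetric]) (use b Ac rc u(1) insert.hyps in auto)
    finally have "i' b \<oplus> finsum R (\<lambda>c. A' b c \<otimes> r c) N
       = (i b \<oplus> A b n \<otimes> u \<otimes> i n) \<oplus> (s b \<oplus> A b n \<otimes> u \<otimes> s n)" by (simp add: i'_def)
    also have "\<dots> = i b \<oplus> (A b n \<otimes> (u \<otimes> (i n \<oplus> s n)) \<oplus> s b)"
      using Ac[OF b' n] u(1) ic[OF n] ic[OF b'] sc[OF n] sc[OF b']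
      by (simp add: r_distr m_assoc a_ac)
    also have "\<dots> = r b" using e[OF b'] rn by simp
    finally show "r b = i' b \<oplus> finsum R (\<lambda>c. A' b c \<otimes> r c) N" ..
  qed (use rc in auto)
  have "s n \<in> I" unfolding s_def
    using right_module.submodule_finsum[OF reg ideal_right_ideal[OF I], of N "\<lambda>c. A n c \<otimes> r c"] IH Ac
    by (simp add: finsum_regular I.I_l_closed)
  then have "r n \<in> I" unfolding rn using insert.prems(3)[OF n] u(1) I.I_l_closed by blast
  then show ?case using IH insert.prems(5) by blast
qed blast

end

text \<open>Here the unknowns are vectors and the matrix acts from the right, as in
  \<open>w = z + w A\<close>. Elimination keeps the solution inside the submodule that contains the
  entries of \<open>z\<close>; with \<open>H = MJ\<close> this makes the later corrections trivial
  modulo the radical.\<close>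

lemma (in right_module) jacobson_row_solvable:
  assumes "finite N" and H: "submodule H R M"
    and "\<And>b c. \<lbrakk>b \<in> N; c \<in> N\<rbrakk> \<Longrightarrow> A b c \<in> jacobson R" "\<And>c. c \<in> N \<Longrightarrow> z c \<in> H"
  shows "\<exists>w. (\<forall>c\<in>N. w c \<in> H) \<and> (\<forall>c\<in>N. w c = z c \<oplus>\<^bsub>M\<^esub> finsum M (\<lambda>b. A b c \<odot>\<^bsub>M\<^esub> w b) N)"
  using assms(1,3,4)
proof (induct N arbitrary: A z)
  case (insert n N)
  interpret J: ideal "jacobson R" R by (rule R.ideal_jacobson)
  note Hm = submodule_mem[OF H]
  have Ac: "A b c \<in> carrier R" if "b \<in> insert n N" "c \<in> insert n N" for b c
    using insert.prems(1)[OF that] J.a_Hcarr by blast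
  note n = insertI1[of n N]
  obtain u where u: "u \<in> carrier R" "u = \<one>\<^bsub>R\<^esub> \<oplus>\<^bsub>R\<^esub> u \<otimes>\<^bsub>R\<^esub> A n n"
    using R.jacobson_one_minus_inverse[OF insert.prems(1)[OF n n]] by blast
  define A' where "A' b c = A b c \<oplus>\<^bsub>R\<^esub> A b n \<otimes>\<^bsub>R\<^esub> (u \<otimes>\<^bsub>R\<^esub> A n c)" for b c
  define z' where "z' c = z c \<oplus>\<^bsub>M\<^esub> (u \<otimes>\<^bsub>R\<^esub> A n c) \<odot>\<^bsub>M\<^esub> z n" for c
  have "\<exists>w. (\<forall>c\<in>N. w c \<in> H) \<and> (\<forall>c\<in>N. w c = z' c \<oplus>\<^bsub>M\<^esub> finsum M (\<lambda>b. A' b c \<odot>\<^bsub>M\<^esub> w b) N)"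
  proof (rule insert.hyps(3))
    show "A' b c \<in> jacobson R" if "b \<in> N" "c \<in> N" for b c
      unfolding A'_def using that insert.prems(1) u(1) Ac
      by (intro J.a_closed J.I_r_closed) auto
    show "z' c \<in> H" if "c \<in> N" for c
      unfolding z'_def using that insert.prems(2) u(1) Ac
      by (intro submodule_add[OF H] submodule_act[OF H]) auto
  qed
  then obtain w where w: "\<And>c. c \<in> N \<Longrightarrow> w c \<in> H"
    "\<And>c. c \<in> N \<Longrightarrow> w c = z' c \<oplus>\<^bsub>M\<^esub> finsum M (\<lambda>b. A' b c \<odot>\<^bsub>M\<^esub> w b) N" by blast
  define t where "t c = finsum M (\<lambda>b. A b c \<odot>\<^bsub>M\<^esub> w b) N" for c
  have tH: "t c \<in> H" if "c \<in> insert n N" for c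
    unfolding t_def by (rule submodule_finsum[OF H]) (use that w(1) Ac in \<open>auto intro: submodule_act[OF H]\<close>)
  \<comment> \<open>Back substitution: the equation with index \<open>n\<close> is solved for its
    own unknown by the inverse \<open>u\<close> of \<open>\<one> \<ominus> A n n\<close>.\<close>
  define wn where "wn = u \<odot>\<^bsub>M\<^esub> (z n \<oplus>\<^bsub>M\<^esub> t n)"
  have snH: "z n \<oplus>\<^bsub>M\<^esub> t n \<in> H" using tH[OF n] insert.prems(2)[OF n] by (rule submodule_add[OF H, rotated])
  have wnH: "wn \<in> H" unfolding wn_def by (rule submodule_act[OF H u(1) snH])
  define w' where "w' = w(n := wn)"
  have "w' c \<in> H" if "c \<in> insert n N" for c using that w(1) wnH by (auto simp: w'_def)
  moreover have "w' c = z c \<oplus>\<^bsub>M\<^esub> finsum M (\<lambda>b. A b c \<odot>\<^bsub>M\<^esub> w' b) (insert n N)" if c: "c \<in> insert n N" for c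
  proof -
    have "finsum M (\<lambda>b. A b c \<odot>\<^bsub>M\<^esub> w' b) (insert n N) = A n c \<odot>\<^bsub>M\<^esub> w' n \<oplus>\<^bsub>M\<^esub> finsum M (\<lambda>b. A b c \<odot>\<^bsub>M\<^esub> w' b) N"
      by (rule M.finsum_insert)
        (use insert.hyps w(1) wnH Hm Ac c in \<open>auto simp: w'_def intro!: act_closed\<close>)
    also have "finsum M (\<lambda>b. A b c \<odot>\<^bsub>M\<^esub> w' b) N = t c"
      unfolding t_def by (rule M.finsum_cong')
        (use insert.hyps w(1) Hm Ac c in \<open>auto simp: w'_def intro!: act_closed\<close>)
    finally have 1: "finsum M (\<lambda>b. A b c \<odot>\<^bsub>M\<^esub> w' b) (insert n N) = A n c \<odot>\<^bsub>M\<^esub> wn \<oplus>\<^bsub>M\<^esub> t c"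
      by (simp add: w'_def)
    have A_wn: "A n c \<odot>\<^bsub>M\<^esub> wn = (u \<otimes>\<^bsub>R\<^esub> A n c) \<odot>\<^bsub>M\<^esub> (z n \<oplus>\<^bsub>M\<^esub> t n)"
      unfolding wn_def using u(1) Ac[OF n c] Hm[OF snH] by (simp add: act_mult)
    note zc = Hm[OF insert.prems(2)[OF c]] and zn = Hm[OF insert.prems(2)[OF n]]
      and tc = Hm[OF tH[OF c]] and tn = Hm[OF tH[OF n]]
    show ?thesis
    proof (cases "c = n")
      case True
      have "wn = (\<one>\<^bsub>R\<^esub> \<oplus>\<^bsub>R\<^esub> u \<otimes>\<^bsub>R\<^esub> A n n) \<odot>\<^bsub>M\<^esub> (z n \<oplus>\<^bsub>M\<^esub> t n)"
        unfolding wn_def using u(2) by simp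
      also have "\<dots> = (z n \<oplus>\<^bsub>M\<^esub> t n) \<oplus>\<^bsub>M\<^esub> A n n \<odot>\<^bsub>M\<^esub> wn"
        using A_wn True Hm[OF snH] u(1) Ac[OF n n] by (simp add: act_add_ring act_one)
      also have "\<dots> = z n \<oplus>\<^bsub>M\<^esub> (A n n \<odot>\<^bsub>M\<^esub> wn \<oplus>\<^bsub>M\<^esub> t n)"
        using zn tn Hm[OF wnH] Ac[OF n n] by (simp add: M.a_ac act_closed)
      finally show ?thesis using 1 True by (simp add: w'_def)
    next
      case False
      then have cN: "c \<in> N" using c by simp
      have "finsum M (\<lambda>b. A' b c \<odot>\<^bsub>M\<^esub> w b) N
        = finsum M (\<lambda>b. A b c \<odot>\<^bsub>M\<^esub> w b \<oplus>\<^bsub>M\<^esub> (u \<otimes>\<^bsub>R\<^esub> A n c) \<odot>\<^bsub>M\<^esub> (A b n \<odot>\<^bsub>M\<^esub> w b)) N"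
        by (rule M.finsum_cong')
          (use Ac u(1) w(1) Hm c in \<open>auto simp: A'_def act_add_ring act_mult intro!: act_closed\<close>)
      also have "\<dots> = t c \<oplus>\<^bsub>M\<^esub> finsum M (\<lambda>b. (u \<otimes>\<^bsub>R\<^esub> A n c) \<odot>\<^bsub>M\<^esub> (A b n \<odot>\<^bsub>M\<^esub> w b)) N"
        unfolding t_def by (rule M.finsum_addf) (use Ac u(1) w(1) Hm c in \<open>auto intro!: act_closed\<close>)
      also have "finsum M (\<lambda>b. (u \<otimes>\<^bsub>R\<^esub> A n c) \<odot>\<^bsub>M\<^esub> (A b n \<odot>\<^bsub>M\<^esub> w b)) N = (u \<otimes>\<^bsub>R\<^esub> A n c) \<odot>\<^bsub>M\<^esub> t n"
        unfolding t_def by (rule finsum_act[symmetric]) (use Ac u(1) w(1) Hm c in \<open>auto intro!: act_closed\<close>)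
      finally have "w c = (z c \<oplus>\<^bsub>M\<^esub> (u \<otimes>\<^bsub>R\<^esub> A n c) \<odot>\<^bsub>M\<^esub> z n) \<oplus>\<^bsub>M\<^esub> (t c \<oplus>\<^bsub>M\<^esub> (u \<otimes>\<^bsub>R\<^esub> A n c) \<odot>\<^bsub>M\<^esub> t n)"
        using w(2)[OF cN] by (simp add: z'_def)
      also have "\<dots> = z c \<oplus>\<^bsub>M\<^esub> (A n c \<odot>\<^bsub>M\<^esub> wn \<oplus>\<^bsub>M\<^esub> t c)"
        using zc zn tc tn u(1) Ac[OF n c] by (simp add: A_wn act_add act_closed M.a_ac)
      finally show ?thesis using 1 False by (simp add: w'_def)
    qed
  qed
  ultimately show ?case by blast
qed simp

subsection \<open>Projective modules are determined by their radical factors\<close>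

text \<open>\<open>W\<close> is a model of \<open>M/MI\<close>, given by the projection and its
  kernel. The model is left open so that semisimple modules in normal form and modules over the
  quotient ring can take the place of the module of cosets.\<close>

definition cover ::
  "('a, 'r) ring_scheme \<Rightarrow> 'a set \<Rightarrow> ('a, 'b, 'm) module_scheme \<Rightarrow> ('a, 'c, 'n) module_scheme \<Rightarrow> ('b \<Rightarrow> 'c) \<Rightarrow> bool"
  where "cover R I M W u \<longleftrightarrow> u \<in> rmod_hom R M W \<and> u ` carrier M = carrier W \<and>
           (\<forall>x\<in>carrier M. u x = \<zero>\<^bsub>W\<^esub> \<longleftrightarrow> x \<in> mod_ideal_prod M I)"

lemma coverD:
  assumes "cover R I M W u"
  shows "u \<in> rmod_hom R M W" "u ` carrier M = carrier W"
    "x \<in> carrier M \<Longrightarrow> u x = \<zero>\<^bsub>W\<^esub> \<longleftrightarrow> x \<in> mod_ideal_prod M I"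
  using assms by (auto simp: cover_def)

lemma cover_eq_iff:
  assumes u: "cover R I M W u" and "right_module R M" "right_module R W" "x \<in> carrier M" "y \<in> carrier M"
  shows "u x = u y \<longleftrightarrow> x \<ominus>\<^bsub>M\<^esub> y \<in> mod_ideal_prod M I"
proof -
  interpret rmod_morphism R M W u using assms coverD(1)[OF u] by (intro rmod_morphismI)
  show ?thesis
    using coverD(3)[OF u, of "x \<ominus>\<^bsub>M\<^esub> y"] assms by (simp add: minus N.diff_eq_zero_iff)
qed

lemma cover_iso:
  assumes u: "cover R I M W u" and W: "right_module R W" and M: "right_module R M" and iso: "rmod_iso R W W'" and W': "right_module R W'"
  shows "\<exists>v. cover R I M W' v"
proof -
  obtain f where f: "f \<in> rmod_hom R W W'" "bij_betw f (carrier W) (carrier W')"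
    using iso unfolding rmod_iso_def by blast
  interpret f: rmod_morphism R W W' f by (rule rmod_morphismI[OF W W' f(1)])
  have inj: "inj_on f (carrier W)" and im: "f ` carrier W = carrier W'" using f(2) by (auto simp: bij_betw_def)
  have "cover R I M W' (\<lambda>x. f (u x))"
    unfolding cover_def
  proof (intro conjI ballI)
    show "(\<lambda>x. f (u x)) \<in> rmod_hom R M W'" by (rule rmod_hom_comp[OF coverD(1)[OF u] f(1)])
    show "(\<lambda>x. f (u x)) ` carrier M = carrier W'"
      using coverD(2)[OF u] im by (metis image_image)
    fix x assume x: "x \<in> carrier M"
    have "u x \<in> carrier W" using rmod_hom_closed[OF coverD(1)[OF u] x] .
    then have "f (u x) = \<zero>\<^bsub>W'\<^esub> \<longleftrightarrow> u x = \<zero>\<^bsub>W\<^esub>"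
      using f.inj_iff inj by auto
    then show "f (u x) = \<zero>\<^bsub>W'\<^esub> \<longleftrightarrow> x \<in> mod_ideal_prod M I" using coverD(3)[OF u x] by simp
  qed
  then show ?thesis by blast
qed

text \<open>Both projections have kernel \<open>MI\<close>, hence the same fibres; sending
  \<open>u x\<close> to \<open>v x\<close> is therefore well defined and bijective.\<close>

lemma cover_unique:
  assumes u: "cover R I M W u" and v: "cover R I M W' v"
    and M: "right_module R M" and W: "right_module R W" and W': "right_module R W'"
  shows "rmod_iso R W W'"
proof -
  interpret M: right_module R M by (rule M)
  interpret W: right_module R W by (rule W)
  let ?s = "inv_into (carrier M) u"
  have s: "?s w \<in> carrier M" "u (?s w) = w" if "w \<in> carrier W" for w
    using that coverD(2)[OF u] by (auto simp: inv_into_into f_inv_into_f)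
  have uv: "u x = u y \<longleftrightarrow> v x = v y" if "x \<in> carrier M" "y \<in> carrier M" for x y
    using cover_eq_iff[OF u M W that] cover_eq_iff[OF v M W' that] by simp
  note uh = coverD(1)[OF u] and vh = coverD(1)[OF v]
  have "(\<lambda>w. v (?s w)) \<in> rmod_hom R W W'"
  proof (rule rmod_homI)
    fix w assume w: "w \<in> carrier W"
    show "v (?s w) \<in> carrier W'" using s(1)[OF w] by (rule rmod_hom_closed[OF vh])
    fix a assume a: "a \<in> carrier R"
    have "u (?s (a \<odot>\<^bsub>W\<^esub> w)) = u (a \<odot>\<^bsub>M\<^esub> ?s w)"
      using s(2)[OF W.act_closed[OF a w]] s(2)[OF w] rmod_hom_act[OF uh a s(1)[OF w]] by simp
    then have "v (?s (a \<odot>\<^bsub>W\<^esub> w)) = v (a \<odot>\<^bsub>M\<^esub> ?s w)"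
      using uv[OF s(1)[OF W.act_closed[OF a w]] M.act_closed[OF a s(1)[OF w]]] by simp
    then show "v (?s (a \<odot>\<^bsub>W\<^esub> w)) = a \<odot>\<^bsub>W'\<^esub> v (?s w)"
      using rmod_hom_act[OF vh a s(1)[OF w]] by simp
  next
    fix w z assume w: "w \<in> carrier W" and z: "z \<in> carrier W"
    have "u (?s (w \<oplus>\<^bsub>W\<^esub> z)) = u (?s w \<oplus>\<^bsub>M\<^esub> ?s z)"
      using s(2)[OF W.M.a_closed[OF w z]] s(2)[OF w] s(2)[OF z] rmod_hom_add[OF uh s(1)[OF w] s(1)[OF z]] by simp
    then have "v (?s (w \<oplus>\<^bsub>W\<^esub> z)) = v (?s w \<oplus>\<^bsub>M\<^esub> ?s z)"
      using uv[OF s(1)[OF W.M.a_closed[OF w z]] M.M.a_closed[OF s(1)[OF w] s(1)[OF z]]] by simp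
    then show "v (?s (w \<oplus>\<^bsub>W\<^esub> z)) = v (?s w) \<oplus>\<^bsub>W'\<^esub> v (?s z)"
      using rmod_hom_add[OF vh s(1)[OF w] s(1)[OF z]] by simp
  qed
  moreover have "bij_betw (\<lambda>w. v (?s w)) (carrier W) (carrier W')"
  proof (rule bij_betw_imageI)
    show "inj_on (\<lambda>w. v (?s w)) (carrier W)"
    proof (rule inj_onI)
      fix w z assume wz: "w \<in> carrier W" "z \<in> carrier W" "v (?s w) = v (?s z)"
      then have "u (?s w) = u (?s z)" using uv[OF s(1) s(1)] by simp
      then show "w = z" using s(2) wz by simp
    qed
    show "(\<lambda>w. v (?s w)) ` carrier W = carrier W'"
    proof (intro equalityI subsetI)
      fix t assume "t \<in> carrier W'"
      then obtain x where x: "x \<in> carrier M" "t = v x" using coverD(2)[OF v] by blast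
      then have ux: "u x \<in> carrier W" using rmod_hom_closed[OF uh] by blast
      have "v (?s (u x)) = v x" using uv[OF s(1)[OF ux] x(1)] s(2)[OF ux] by simp
      then show "t \<in> (\<lambda>w. v (?s w)) ` carrier W" using x ux by (metis image_eqI)
    qed (use s(1) rmod_hom_closed[OF vh] in auto)
  qed
  ultimately show ?thesis unfolding rmod_iso_def by blast
qed

lemma cover_quot_module:
  assumes "right_module R M" "ideal I R"
  shows "cover R I M (quot_module M (mod_ideal_prod M I)) (\<lambda>x. mod_ideal_prod M I +>\<^bsub>M\<^esub> x)"
proof -
  interpret module_ideal R M I by (intro module_ideal.intro assms)
  note H = submodule_mod_ideal_prod
  show ?thesis
    unfolding cover_def using rmod_hom_quot[OF H] coset_eq_self_iff[OF H]
    by (auto simp: quot_module_carrier quot_module_zero)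
qed

lemma right_module_reduce:
  assumes "right_module R M" "ideal I R"
  shows "right_module R (quot_module M (mod_ideal_prod M I))"
proof -
  interpret module_ideal R M I by (intro module_ideal.intro assms)
  show ?thesis by (rule right_module_quot_module[OF submodule_mod_ideal_prod])
qed

context dual_basis
begin

text \<open>A functional maps \<open>MI\<close> into \<open>RI\<close>, which lies in
  \<open>I\<close>.\<close>

lemma functional_mod_ideal_prod:
  assumes I: "ideal I R" and b: "b \<in> B" and x: "x \<in> mod_ideal_prod M I"
  shows "\<phi> b x \<in> I"
proof -
  interpret I: ideal I R by (rule I)
  interpret reg: module_ideal R "regular R" I
    by (intro module_ideal.intro I right_module_regular R.ring_axioms)
  have "mod_ideal_prod (regular R) I \<subseteq> I"
    by (rule reg.mod_ideal_prod_least[OF R.ideal_right_ideal[OF I]]) (auto intro: I.I_l_closed)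
  then show ?thesis
    using rmod_hom_mod_ideal_prod[OF right_module_axioms reg.right_module_axioms I \<phi>_hom[OF b] x] by blast
qed

text \<open>An endomorphism congruent to the identity modulo the radical can be inverted on any prescribed
  finite set. In terms of the coordinates involved this is a linear system with
  coefficient matrix \<open>1 - A\<close>, where \<open>A\<close> has entries in the radical.\<close>

lemma radical_correction:
  assumes \<theta>: "\<theta> \<in> rmod_hom R M M"
    and \<theta>J: "\<And>x. x \<in> carrier M \<Longrightarrow> x \<ominus>\<^bsub>M\<^esub> \<theta> x \<in> mod_ideal_prod M (jacobson R)"
    and X: "finite X" "X \<subseteq> carrier M"
  obtains h where "h \<in> rmod_hom R M M" "\<And>x. x \<in> X \<Longrightarrow> h (\<theta> x) = x"
    "\<And>x. x \<in> carrier M \<Longrightarrow> h x \<ominus>\<^bsub>M\<^esub> x \<in> mod_ideal_prod M (jacobson R)"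
proof -
  note J = R.ideal_jacobson
  interpret MJ: module_ideal R M "jacobson R" by (intro module_ideal.intro right_module_axioms J)
  let ?MJ = "mod_ideal_prod M (jacobson R)"
  note H = MJ.submodule_mod_ideal_prod
  define j where "j = (\<lambda>x. x \<ominus>\<^bsub>M\<^esub> \<theta> x)"
  have j: "j \<in> rmod_hom R M M"
    unfolding j_def by (rule rmod_hom_minus[OF right_module_axioms rmod_hom_id \<theta>])
  interpret j: rmod_morphism R M M j by (rule rmod_morphismI[OF right_module_axioms right_module_axioms j])
  have jJ: "j x \<in> ?MJ" if "x \<in> carrier M" for x using \<theta>J[OF that] by (simp add: j_def)
  \<comment> \<open>Only these finitely many coordinates occur in elements of
    \<open>X\<close>.\<close>
  define N where "N = (\<Union>x\<in>X. {b \<in> B. \<phi> b x \<noteq> \<zero>\<^bsub>R\<^esub>})"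
  have N: "finite N" "N \<subseteq> B" unfolding N_def using X finite_support by auto
  have yN: "y b \<in> carrier M" if "b \<in> N" for b using N that y_closed by blast
  have \<phi>N: "\<phi> b x \<in> carrier R" if "b \<in> N" "x \<in> carrier M" for b x using N that \<phi>_closed by blast
  \<comment> \<open>For \<open>h = 1 + k\<close> and \<open>\<theta> = 1 - j\<close> the equation
    \<open>h \<theta> = 1\<close> amounts to \<open>k = j + k j\<close>. The map \<open>k\<close> is
    sought with coordinate vectors \<open>w c\<close>, and the system demands that
    \<open>w c\<close> be the right-hand side at \<open>y c\<close>. Expanding the elements of
    \<open>X\<close> then gives the equation on \<open>X\<close>.\<close>
  obtain w where w: "\<And>c. c \<in> N \<Longrightarrow> w c \<in> ?MJ"
    "\<And>c. c \<in> N \<Longrightarrow> w c = j (y c) \<oplus>\<^bsub>M\<^esub> finsum M (\<lambda>b. \<phi> b (j (y c)) \<odot>\<^bsub>M\<^esub> w b) N"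
  proof -
    have "\<phi> b (j (y c)) \<in> jacobson R" if "b \<in> N" "c \<in> N" for b c
      using functional_mod_ideal_prod[OF J _ jJ[OF yN[OF that(2)]]] N(2) that(1) by blast
    from jacobson_row_solvable[OF N(1) H, of "\<lambda>b c. \<phi> b (j (y c))" "\<lambda>c. j (y c)", OF this jJ[OF yN]]
    show ?thesis using that by blast
  qed
  have wc: "w c \<in> carrier M" if "c \<in> N" for c using submodule_mem[OF H w(1)[OF that]] .
  define k where "k = (\<lambda>x. finsum M (\<lambda>b. \<phi> b x \<odot>\<^bsub>M\<^esub> w b) N)"
  have k: "k \<in> rmod_hom R M M"
    unfolding k_def
  proof (rule rmod_hom_finsum[OF right_module_axioms right_module_axioms])
    fix b assume b: "b \<in> N"
    then have "\<phi> b \<in> rmod_hom R M (regular R)" using N \<phi>_hom by blast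
    from rmod_hom_comp[OF this rmod_hom_act_element[OF right_module_axioms wc[OF b]]]
    show "(\<lambda>x. \<phi> b x \<odot>\<^bsub>M\<^esub> w b) \<in> rmod_hom R M M" .
  qed
  interpret k: rmod_morphism R M M k by (rule rmod_morphismI[OF right_module_axioms right_module_axioms k])
  have kJ: "k x \<in> ?MJ" if "x \<in> carrier M" for x
    unfolding k_def by (rule submodule_finsum[OF H]) (use w(1) that \<phi>N in \<open>auto intro: submodule_act[OF H]\<close>)
  define h where "h = (\<lambda>x. x \<oplus>\<^bsub>M\<^esub> k x)"
  have h: "h \<in> rmod_hom R M M"
    unfolding h_def by (rule rmod_hom_plus[OF right_module_axioms rmod_hom_id k])
  interpret jk: rmod_morphism R M M "\<lambda>x. j x \<oplus>\<^bsub>M\<^esub> k (j x)"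
    by (rule rmod_morphismI[OF right_module_axioms right_module_axioms
          rmod_hom_plus[OF right_module_axioms j rmod_hom_comp[OF j k]]])
  have kx: "k x = j x \<oplus>\<^bsub>M\<^esub> k (j x)" if x: "x \<in> X" for x
  proof -
    have xc: "x \<in> carrier M" using X x by blast
    have ex: "finsum M (\<lambda>c. \<phi> c x \<odot>\<^bsub>M\<^esub> y c) N = x"
      by (rule expand_superset[OF xc N]) (use x in \<open>auto simp: N_def\<close>)
    have "k x = finsum M (\<lambda>c. j (\<phi> c x \<odot>\<^bsub>M\<^esub> y c) \<oplus>\<^bsub>M\<^esub> k (j (\<phi> c x \<odot>\<^bsub>M\<^esub> y c))) N"
      unfolding k_def[THEN fun_cong, of x]
    proof (rule M.finsum_cong'[OF refl])
      fix c assume c: "c \<in> N"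
      have "w c = j (y c) \<oplus>\<^bsub>M\<^esub> k (j (y c))" using w(2)[OF c] by (simp add: k_def)
      then show "\<phi> c x \<odot>\<^bsub>M\<^esub> w c = j (\<phi> c x \<odot>\<^bsub>M\<^esub> y c) \<oplus>\<^bsub>M\<^esub> k (j (\<phi> c x \<odot>\<^bsub>M\<^esub> y c))"
        using c yN \<phi>N xc jk.act[of "\<phi> c x" "y c"] by simp
    qed (use yN \<phi>N xc in \<open>auto intro!: act_closed\<close>)
    also have "\<dots> = j x \<oplus>\<^bsub>M\<^esub> k (j x)"
      using jk.finsum[of "\<lambda>c. \<phi> c x \<odot>\<^bsub>M\<^esub> y c" N] ex yN \<phi>N xc by (simp add: Pi_iff act_closed)
    finally show ?thesis .
  qed
  show ?thesis
  proof (rule that[OF h])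
    fix x assume x: "x \<in> X"
    then have xc: "x \<in> carrier M" using X by blast
    then have jx: "j x \<in> carrier M" and kx': "k (j x) \<in> carrier M" by auto
    have tc: "\<theta> x \<in> carrier M" using rmod_hom_closed[OF \<theta> xc] .
    have tx: "x = j x \<oplus>\<^bsub>M\<^esub> \<theta> x" using diff_add_cancel[OF xc tc] by (simp add: j_def)
    then have "k x = k (j x) \<oplus>\<^bsub>M\<^esub> k (\<theta> x)" using k.add[OF jx tc] by simp
    then have "j x \<oplus>\<^bsub>M\<^esub> k (j x) = k (\<theta> x) \<oplus>\<^bsub>M\<^esub> k (j x)" using kx[OF x] kx' tc by (simp add: M.a_comm)
    then have "j x = k (\<theta> x)" using jx kx' k.closed[OF tc] by simp
    then show "h (\<theta> x) = x" using tx jx tc by (simp add: h_def M.a_comm)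
  next
    fix x assume x: "x \<in> carrier M"
    then have "h x = k x \<oplus>\<^bsub>M\<^esub> x" unfolding h_def by (simp add: M.a_comm)
    then have "h x \<ominus>\<^bsub>M\<^esub> x = k x" using x by (simp add: M.minus_eq M.a_assoc M.r_neg)
    then show "h x \<ominus>\<^bsub>M\<^esub> x \<in> ?MJ" using kJ[OF x] by simp
  qed
qed

text \<open>Any lift \<open>g0\<close> of \<open>v\<close> along \<open>u\<close> satisfies
  \<open>g0 (f x) = x\<close> modulo the radical, so \<open>radical_correction\<close> applies to
  the composite. The correcting map is the identity modulo the radical and thus preserves the
  lifting property.\<close>

lemma radical_inverse_on_finite:
  assumes Q: "right_module R Q" and W: "right_module R W"
    and u: "cover R (jacobson R) M W u" and v: "v \<in> rmod_hom R Q W"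
    and dbQ: "dual_basis R Q C z \<psi>"
    and f: "f \<in> rmod_hom R M Q" "\<And>x. x \<in> carrier M \<Longrightarrow> v (f x) = u x"
    and X: "finite X" "X \<subseteq> carrier M"
  obtains g where "g \<in> rmod_hom R Q M" "\<And>q. q \<in> carrier Q \<Longrightarrow> u (g q) = v q" "\<And>x. x \<in> X \<Longrightarrow> g (f x) = x"
proof -
  interpret Q: dual_basis R Q C z \<psi> by (rule dbQ)
  obtain g0 where g0: "g0 \<in> rmod_hom R Q M" "\<And>q. q \<in> carrier Q \<Longrightarrow> u (g0 q) = v q"
    using Q.lifting[OF right_module_axioms W v coverD(1)[OF u] coverD(2)[OF u]] by blast
  have gf: "(\<lambda>x. g0 (f x)) \<in> rmod_hom R M M" by (rule rmod_hom_comp[OF f(1) g0(1)])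
  have "x \<ominus>\<^bsub>M\<^esub> g0 (f x) \<in> mod_ideal_prod M (jacobson R)" if x: "x \<in> carrier M" for x
  proof -
    have "u x = u (g0 (f x))" using g0(2)[OF rmod_hom_closed[OF f(1) x]] f(2)[OF x] by simp
    then show ?thesis
      using cover_eq_iff[OF u right_module_axioms W x rmod_hom_closed[OF gf x]] by simp
  qed
  from radical_correction[OF gf this X] obtain h where h: "h \<in> rmod_hom R M M" "\<And>x. x \<in> X \<Longrightarrow> h (g0 (f x)) = x"
    "\<And>x. x \<in> carrier M \<Longrightarrow> h x \<ominus>\<^bsub>M\<^esub> x \<in> mod_ideal_prod M (jacobson R)" by blast
  have uh: "u (h x) = u x" if x: "x \<in> carrier M" for x
    using cover_eq_iff[OF u right_module_axioms W rmod_hom_closed[OF h(1) x] x] h(3)[OF x] by simp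
  show ?thesis
  proof (rule that[OF rmod_hom_comp[OF g0(1) h(1)]])
    show "u (h (g0 q)) = v q" if "q \<in> carrier Q" for q
      using uh[OF rmod_hom_closed[OF g0(1) that]] g0(2)[OF that] by simp
  qed (rule h(2))
qed

end

theorem projective_iso_of_radical_factor:
  fixes P :: "('a, 'b, 'm) module_scheme" and Q :: "('a, 'c, 'n) module_scheme"
  assumes P: "projective R P" "countably_gen R P" and Q: "projective R Q" "countably_gen R Q"
    and W: "right_module R W"
    and u: "cover R (jacobson R) P W u" and v: "cover R (jacobson R) Q W v"
  shows "rmod_iso R P Q"
proof -
  obtain B :: "nat set" and y \<phi> where "dual_basis R P B y \<phi>"
    using projective_countable_dual_basis[OF P] by blast
  then interpret P: dual_basis R P B y \<phi> .
  obtain C :: "nat set" and z \<psi> where "dual_basis R Q C z \<psi>"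
    using projective_countable_dual_basis[OF Q] by blast
  then interpret Q: dual_basis R Q C z \<psi> .
  note P' = P.right_module_axioms and Q' = Q.right_module_axioms
  note uh = coverD(1)[OF u] and vh = coverD(1)[OF v]
  \<comment> \<open>A stage consists of a lift \<open>f\<close> of the identity of \<open>W\<close>,
    a map \<open>g\<close> back, and a finite set \<open>X\<close> on which \<open>g\<close> inverts
    \<open>f\<close>.\<close>
  define good where "good = (\<lambda>(f, g, X). f \<in> rmod_hom R P Q \<and> (\<forall>x\<in>carrier P. v (f x) = u x) \<and>
    g \<in> rmod_hom R Q P \<and> (\<forall>x\<in>X. g (f x) = x) \<and> finite X \<and> X \<subseteq> carrier P)"
  \<comment> \<open>The next stage keeps \<open>f\<close> on \<open>X\<close> and takes up the
    generators with index at most \<open>n\<close> on both sides.\<close>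
  define step where "step = (\<lambda>n (f, g :: 'c \<Rightarrow> 'b, X) (f', g' :: 'c \<Rightarrow> 'b, X'). X \<subseteq> X' \<and> (\<forall>x\<in>X. f' x = f x) \<and>
    (\<forall>i\<in>B. i \<le> n \<longrightarrow> y i \<in> X') \<and> (\<forall>i\<in>C. i \<le> n \<longrightarrow> z i \<in> f' ` X'))"
  have "\<exists>F. \<forall>n. good (F n) \<and> step n (F n) (F (Suc n))"
  proof (rule dependent_nat_choice)
    obtain f where f: "f \<in> rmod_hom R P Q" "\<And>x. x \<in> carrier P \<Longrightarrow> v (f x) = u x"
      using P.lifting[OF Q' W uh vh coverD(2)[OF v]] by blast
    obtain g where "g \<in> rmod_hom R Q P"
      using Q.lifting[OF P' W vh uh coverD(2)[OF u]] by blast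
    then have "good (f, g, {})" using f by (simp add: good_def)
    then show "\<exists>s. good s" by blast
  next
    fix s n assume "good s"
    then obtain f g0 X where s: "s = (f, g0, X)" and f: "f \<in> rmod_hom R P Q" "\<And>x. x \<in> carrier P \<Longrightarrow> v (f x) = u x"
      and X: "finite X" "X \<subseteq> carrier P" by (cases s) (auto simp: good_def)
    obtain g where g: "g \<in> rmod_hom R Q P" "\<And>q. q \<in> carrier Q \<Longrightarrow> u (g q) = v q" "\<And>x. x \<in> X \<Longrightarrow> g (f x) = x"
      using P.radical_inverse_on_finite[OF Q' W u vh Q.dual_basis_axioms f X] by blast
    \<comment> \<open>The image of \<open>X\<close> under \<open>f\<close> belongs to
      \<open>Y\<close> in order that the next map, which inverts \<open>g\<close> on
      \<open>Y\<close>, agrees with \<open>f\<close> on \<open>X\<close>.\<close>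
    define Y where "Y = f ` X \<union> z ` {i \<in> C. i \<le> n}"
    have Y: "finite Y" "Y \<subseteq> carrier Q"
      unfolding Y_def using X rmod_hom_closed[OF f(1)] Q.y_closed by auto
    obtain f' where f': "f' \<in> rmod_hom R P Q" "\<And>x. x \<in> carrier P \<Longrightarrow> v (f' x) = u x" "\<And>q. q \<in> Y \<Longrightarrow> f' (g q) = q"
      using Q.radical_inverse_on_finite[OF P' W v uh P.dual_basis_axioms g(1,2) Y] by blast
    \<comment> \<open>With the image of \<open>Y\<close> under \<open>g\<close> included, each
      \<open>z i\<close> is the value of \<open>f'\<close> at
      \<open>g (z i) \<in> X'\<close>.\<close>
    define X' where "X' = X \<union> g ` Y \<union> y ` {i \<in> B. i \<le> n}"
    have X': "finite X'" "X' \<subseteq> carrier P"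
      unfolding X'_def using X Y rmod_hom_closed[OF g(1)] P.y_closed by auto
    obtain g' where g': "g' \<in> rmod_hom R Q P" "\<And>q. q \<in> carrier Q \<Longrightarrow> u (g' q) = v q" "\<And>x. x \<in> X' \<Longrightarrow> g' (f' x) = x"
      by (rule P.radical_inverse_on_finite[OF Q' W u vh Q.dual_basis_axioms f'(1,2) X']) blast+
    have "good (f', g', X')" using f' g' X' by (simp add: good_def)
    moreover have "f' x = f x" if x: "x \<in> X" for x
      using f'(3)[of "f x"] g(3)[OF x] x by (simp add: Y_def)
    moreover have "z i \<in> f' ` X'" if "i \<in> C" "i \<le> n" for i
    proof -
      have "z i \<in> Y" using that by (auto simp: Y_def)
      then show ?thesis using f'(3)[of "z i"] by (intro image_eqI[of _ _ "g (z i)"]) (auto simp: X'_def)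
    qed
    ultimately have "good (f', g', X') \<and> step n s (f', g', X')"
      unfolding s step_def by (auto simp: X'_def)
    then show "\<exists>t. good t \<and> step n s t" by blast
  qed
  then obtain F where F: "\<And>n. good (F n)" "\<And>n. step n (F n) (F (Suc n))" by blast
  define f g X where "f n = fst (F n)" and "g n = fst (snd (F n))" and "X n = snd (snd (F n))" for n
  have Fn: "F n = (f n, g n, X n)" for n by (simp add: f_def g_def X_def)
  have fh: "f n \<in> rmod_hom R P Q" and gh: "g n \<in> rmod_hom R Q P" and gf: "x \<in> X n \<Longrightarrow> g n (f n x) = x"
    and Xc: "x \<in> X n \<Longrightarrow> x \<in> carrier P" for n x
    using F(1)[of n] by (auto simp: good_def Fn)
  have XS: "X n \<subseteq> X (Suc n)" and fS: "x \<in> X n \<Longrightarrow> f (Suc n) x = f n x"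
    and yX: "\<lbrakk>i \<in> B; i \<le> n\<rbrakk> \<Longrightarrow> y i \<in> X (Suc n)" and zX: "\<lbrakk>i \<in> C; i \<le> n\<rbrakk> \<Longrightarrow> z i \<in> f (Suc n) ` X (Suc n)"
    for n x i
    using F(2)[of n] unfolding step_def Fn prod.case by blast+
  have Xmono: "X n \<subseteq> X m" if "n \<le> m" for n m using that XS by (rule lift_Suc_mono_le[rotated])
  have fX: "f m x = f n x" if "x \<in> X n" "n \<le> m" for m n x
    using that(2)
  proof (induct m rule: dec_induct)
    case (step l)
    have "x \<in> X l" using Xmono[OF step(1)] that(1) by blast
    then show ?case using fS step(3) by simp
  qed simp
  \<comment> \<open>Elements at which the sequence becomes stationary and is inverted from some
    stage on. They form a submodule, and it contains all generators \<open>y i\<close>.\<close>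
  define E where "E = {x \<in> carrier P. \<exists>n. \<forall>m\<ge>n. f m x = f n x \<and> g m (f m x) = x}"
  have XE: "x \<in> E" if x: "x \<in> X n" for x n
    unfolding E_def
  proof (intro CollectI conjI exI[of _ n] allI impI)
    fix m assume m: "n \<le> m"
    show "f m x = f n x" by (rule fX[OF x m])
    show "g m (f m x) = x" using gf[of x m] Xmono[OF m] x by blast
  qed (rule Xc[OF x])
  have f_mor: "rmod_morphism R P Q (f n)" and g_mor: "rmod_morphism R Q P (g n)" for n
    using fh gh P' Q' by (auto intro: rmod_morphismI)
  have Esub: "submodule E R P"
  proof (rule P.submoduleI)
    show "E \<subseteq> carrier P" by (auto simp: E_def)
    show "\<zero>\<^bsub>P\<^esub> \<in> E"
      using rmod_morphism.zero[OF f_mor] rmod_morphism.zero[OF g_mor] by (auto simp: E_def)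
  next
    fix a x assume a: "a \<in> carrier R" and "x \<in> E"
    then obtain n where x: "x \<in> carrier P" and n: "\<And>m. m \<ge> n \<Longrightarrow> f m x = f n x \<and> g m (f m x) = x"
      by (auto simp: E_def)
    have "f m (a \<odot>\<^bsub>P\<^esub> x) = f n (a \<odot>\<^bsub>P\<^esub> x) \<and> g m (f m (a \<odot>\<^bsub>P\<^esub> x)) = a \<odot>\<^bsub>P\<^esub> x" if "m \<ge> n" for m
    proof -
      have 1: "f m (a \<odot>\<^bsub>P\<^esub> x) = a \<odot>\<^bsub>Q\<^esub> f m x" "f n (a \<odot>\<^bsub>P\<^esub> x) = a \<odot>\<^bsub>Q\<^esub> f n x"
        using rmod_hom_act[OF fh a x] by auto
      have "g m (a \<odot>\<^bsub>Q\<^esub> f m x) = a \<odot>\<^bsub>P\<^esub> g m (f m x)"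
        by (rule rmod_hom_act[OF gh a rmod_hom_closed[OF fh x]])
      also have "\<dots> = a \<odot>\<^bsub>P\<^esub> x" using n[OF that, THEN conjunct2] by simp
      finally have "g m (f m (a \<odot>\<^bsub>P\<^esub> x)) = a \<odot>\<^bsub>P\<^esub> x" unfolding 1(1) .
      moreover have "f m (a \<odot>\<^bsub>P\<^esub> x) = f n (a \<odot>\<^bsub>P\<^esub> x)" unfolding 1 using n[OF that] by simp
      ultimately show ?thesis by blast
    qed
    then have "\<forall>m\<ge>n. f m (a \<odot>\<^bsub>P\<^esub> x) = f n (a \<odot>\<^bsub>P\<^esub> x) \<and> g m (f m (a \<odot>\<^bsub>P\<^esub> x)) = a \<odot>\<^bsub>P\<^esub> x" by blast
    then show "a \<odot>\<^bsub>P\<^esub> x \<in> E"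
      unfolding E_def by (rule_tac CollectI, rule_tac conjI[OF P.act_closed[OF a x]], rule_tac exI)
  next
    fix x x' assume "x \<in> E" "x' \<in> E"
    then obtain n n' where x: "x \<in> carrier P" and n: "\<And>m. m \<ge> n \<Longrightarrow> f m x = f n x \<and> g m (f m x) = x"
      and x': "x' \<in> carrier P" and n': "\<And>m. m \<ge> n' \<Longrightarrow> f m x' = f n' x' \<and> g m (f m x') = x'"
      by (auto simp: E_def)
    have "f m (x \<oplus>\<^bsub>P\<^esub> x') = f (max n n') (x \<oplus>\<^bsub>P\<^esub> x') \<and> g m (f m (x \<oplus>\<^bsub>P\<^esub> x')) = x \<oplus>\<^bsub>P\<^esub> x'"
      if m: "m \<ge> max n n'" for m
    proof -
      have 1: "f l (x \<oplus>\<^bsub>P\<^esub> x') = f n x \<oplus>\<^bsub>Q\<^esub> f n' x'" if "l \<ge> max n n'" for l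
      proof -
        have "f l x = f n x" "f l x' = f n' x'" using n[of l] n'[of l] that by auto
        then show ?thesis using rmod_hom_add[OF fh x x', of l] by simp
      qed
      have "g m (f m (x \<oplus>\<^bsub>P\<^esub> x')) = g m (f m x \<oplus>\<^bsub>Q\<^esub> f m x')"
        using rmod_hom_add[OF fh x x', of m] by simp
      also have "\<dots> = g m (f m x) \<oplus>\<^bsub>P\<^esub> g m (f m x')"
        by (rule rmod_hom_add[OF gh rmod_hom_closed[OF fh x] rmod_hom_closed[OF fh x']])
      also have "\<dots> = x \<oplus>\<^bsub>P\<^esub> x'"
      proof -
        have "g m (f m x) = x" "g m (f m x') = x'"
          using n[of m, THEN conjunct2] n'[of m, THEN conjunct2] m by auto
        then show ?thesis by simp
      qed
      finally show ?thesis using 1[OF m] 1[OF order_refl] by simp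
    qed
    then have "\<forall>m\<ge>max n n'. f m (x \<oplus>\<^bsub>P\<^esub> x') = f (max n n') (x \<oplus>\<^bsub>P\<^esub> x') \<and> g m (f m (x \<oplus>\<^bsub>P\<^esub> x')) = x \<oplus>\<^bsub>P\<^esub> x'" by blast
    then show "x \<oplus>\<^bsub>P\<^esub> x' \<in> E"
      unfolding E_def by (rule_tac CollectI, rule_tac conjI[OF P.M.a_closed[OF x x']], rule_tac exI)
  qed
  have E: "x \<in> E" if "x \<in> carrier P" for x
    by (rule generated_byD[OF P.generated_by_y Esub _ that]) (use yX XE in blast)
  define lim where "lim x = (SOME q. \<exists>n. \<forall>m\<ge>n. f m x = q)" for x
  have limI: "lim x = q" if "\<And>m. m \<ge> n \<Longrightarrow> f m x = q" for x q and n :: nat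
    unfolding lim_def
  proof (rule some_equality)
    fix q' assume "\<exists>n. \<forall>m\<ge>n. f m x = q'"
    then obtain n' where "\<And>m. m \<ge> n' \<Longrightarrow> f m x = q'" by blast
    then show "q' = q" using that[of "max n n'"] by (metis max.cobounded1 max.cobounded2)
  qed (use that in blast)
  have lim: "\<exists>n. \<forall>m\<ge>n. f m x = lim x \<and> g m (f m x) = x" if x: "x \<in> carrier P" for x
  proof -
    obtain n where n: "\<And>m. m \<ge> n \<Longrightarrow> f m x = f n x \<and> g m (f m x) = x" using E[OF x] by (auto simp: E_def)
    then have e: "lim x = f n x" by (intro limI[of n]) (rule conjunct1)
    show ?thesis unfolding e using n by blast
  qed
  have lim_hom: "lim \<in> rmod_hom R P Q"
  proof (rule rmod_homI)
    fix x assume x: "x \<in> carrier P"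
    then obtain n where n: "\<And>m. m \<ge> n \<Longrightarrow> f m x = lim x" using lim by blast
    then show "lim x \<in> carrier Q" using rmod_hom_closed[OF fh x] by (metis order_refl)
    fix a assume a: "a \<in> carrier R"
    show "lim (a \<odot>\<^bsub>P\<^esub> x) = a \<odot>\<^bsub>Q\<^esub> lim x"
      by (rule limI[of n]) (use n rmod_hom_act[OF fh a x] in simp)
  next
    fix x x' assume x: "x \<in> carrier P" "x' \<in> carrier P"
    obtain n where n: "\<And>m. m \<ge> n \<Longrightarrow> f m x = lim x" using lim[OF x(1)] by blast
    obtain n' where n': "\<And>m. m \<ge> n' \<Longrightarrow> f m x' = lim x'" using lim[OF x(2)] by blast
    show "lim (x \<oplus>\<^bsub>P\<^esub> x') = lim x \<oplus>\<^bsub>Q\<^esub> lim x'"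
      by (rule limI[of "max n n'"]) (use n n' rmod_hom_add[OF fh x] in simp)
  qed
  interpret lim: rmod_morphism R P Q lim by (rule rmod_morphismI[OF P' Q' lim_hom])
  \<comment> \<open>At a late stage \<open>g n\<close> recovers \<open>x\<close> from
    \<open>lim x\<close>, and it maps zero to zero.\<close>
  have "inj_on lim (carrier P)"
    unfolding lim.inj_iff
  proof (intro ballI impI)
    fix x assume x: "x \<in> carrier P" and 0: "lim x = \<zero>\<^bsub>Q\<^esub>"
    obtain n where n: "\<And>m. m \<ge> n \<Longrightarrow> f m x = lim x \<and> g m (f m x) = x" using lim[OF x] by blast
    then have "x = g n \<zero>\<^bsub>Q\<^esub>" using 0 by (metis order_refl)
    then show "x = \<zero>\<^bsub>P\<^esub>" using rmod_morphism.zero[OF g_mor] by simp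
  qed
  moreover have "lim ` carrier P = carrier Q"
  proof -
    \<comment> \<open>The generator \<open>z i\<close> is attained on \<open>X (Suc i)\<close>,
      where the sequence no longer changes after stage \<open>Suc i\<close>.\<close>
    have "z ` C \<subseteq> lim ` carrier P"
    proof
      fix q assume "q \<in> z ` C"
      then obtain i where i: "i \<in> C" "q = z i" by blast
      then obtain x where x: "x \<in> X (Suc i)" "q = f (Suc i) x" using zX[OF i(1) order_refl] by blast
      have "lim x = f (Suc i) x" by (rule limI[of "Suc i"]) (rule fX[OF x(1)])
      then have "q = lim x" using x(2) by simp
      then show "q \<in> lim ` carrier P" using Xc[OF x(1)] by blast
    qed
    then have "carrier Q \<subseteq> lim ` carrier P"
      using generated_byD[OF Q.generated_by_y lim.submodule_image[OF P.submodule_carrier]] by blast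
    then show ?thesis by auto
  qed
  ultimately show ?thesis
    unfolding rmod_iso_def using lim_hom by (auto simp: bij_betw_def)
qed

subsection \<open>Simple modules\<close>

lemma simple_moduleD:
  assumes "simple_module R V"
  shows "right_module R V" "\<exists>v\<in>carrier V. v \<noteq> \<zero>\<^bsub>V\<^esub>"
    "submodule N R V \<Longrightarrow> N = {\<zero>\<^bsub>V\<^esub>} \<or> N = carrier V"
proof -
  show 1: "right_module R V" using assms by (simp add: simple_module_def)
  then interpret right_module R V .
  have "carrier V \<noteq> {\<zero>\<^bsub>V\<^esub>}" using assms by (simp add: simple_module_def)
  then show "\<exists>v\<in>carrier V. v \<noteq> \<zero>\<^bsub>V\<^esub>" using M.zero_closed by blast
  show "submodule N R V \<Longrightarrow> N = {\<zero>\<^bsub>V\<^esub>} \<or> N = carrier V" using assms by (simp add: simple_module_def)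
qed

lemma simple_module_cyclic:
  assumes V: "simple_module R V" and v: "v \<in> carrier V" "v \<noteq> \<zero>\<^bsub>V\<^esub>" and w: "w \<in> carrier V"
  obtains a where "a \<in> carrier R" "w = a \<odot>\<^bsub>V\<^esub> v"
proof -
  interpret right_module R V by (rule simple_moduleD(1)[OF V])
  have "v \<in> (\<lambda>a. a \<odot>\<^bsub>V\<^esub> v) ` carrier R"
    using act_one[OF v(1)] by (intro image_eqI[of _ _ "\<one>\<^bsub>R\<^esub>"]) auto
  then have "(\<lambda>a. a \<odot>\<^bsub>V\<^esub> v) ` carrier R = carrier V"
    using simple_moduleD(3)[OF V submodule_cyclic[OF v(1)]] v(2) by blast
  then show ?thesis using w that by blast
qed

lemma simple_hom_inj:
  assumes V: "simple_module R V" and M: "right_module R M" and f: "f \<in> rmod_hom R V M"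
    and x: "x \<in> carrier V" "f x \<noteq> \<zero>\<^bsub>M\<^esub>"
  shows "inj_on f (carrier V)"
proof -
  interpret rmod_morphism R V M f by (rule rmod_morphismI[OF simple_moduleD(1)[OF V] M f])
  have "{x \<in> carrier V. f x = \<zero>\<^bsub>M\<^esub>} = {\<zero>\<^bsub>V\<^esub>}"
    using simple_moduleD(3)[OF V submodule_kernel] x by blast
  then show ?thesis unfolding inj_iff by blast
qed

lemma simple_hom_surj:
  assumes V: "simple_module R V" and M: "right_module R M" and f: "f \<in> rmod_hom R M V"
    and x: "x \<in> carrier M" "f x \<noteq> \<zero>\<^bsub>V\<^esub>"
  shows "f ` carrier M = carrier V"
proof -
  interpret rmod_morphism R M V f by (rule rmod_morphismI[OF M simple_moduleD(1)[OF V] f])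
  show ?thesis using simple_moduleD(3)[OF V submodule_image[OF M.submodule_carrier]] x by blast
qed

text \<open>Schur's lemma, with one nonzero value as witness that the map is not zero.\<close>

lemma simple_hom_bij:
  assumes V: "simple_module R V" and W: "simple_module R W" and f: "f \<in> rmod_hom R V W"
    and x: "x \<in> carrier V" "f x \<noteq> \<zero>\<^bsub>W\<^esub>"
  shows "bij_betw f (carrier V) (carrier W)"
  using simple_hom_inj[OF V simple_moduleD(1)[OF W] f x] simple_hom_surj[OF W simple_moduleD(1)[OF V] f x]
  by (simp add: bij_betw_def)

lemma simple_module_iso:
  assumes V: "simple_module R V" and W: "right_module R W" and iso: "rmod_iso R W V"
  shows "simple_module R W"
proof -
  obtain f where f: "f \<in> rmod_hom R W V" "bij_betw f (carrier W) (carrier V)"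
    using iso unfolding rmod_iso_def by blast
  interpret f: rmod_morphism R W V f by (rule rmod_morphismI[OF W simple_moduleD(1)[OF V] f(1)])
  have inj: "inj_on f (carrier W)" and im: "f ` carrier W = carrier V" using f(2) by (auto simp: bij_betw_def)
  show ?thesis unfolding simple_module_def
  proof (intro conjI allI impI)
    show "carrier W \<noteq> {\<zero>\<^bsub>W\<^esub>}"
    proof
      assume "carrier W = {\<zero>\<^bsub>W\<^esub>}"
      then have "carrier V = {\<zero>\<^bsub>V\<^esub>}" using im f.zero by auto
      then show False using simple_moduleD(2)[OF V] by auto
    qed
    fix N assume N: "submodule N R W"
    then have sub: "N \<subseteq> carrier W" by (rule f.M.submodule_subset)
    from simple_moduleD(3)[OF V f.submodule_image[OF N]] show "N = {\<zero>\<^bsub>W\<^esub>} \<or> N = carrier W"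
    proof
      assume "f ` N = {\<zero>\<^bsub>V\<^esub>}"
      then have "x = \<zero>\<^bsub>W\<^esub>" if "x \<in> N" for x using that sub inj f.inj_iff by blast
      then show ?thesis using f.M.submodule_zero[OF N] by blast
    next
      assume "f ` N = carrier V"
      then have "f ` N = f ` carrier W" using im by simp
      then show ?thesis using inj_on_image_eq_iff[OF inj sub order_refl] by simp
    qed
  qed (rule W)
qed

context ring
begin

lemma annihilator_maximal:
  assumes V: "simple_module R V" and v: "v \<in> carrier V" "v \<noteq> \<zero>\<^bsub>V\<^esub>"
  shows "maximal_right_ideal {r \<in> carrier R. r \<odot>\<^bsub>V\<^esub> v = \<zero>\<^bsub>V\<^esub>} R"
proof -
  interpret V: right_module R V by (rule simple_moduleD(1)[OF V])
  interpret f: rmod_morphism R "regular R" V "\<lambda>r. r \<odot>\<^bsub>V\<^esub> v"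
    by (rule rmod_morphismI[OF reg V.right_module_axioms rmod_hom_act_element[OF V.right_module_axioms v(1)]])
  let ?A = "{r \<in> carrier R. r \<odot>\<^bsub>V\<^esub> v = \<zero>\<^bsub>V\<^esub>}"
  have A: "submodule ?A R (regular R)" using f.submodule_kernel by simp
  have "\<one> \<notin> ?A" using V.act_one[OF v(1)] v(2) by simp
  then have "?A \<noteq> carrier R" using one_closed by metis
  moreover have "K = carrier R" if K: "submodule K R (regular R)" "?A \<subseteq> K" "K \<noteq> ?A" for K
  proof -
    obtain x where x: "x \<in> K" "x \<notin> ?A" using K by blast
    then have xc: "x \<in> carrier R" using right_ideal_mem[OF K(1)] by blast
    then have "x \<odot>\<^bsub>V\<^esub> v \<noteq> \<zero>\<^bsub>V\<^esub>" using x by simp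
    then obtain a where a: "a \<in> carrier R" "v = a \<odot>\<^bsub>V\<^esub> (x \<odot>\<^bsub>V\<^esub> v)"
      using simple_module_cyclic[OF V V.act_closed[OF xc v(1)] _ v(1)] by blast
    have "(\<one> \<ominus> x \<otimes> a) \<odot>\<^bsub>V\<^esub> v = v \<ominus>\<^bsub>V\<^esub> a \<odot>\<^bsub>V\<^esub> (x \<odot>\<^bsub>V\<^esub> v)"
      using a(1) xc v(1) by (simp add: minus_eq V.M.minus_eq V.act_add_ring V.act_minus_ring V.act_mult V.act_one)
    then have "(\<one> \<ominus> x \<otimes> a) \<in> ?A" using a v(1) xc by (simp add: V.M.minus_eq V.M.r_neg)
    then have "(\<one> \<ominus> x \<otimes> a) \<oplus> x \<otimes> a \<in> K"
      using K(2) right_ideal_add[OF K(1)] right_ideal_mult[OF K(1) x(1) a(1)] by blast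
    then have "\<one> \<in> K" using a(1) xc by (simp add: minus_eq a_assoc l_neg)
    then show ?thesis by (rule right_ideal_one[OF K(1)])
  qed
  ultimately show ?thesis using A unfolding maximal_right_ideal_def by blast
qed

text \<open>The annihilator of a nonzero vector is a maximal right ideal, and the radical lies in
  all of these.\<close>

lemma simple_jacobson_act:
  assumes V: "simple_module R V" and v: "v \<in> carrier V" and r: "r \<in> jacobson R"
  shows "r \<odot>\<^bsub>V\<^esub> v = \<zero>\<^bsub>V\<^esub>"
proof (cases "v = \<zero>\<^bsub>V\<^esub>")
  case True
  interpret V: right_module R V by (rule simple_moduleD(1)[OF V])
  show ?thesis using True right_ideal_mem[OF right_ideal_jacobson r] by simp
next
  case False
  then show ?thesis using annihilator_maximal[OF V v] r by (auto simp: jacobson_def)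
qed

lemma fin_gen_regular: "fin_gen R (regular R)"
proof -
  have "generated_by R (regular R) {\<one>}"
  proof (rule generated_byI)
    fix H x assume H: "submodule H R (regular R)" "{\<one>} \<subseteq> H" and "x \<in> carrier (regular R)"
    then show "x \<in> H" using right_ideal_mult[OF H(1), of \<one> x] by simp
  qed simp
  then show ?thesis unfolding fin_gen_def by blast
qed

text \<open>Submodules of the quotient pull back to right ideals between \<open>N\<close> and
  \<open>R\<close>.\<close>

lemma simple_quot_maximal:
  assumes N: "maximal_right_ideal N R"
  shows "simple_module R (quot_module (regular R) N)"
proof -
  interpret reg: right_module R "regular R" by (rule reg)
  let ?Q = "quot_module (regular R) N"
  let ?p = "\<lambda>x. N +>\<^bsub>regular R\<^esub> x"
  have N': "submodule N R (regular R)" using N by (simp add: maximal_right_ideal_def)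
  have Q: "right_module R ?Q" by (rule reg.right_module_quot_module[OF N'])
  interpret p: rmod_morphism R "regular R" ?Q ?p by (rule rmod_morphismI[OF reg Q reg.rmod_hom_quot[OF N']])
  have pz: "?p x = \<zero>\<^bsub>?Q\<^esub> \<longleftrightarrow> x \<in> N" if "x \<in> carrier R" for x
    using reg.coset_eq_self_iff[OF N', of x] that by (simp add: reg.quot_module_zero)
  have pc: "carrier ?Q = ?p ` carrier R" using reg.quot_module_carrier by simp
  show ?thesis unfolding simple_module_def
  proof (intro conjI allI impI)
    show "carrier ?Q \<noteq> {\<zero>\<^bsub>?Q\<^esub>}"
    proof
      assume *: "carrier ?Q = {\<zero>\<^bsub>?Q\<^esub>}"
      have "?p \<one> \<in> carrier ?Q" using pc by simp
      then have "\<one> \<in> N" using pz[of \<one>] * by simp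
      then show False using right_ideal_one[OF N'] N by (simp add: maximal_right_ideal_def)
    qed
    fix K assume K: "submodule K R ?Q"
    let ?L = "{x \<in> carrier (regular R). ?p x \<in> K}"
    have L: "submodule ?L R (regular R)" by (rule p.submodule_vimage[OF K])
    have "N \<subseteq> ?L" using pz p.N.submodule_zero[OF K] right_ideal_mem[OF N'] by force
    then have "?L = N \<or> ?L = carrier R" using N L unfolding maximal_right_ideal_def by blast
    then show "K = {\<zero>\<^bsub>?Q\<^esub>} \<or> K = carrier ?Q"
    proof
      assume L: "?L = N"
      have "q = \<zero>\<^bsub>?Q\<^esub>" if "q \<in> K" for q
      proof -
        have "q \<in> carrier ?Q" using p.N.submodule_mem[OF K that] .
        then obtain x where x: "x \<in> carrier R" "q = ?p x" using pc by blast
        then have "x \<in> ?L" using that by simp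
        then have "x \<in> N" unfolding L .
        then show ?thesis using pz[OF x(1)] x(2) by simp
      qed
      then show ?thesis using p.N.submodule_zero[OF K] by blast
    next
      assume "?L = carrier R"
      then have "carrier ?Q \<subseteq> K" using pc by auto
      then show ?thesis using p.N.submodule_subset[OF K] by blast
    qed
  qed (rule Q)
qed

end

subsection \<open>Semilocal rings\<close>

locale semilocal_ring = ring R for R :: "('a, 'r) ring_scheme" (structure) +
  fixes k :: nat and V :: "nat \<Rightarrow> ('a, 'v) module"
  assumes semilocal: "semilocal R" and representatives: "simple_representatives R k V"
begin

abbreviation "J \<equiv> jacobson R"

lemma V_simple: "i \<in> {1..k} \<Longrightarrow> simple_module R (V i)"
  using representatives unfolding simple_representatives_def by blast

lemma V_module: "i \<in> {1..k} \<Longrightarrow> right_module R (V i)"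
  by (rule simple_moduleD(1)[OF V_simple])

lemma V_not_iso: "\<lbrakk>i \<in> {1..k}; j \<in> {1..k}; rmod_iso R (V i) (V j)\<rbrakk> \<Longrightarrow> i = j"
  using representatives unfolding simple_representatives_def by blast

text \<open>\<open>R/N\<close> is simple and has a copy in the universal type, for which the
  representatives are complete. So it is isomorphic to some \<open>V j\<close>, and the vector
  wanted is the image of the coset of one.\<close>

lemma maximal_right_ideal_annihilator:
  assumes N: "maximal_right_ideal N R"
  obtains j v where "j \<in> {1..k}" "v \<in> carrier (V j)" "\<And>r. r \<in> carrier R \<Longrightarrow> r \<odot>\<^bsub>V j\<^esub> v = \<zero>\<^bsub>V j\<^esub> \<longleftrightarrow> r \<in> N"
proof -
  interpret reg: right_module R "regular R" by (rule reg)
  let ?Q = "quot_module (regular R) N"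
  let ?p = "\<lambda>x. N +>\<^bsub>regular R\<^esub> x"
  have N': "submodule N R (regular R)" using N by (simp add: maximal_right_ideal_def)
  have Q: "right_module R ?Q" by (rule reg.right_module_quot_module[OF N'])
  have p: "?p \<in> rmod_hom R (regular R) ?Q" by (rule reg.rmod_hom_quot[OF N'])
  have "fin_gen R ?Q"
    by (rule fin_gen_image[OF reg Q p _ fin_gen_regular]) (simp add: reg.quot_module_carrier)
  then obtain S :: "'a univ_module" where S: "right_module R S" "rmod_iso R S ?Q"
    using countably_gen_univ_copy[OF Q fin_gen_imp_countably_gen] by blast
  have "simple_module R S" by (rule simple_module_iso[OF simple_quot_maximal[OF N] S])
  then obtain j where j: "j \<in> {1..k}" "rmod_iso R S (V j)"
    using representatives unfolding simple_representatives_def by blast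
  have "rmod_iso R ?Q (V j)" by (rule rmod_iso_trans[OF rmod_iso_sym[OF S(2,1)] j(2)])
  then obtain g where g: "g \<in> rmod_hom R ?Q (V j)" "bij_betw g (carrier ?Q) (carrier (V j))"
    unfolding rmod_iso_def by blast
  interpret g: rmod_morphism R ?Q "V j" g by (rule rmod_morphismI[OF Q V_module[OF j(1)] g(1)])
  have pc: "?p x \<in> carrier ?Q" if "x \<in> carrier R" for x using rmod_hom_closed[OF p] that by simp
  have "r \<odot>\<^bsub>V j\<^esub> g (?p \<one>) = \<zero>\<^bsub>V j\<^esub> \<longleftrightarrow> r \<in> N" if r: "r \<in> carrier R" for r
  proof -
    have "r \<odot>\<^bsub>V j\<^esub> g (?p \<one>) = g (?p r)"
      using g.act[OF r pc[OF one_closed]] rmod_hom_act[OF p r, of \<one>] r by simp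
    moreover have "g (?p r) = \<zero>\<^bsub>V j\<^esub> \<longleftrightarrow> ?p r = \<zero>\<^bsub>?Q\<^esub>"
      using g(2) g.inj_iff pc[OF r] g.zero by (auto simp: bij_betw_def)
    ultimately show ?thesis
      using reg.coset_eq_self_iff[OF N', of r] r by (simp add: reg.quot_module_zero)
  qed
  then show ?thesis using that[OF j(1)] g.closed[OF pc[OF one_closed]] by blast
qed

lemma J_ideal: "ideal J R" by (rule ideal_jacobson)

lemma quotient_right_ideal:
  assumes K: "submodule K R (regular R)"
  shows "submodule ((\<lambda>x. J +>\<^bsub>R\<^esub> x) ` K) (R Quot J) (regular (R Quot J))"
proof -
  interpret J: ideal J R by (rule J_ideal)
  interpret Q: ring "R Quot J" by (rule J.quotient_is_ring)
  have c: "carrier (R Quot J) = (\<lambda>x. J +>\<^bsub>R\<^esub> x) ` carrier R" by (auto simp: FactRing_def A_RCOSETS_def')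
  show ?thesis
  proof (rule Q.right_idealI)
    show "(\<lambda>x. J +>\<^bsub>R\<^esub> x) ` K \<subseteq> carrier (R Quot J)" using c right_ideal_mem[OF K] by blast
    have "J +>\<^bsub>R\<^esub> \<zero> = J" using J.a_subset by simp
    then show "\<zero>\<^bsub>R Quot J\<^esub> \<in> (\<lambda>x. J +>\<^bsub>R\<^esub> x) ` K"
      using right_ideal_zero[OF K] by (auto simp: FactRing_def)
  next
    fix a b assume "a \<in> (\<lambda>x. J +>\<^bsub>R\<^esub> x) ` K" "b \<in> (\<lambda>x. J +>\<^bsub>R\<^esub> x) ` K"
    then obtain x y where "x \<in> K" "y \<in> K" "a = J +>\<^bsub>R\<^esub> x" "b = J +>\<^bsub>R\<^esub> y" by blast
    then show "a \<oplus>\<^bsub>R Quot J\<^esub> b \<in> (\<lambda>x. J +>\<^bsub>R\<^esub> x) ` K"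
      using right_ideal_mem[OF K] right_ideal_add[OF K] by (auto simp: FactRing_def J.a_rcos_sum)
  next
    fix a b assume "a \<in> (\<lambda>x. J +>\<^bsub>R\<^esub> x) ` K" "b \<in> carrier (R Quot J)"
    then obtain x y where "x \<in> K" "y \<in> carrier R" "a = J +>\<^bsub>R\<^esub> x" "b = J +>\<^bsub>R\<^esub> y" using c by blast
    then show "a \<otimes>\<^bsub>R Quot J\<^esub> b \<in> (\<lambda>x. J +>\<^bsub>R\<^esub> x) ` K"
      using right_ideal_mem[OF K] right_ideal_mult[OF K] by (auto simp: FactRing_def J.rcoset_mult_add)
  qed
qed

lemma mem_of_coset_mem:
  assumes K: "submodule K R (regular R)" "J \<subseteq> K" and x: "x \<in> carrier R" and m: "J +>\<^bsub>R\<^esub> x \<in> (\<lambda>x. J +>\<^bsub>R\<^esub> x) ` K"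
  shows "x \<in> K"
proof -
  interpret J: ideal J R by (rule J_ideal)
  obtain y where y: "y \<in> K" "J +>\<^bsub>R\<^esub> x = J +>\<^bsub>R\<^esub> y" using m by blast
  then have yc: "y \<in> carrier R" using right_ideal_mem[OF K(1)] by blast
  have "x \<in> J +>\<^bsub>R\<^esub> y" using J.a_rcos_self[OF x] y(2) by simp
  then obtain z where "z \<in> J" "x = z \<oplus> y" by (auto simp: a_r_coset_def')
  then show ?thesis using K y right_ideal_add[OF K(1)] by blast
qed

text \<open>Semisimplicity of \<open>R/J\<close> expressed inside \<open>R\<close>: a complement in
  the quotient ring is pulled back along the projection.\<close>

lemma right_ideal_complement:
  assumes K: "submodule K R (regular R)" "J \<subseteq> K"
  obtains K' where "submodule K' R (regular R)" "J \<subseteq> K'" "K \<inter> K' \<subseteq> J"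
    "\<And>r. r \<in> carrier R \<Longrightarrow> \<exists>x\<in>K. \<exists>y\<in>K'. r = x \<oplus> y"
proof -
  interpret J: ideal J R by (rule J_ideal)
  interpret Q: ring "R Quot J" by (rule J.quotient_is_ring)
  have c: "carrier (R Quot J) = (\<lambda>x. J +>\<^bsub>R\<^esub> x) ` carrier R" by (auto simp: FactRing_def A_RCOSETS_def')
  have z: "zero (R Quot J) = J" by (simp add: FactRing_def)
  have add: "add (R Quot J) (J +>\<^bsub>R\<^esub> x) (J +>\<^bsub>R\<^esub> y) = J +>\<^bsub>R\<^esub> (x \<oplus> y)" if "x \<in> carrier R" "y \<in> carrier R" for x y
    using that by (simp add: FactRing_def J.a_rcos_sum)
  have mult: "(J +>\<^bsub>R\<^esub> x) \<otimes>\<^bsub>R Quot J\<^esub> (J +>\<^bsub>R\<^esub> y) = J +>\<^bsub>R\<^esub> (x \<otimes> y)" if "x \<in> carrier R" "y \<in> carrier R" for x y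
    using that by (simp add: FactRing_def J.rcoset_mult_add)
  have selfJ: "J +>\<^bsub>R\<^esub> x = J \<longleftrightarrow> x \<in> J" if "x \<in> carrier R" for x
    using J.a_rcos_const a_coset_join1[OF _ that J.a_subgroup] by blast
  have "semisimple_module (R Quot J) (regular (R Quot J))"
    using semilocal by (simp add: semilocal_def semisimple_artinian_def)
  then obtain N' where N': "submodule N' (R Quot J) (regular (R Quot J))"
    "(\<lambda>x. J +>\<^bsub>R\<^esub> x) ` K \<inter> N' = {J}"
    "(\<lambda>x. J +>\<^bsub>R\<^esub> x) ` K <+>\<^bsub>regular (R Quot J)\<^esub> N' = carrier (R Quot J)"
    using quotient_right_ideal[OF K(1)] unfolding semisimple_module_def by (auto simp: z)
  define K' where "K' = {x \<in> carrier R. J +>\<^bsub>R\<^esub> x \<in> N'}"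
  have K': "submodule K' R (regular R)"
  proof (rule right_idealI)
    show "\<zero> \<in> K'" using Q.right_ideal_zero[OF N'(1)] selfJ[of \<zero>] by (simp add: K'_def z)
    show "x \<oplus> y \<in> K'" if "x \<in> K'" "y \<in> K'" for x y
      using that Q.right_ideal_add[OF N'(1), of "J +>\<^bsub>R\<^esub> x" "J +>\<^bsub>R\<^esub> y"] by (simp add: K'_def add)
    show "x \<otimes> a \<in> K'" if "x \<in> K'" "a \<in> carrier R" for x a
      using that Q.right_ideal_mult[OF N'(1), of "J +>\<^bsub>R\<^esub> x" "J +>\<^bsub>R\<^esub> a"] c by (simp add: K'_def mult)
  qed (auto simp: K'_def)
  show ?thesis
  proof (rule that[OF K'])
    show "J \<subseteq> K'"
    proof
      fix x assume x: "x \<in> J"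
      then have "J +>\<^bsub>R\<^esub> x = J" using selfJ[OF J.a_Hcarr] by blast
      then show "x \<in> K'" using x J.a_Hcarr Q.right_ideal_zero[OF N'(1)] by (simp add: K'_def z)
    qed
    show "K \<inter> K' \<subseteq> J"
    proof
      fix x assume x: "x \<in> K \<inter> K'"
      then have xc: "x \<in> carrier R" by (simp add: K'_def)
      have "J +>\<^bsub>R\<^esub> x \<in> (\<lambda>x. J +>\<^bsub>R\<^esub> x) ` K \<inter> N'" using x by (auto simp: K'_def)
      then show "x \<in> J" using N'(2) selfJ[OF xc] by simp
    qed
    fix r assume r: "r \<in> carrier R"
    then have "J +>\<^bsub>R\<^esub> r \<in> (\<lambda>x. J +>\<^bsub>R\<^esub> x) ` K <+>\<^bsub>regular (R Quot J)\<^esub> N'" using N'(3) c by blast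
    then obtain x b where xb: "x \<in> K" "b \<in> N'" "J +>\<^bsub>R\<^esub> r = (J +>\<^bsub>R\<^esub> x) \<oplus>\<^bsub>R Quot J\<^esub> b"
      by (auto simp: set_add_def')
    then obtain y where y: "y \<in> carrier R" "b = J +>\<^bsub>R\<^esub> y" using c Q.right_ideal_mem[OF N'(1)] by blast
    then have yK: "y \<in> K'" using xb by (simp add: K'_def)
    have xc: "x \<in> carrier R" using xb right_ideal_mem[OF K(1)] by blast
    have "J +>\<^bsub>R\<^esub> r = J +>\<^bsub>R\<^esub> (x \<oplus> y)" using xb y xc by (simp add: add)
    then have "r \<in> J +>\<^bsub>R\<^esub> (x \<oplus> y)" using J.a_rcos_self[OF r] by simp
    then obtain z where z: "z \<in> J" "r = z \<oplus> (x \<oplus> y)" by (auto simp: a_r_coset_def')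
    then have "r = (z \<oplus> x) \<oplus> y" using xc y J.a_Hcarr by (simp add: a_assoc)
    moreover have "z \<oplus> x \<in> K" using z(1) K xb(1) right_ideal_add[OF K(1)] by blast
    ultimately show "\<exists>x\<in>K. \<exists>y\<in>K'. r = x \<oplus> y" using yK by blast
  qed
qed

text \<open>The descending chain condition of \<open>R/J\<close>, for right ideals above
  \<open>J\<close>. An infinite strict chain would become stationary in \<open>R/J\<close>, but
  right ideals containing \<open>J\<close> are recovered from their images.\<close>

lemma right_ideal_minimal:
  assumes ne: "L0 \<in> \<S>" and S: "\<And>L. L \<in> \<S> \<Longrightarrow> submodule L R (regular R) \<and> J \<subseteq> L"
  obtains L where "L \<in> \<S>" "\<And>K. \<lbrakk>K \<in> \<S>; K \<subseteq> L\<rbrakk> \<Longrightarrow> K = L"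
proof (rule ccontr)
  note found = that
  assume neg: "\<not> thesis"
  have *: "\<exists>K. K \<in> \<S> \<and> K \<subset> L" if L: "L \<in> \<S>" for L
  proof (rule ccontr)
    assume "\<not> ?thesis"
    then have "K = L" if "K \<in> \<S>" "K \<subseteq> L" for K using that by blast
    from found[OF L this] show False using neg by blast
  qed
  have "\<exists>f. \<forall>n :: nat. f n \<in> \<S> \<and> f (Suc n) \<subset> f n"
    by (rule dependent_nat_choice) (use ne * in blast)+
  then obtain f :: "nat \<Rightarrow> 'a set" where f: "\<And>n. f n \<in> \<S>" "\<And>n. f (Suc n) \<subset> f n" by blast
  let ?c = "\<lambda>x. J +>\<^bsub>R\<^esub> x"
  have art: "artinian_module (R Quot J) (regular (R Quot J))"
    using semilocal by (simp add: semilocal_def semisimple_artinian_def)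
  have chain: "\<forall>j. submodule (?c ` f j) (R Quot J) (regular (R Quot J)) \<and> ?c ` f (Suc j) \<subseteq> ?c ` f j"
    using f quotient_right_ideal S by blast
  have "\<exists>m. \<forall>j\<ge>m. ?c ` f j = ?c ` f m"
    by (rule art[unfolded artinian_module_def, THEN conjunct2, THEN spec, THEN mp, OF chain])
  then obtain m where "\<forall>j\<ge>m. ?c ` f j = ?c ` f m" ..
  then have e: "?c ` f (Suc m) = ?c ` f m" using le_SucI[OF order_refl] by blast
  have "f m \<subseteq> f (Suc m)"
  proof
    fix x assume x: "x \<in> f m"
    then have "?c x \<in> ?c ` f (Suc m)" using e by blast
    then show "x \<in> f (Suc m)"
      using mem_of_coset_mem[of "f (Suc m)" x] S[OF f(1)] x right_ideal_mem by blast
  qed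
  then show False using f(2)[of m] by blast
qed

text \<open>The coset of \<open>e\<close> generates a right ideal of \<open>R/J\<close> that is zero
  or minimal. In terms of elements: from every multiple outside \<open>J\<close> one returns to
  \<open>e\<close> modulo \<open>J\<close>.\<close>

definition minimal_elt :: "'a \<Rightarrow> bool"
  where "minimal_elt e \<longleftrightarrow> e \<in> carrier R \<and> (\<forall>r\<in>carrier R. e \<otimes> r \<in> J \<or> (\<exists>s\<in>carrier R. e \<ominus> e \<otimes> r \<otimes> s \<in> J))"

text \<open>Every element outside \<open>J\<close> of a right ideal minimal among those strictly
  above \<open>J\<close> will do: if \<open>e \<otimes> r \<notin> J\<close>, then \<open>J\<close>
  and \<open>e \<otimes> r\<close> together generate this ideal again.\<close>

lemma minimal_elt_exists:
  assumes L: "submodule L R (regular R)" "J \<subset> L"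
  obtains e where "e \<in> L" "e \<notin> J" "minimal_elt e"
proof -
  interpret J: ideal J R by (rule J_ideal)
  let ?S = "{K. submodule K R (regular R) \<and> J \<subset> K \<and> K \<subseteq> L}"
  have LS: "L \<in> ?S" using L by simp
  obtain K where K: "K \<in> ?S" "\<And>K'. \<lbrakk>K' \<in> ?S; K' \<subseteq> K\<rbrakk> \<Longrightarrow> K' = K"
    by (rule right_ideal_minimal[OF LS]) auto
  then obtain e where e: "e \<in> K" "e \<notin> J" by blast
  have Ks: "submodule K R (regular R)" using K by simp
  have ec: "e \<in> carrier R" using e right_ideal_mem[OF Ks] by blast
  have "\<exists>s\<in>carrier R. e \<ominus> e \<otimes> r \<otimes> s \<in> J" if r: "r \<in> carrier R" "e \<otimes> r \<notin> J" for r
  proof -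
    let ?P = "(\<lambda>a. e \<otimes> r \<otimes> a) ` carrier R"
    let ?K' = "{x \<oplus> y |x y. x \<in> J \<and> y \<in> ?P}"
    have P: "submodule ?P R (regular R)" using right_ideal_principal ec r by simp
    note up = right_ideal_sum_upper[OF right_ideal_jacobson P]
    have "e \<otimes> r \<otimes> \<one> \<in> ?P" by blast
    then have "e \<otimes> r \<in> ?K'" using up ec r by auto
    then have JK: "J \<subset> ?K'" using up r by blast
    have erK: "e \<otimes> r \<in> K" using right_ideal_mult[OF Ks e(1) r(1)] .
    have KK: "?K' \<subseteq> K"
      using right_ideal_mult[OF Ks erK] right_ideal_add[OF Ks] K(1) by blast
    have "K \<subseteq> L" using K(1) by blast
    then have "?K' \<in> ?S"
      using JK KK right_ideal_sum[OF right_ideal_jacobson P] by (intro CollectI conjI) (assumption | erule (1) order_trans)+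
    then have KK': "?K' = K" using KK by (rule K(2))
    have eK': "e \<in> ?K'" unfolding KK' by (rule e(1))
    have "\<exists>x\<in>J. \<exists>a\<in>carrier R. z = x \<oplus> e \<otimes> r \<otimes> a" if "z \<in> ?K'" for z using that by blast
    from this[OF eK'] have "\<exists>x\<in>J. \<exists>a\<in>carrier R. e = x \<oplus> e \<otimes> r \<otimes> a" .
    then obtain x where x: "x \<in> J" "\<exists>a\<in>carrier R. e = x \<oplus> e \<otimes> r \<otimes> a" by (rule bexE)
    from x(2) obtain a where "a \<in> carrier R" "e = x \<oplus> e \<otimes> r \<otimes> a" by (rule bexE)
    note xa = x(1) this
    have xc: "x \<in> carrier R" and q: "e \<otimes> r \<otimes> a \<in> carrier R" using x(1) J.a_Hcarr ec r(1) xa(2) by auto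
    have "x \<oplus> q \<ominus> q = x" if "q \<in> carrier R" for q using xc that by (simp add: minus_eq a_assoc r_neg)
    from this[OF q] have "e \<ominus> e \<otimes> r \<otimes> a = x" unfolding xa(3)[symmetric] .
    then have "e \<ominus> e \<otimes> r \<otimes> a \<in> J" using x(1) by simp
    then show ?thesis by (rule bexI[OF _ xa(2)])
  qed
  then have "minimal_elt e" unfolding minimal_elt_def using ec by blast
  then show ?thesis using that e K(1) by blast
qed

text \<open>Consider the right ideals \<open>L\<close> above \<open>J\<close> that generate
  \<open>R\<close> together with finitely many minimal elements. A minimal such \<open>L\<close>
  must be \<open>J\<close>: otherwise a minimal element \<open>e\<close> of \<open>L\<close> can be
  split off, and the intersection of \<open>L\<close> with a complement of \<open>J + eR\<close> is
  smaller and has the same property.\<close>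

lemma minimal_elts_generate:
  obtains E where "finite E" "\<And>e. e \<in> E \<Longrightarrow> minimal_elt e"
    "\<And>H. \<lbrakk>submodule H R (regular R); E \<subseteq> H; J \<subseteq> H\<rbrakk> \<Longrightarrow> \<one> \<in> H"
proof -
  interpret J: ideal J R by (rule J_ideal)
  interpret reg: right_module R "regular R" by (rule reg)
  let ?S = "{L. submodule L R (regular R) \<and> J \<subseteq> L \<and> (\<exists>E. finite E \<and> (\<forall>e\<in>E. minimal_elt e) \<and>
     (\<forall>H. submodule H R (regular R) \<and> E \<subseteq> H \<and> L \<subseteq> H \<longrightarrow> \<one> \<in> H))}"
  have "carrier R \<in> ?S" using reg.submodule_carrier J.a_subset by (auto intro!: exI[of _ "{}"])
  then obtain L where L: "L \<in> ?S" "\<And>K. \<lbrakk>K \<in> ?S; K \<subseteq> L\<rbrakk> \<Longrightarrow> K = L"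
    by (rule right_ideal_minimal) auto
  from CollectD[OF L(1)] have "\<exists>E. finite E \<and> (\<forall>e\<in>E. minimal_elt e) \<and>
     (\<forall>H. submodule H R (regular R) \<and> E \<subseteq> H \<and> L \<subseteq> H \<longrightarrow> \<one> \<in> H)" by (elim conjE)
  then obtain E where E0: "finite E \<and> (\<forall>e\<in>E. minimal_elt e) \<and>
     (\<forall>H. submodule H R (regular R) \<and> E \<subseteq> H \<and> L \<subseteq> H \<longrightarrow> \<one> \<in> H)" ..
  then have E: "finite E" "\<forall>e\<in>E. minimal_elt e"
    "\<And>H. \<lbrakk>submodule H R (regular R); E \<subseteq> H; L \<subseteq> H\<rbrakk> \<Longrightarrow> \<one> \<in> H" by blast+
  have Ls: "submodule L R (regular R)" "J \<subseteq> L" using L by auto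
  have "L = J"
  proof (rule ccontr)
    assume "L \<noteq> J"
    then obtain e where e: "e \<in> L" "e \<notin> J" "minimal_elt e" using minimal_elt_exists[OF Ls(1)] Ls(2) by blast
    have ec: "e \<in> carrier R" using e(3) by (simp add: minimal_elt_def)
    let ?P = "(\<lambda>a. e \<otimes> a) ` carrier R"
    let ?K = "{x \<oplus> y |x y. x \<in> J \<and> y \<in> ?P}"
    have P: "submodule ?P R (regular R)" by (rule right_ideal_principal[OF ec])
    have K: "submodule ?K R (regular R)" by (rule right_ideal_sum[OF right_ideal_jacobson P])
    note up = right_ideal_sum_upper[OF right_ideal_jacobson P]
    have "e \<otimes> \<one> \<in> ?P" by blast
    then have eK: "e \<in> ?K" using up ec by auto
    obtain K' where K': "submodule K' R (regular R)" "J \<subseteq> K'" "?K \<inter> K' \<subseteq> J"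
      "\<And>r. r \<in> carrier R \<Longrightarrow> \<exists>x\<in>?K. \<exists>y\<in>K'. r = x \<oplus> y"
      by (rule right_ideal_complement[OF K up(1)]) blast+
    have L': "submodule (L \<inter> K') R (regular R)"
      by (rule right_idealI) (use right_ideal_mem[OF Ls(1)] right_ideal_zero[OF Ls(1)] right_ideal_zero[OF K'(1)]
        right_ideal_add[OF Ls(1)] right_ideal_add[OF K'(1)] right_ideal_mult[OF Ls(1)] right_ideal_mult[OF K'(1)] in auto)
    have "\<one> \<in> H" if H: "submodule H R (regular R)" "insert e E \<subseteq> H" "L \<inter> K' \<subseteq> H" for H
    proof (rule E(3)[OF H(1)])
      show "L \<subseteq> H"
      proof
        fix l assume l: "l \<in> L"
        then have lc: "l \<in> carrier R" by (rule right_ideal_mem[OF Ls(1)])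
        obtain x y where xy: "x \<in> ?K" "y \<in> K'" "l = x \<oplus> y" using K'(4)[OF lc] by blast
        then obtain j a where ja: "j \<in> J" "a \<in> carrier R" "x = j \<oplus> e \<otimes> a" by blast
        have jc: "j \<in> carrier R" and yc: "y \<in> carrier R" using ja(1) J.a_Hcarr xy(2) right_ideal_mem[OF K'(1)] by auto
        have eaL: "e \<otimes> a \<in> L" by (rule right_ideal_mult[OF Ls(1) e(1) ja(2)])
        \<comment> \<open>Moving the multiple of \<open>e\<close> to the other side leaves
          \<open>j \<oplus> y\<close>, which lies both in \<open>L\<close> and in
          \<open>K'\<close>.\<close>
        have l_eq: "l = (j \<oplus> y) \<oplus> e \<otimes> a" using xy(3) ja jc yc ec by (simp add: a_ac)
        have "l \<oplus> \<ominus> (e \<otimes> a) \<in> L" using right_ideal_add[OF Ls(1) l right_ideal_neg[OF Ls(1) eaL]] .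
        then have "j \<oplus> y \<in> L" using l_eq jc yc ec ja(2) by (simp add: a_assoc r_neg)
        moreover have "j \<oplus> y \<in> K'" using right_ideal_add[OF K'(1)] ja(1) K'(2) xy(2) by blast
        ultimately have "j \<oplus> y \<in> H" using H(3) by blast
        moreover have "e \<otimes> a \<in> H" using right_ideal_mult[OF H(1) _ ja(2)] H(2) by blast
        ultimately show "l \<in> H" using l_eq right_ideal_add[OF H(1)] by simp
      qed
    qed (use H in auto)
    then have "L \<inter> K' \<in> ?S"
      using L' Ls(2) K'(2) E(1,2) e(3) by (auto intro!: exI[of _ "insert e E"])
    then have "L \<inter> K' = L" using L(2) by blast
    then show False using e eK K'(3) by blast
  qed
  then show ?thesis using that E by blast
qed

text \<open>Take \<open>N\<close> maximal among the right ideals above \<open>L\<close> that avoid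
  \<open>a\<close>. Semisimplicity turns \<open>N\<close> into a maximal right ideal, and the simple
  module \<open>R/N\<close> provides the vector.\<close>

lemma simple_separates:
  assumes L: "submodule L R (regular R)" "J \<subseteq> L" and a: "a \<in> carrier R" "a \<notin> L"
  obtains j v where "j \<in> {1..k}" "v \<in> carrier (V j)" "\<And>x. x \<in> L \<Longrightarrow> x \<odot>\<^bsub>V j\<^esub> v = \<zero>\<^bsub>V j\<^esub>" "a \<odot>\<^bsub>V j\<^esub> v \<noteq> \<zero>\<^bsub>V j\<^esub>"
proof -
  obtain N where N: "submodule N R (regular R)" "L \<subseteq> N" "a \<notin> N"
    "\<And>K. \<lbrakk>submodule K R (regular R); N \<subseteq> K; N \<noteq> K\<rbrakk> \<Longrightarrow> a \<in> K"
    using right_module.submodule_maximal_avoiding[OF reg L(1) a(2)] by metis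
  have "K = carrier R" if K: "submodule K R (regular R)" "N \<subseteq> K" "K \<noteq> N" for K
  proof -
    have aK: "a \<in> K" using N(4)[OF K(1,2)] K(3) by blast
    have JK: "J \<subseteq> K" using L(2) N(2) K(2) by blast
    obtain K' where K': "submodule K' R (regular R)" "J \<subseteq> K'" "K \<inter> K' \<subseteq> J"
      "\<And>r. r \<in> carrier R \<Longrightarrow> \<exists>x\<in>K. \<exists>y\<in>K'. r = x \<oplus> y"
      by (rule right_ideal_complement[OF K(1) JK]) blast+
    \<comment> \<open>If \<open>a = x \<oplus> y\<close> belonged to this sum, then \<open>y\<close>
      would lie in \<open>K \<inter> K'\<close>, hence in \<open>J\<close> and in \<open>N\<close>,
      and \<open>a\<close> would lie in \<open>N\<close>. So the sum equals \<open>N\<close>, whence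
      \<open>K' \<subseteq> K\<close> and \<open>K\<close> is everything.\<close>
    let ?N' = "{x \<oplus> y |x y. x \<in> N \<and> y \<in> K'}"
    have "a \<notin> ?N'"
    proof
      assume "a \<in> ?N'"
      then obtain x y where xy: "x \<in> N" "y \<in> K'" "a = x \<oplus> y" by blast
      have xc: "x \<in> carrier R" "y \<in> carrier R" using xy right_ideal_mem[OF N(1)] right_ideal_mem[OF K'(1)] by auto
      have "\<ominus> x \<oplus> a \<in> K"
        using right_ideal_add[OF K(1) right_ideal_neg[OF K(1)] aK] xy(1) K(2) by blast
      then have "y \<in> K" using xy(3) xc by (simp add: r_neg1)
      then have "y \<in> N" using xy(2) K'(3) L(2) N(2) by blast
      then show False using N(3) xy right_ideal_add[OF N(1)] by blast
    qed
    then have "?N' = N"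
      using N(4)[OF right_ideal_sum[OF N(1) K'(1)]] right_ideal_sum_upper[OF N(1) K'(1)] by blast
    then have "K' \<subseteq> N" using right_ideal_sum_upper[OF N(1) K'(1)] by blast
    then have "K' \<subseteq> K" using K(2) by blast
    have "r \<in> K" if "r \<in> carrier R" for r
      using K'(4)[OF that] \<open>K' \<subseteq> K\<close> right_ideal_add[OF K(1)] by blast
    then show ?thesis using right_ideal_mem[OF K(1)] by blast
  qed
  moreover have "N \<noteq> carrier R" using N(3) a(1) by blast
  ultimately have "maximal_right_ideal N R" using N(1) unfolding maximal_right_ideal_def by blast
  from maximal_right_ideal_annihilator[OF this] obtain j v where
    "j \<in> {1..k}" "v \<in> carrier (V j)" "\<And>r. r \<in> carrier R \<Longrightarrow> r \<odot>\<^bsub>V j\<^esub> v = \<zero>\<^bsub>V j\<^esub> \<longleftrightarrow> r \<in> N" by blast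
  then show ?thesis using that[of j v] N a right_ideal_mem[OF L(1)] by blast
qed

end

subsection \<open>Decomposition of semisimple modules\<close>

text \<open>Elements with the same image under \<open>u\<close> differ by an element of its kernel,
  which \<open>h\<close> kills.\<close>

lemma hom_factor:
  assumes M: "right_module R M" and W: "right_module R W" and N: "right_module R N"
    and u: "u \<in> rmod_hom R M W" "u ` carrier M = carrier W" and h: "h \<in> rmod_hom R M N"
    and ker: "\<And>x. \<lbrakk>x \<in> carrier M; u x = \<zero>\<^bsub>W\<^esub>\<rbrakk> \<Longrightarrow> h x = \<zero>\<^bsub>N\<^esub>"
  obtains g where "g \<in> rmod_hom R W N" "\<And>x. x \<in> carrier M \<Longrightarrow> g (u x) = h x"
proof -
  interpret u: rmod_morphism R M W u by (rule rmod_morphismI[OF M W u(1)])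
  interpret h: rmod_morphism R M N h by (rule rmod_morphismI[OF M N h])
  let ?s = "inv_into (carrier M) u"
  have s: "?s w \<in> carrier M" "u (?s w) = w" if "w \<in> carrier W" for w
    using that u(2) by (auto simp: inv_into_into f_inv_into_f)
  have eq: "h x = h x'" if "x \<in> carrier M" "x' \<in> carrier M" "u x = u x'" for x x'
  proof -
    have "u x \<ominus>\<^bsub>W\<^esub> u x' = \<zero>\<^bsub>W\<^esub>"
      using u.N.diff_eq_zero_iff[OF u.closed[OF that(1)] u.closed[OF that(2)]] that(3) by simp
    then have "h (x \<ominus>\<^bsub>M\<^esub> x') = \<zero>\<^bsub>N\<^esub>"
      using ker[of "x \<ominus>\<^bsub>M\<^esub> x'"] u.minus[OF that(1,2)] that by simp
    then show ?thesis
      using h.minus[OF that(1,2)] h.N.diff_eq_zero_iff[OF h.closed[OF that(1)] h.closed[OF that(2)]] by simp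
  qed
  have g: "(\<lambda>w. h (?s w)) \<in> rmod_hom R W N"
  proof (rule rmod_homI)
    fix w z assume w: "w \<in> carrier W" and z: "z \<in> carrier W"
    have "h (?s (w \<oplus>\<^bsub>W\<^esub> z)) = h (?s w \<oplus>\<^bsub>M\<^esub> ?s z)"
      by (rule eq) (use w z in \<open>simp_all add: s u.add\<close>)
    then show "h (?s (w \<oplus>\<^bsub>W\<^esub> z)) = h (?s w) \<oplus>\<^bsub>N\<^esub> h (?s z)" using h.add[OF s(1)[OF w] s(1)[OF z]] by simp
  next
    fix a w assume a: "a \<in> carrier R" and w: "w \<in> carrier W"
    have "h (?s (a \<odot>\<^bsub>W\<^esub> w)) = h (a \<odot>\<^bsub>M\<^esub> ?s w)"
      by (rule eq) (use a w in \<open>simp_all add: s u.act u.M.act_closed u.N.act_closed\<close>)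
    then show "h (?s (a \<odot>\<^bsub>W\<^esub> w)) = a \<odot>\<^bsub>N\<^esub> h (?s w)" using h.act[OF a s(1)[OF w]] by simp
  qed (use s(1) in auto)
  have "h (?s (u x)) = h x" if "x \<in> carrier M" for x
    by (rule eq) (use that s in auto)
  then show ?thesis using that g by blast
qed

context semilocal_ring
begin

abbreviation semisimple_sum :: "(nat \<Rightarrow> 't set) \<Rightarrow> ('a, nat \<Rightarrow> 't \<Rightarrow> 'v) module"
  where "semisimple_sum I \<equiv> direct_sum {1..k} (\<lambda>i. copies (I i) (V i))"

lemma copies_V_module: "i \<in> {1..k} \<Longrightarrow> right_module R (copies S (V i))"
  unfolding copies_def by (rule right_module_direct_sum[OF ring_axioms V_module])

lemma semisimple_sum_module: "right_module R (semisimple_sum I)"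
  by (rule right_module_direct_sum[OF ring_axioms copies_V_module])

text \<open>The module version of \<open>minimal_elt\<close>: \<open>x\<close> generates a submodule
  that is zero or simple.\<close>

definition minimal_mod_elt :: "('a, 'b, 'm) module_scheme \<Rightarrow> 'b \<Rightarrow> bool"
  where "minimal_mod_elt M x \<longleftrightarrow> x \<in> carrier M \<and>
    (\<forall>r\<in>carrier R. r \<odot>\<^bsub>M\<^esub> x = \<zero>\<^bsub>M\<^esub> \<or> (\<exists>s\<in>carrier R. s \<odot>\<^bsub>M\<^esub> (r \<odot>\<^bsub>M\<^esub> x) = x))"

text \<open>The cyclic module generated by \<open>x\<close> is simple, so the annihilator of
  \<open>x\<close> is also the annihilator of a vector \<open>v\<close> in some \<open>V j\<close>.
  Sending \<open>v\<close> to \<open>x\<close> defines \<sigma>.\<close>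

lemma minimal_mod_elt_simple:
  assumes M: "right_module R M" and x: "minimal_mod_elt M x" "x \<noteq> \<zero>\<^bsub>M\<^esub>"
  obtains j \<sigma> where "j \<in> {1..k}" "\<sigma> \<in> rmod_hom R (V j) M" "inj_on \<sigma> (carrier (V j))"
    "\<sigma> ` carrier (V j) = (\<lambda>r. r \<odot>\<^bsub>M\<^esub> x) ` carrier R"
proof -
  interpret M: right_module R M by (rule M)
  have xc: "x \<in> carrier M" using x by (simp add: minimal_mod_elt_def)
  let ?C = "(\<lambda>r. r \<odot>\<^bsub>M\<^esub> x) ` carrier R"
  have xC: "x \<in> ?C" using M.act_one[OF xc] by (intro image_eqI[of _ _ \<one>]) auto
  let ?S = "M\<lparr>carrier := ?C\<rparr>"
  have S: "right_module R ?S" by (rule M.right_module_submodule[OF M.submodule_cyclic[OF xc]])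
  interpret S: right_module R ?S by (rule S)
  have simple: "simple_module R ?S" unfolding simple_module_def
  proof (intro conjI allI impI S)
    show "carrier ?S \<noteq> {\<zero>\<^bsub>?S\<^esub>}" using xC x(2) by auto
    fix N assume N: "submodule N R ?S"
    show "N = {\<zero>\<^bsub>?S\<^esub>} \<or> N = carrier ?S"
    proof (cases "N = {\<zero>\<^bsub>?S\<^esub>}")
      case False
      then obtain y where y: "y \<in> N" "y \<noteq> \<zero>\<^bsub>M\<^esub>" using S.submodule_zero[OF N] by auto
      then obtain r where r: "r \<in> carrier R" "y = r \<odot>\<^bsub>M\<^esub> x" using S.submodule_mem[OF N] by auto
      then obtain s where s: "s \<in> carrier R" "s \<odot>\<^bsub>M\<^esub> y = x" using x(1) y(2) unfolding minimal_mod_elt_def by blast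
      have "x \<in> N" using S.submodule_act[OF N s(1) y(1)] s(2) by simp
      then have "?C \<subseteq> N" using S.submodule_act[OF N] by auto
      then show ?thesis using S.submodule_subset[OF N] by auto
    qed simp
  qed
  let ?A = "{r \<in> carrier R. r \<odot>\<^bsub>M\<^esub> x = \<zero>\<^bsub>M\<^esub>}"
  have "maximal_right_ideal ?A R"
    using annihilator_maximal[OF simple, of x] xC x(2) by simp
  from maximal_right_ideal_annihilator[OF this] obtain j v where
    j: "j \<in> {1..k}" and v: "v \<in> carrier (V j)" and ann: "\<And>r. r \<in> carrier R \<Longrightarrow> r \<odot>\<^bsub>V j\<^esub> v = \<zero>\<^bsub>V j\<^esub> \<longleftrightarrow> r \<in> ?A"
    by blast
  interpret Vj: right_module R "V j" by (rule V_module[OF j])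
  have v0: "v \<noteq> \<zero>\<^bsub>V j\<^esub>" using ann[OF one_closed] M.act_one[OF xc] x(2) by auto
  have surj: "(\<lambda>r. r \<odot>\<^bsub>V j\<^esub> v) ` carrier (regular R) = carrier (V j)"
    using simple_module_cyclic[OF V_simple[OF j] v v0] v Vj.act_closed by auto
  obtain \<sigma> where \<sigma>: "\<sigma> \<in> rmod_hom R (V j) M" "\<And>r. r \<in> carrier R \<Longrightarrow> \<sigma> (r \<odot>\<^bsub>V j\<^esub> v) = r \<odot>\<^bsub>M\<^esub> x"
    by (rule hom_factor[OF reg Vj.right_module_axioms M rmod_hom_act_element[OF Vj.right_module_axioms v] surj
          rmod_hom_act_element[OF M xc]]) (use ann in auto)
  have "\<sigma> v = x" using \<sigma>(2)[of \<one>] Vj.act_one[OF v] M.act_one[OF xc] by simp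
  then have "inj_on \<sigma> (carrier (V j))"
    using simple_hom_inj[OF V_simple[OF j] M \<sigma>(1) v] x(2) by simp
  moreover have "\<sigma> ` carrier (V j) = ?C"
    unfolding surj[symmetric] using \<sigma>(2) by (auto simp: image_iff)
  ultimately show ?thesis using that j \<sigma>(1) by blast
qed

text \<open>The module is spanned by a sequence of elements that generate zero or simple submodules.
  As in the construction of a basis, those not in the span of their predecessors are kept, and the
  resulting summands are sorted by type.\<close>

lemma semisimple_decomposition:
  assumes M: "right_module R M" and cg: "countably_gen R M"
    and JM: "\<And>a x. \<lbrakk>a \<in> J; x \<in> carrier M\<rbrakk> \<Longrightarrow> a \<odot>\<^bsub>M\<^esub> x = \<zero>\<^bsub>M\<^esub>"
  shows "\<exists>I :: nat \<Rightarrow> nat set. rmod_iso R M (semisimple_sum I)"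
proof -
  interpret M: right_module R M by (rule M)
  interpret J: ideal J R by (rule J_ideal)
  obtain S where S: "countable S" "generated_by R M S" using cg unfolding countably_gen_def by blast
  obtain E where E: "finite E" "\<And>e. e \<in> E \<Longrightarrow> minimal_elt e"
    "\<And>H. \<lbrakk>submodule H R (regular R); E \<subseteq> H; J \<subseteq> H\<rbrakk> \<Longrightarrow> \<one> \<in> H"
    by (rule minimal_elts_generate) blast
  have Ec: "e \<in> carrier R" if "e \<in> E" for e using E(2)[OF that] by (simp add: minimal_elt_def)
  have Sc: "s \<in> carrier M" if "s \<in> S" for s using S(2) that by (auto simp: generated_by_def)
  \<comment> \<open>Multiples of the generators by the finitely many minimal elements of
    \<open>R\<close>. Zero makes the set nonempty, so that it can be enumerated.\<close>
  define T where "T = insert \<zero>\<^bsub>M\<^esub> ((\<lambda>(e, s). e \<odot>\<^bsub>M\<^esub> s) ` (E \<times> S))"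
  have Tc: "countable T" unfolding T_def using S(1) E(1) by (auto intro: countable_finite)
  have Tmin: "minimal_mod_elt M t" if "t \<in> T" for t
  proof (cases "t = \<zero>\<^bsub>M\<^esub>")
    case True
    then show ?thesis by (simp add: minimal_mod_elt_def)
  next
    case False
    then obtain e s where es: "e \<in> E" "s \<in> S" "t = e \<odot>\<^bsub>M\<^esub> s" using \<open>t \<in> T\<close> by (auto simp: T_def)
    note ec = Ec[OF es(1)] and sc = Sc[OF es(2)]
    have "r \<odot>\<^bsub>M\<^esub> t = \<zero>\<^bsub>M\<^esub> \<or> (\<exists>q\<in>carrier R. q \<odot>\<^bsub>M\<^esub> (r \<odot>\<^bsub>M\<^esub> t) = t)" if r: "r \<in> carrier R" for r
    proof (cases "e \<otimes> r \<in> J")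
      case True
      then have "(e \<otimes> r) \<odot>\<^bsub>M\<^esub> s = \<zero>\<^bsub>M\<^esub>" using JM sc by blast
      then show ?thesis using es(3) ec r sc by (simp add: M.act_mult)
    next
      case False
      then obtain q where q: "q \<in> carrier R" "e \<ominus> e \<otimes> r \<otimes> q \<in> J"
        using E(2)[OF es(1)] r unfolding minimal_elt_def by blast
      have "(e \<ominus> e \<otimes> r \<otimes> q) \<odot>\<^bsub>M\<^esub> s = t \<ominus>\<^bsub>M\<^esub> q \<odot>\<^bsub>M\<^esub> (r \<odot>\<^bsub>M\<^esub> t)"
        using ec r q(1) sc by (simp add: es(3) minus_eq M.M.minus_eq M.act_add_ring M.act_minus_ring M.act_mult M.act_closed)
      then have "t \<ominus>\<^bsub>M\<^esub> q \<odot>\<^bsub>M\<^esub> (r \<odot>\<^bsub>M\<^esub> t) = \<zero>\<^bsub>M\<^esub>" using JM[OF q(2) sc] by simp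
      moreover have "t \<in> carrier M" using es ec sc by (simp add: M.act_closed)
      ultimately have "q \<odot>\<^bsub>M\<^esub> (r \<odot>\<^bsub>M\<^esub> t) = t"
        using M.diff_eq_zero_iff[of t "q \<odot>\<^bsub>M\<^esub> (r \<odot>\<^bsub>M\<^esub> t)"] q(1) r by (simp add: M.act_closed)
      then show ?thesis using q(1) by blast
    qed
    then show ?thesis using es ec sc by (simp add: minimal_mod_elt_def M.act_closed)
  qed
  have Tgen: "x \<in> H" if H: "submodule H R M" "T \<subseteq> H" and x: "x \<in> carrier M" for H x
  proof (rule generated_byD[OF S(2) H(1) _ x])
    show "S \<subseteq> H"
    proof
      fix s assume s: "s \<in> S"
      interpret f: rmod_morphism R "regular R" M "\<lambda>r. r \<odot>\<^bsub>M\<^esub> s"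
        by (rule rmod_morphismI[OF reg M rmod_hom_act_element[OF M Sc[OF s]]])
      \<comment> \<open>The scalars that send \<open>s\<close> into \<open>H\<close> form a right
        ideal containing \<open>E\<close> and \<open>J\<close>, hence containing one.\<close>
      have "submodule {r \<in> carrier R. r \<odot>\<^bsub>M\<^esub> s \<in> H} R (regular R)"
        using f.submodule_vimage[OF H(1)] by simp
      moreover have "E \<subseteq> {r \<in> carrier R. r \<odot>\<^bsub>M\<^esub> s \<in> H}" using Ec H(2) s by (auto simp: T_def)
      moreover have "J \<subseteq> {r \<in> carrier R. r \<odot>\<^bsub>M\<^esub> s \<in> H}"
        using J.a_Hcarr JM[OF _ Sc[OF s]] M.submodule_zero[OF H(1)] by auto
      ultimately have "\<one> \<odot>\<^bsub>M\<^esub> s \<in> H" using E(3) by blast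
      then show "s \<in> H" using M.act_one[OF Sc[OF s]] by simp
    qed
  qed
  define t where "t = from_nat_into T"
  have rt: "range t = T" unfolding t_def by (rule range_from_nat_into) (use Tc in \<open>auto simp: T_def\<close>)
  have tT: "t n \<in> T" for n using rt by blast
  have tc: "t n \<in> carrier M" for n using Tmin[OF tT] by (simp add: minimal_mod_elt_def)
  define H where "H n = carrier M \<inter> \<Inter>{H. submodule H R M \<and> (\<forall>m<n. t m \<in> H)}" for n :: nat
  have Hs: "submodule (H n) R M" for n unfolding H_def by (rule M.submodule_Inter) simp
  have Hle: "H n \<subseteq> K" if "submodule K R M" "\<And>m. m < n \<Longrightarrow> t m \<in> K" for n K using that by (auto simp: H_def)
  have Hmem: "t m \<in> H n" if "m < n" for m n using that tc by (auto simp: H_def)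
  \<comment> \<open>Greedy choice: an index \<open>n\<close> is kept if \<open>t n\<close> is not in
    the span \<open>H n\<close> of its predecessors.\<close>
  define A where "A = {n. t n \<notin> H n}"
  have t0: "t n \<noteq> \<zero>\<^bsub>M\<^esub>" if "n \<in> A" for n using that M.submodule_zero[OF Hs] by (auto simp: A_def)
  have "\<forall>n\<in>A. \<exists>j \<sigma>. j \<in> {1..k} \<and> \<sigma> \<in> rmod_hom R (V j) M \<and> inj_on \<sigma> (carrier (V j)) \<and>
      \<sigma> ` carrier (V j) = (\<lambda>r. r \<odot>\<^bsub>M\<^esub> t n) ` carrier R"
    using minimal_mod_elt_simple[OF M Tmin[OF tT] t0] by metis
  then obtain c \<sigma> where c: "\<And>n. n \<in> A \<Longrightarrow> c n \<in> {1..k}"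
    and \<sigma>: "\<And>n. n \<in> A \<Longrightarrow> \<sigma> n \<in> rmod_hom R (V (c n)) M" "\<And>n. n \<in> A \<Longrightarrow> inj_on (\<sigma> n) (carrier (V (c n)))"
      "\<And>n. n \<in> A \<Longrightarrow> \<sigma> n ` carrier (V (c n)) = (\<lambda>r. r \<odot>\<^bsub>M\<^esub> t n) ` carrier R" by metis
  define D where "D = direct_sum A (\<lambda>n. V (c n))"
  have Vc: "right_module R (V (c n))" if "n \<in> A" for n using V_module c[OF that] by blast
  have D: "right_module R D" unfolding D_def by (rule right_module_direct_sum[OF ring_axioms Vc])
  interpret D: right_module R D by (rule D)
  define f where "f = ds_sum M A \<sigma>"
  have f: "f \<in> rmod_hom R D M" unfolding f_def D_def by (rule rmod_hom_ds_sum[OF ring_axioms Vc M \<sigma>(1)])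
  interpret f: rmod_morphism R D M f by (rule rmod_morphismI[OF D M f])
  have wc: "w n \<in> carrier (V (c n))" if "w \<in> carrier D" "n \<in> A" for w n
    using direct_sum_closed[OF that(1)[unfolded D_def] that(2)] .
  have inj: "inj_on f (carrier D)"
    unfolding f.inj_iff
  proof (intro ballI impI, rule ccontr)
    fix w assume w: "w \<in> carrier D" and fw: "f w = \<zero>\<^bsub>M\<^esub>" and ne: "w \<noteq> \<zero>\<^bsub>D\<^esub>"
    define B where "B = {n \<in> A. w n \<noteq> \<zero>\<^bsub>V (c n)\<^esub>}"
    have Bf: "finite B" unfolding B_def using direct_sum_finite[OF w[unfolded D_def]] .
    have "B \<noteq> {}"
    proof
      assume "B = {}"
      then have "w n = \<zero>\<^bsub>D\<^esub> n" if "n \<in> A" for n using that by (auto simp: B_def D_def)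
      then have "w = \<zero>\<^bsub>D\<^esub>"
        by (intro direct_sum_eqI[of _ A "\<lambda>n. V (c n)"]) (use w D.M.zero_closed in \<open>auto simp: D_def[symmetric]\<close>)
      then show False using ne by blast
    qed
    define n where "n = Max B"
    have n: "n \<in> B" unfolding n_def using Bf \<open>B \<noteq> {}\<close> by simp
    have nA: "n \<in> A" using n by (simp add: B_def)
    have \<sigma>w: "\<sigma> m (w m) \<in> carrier M" if "m \<in> A" for m using rmod_hom_closed[OF \<sigma>(1)[OF that] wc[OF w that]] .
    have \<sigma>0: "\<sigma> m \<zero>\<^bsub>V (c m)\<^esub> = \<zero>\<^bsub>M\<^esub>" if "m \<in> A" for m
      using rmod_morphism.zero[OF rmod_morphismI[OF Vc[OF that] M \<sigma>(1)[OF that]]] .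
    have "f w = finsum M (\<lambda>m. \<sigma> m (w m)) B" unfolding f_def
      by (rule ds_sum_eq[OF M Bf]) (use \<sigma>w \<sigma>0 in \<open>auto simp: B_def\<close>)
    also have "\<dots> = \<sigma> n (w n) \<oplus>\<^bsub>M\<^esub> finsum M (\<lambda>m. \<sigma> m (w m)) (B - {n})"
      using M.M.finsum_insert[of "B - {n}" n "\<lambda>m. \<sigma> m (w m)"] Bf n \<sigma>w by (auto simp: insert_absorb B_def)
    finally have e: "\<sigma> n (w n) \<oplus>\<^bsub>M\<^esub> finsum M (\<lambda>m. \<sigma> m (w m)) (B - {n}) = \<zero>\<^bsub>M\<^esub>" using fw by simp
    have sH: "finsum M (\<lambda>m. \<sigma> m (w m)) (B - {n}) \<in> H n"
    proof (rule M.submodule_finsum[OF Hs])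
      fix m assume m: "m \<in> B - {n}"
      then have mA: "m \<in> A" and "m \<le> n" using Max_ge[OF Bf, of m] by (auto simp: B_def n_def)
      then have mn: "m < n" using m by auto
      have "\<sigma> m (w m) \<in> (\<lambda>r. r \<odot>\<^bsub>M\<^esub> t m) ` carrier R" using \<sigma>(3)[OF mA] wc[OF w mA] by blast
      then show "\<sigma> m (w m) \<in> H n" using M.submodule_act[OF Hs _ Hmem[OF mn]] by auto
    qed
    have "\<sigma> n (w n) = \<ominus>\<^bsub>M\<^esub> finsum M (\<lambda>m. \<sigma> m (w m)) (B - {n})"
      using e M.M.minus_equality[OF e] \<sigma>w[OF nA] M.submodule_mem[OF Hs sH] by simp
    then have inH: "\<sigma> n (w n) \<in> H n" using M.submodule_neg[OF Hs sH] by simp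
    have nz: "\<sigma> n (w n) \<noteq> \<zero>\<^bsub>M\<^esub>"
      using \<sigma>(2)[OF nA] rmod_morphism.inj_iff[OF rmod_morphismI[OF Vc[OF nA] M \<sigma>(1)[OF nA]]] wc[OF w nA] n
      by (auto simp: B_def)
    obtain r where r: "r \<in> carrier R" "\<sigma> n (w n) = r \<odot>\<^bsub>M\<^esub> t n" using \<sigma>(3)[OF nA] wc[OF w nA] by blast
    then obtain s where "s \<in> carrier R" "s \<odot>\<^bsub>M\<^esub> (\<sigma> n (w n)) = t n"
      using Tmin[OF tT[of n]] nz unfolding minimal_mod_elt_def by metis
    then have "t n \<in> H n" using M.submodule_act[OF Hs _ inH] by metis
    then show False using nA by (simp add: A_def)
  qed
  have im: "submodule (f ` carrier D) R M" by (rule f.submodule_image[OF D.submodule_carrier])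
  have "t n \<in> f ` carrier D" for n
  proof (induct n rule: less_induct)
    case (less n)
    show ?case
    proof (cases "n \<in> A")
      case True
      have "t n \<in> (\<lambda>r. r \<odot>\<^bsub>M\<^esub> t n) ` carrier R" using M.act_one[OF tc] by (intro image_eqI[of _ _ \<one>]) auto
      then obtain v where v: "v \<in> carrier (V (c n))" "t n = \<sigma> n v" using \<sigma>(3)[OF True] by blast
      have "f (ds_single A (\<lambda>n. V (c n)) n v) = \<sigma> n v"
        unfolding f_def by (rule ds_sum_single[where M = "\<lambda>n. V (c n)", OF Vc M \<sigma>(1) True v(1)])
      moreover have "ds_single A (\<lambda>n. V (c n)) n v \<in> carrier D"
        unfolding D_def by (rule rmod_hom_closed[OF rmod_hom_ds_single[where M = "\<lambda>n. V (c n)", OF Vc True] v(1)])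
      ultimately show ?thesis using v(2) by (metis image_eqI)
    next
      case False
      then have "t n \<in> H n" by (simp add: A_def)
      then show ?thesis using Hle[OF im less] by blast
    qed
  qed
  then have "T \<subseteq> f ` carrier D" using rt by blast
  then have surj: "f ` carrier D = carrier M" using Tgen[OF im] by auto
  have DM: "rmod_iso R D M" unfolding rmod_iso_def using f inj surj by (auto simp: bij_betw_def)
  \<comment> \<open>The positions of the summands isomorphic to \<open>V i\<close>.\<close>
  define I where "I i = {n \<in> A. c n = i}" for i
  have "rmod_iso R D (semisimple_sum I)"
  proof (rule rmod_isoI[where f = "\<lambda>w. \<lambda>i\<in>{1..k}. \<lambda>n\<in>I i. w n" and g = "\<lambda>w. \<lambda>n\<in>A. w (c n) n"])
    have IA: "n \<in> I i \<longleftrightarrow> n \<in> A \<and> c n = i" for n i by (simp add: I_def)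
    show "(\<lambda>w. \<lambda>i\<in>{1..k}. \<lambda>n\<in>I i. w n) \<in> rmod_hom R D (semisimple_sum I)"
    proof (rule rmod_homI)
      fix w assume w: "w \<in> carrier D"
      have "(\<lambda>n\<in>I i. w n) \<in> carrier (copies (I i) (V i))" for i unfolding copies_def
        by (rule direct_sumI[OF _ _ direct_sum_finite[OF w[unfolded D_def]]]) (use wc[OF w] in \<open>auto simp: IA\<close>)
      then show "(\<lambda>i\<in>{1..k}. \<lambda>n\<in>I i. w n) \<in> carrier (semisimple_sum I)"
        by (intro direct_sumI[where A = "{1..k}"]) auto
    qed (auto simp: D_def copies_def fun_eq_iff restrict_def IA)
    show "(\<lambda>w. \<lambda>n\<in>A. w (c n) n) \<in> rmod_hom R (semisimple_sum I) D"
    proof (rule rmod_homI)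
      fix w assume w: "w \<in> carrier (semisimple_sum I)"
      have wi: "w i \<in> carrier (copies (I i) (V i))" if "i \<in> {1..k}" for i using direct_sum_closed[OF w that] .
      show "(\<lambda>n\<in>A. w (c n) n) \<in> carrier D" unfolding D_def
      proof (rule direct_sumI)
        show "finite (\<Union>i\<in>{1..k}. {n \<in> I i. w i n \<noteq> \<zero>\<^bsub>V i\<^esub>})"
          using direct_sum_finite[OF wi[unfolded copies_def]] by blast
        show "(\<lambda>n\<in>A. w (c n) n) n \<in> carrier (V (c n))" if "n \<in> A" for n
          using direct_sum_closed[OF wi[OF c[OF that], unfolded copies_def], of n] that by (simp add: IA)
        show "(\<lambda>n\<in>A. w (c n) n) n = \<zero>\<^bsub>V (c n)\<^esub>" if "n \<in> A - (\<Union>i\<in>{1..k}. {n \<in> I i. w i n \<noteq> \<zero>\<^bsub>V i\<^esub>})" for n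
          using that c by (auto simp: IA)
      qed simp
    next
      fix w w' show "(\<lambda>n\<in>A. (w \<oplus>\<^bsub>semisimple_sum I\<^esub> w') (c n) n) = (\<lambda>n\<in>A. w (c n) n) \<oplus>\<^bsub>D\<^esub> (\<lambda>n\<in>A. w' (c n) n)"
        using c by (fastforce simp: D_def copies_def fun_eq_iff restrict_def IA)
    next
      fix a w show "(\<lambda>n\<in>A. (a \<odot>\<^bsub>semisimple_sum I\<^esub> w) (c n) n) = a \<odot>\<^bsub>D\<^esub> (\<lambda>n\<in>A. w (c n) n)"
        using c by (fastforce simp: D_def copies_def fun_eq_iff restrict_def IA)
    qed
    show "(\<lambda>n\<in>A. (\<lambda>i\<in>{1..k}. \<lambda>n\<in>I i. w n) (c n) n) = w" if w: "w \<in> carrier D" for w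
    proof (rule extensionalityI[of _ A])
      show "w \<in> extensional A" using w by (simp add: D_def direct_sum_carrier PiE_iff)
      show "(\<lambda>n\<in>A. (\<lambda>i\<in>{1..k}. \<lambda>n\<in>I i. w n) (c n) n) n = w n" if "n \<in> A" for n using c[OF that] that by (simp add: IA)
    qed simp
    show "(\<lambda>i\<in>{1..k}. \<lambda>n\<in>I i. (\<lambda>n\<in>A. w (c n) n) n) = w" if w: "w \<in> carrier (semisimple_sum I)" for w
    proof (rule extensionalityI[of _ "{1..k}"])
      show "w \<in> extensional {1..k}" using w by (simp add: direct_sum_carrier PiE_iff)
      fix i assume i: "i \<in> {1..k}"
      have "w i \<in> extensional (I i)"
        using direct_sum_closed[OF w i] by (simp add: copies_def direct_sum_carrier PiE_iff)
      then have "(\<lambda>n\<in>I i. (\<lambda>n\<in>A. w (c n) n) n) = w i"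
        by (intro extensionalityI[of _ "I i"]) (auto simp: IA)
      then show "(\<lambda>i\<in>{1..k}. \<lambda>n\<in>I i. (\<lambda>n\<in>A. w (c n) n) n) i = w i" using i by simp
    qed simp
  qed
  then show ?thesis using rmod_iso_trans[OF rmod_iso_sym[OF DM D]] by blast
qed

end

subsection \<open>Multiplicities of simple modules\<close>

text \<open>For simple \<open>V\<close> this says that the space of homomorphisms into
  \<open>V\<close> has dimension at least \<open>n\<close> over the division ring of endomorphisms:
  the triangular pattern of values excludes a nontrivial linear relation. No decomposition of
  \<open>M\<close> is involved.\<close>

definition dim_ge :: "('a, 'r) ring_scheme \<Rightarrow> ('a, 'b, 'm) module_scheme \<Rightarrow> ('a, 'c, 'n) module_scheme \<Rightarrow> nat \<Rightarrow> bool"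
  where "dim_ge R M V n \<longleftrightarrow> (\<exists>h x. (\<forall>i<n. h i \<in> rmod_hom R M V \<and> x i \<in> carrier M \<and> h i (x i) \<noteq> \<zero>\<^bsub>V\<^esub>) \<and>
            (\<forall>i<n. \<forall>j<i. h j (x i) = \<zero>\<^bsub>V\<^esub>))"

lemma dim_geI:
  assumes "\<And>i. i < n \<Longrightarrow> h i \<in> rmod_hom R M V" "\<And>i. i < n \<Longrightarrow> x i \<in> carrier M"
    "\<And>i. i < n \<Longrightarrow> h i (x i) \<noteq> \<zero>\<^bsub>V\<^esub>" "\<And>i j. \<lbrakk>i < n; j < i\<rbrakk> \<Longrightarrow> h j (x i) = \<zero>\<^bsub>V\<^esub>"
  shows "dim_ge R M V n"
  unfolding dim_ge_def using assms by blast

lemma dim_geE: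
  assumes "dim_ge R M V n"
  obtains h x where "\<And>i. i < n \<Longrightarrow> h i \<in> rmod_hom R M V" "\<And>i. i < n \<Longrightarrow> x i \<in> carrier M"
    "\<And>i. i < n \<Longrightarrow> h i (x i) \<noteq> \<zero>\<^bsub>V\<^esub>" "\<And>i j. \<lbrakk>i < n; j < i\<rbrakk> \<Longrightarrow> h j (x i) = \<zero>\<^bsub>V\<^esub>"
  using assms unfolding dim_ge_def by blast

text \<open>Gaussian elimination over the division ring of endomorphisms of a simple module.\<close>

lemma triangular_system_card:
  assumes V: "simple_module R V" and "finite S"
    and "\<And>i s. \<lbrakk>i < n; s \<in> S\<rbrakk> \<Longrightarrow> d i s \<in> rmod_hom R V V"
    and "\<And>i s. \<lbrakk>i < n; s \<in> S\<rbrakk> \<Longrightarrow> v i s \<in> carrier V"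
    and "\<And>i. i < n \<Longrightarrow> finsum V (\<lambda>s. d i s (v i s)) S \<noteq> \<zero>\<^bsub>V\<^esub>"
    and "\<And>i j. \<lbrakk>i < n; j < i\<rbrakk> \<Longrightarrow> finsum V (\<lambda>s. d j s (v i s)) S = \<zero>\<^bsub>V\<^esub>"
  shows "n \<le> card S"
  using assms(2-)
proof (induct n arbitrary: S d v)
  case (Suc n)
  note V' = simple_moduleD(1)[OF V]
  interpret V: right_module R V by (rule V')
  note d = Suc.prems(2) and v = Suc.prems(3)
  have dc: "d i s w \<in> carrier V" if "i < Suc n" "s \<in> S" "w \<in> carrier V" for i s w
    using rmod_hom_closed[OF d[OF that(1,2)] that(3)] .
  \<comment> \<open>A pivot exists since the first diagonal value is not zero; it is invertible by
    Schur's lemma.\<close>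
  have "\<exists>t\<in>S. d 0 t (v 0 t) \<noteq> \<zero>\<^bsub>V\<^esub>"
  proof (rule ccontr)
    assume "\<not> ?thesis"
    then have "finsum V (\<lambda>s. d 0 s (v 0 s)) S = finsum V (\<lambda>s. \<zero>\<^bsub>V\<^esub>) S"
      by (intro V.M.finsum_cong') auto
    then show False using Suc.prems(4)[of 0] by simp
  qed
  then obtain t where t: "t \<in> S" "d 0 t (v 0 t) \<noteq> \<zero>\<^bsub>V\<^esub>" by blast
  have bij: "bij_betw (d 0 t) (carrier V) (carrier V)"
    by (rule simple_hom_bij[OF V V d v t(2)]) (use t in auto)
  define \<delta> where "\<delta> = inv_into (carrier V) (d 0 t)"
  have \<delta>: "\<delta> \<in> rmod_hom R V V" unfolding \<delta>_def by (rule rmod_hom_inv[OF d bij V']) (use t in auto)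
  have \<delta>d: "\<delta> (d 0 t w) = w" if "w \<in> carrier V" for w
    unfolding \<delta>_def using bij that by (auto simp: bij_betw_def)
  interpret \<delta>: rmod_morphism R V V \<delta> by (rule rmod_morphismI[OF V' V' \<delta>])
  let ?S = "S - {t}"
  \<comment> \<open>Elimination of the pivot column \<open>t\<close> from the later rows. On a later
    vector the sum belonging to \<open>d 0\<close> is zero, which determines the entry at
    \<open>t\<close> from the other entries; inserting it leaves the later sums unchanged.\<close>
  define d' where "d' i s = (\<lambda>w. d (Suc i) s w \<ominus>\<^bsub>V\<^esub> d (Suc i) t (\<delta> (d 0 s w)))" for i s
  define v' where "v' i = v (Suc i)" for i
  have key: "finsum V (\<lambda>s. d' j s (v' i s)) ?S = finsum V (\<lambda>s. d (Suc j) s (v (Suc i) s)) S"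
    if ij: "j < n" "i < n" for i j
  proof -
    let ?w = "v (Suc i)"
    have w: "?w s \<in> carrier V" if "s \<in> S" for s using v that ij by simp
    interpret dt: rmod_morphism R V V "d (Suc j) t" by (rule rmod_morphismI[OF V' V' d]) (use ij t in auto)
    have Sins: "finsum V g S = g t \<oplus>\<^bsub>V\<^esub> finsum V g ?S" if "g \<in> S \<rightarrow> carrier V" for g
      using V.M.finsum_insert[of ?S t g] that t(1) Suc.prems(1) by (auto simp: insert_absorb Pi_iff)
    define q where "q = finsum V (\<lambda>s. d 0 s (?w s)) ?S"
    have q: "q \<in> carrier V" unfolding q_def by (rule V.M.finsum_closed) (use dc w in auto)
    have "d 0 t (?w t) \<oplus>\<^bsub>V\<^esub> q = \<zero>\<^bsub>V\<^esub>"
      using Sins[of "\<lambda>s. d 0 s (?w s)"] Suc.prems(5)[of "Suc i" 0] ij dc w by (simp add: q_def Pi_iff)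
    then have "d 0 t (?w t) = \<ominus>\<^bsub>V\<^esub> q" using V.M.minus_equality[of "d 0 t (?w t)" q] q dc w t by simp
    then have wt: "?w t = \<ominus>\<^bsub>V\<^esub> \<delta> q" using \<delta>d[OF w[OF t(1)]] \<delta>.neg[OF q] by simp
    have "\<delta> q = finsum V (\<lambda>s. \<delta> (d 0 s (?w s))) ?S"
      unfolding q_def by (rule \<delta>.finsum) (use dc w in auto)
    then have dq: "d (Suc j) t (\<delta> q) = finsum V (\<lambda>s. d (Suc j) t (\<delta> (d 0 s (?w s)))) ?S"
      using dt.finsum[of "\<lambda>s. \<delta> (d 0 s (?w s))" ?S] dc w by (simp add: Pi_iff)
    define a b where "a = finsum V (\<lambda>s. d (Suc j) s (?w s)) ?S" and "b = d (Suc j) t (\<delta> q)"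
    have a: "a \<in> carrier V" unfolding a_def by (rule V.M.finsum_closed) (use dc w ij in auto)
    have b: "b \<in> carrier V" unfolding b_def using q by simp
    have "a = finsum V (\<lambda>s. d' j s (v' i s) \<oplus>\<^bsub>V\<^esub> d (Suc j) t (\<delta> (d 0 s (?w s)))) ?S"
      unfolding a_def
      by (rule V.M.finsum_cong') (use dc w ij in \<open>auto simp: d'_def v'_def V.diff_add_cancel\<close>)
    also have "\<dots> = finsum V (\<lambda>s. d' j s (v' i s)) ?S \<oplus>\<^bsub>V\<^esub> b"
      unfolding b_def dq by (rule V.M.finsum_addf) (use dc w ij in \<open>auto simp: d'_def v'_def\<close>)
    finally have 1: "a = finsum V (\<lambda>s. d' j s (v' i s)) ?S \<oplus>\<^bsub>V\<^esub> b" .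
    have c: "finsum V (\<lambda>s. d' j s (v' i s)) ?S \<in> carrier V"
      by (rule V.M.finsum_closed) (use dc w ij in \<open>auto simp: d'_def v'_def\<close>)
    have "finsum V (\<lambda>s. d (Suc j) s (?w s)) S = \<ominus>\<^bsub>V\<^esub> b \<oplus>\<^bsub>V\<^esub> a"
      using Sins[of "\<lambda>s. d (Suc j) s (?w s)"] dc w ij dt.neg[OF \<delta>.closed[OF q]]
      by (simp add: Pi_iff a_def b_def wt)
    also have "\<dots> = finsum V (\<lambda>s. d' j s (v' i s)) ?S"
      using 1 b c by (simp add: V.M.a_comm[of _ b] V.M.r_neg1)
    finally show ?thesis ..
  qed
  have "n \<le> card ?S"
  proof (rule Suc.hyps[of ?S d' v'])
    show "d' i s \<in> rmod_hom R V V" if "i < n" "s \<in> ?S" for i s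
      unfolding d'_def
      by (rule rmod_hom_minus[OF V' d rmod_hom_comp[OF rmod_hom_comp[OF d \<delta>] d]]) (use that t in auto)
    show "v' i s \<in> carrier V" if "i < n" "s \<in> ?S" for i s using that v by (simp add: v'_def)
    show "finsum V (\<lambda>s. d' i s (v' i s)) ?S \<noteq> \<zero>\<^bsub>V\<^esub>" if "i < n" for i
      unfolding key[OF that that] by (rule Suc.prems(4)) (use that in simp)
    show "finsum V (\<lambda>s. d' j s (v' i s)) ?S = \<zero>\<^bsub>V\<^esub>" if "i < n" "j < i" for i j
    proof -
      have jn: "j < n" using that by simp
      show ?thesis unfolding key[OF jn that(1)] by (rule Suc.prems(5)) (use that in simp_all)
    qed
  qed (use Suc.prems(1) in simp)
  then show ?case using t(1) Suc.prems(1) card_gt_0_iff[of S] by (auto simp: card_Diff_singleton)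
qed simp

lemma rmod_iso_bij: "\<lbrakk>f \<in> rmod_hom R M N; bij_betw f (carrier M) (carrier N)\<rbrakk> \<Longrightarrow> rmod_iso R M N"
  unfolding rmod_iso_def by blast

text \<open>The projections give one direction, and the expansion of an element into its finitely
  many components gives the other.\<close>

lemma mod_ideal_prod_direct_sum:
  assumes I: "ideal I R" and M: "\<And>t. t \<in> T \<Longrightarrow> right_module R (M t)" and f: "f \<in> carrier (direct_sum T M)"
  shows "f \<in> mod_ideal_prod (direct_sum T M) I \<longleftrightarrow> (\<forall>t\<in>T. f t \<in> mod_ideal_prod (M t) I)"
proof -
  interpret I: ideal I R by (rule I)
  let ?D = "direct_sum T M"
  have D: "right_module R ?D" by (rule right_module_direct_sum[OF I.ring_axioms M])
  interpret D: module_ideal R ?D I by (intro module_ideal.intro D I)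
  show ?thesis
  proof (intro iffI ballI)
    fix t assume "f \<in> mod_ideal_prod ?D I" "t \<in> T"
    then show "f t \<in> mod_ideal_prod (M t) I"
      using rmod_hom_mod_ideal_prod[OF D M I rmod_hom_proj[where M = M]] by blast
  next
    assume *: "\<forall>t\<in>T. f t \<in> mod_ideal_prod (M t) I"
    have "finsum ?D (\<lambda>t. ds_single T M t (f t)) {t \<in> T. f t \<noteq> \<zero>\<^bsub>M t\<^esub>} \<in> mod_ideal_prod ?D I"
    proof (rule D.submodule_finsum[OF D.submodule_mod_ideal_prod])
      fix t assume "t \<in> {t \<in> T. f t \<noteq> \<zero>\<^bsub>M t\<^esub>}"
      then have t: "t \<in> T" by simp
      show "ds_single T M t (f t) \<in> mod_ideal_prod ?D I"
        by (rule rmod_hom_mod_ideal_prod[OF M[OF t] D I rmod_hom_ds_single[where M = M, OF M t]])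
          (use * t in auto)
    qed
    then show "f \<in> mod_ideal_prod ?D I"
      using direct_sum_eq_finsum[OF I.ring_axioms M f] by simp
  qed
qed

text \<open>The kernel of \<open>h\<close> is a submodule that contains all products of elements of
  \<open>M\<close> with elements of \<open>I\<close>.\<close>

lemma rmod_hom_kill:
  assumes I: "ideal I R" and M: "right_module R M" and V: "right_module R V" and h: "h \<in> rmod_hom R M V"
    and kill: "\<And>a v. \<lbrakk>a \<in> I; v \<in> carrier V\<rbrakk> \<Longrightarrow> a \<odot>\<^bsub>V\<^esub> v = \<zero>\<^bsub>V\<^esub>" and x: "x \<in> mod_ideal_prod M I"
  shows "h x = \<zero>\<^bsub>V\<^esub>"
proof -
  interpret M: module_ideal R M I by (intro module_ideal.intro M I)
  interpret h: rmod_morphism R M V h by (rule rmod_morphismI[OF M V h])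
  have "mod_ideal_prod M I \<subseteq> {x \<in> carrier M. h x = \<zero>\<^bsub>V\<^esub>}"
    by (rule M.mod_ideal_prod_least[OF h.submodule_kernel])
      (auto simp: h.act M.I.a_Hcarr kill intro: M.act_closed)
  then show ?thesis using x by auto
qed

text \<open>Homomorphisms are composed with \<open>u\<close>, and elements are lifted along
  it.\<close>

lemma dim_ge_surj:
  assumes u: "u \<in> rmod_hom R M W" "u ` carrier M = carrier W" and W: "dim_ge R W V n"
  shows "dim_ge R M V n"
proof -
  obtain h x where h: "\<And>i. i < n \<Longrightarrow> h i \<in> rmod_hom R W V" and x: "\<And>i. i < n \<Longrightarrow> x i \<in> carrier W"
    and hx: "\<And>i. i < n \<Longrightarrow> h i (x i) \<noteq> \<zero>\<^bsub>V\<^esub>" "\<And>i j. \<lbrakk>i < n; j < i\<rbrakk> \<Longrightarrow> h j (x i) = \<zero>\<^bsub>V\<^esub>"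
    by (rule dim_geE[OF W]) blast
  have s: "inv_into (carrier M) u (x i) \<in> carrier M" "u (inv_into (carrier M) u (x i)) = x i" if "i < n" for i
    using x[OF that] u(2) by (auto simp: inv_into_into f_inv_into_f)
  show ?thesis
    by (rule dim_geI[where h = "\<lambda>i y. h i (u y)" and x = "\<lambda>i. inv_into (carrier M) u (x i)"])
      (use s hx rmod_hom_comp[OF u(1) h] in auto)
qed

lemma dim_ge_iso:
  assumes "rmod_iso R M W" "right_module R M"
  shows "dim_ge R M V n \<longleftrightarrow> dim_ge R W V n"
proof -
  have "dim_ge R M V n" if "rmod_iso R M W" "dim_ge R W V n" for M :: "('a, 'x, 'y) module_scheme" and W :: "('a, 'z, 'w) module_scheme"
    using that dim_ge_surj unfolding rmod_iso_def bij_betw_def by blast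
  note * = this
  have "dim_ge R W V n" if "dim_ge R M V n"
  proof -
    obtain g where "g \<in> rmod_hom R W M" "bij_betw g (carrier W) (carrier M)"
      using rmod_iso_sym[OF assms] unfolding rmod_iso_def by blast
    then show ?thesis using dim_ge_surj that by (auto simp: bij_betw_def)
  qed
  then show ?thesis using *[OF assms(1)] by blast
qed

text \<open>All infinite sets of natural numbers are equipotent, so the single value \<infinity>
  loses no information.\<close>

lemma ecard_eq_bij:
  fixes A B :: "nat set"
  assumes "ecard A = ecard B"
  obtains f where "bij_betw f A B"
proof (cases "finite A")
  case True
  then have "finite B" "card A = card B" using assms by (auto simp: ecard_def split: if_splits)
  then show ?thesis using True finite_same_card_bij that by blast
next
  case False
  then have "infinite B" using assms by (auto simp: ecard_def split: if_splits)
  then have "bij_betw (\<lambda>x. from_nat_into B (to_nat_on A x)) A B"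
    using bij_betw_trans[OF to_nat_on_infinite[of A] bij_betw_from_nat_into[of B]] False by (simp add: comp_def)
  then show ?thesis by (rule that)
qed

section \<open>Dimension vectors as counts of homomorphisms\<close>

context semilocal_ring
begin

text \<open>The injection of the copy of \<open>V i\<close> with index \<open>s\<close>.\<close>

definition ss_single :: "(nat \<Rightarrow> 't set) \<Rightarrow> nat \<Rightarrow> 't \<Rightarrow> 'v \<Rightarrow> nat \<Rightarrow> 't \<Rightarrow> 'v"
  where "ss_single I i s v = ds_single {1..k} (\<lambda>i. copies (I i) (V i)) i (ds_single (I i) (\<lambda>_. V i) s v)"

lemma ss_single_apply:
  assumes "j \<in> {1..k}" "s' \<in> I j"
  shows "ss_single I i s v j s' = (if i = j \<and> s = s' then v else \<zero>\<^bsub>V j\<^esub>)"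
  using assms by (auto simp: ss_single_def ds_single_apply copies_def)

lemma ss_single_hom:
  assumes i: "i \<in> {1..k}" and s: "s \<in> I i"
  shows "ss_single I i s \<in> rmod_hom R (V i) (semisimple_sum I)"
proof -
  have 1: "ds_single (I i) (\<lambda>_. V i) s \<in> rmod_hom R (V i) (copies (I i) (V i))"
    unfolding copies_def by (rule rmod_hom_ds_single[where M = "\<lambda>_. V i", OF V_module[OF i] s])
  have 2: "ds_single {1..k} (\<lambda>i. copies (I i) (V i)) i \<in> rmod_hom R (copies (I i) (V i)) (semisimple_sum I)"
    by (rule rmod_hom_ds_single[where M = "\<lambda>i. copies (I i) (V i)", OF copies_V_module i])
  show ?thesis using rmod_hom_comp[OF 1 2] by (simp add: ss_single_def[abs_def])
qed

text \<open>Induction over direct sums applied twice, to the types of simple modules and then to the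
  copies of one type.\<close>

lemma semisimple_sum_submodule:
  assumes H: "submodule H R (semisimple_sum I)"
    and single: "\<And>i s v. \<lbrakk>i \<in> {1..k}; s \<in> I i; v \<in> carrier (V i)\<rbrakk> \<Longrightarrow> ss_single I i s v \<in> H"
    and w: "w \<in> carrier (semisimple_sum I)"
  shows "w \<in> H"
proof (rule direct_sum_submodule_eq[where M = "\<lambda>i. copies (I i) (V i)", OF ring_axioms copies_V_module H _ w])
  fix i c assume i: "i \<in> {1..k}" and c: "c \<in> carrier (copies (I i) (V i))"
  let ?e = "ds_single {1..k} (\<lambda>i. copies (I i) (V i)) i"
  interpret e: rmod_morphism R "copies (I i) (V i)" "semisimple_sum I" ?e
    by (rule rmod_morphismI[OF copies_V_module[OF i] semisimple_sum_module
          rmod_hom_ds_single[where M = "\<lambda>i. copies (I i) (V i)", OF copies_V_module i]])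
  note K = e.submodule_vimage[OF H]
  have "c \<in> {c \<in> carrier (copies (I i) (V i)). ?e c \<in> H}"
  proof (rule direct_sum_submodule_eq[where M = "\<lambda>_. V i" and I = "I i", folded copies_def, OF ring_axioms V_module[OF i] K _ c])
    fix s v assume s: "s \<in> I i" and v: "v \<in> carrier (V i)"
    have "ds_single (I i) (\<lambda>_. V i) s v \<in> carrier (copies (I i) (V i))"
      unfolding copies_def by (rule rmod_hom_closed[OF rmod_hom_ds_single[where M = "\<lambda>_. V i", OF V_module[OF i] s] v])
    then show "ds_single (I i) (\<lambda>_. V i) s v \<in> {c \<in> carrier (copies (I i) (V i)). ?e c \<in> H}"
      using single[OF i s v] by (simp add: ss_single_def)
  qed
  then show "?e c \<in> H" by simp
qed

lemma coord_hom:
  assumes "i \<in> {1..k}" "s \<in> I i"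
  shows "(\<lambda>w. w i s) \<in> rmod_hom R (semisimple_sum I) (V i)"
  using rmod_hom_comp[OF rmod_hom_proj[where M = "\<lambda>i. copies (I i) (V i)", OF assms(1)]
      rmod_hom_proj[where M = "\<lambda>_. V i", OF assms(2), folded copies_def]] .

text \<open>A homomorphism into \<open>V i\<close> vanishes on the copies of other simple modules.
  If \<open>I i\<close> is finite, it is thus a row of endomorphisms of \<open>V i\<close>, and a
  triangular system of such rows has at most \<open>card (I i)\<close> members. Conversely,
  coordinates at distinct positions form a triangular system.\<close>

lemma dim_ge_semisimple_sum:
  assumes i: "i \<in> {1..k}"
  shows "dim_ge R (semisimple_sum I) (V i) n \<longleftrightarrow> enat n \<le> ecard (I i)"
proof
  assume n: "enat n \<le> ecard (I i)"
  obtain v where v: "v \<in> carrier (V i)" "v \<noteq> \<zero>\<^bsub>V i\<^esub>" using simple_moduleD(2)[OF V_simple[OF i]] by blast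
  have "\<exists>s :: nat \<Rightarrow> 'b. inj_on s {..<n} \<and> s ` {..<n} \<subseteq> I i"
  proof -
    obtain C where C: "C \<subseteq> I i" "finite C" "card C = n"
    proof (cases "finite (I i)")
      case True
      then have "n \<le> card (I i)" using n by (simp add: ecard_def)
      then show ?thesis using obtain_subset_with_card_n[of n "I i"] True that finite_subset by metis
    next
      case False
      then show ?thesis using infinite_arbitrarily_large[OF False, of n] that by blast
    qed
    then obtain s where "bij_betw s {0..<n} C" using ex_bij_betw_nat_finite[OF C(2)] by auto
    then show ?thesis using C(1) by (auto simp: bij_betw_def atLeast0LessThan intro!: exI[of _ s])
  qed
  then obtain s :: "nat \<Rightarrow> 'b" where s: "inj_on s {..<n}" "\<And>a. a < n \<Longrightarrow> s a \<in> I i" by blast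
  show "dim_ge R (semisimple_sum I) (V i) n"
  proof (rule dim_geI[where h = "\<lambda>a w. w i (s a)" and x = "\<lambda>a. ss_single I i (s a) v"])
    fix a assume a: "a < n"
    show "(\<lambda>w. w i (s a)) \<in> rmod_hom R (semisimple_sum I) (V i)" by (rule coord_hom[where I = I, OF i s(2)[OF a]])
    show "ss_single I i (s a) v \<in> carrier (semisimple_sum I)"
      by (rule rmod_hom_closed[OF ss_single_hom[where I = I, OF i s(2)[OF a]] v(1)])
    show "ss_single I i (s a) v i (s a) \<noteq> \<zero>\<^bsub>V i\<^esub>" using ss_single_apply[where I = I, OF i s(2)[OF a]] v(2) by simp
    fix b assume b: "b < a"
    then have "s a \<noteq> s b" using inj_onD[OF s(1), of a b] a by auto
    then show "ss_single I i (s a) v i (s b) = \<zero>\<^bsub>V i\<^esub>" using ss_single_apply[where I = I, OF i s(2)[of b], of i "s a" v] a b by simp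
  qed
next
  assume "dim_ge R (semisimple_sum I) (V i) n"
  then obtain h x where h: "\<And>a. a < n \<Longrightarrow> h a \<in> rmod_hom R (semisimple_sum I) (V i)"
    and x: "\<And>a. a < n \<Longrightarrow> x a \<in> carrier (semisimple_sum I)"
    and hx: "\<And>a. a < n \<Longrightarrow> h a (x a) \<noteq> \<zero>\<^bsub>V i\<^esub>" "\<And>a b. \<lbrakk>a < n; b < a\<rbrakk> \<Longrightarrow> h b (x a) = \<zero>\<^bsub>V i\<^esub>"
    by (rule dim_geE) blast
  show "enat n \<le> ecard (I i)"
  proof (cases "finite (I i)")
    case fin: True
    let ?W = "semisimple_sum I"
    note W = semisimple_sum_module[of I] and Vi = V_module[OF i]
    interpret Vi: right_module R "V i" by (rule Vi)
    \<comment> \<open>Both sides are homomorphisms in \<open>w\<close>, so they are compared on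
      single components; for a type other than \<open>i\<close> both are zero.\<close>
    have expand: "g w = finsum (V i) (\<lambda>s. g (ss_single I i s (w i s))) (I i)"
      if g: "g \<in> rmod_hom R ?W (V i)" and w: "w \<in> carrier ?W" for g w
    proof -
      let ?g = "\<lambda>w. finsum (V i) (\<lambda>s. g (ss_single I i s (w i s))) (I i)"
      interpret g: rmod_morphism R ?W "V i" g by (rule rmod_morphismI[OF W Vi g])
      have g': "?g \<in> rmod_hom R ?W (V i)"
        by (rule rmod_hom_finsum[OF Vi W]) (rule rmod_hom_comp[OF rmod_hom_comp[OF coord_hom[where I = I, OF i] ss_single_hom[OF i]] g])
      have gsc: "g (ss_single I i s v) \<in> carrier (V i)" if "s \<in> I i" "v \<in> carrier (V i)" for s v
        using rmod_hom_closed[OF ss_single_hom[where I = I, OF i that(1)] that(2)] by simp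
      have gs0: "g (ss_single I i s \<zero>\<^bsub>V i\<^esub>) = \<zero>\<^bsub>V i\<^esub>" if "s \<in> I i" for s
        using rmod_morphism.zero[OF rmod_morphismI[OF Vi Vi rmod_hom_comp[OF ss_single_hom[where I = I, OF i that] g]]] .
      interpret d: rmod_morphism R ?W "V i" "\<lambda>w. g w \<ominus>\<^bsub>V i\<^esub> ?g w"
        by (rule rmod_morphismI[OF W Vi rmod_hom_minus[OF Vi g g']])
      have "w \<in> {w \<in> carrier ?W. g w \<ominus>\<^bsub>V i\<^esub> ?g w = \<zero>\<^bsub>V i\<^esub>}"
      proof (rule semisimple_sum_submodule[OF d.submodule_kernel _ w])
        fix j s v assume j: "j \<in> {1..k}" and s: "s \<in> I j" and v: "v \<in> carrier (V j)"
        have c: "ss_single I j s v \<in> carrier ?W" by (rule rmod_hom_closed[OF ss_single_hom[where I = I, OF j s] v])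
        have "g (ss_single I j s v) = ?g (ss_single I j s v)"
        proof (cases "j = i")
          case True
          have "?g (ss_single I j s v) = finsum (V i) (\<lambda>s'. g (ss_single I i s' (ss_single I j s v i s'))) {s}"
            by (rule Vi.M.add.finprod_mono_neutral_cong_right[OF fin])
              (use True i s v gs0 gsc in \<open>auto simp: ss_single_apply\<close>)
          then show ?thesis using True s v gsc i by (simp add: ss_single_apply)
        next
          case False
          have "g (ss_single I j s v) = \<zero>\<^bsub>V i\<^esub>"
          proof (rule ccontr)
            assume ne: "g (ss_single I j s v) \<noteq> \<zero>\<^bsub>V i\<^esub>"
            note f = rmod_hom_comp[OF ss_single_hom[where I = I, OF j s] g]
            have "rmod_iso R (V j) (V i)"
              by (rule rmod_iso_bij[OF f simple_hom_bij[OF V_simple[OF j] V_simple[OF i] f v ne]])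
            then show False using V_not_iso[OF j i] False by blast
          qed
          moreover have "?g (ss_single I j s v) = finsum (V i) (\<lambda>s. \<zero>\<^bsub>V i\<^esub>) (I i)"
            by (rule Vi.M.finsum_cong') (use False i gs0 in \<open>auto simp: ss_single_apply\<close>)
          ultimately show ?thesis by simp
        qed
        then show "ss_single I j s v \<in> {w \<in> carrier ?W. g w \<ominus>\<^bsub>V i\<^esub> ?g w = \<zero>\<^bsub>V i\<^esub>}"
          using c Vi.diff_eq_zero_iff g.closed[OF c] by simp
      qed
      then show ?thesis using Vi.diff_eq_zero_iff[OF rmod_hom_closed[OF g w] rmod_hom_closed[OF g' w]] by simp
    qed
    have "n \<le> card (I i)"
    proof (rule triangular_system_card[OF V_simple[OF i] fin, of n "\<lambda>a s v. h a (ss_single I i s v)" "\<lambda>a s. x a i s"])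
      show "(\<lambda>v. h a (ss_single I i s v)) \<in> rmod_hom R (V i) (V i)" if "a < n" "s \<in> I i" for a s
        by (rule rmod_hom_comp[OF ss_single_hom[where I = I, OF i that(2)] h[OF that(1)]])
      show "x a i s \<in> carrier (V i)" if "a < n" "s \<in> I i" for a s
        by (rule rmod_hom_closed[OF coord_hom[where I = I, OF i that(2)] x[OF that(1)]])
      show "finsum (V i) (\<lambda>s. h a (ss_single I i s (x a i s))) (I i) \<noteq> \<zero>\<^bsub>V i\<^esub>" if "a < n" for a
        using hx(1)[OF that] expand[OF h[OF that] x[OF that]] by simp
      show "finsum (V i) (\<lambda>s. h b (ss_single I i s (x a i s))) (I i) = \<zero>\<^bsub>V i\<^esub>" if "a < n" "b < a" for a b
        using hx(2)[OF that] expand[OF h x[OF that(1)], of b] that by simp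
    qed
    then show ?thesis using fin by (simp add: ecard_def)
  qed (simp add: ecard_def)
qed

text \<open>Homomorphisms into a simple module kill \<open>MJ\<close>, because \<open>J\<close>
  annihilates simple modules. Hence they factor through the cover.\<close>

lemma dim_ge_cover:
  assumes M: "right_module R M" and W: "right_module R W" and u: "cover R J M W u" and i: "i \<in> {1..k}"
  shows "dim_ge R M (V i) n \<longleftrightarrow> dim_ge R W (V i) n"
proof
  assume "dim_ge R M (V i) n"
  then obtain h x where h: "\<And>a. a < n \<Longrightarrow> h a \<in> rmod_hom R M (V i)"
    and x: "\<And>a. a < n \<Longrightarrow> x a \<in> carrier M"
    and hx: "\<And>a. a < n \<Longrightarrow> h a (x a) \<noteq> \<zero>\<^bsub>V i\<^esub>" "\<And>a b. \<lbrakk>a < n; b < a\<rbrakk> \<Longrightarrow> h b (x a) = \<zero>\<^bsub>V i\<^esub>"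
    by (rule dim_geE) blast
  have "\<exists>g. g \<in> rmod_hom R W (V i) \<and> (\<forall>y\<in>carrier M. g (u y) = h a y)" if a: "a < n" for a
  proof -
    have "h a y = \<zero>\<^bsub>V i\<^esub>" if y: "y \<in> carrier M" "u y = \<zero>\<^bsub>W\<^esub>" for y
      using rmod_hom_kill[OF J_ideal M V_module[OF i] h[OF a] simple_jacobson_act[OF V_simple[OF i]]]
        coverD(3)[OF u y(1)] y(2) by blast
    from hom_factor[OF M W V_module[OF i] coverD(1,2)[OF u] h[OF a] this]
    obtain g where "g \<in> rmod_hom R W (V i)" "\<And>y. y \<in> carrier M \<Longrightarrow> g (u y) = h a y" by metis
    then show ?thesis by (intro exI[of _ g]) simp
  qed
  then obtain g where g: "\<And>a. a < n \<Longrightarrow> g a \<in> rmod_hom R W (V i)"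
    "\<And>a y. \<lbrakk>a < n; y \<in> carrier M\<rbrakk> \<Longrightarrow> g a (u y) = h a y" by metis
  show "dim_ge R W (V i) n"
    by (rule dim_geI[where h = g and x = "\<lambda>a. u (x a)"])
      (use g hx x rmod_hom_closed[OF coverD(1)[OF u] x] in auto)
qed (rule dim_ge_surj[OF coverD(1,2)[OF u]])

lemma cover_multiplicity:
  assumes "right_module R M" "cover R J M (semisimple_sum I) u" "i \<in> {1..k}"
  shows "dim_ge R M (V i) n \<longleftrightarrow> enat n \<le> ecard (I i)"
  using dim_ge_cover[OF assms(1) semisimple_sum_module assms(2,3)] dim_ge_semisimple_sum[OF assms(3)] by blast

lemma enat_eqI:
  assumes "\<And>n. enat n \<le> a \<longleftrightarrow> enat n \<le> b" shows "a = b"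
proof (cases a; cases b)
  fix m n assume "a = enat m" "b = enat n"
  then show ?thesis using assms[of m] assms[of n] by simp
next
  fix m assume "a = enat m" "b = \<infinity>"
  then show ?thesis using assms[of "Suc m"] by simp
next
  fix n assume "a = \<infinity>" "b = enat n"
  then show ?thesis using assms[of "Suc n"] by simp
qed simp

text \<open>Justifies the definite description in \<open>dim_vec\<close>: \<open>M/MJ\<close>
  decomposes because it is countably generated and killed by \<open>J\<close>, and the cardinalities
  do not depend on the decomposition by \<open>cover_multiplicity\<close>.\<close>

lemma dim_vec_cover:
  assumes M: "right_module R M" and cg: "countably_gen R M"
  obtains I :: "nat \<Rightarrow> nat set" and u where "cover R J M (semisimple_sum I) u"
    "dim_vec R k V M = (\<lambda>i. if i \<in> {1..k} then ecard (I i) else 0)"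
proof -
  let ?Q = "mod_jacobson R M"
  note Q = right_module_reduce[OF M J_ideal] and c = cover_quot_module[OF M J_ideal]
  interpret M: module_ideal R M J by (intro module_ideal.intro M J_ideal)
  interpret Q: right_module R ?Q by (rule Q)
  have cgQ: "countably_gen R ?Q" by (rule countably_gen_image[OF M Q coverD(1,2)[OF c] cg])
  have "a \<odot>\<^bsub>?Q\<^esub> x = \<zero>\<^bsub>?Q\<^esub>" if a: "a \<in> J" and x: "x \<in> carrier ?Q" for a x
  proof -
    obtain y where y: "y \<in> carrier M" "x = mod_ideal_prod M J +>\<^bsub>M\<^esub> y" using x by (auto simp: M.quot_module_carrier)
    have ac: "a \<in> carrier R" using M.I.a_Hcarr a .
    have "a \<odot>\<^bsub>?Q\<^esub> x = mod_ideal_prod M J +>\<^bsub>M\<^esub> (a \<odot>\<^bsub>M\<^esub> y)"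
      using M.quot_module_act[OF M.submodule_mod_ideal_prod ac y(1)] y(2) by simp
    also have "\<dots> = \<zero>\<^bsub>?Q\<^esub>"
      using coverD(3)[OF c, of "a \<odot>\<^bsub>M\<^esub> y"] M.act_mem_mod_ideal_prod[OF a y(1)] M.act_closed[OF ac y(1)] by simp
    finally show ?thesis .
  qed
  from semisimple_decomposition[OF Q cgQ this] obtain I :: "nat \<Rightarrow> nat set" where
    I: "rmod_iso R ?Q (semisimple_sum I)" by blast
  obtain u where u: "cover R J M (semisimple_sum I) u"
    using cover_iso[OF c Q M I semisimple_sum_module] by blast
  have "dim_vec R k V M = (\<lambda>i. if i \<in> {1..k} then ecard (I i) else 0)"
    unfolding dim_vec_def
  proof (rule the_equality)
    show "(\<forall>i. i \<notin> {1..k} \<longrightarrow> (if i \<in> {1..k} then ecard (I i) else 0) = 0) \<and>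
      (\<exists>I' :: nat \<Rightarrow> nat set. rmod_iso R ?Q (semisimple_sum I') \<and>
        (\<forall>i\<in>{1..k}. (if i \<in> {1..k} then ecard (I i) else 0) = ecard (I' i)))"
      using I by (intro conjI exI[of _ I]) auto
    fix m assume m: "(\<forall>i. i \<notin> {1..k} \<longrightarrow> m i = 0) \<and>
      (\<exists>I' :: nat \<Rightarrow> nat set. rmod_iso R ?Q (semisimple_sum I') \<and> (\<forall>i\<in>{1..k}. m i = ecard (I' i)))"
    then obtain I' :: "nat \<Rightarrow> nat set" where I': "rmod_iso R ?Q (semisimple_sum I')" "\<And>i. i \<in> {1..k} \<Longrightarrow> m i = ecard (I' i)"
      by blast
    obtain u' where u': "cover R J M (semisimple_sum I') u'"
      using cover_iso[OF c Q M I'(1) semisimple_sum_module] by blast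
    have "ecard (I' i) = ecard (I i)" if "i \<in> {1..k}" for i
      by (rule enat_eqI) (use cover_multiplicity[OF M u that] cover_multiplicity[OF M u' that] in blast)
    then show "m = (\<lambda>i. if i \<in> {1..k} then ecard (I i) else 0)" using m I'(2) by auto
  qed
  then show ?thesis using u that by blast
qed

text \<open>Reduces comparisons of dimension vectors to \<open>dim_ge\<close>, which behaves well
  under surjections.\<close>

lemma dim_vec_ge:
  assumes M: "right_module R M" and cg: "countably_gen R M" and i: "i \<in> {1..k}"
  shows "enat n \<le> dim_vec R k V M i \<longleftrightarrow> dim_ge R M (V i) n"
proof -
  obtain I :: "nat \<Rightarrow> nat set" and u where C: "cover R J M (semisimple_sum I) u"
    and D: "dim_vec R k V M = (\<lambda>i. if i \<in> {1..k} then ecard (I i) else 0)"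
    by (rule dim_vec_cover[OF M cg])
  show ?thesis unfolding D if_P[OF i] using cover_multiplicity[OF M C i] by blast
qed

lemma dim_vec_outside:
  assumes M: "right_module R M" and cg: "countably_gen R M" and i: "i \<notin> {1..k}"
  shows "dim_vec R k V M i = 0"
proof -
  obtain I :: "nat \<Rightarrow> nat set" and u where "cover R J M (semisimple_sum I) u"
    and D: "dim_vec R k V M = (\<lambda>i. if i \<in> {1..k} then ecard (I i) else 0)"
    by (rule dim_vec_cover[OF M cg])
  show ?thesis unfolding D by (rule if_not_P[OF i])
qed

lemma dim_vec_eqI:
  assumes M: "right_module R M" and cg: "countably_gen R M" and i: "i \<in> {1..k}"
    and u: "cover R J M (semisimple_sum I) u"
  shows "dim_vec R k V M i = ecard (I i)"
  by (rule enat_eqI) (use dim_vec_ge[OF M cg i] cover_multiplicity[OF M u i] in blast)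

lemma semisimple_sum_iso:
  fixes I I' :: "nat \<Rightarrow> nat set"
  assumes "\<And>i. i \<in> {1..k} \<Longrightarrow> ecard (I i) = ecard (I' i)"
  shows "rmod_iso R (semisimple_sum I) (semisimple_sum I')"
proof -
  have "\<exists>f. bij_betw f (I' i) (I i)" if "i \<in> {1..k}" for i
    using ecard_eq_bij[of "I' i" "I i"] assms[OF that] by metis
  then obtain f where f: "\<And>i. i \<in> {1..k} \<Longrightarrow> bij_betw (f i) (I' i) (I i)" by metis
  have reindex: "(\<lambda>w. \<lambda>i\<in>{1..k}. \<lambda>s\<in>I' i. w i (f i s)) \<in> rmod_hom R (semisimple_sum I) (semisimple_sum I')"
    if f: "\<And>i. i \<in> {1..k} \<Longrightarrow> bij_betw (f i) (I' i) (I i)" for f and I I' :: "nat \<Rightarrow> nat set"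
  proof (rule rmod_homI)
    have fI: "f i s \<in> I i" if "i \<in> {1..k}" "s \<in> I' i" for i s using f[OF that(1)] that(2) by (auto simp: bij_betw_def)
    {
      fix w assume w: "w \<in> carrier (semisimple_sum I)"
      have "(\<lambda>s\<in>I' i. w i (f i s)) \<in> carrier (copies (I' i) (V i))" if i: "i \<in> {1..k}" for i unfolding copies_def
      proof (rule direct_sumI)
        have wi: "w i \<in> carrier (direct_sum (I i) (\<lambda>_. V i))" using direct_sum_closed[OF w i] by (simp add: copies_def)
        show "finite (f i -` {s \<in> I i. w i s \<noteq> \<zero>\<^bsub>V i\<^esub>} \<inter> I' i)"
          by (rule finite_vimage_IntI[OF direct_sum_finite[OF wi]]) (use f[OF i] in \<open>simp add: bij_betw_def\<close>)
        show "(\<lambda>s\<in>I' i. w i (f i s)) s \<in> carrier (V i)" if "s \<in> I' i" for s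
          using direct_sum_closed[OF wi fI[OF i that]] that by simp
      qed (use fI[OF i] in auto)
      then show "(\<lambda>i\<in>{1..k}. \<lambda>s\<in>I' i. w i (f i s)) \<in> carrier (semisimple_sum I')"
        by (intro direct_sumI[where A = "{1..k}"]) auto
    }
  qed (use f in \<open>auto simp: copies_def fun_eq_iff restrict_def bij_betw_def\<close>)
  let ?g = "\<lambda>i. inv_into (I' i) (f i)"
  show ?thesis
  proof (rule rmod_isoI[OF reindex[OF f] reindex[of ?g]])
    show "bij_betw (?g i) (I i) (I' i)" if "i \<in> {1..k}" for i using bij_betw_inv_into[OF f[OF that]] .
    have fg: "f i (?g i s) = s" "?g i s \<in> I' i" if "i \<in> {1..k}" "s \<in> I i" for i s
      using f[OF that(1)] that(2) by (auto simp: bij_betw_def f_inv_into_f inv_into_into)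
    have gf: "?g i (f i s) = s" "f i s \<in> I i" if "i \<in> {1..k}" "s \<in> I' i" for i s
      using f[OF that(1)] that(2) by (auto simp: bij_betw_def)
    have ext: "(\<lambda>i\<in>{1..k}. \<lambda>s\<in>I i. w i s) = w" if w: "w \<in> carrier (semisimple_sum I)" for w and I :: "nat \<Rightarrow> nat set"
    proof (rule extensionalityI[of _ "{1..k}"])
      show "w \<in> extensional {1..k}" using w by (simp add: direct_sum_carrier PiE_iff)
      fix i assume i: "i \<in> {1..k}"
      have "w i \<in> extensional (I i)"
        using direct_sum_closed[OF w i] by (simp add: copies_def direct_sum_carrier PiE_iff)
      then show "(\<lambda>i\<in>{1..k}. \<lambda>s\<in>I i. w i s) i = w i" using i by (simp add: extensional_restrict)
    qed simp
    {
      fix w assume w: "w \<in> carrier (semisimple_sum I)"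
      have "(\<lambda>i\<in>{1..k}. \<lambda>s\<in>I i. (\<lambda>i\<in>{1..k}. \<lambda>s\<in>I' i. w i (f i s)) i (?g i s)) = (\<lambda>i\<in>{1..k}. \<lambda>s\<in>I i. w i s)"
        using fg by (auto simp: fun_eq_iff restrict_def)
      then show "(\<lambda>i\<in>{1..k}. \<lambda>s\<in>I i. (\<lambda>i\<in>{1..k}. \<lambda>s\<in>I' i. w i (f i s)) i (?g i s)) = w" using ext[OF w] by simp
    next
      fix w assume w: "w \<in> carrier (semisimple_sum I')"
      have "(\<lambda>i\<in>{1..k}. \<lambda>s\<in>I' i. (\<lambda>i\<in>{1..k}. \<lambda>s\<in>I i. w i (?g i s)) i (f i s)) = (\<lambda>i\<in>{1..k}. \<lambda>s\<in>I' i. w i s)"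
        using gf by (auto simp: fun_eq_iff restrict_def)
      then show "(\<lambda>i\<in>{1..k}. \<lambda>s\<in>I' i. (\<lambda>i\<in>{1..k}. \<lambda>s\<in>I i. w i (?g i s)) i (f i s)) = w" using ext[OF w] by simp
    }
  qed
qed

theorem projective_iso_of_dim_vec:
  assumes P: "projective R P" "countably_gen R P" and Q: "projective R Q" "countably_gen R Q"
    and dim: "\<And>i. i \<in> {1..k} \<Longrightarrow> dim_vec R k V P i = dim_vec R k V Q i"
  shows "rmod_iso R P Q"
proof -
  note P' = projective_right_module[OF P(1)] and Q' = projective_right_module[OF Q(1)]
  obtain I :: "nat \<Rightarrow> nat set" and u where u: "cover R J P (semisimple_sum I) u"
    "dim_vec R k V P = (\<lambda>i. if i \<in> {1..k} then ecard (I i) else 0)" by (rule dim_vec_cover[OF P' P(2)])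
  obtain I' :: "nat \<Rightarrow> nat set" and u' where u': "cover R J Q (semisimple_sum I') u'"
    "dim_vec R k V Q = (\<lambda>i. if i \<in> {1..k} then ecard (I' i) else 0)" by (rule dim_vec_cover[OF Q' Q(2)])
  have "ecard (I i) = ecard (I' i)" if "i \<in> {1..k}" for i
    using dim[OF that] unfolding u(2) u'(2) if_P[OF that] .
  then have "rmod_iso R (semisimple_sum I) (semisimple_sum I')" by (rule semisimple_sum_iso)
  then obtain v where "cover R J P (semisimple_sum I') v"
    using cover_iso[OF u(1) semisimple_sum_module P' _ semisimple_sum_module] by blast
  from projective_iso_of_radical_factor[OF P Q semisimple_sum_module this u'(1)] show ?thesis .
qed

text \<open>Each summand is covered separately, and the index sets are combined as disjoint unions:
  position \<open>(t, s)\<close> is position \<open>s\<close> of summand \<open>t\<close>.\<close>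

lemma cover_direct_sum:
  fixes I :: "'t \<Rightarrow> nat \<Rightarrow> 's set"
  assumes M: "\<And>t. t \<in> T \<Longrightarrow> right_module R (M t)"
    and u: "\<And>t. t \<in> T \<Longrightarrow> cover R J (M t) (semisimple_sum (I t)) (u t)"
  shows "cover R J (direct_sum T M) (semisimple_sum (\<lambda>i. SIGMA t:T. I t i))
     (\<lambda>f. \<lambda>i\<in>{1..k}. \<lambda>(t, s)\<in>(SIGMA t:T. I t i). u t (f t) i s)"
    (is "cover R J ?D ?W ?u")
proof -
  note uh = coverD(1)[OF u]
  have D: "right_module R ?D" by (rule right_module_direct_sum[OF ring_axioms M])
  have u_mor: "rmod_morphism R (M t) (semisimple_sum (I t)) (u t)" if "t \<in> T" for t
    by (rule rmod_morphismI[OF M[OF that] semisimple_sum_module uh[OF that]])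
  have uc: "u t (f t) \<in> carrier (semisimple_sum (I t))" if "f \<in> carrier ?D" "t \<in> T" for f t
    by (rule rmod_hom_closed[OF uh[OF that(2)] direct_sum_closed[OF that]])
  have uci: "u t (f t) i \<in> carrier (direct_sum (I t i) (\<lambda>_. V i))" if "f \<in> carrier ?D" "t \<in> T" "i \<in> {1..k}" for f t i
    using direct_sum_closed[OF uc[OF that(1,2)] that(3)] by (simp add: copies_def)
  have hom: "?u \<in> rmod_hom R ?D ?W"
  proof (rule rmod_homI)
    fix f assume f: "f \<in> carrier ?D"
    have "(\<lambda>(t, s)\<in>(SIGMA t:T. I t i). u t (f t) i s) \<in> carrier (copies (SIGMA t:T. I t i) (V i))" if i: "i \<in> {1..k}" for i
      unfolding copies_def
    proof (rule direct_sumI)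
      show "finite (SIGMA t:{t \<in> T. f t \<noteq> \<zero>\<^bsub>M t\<^esub>}. {s \<in> I t i. u t (f t) i s \<noteq> \<zero>\<^bsub>V i\<^esub>})"
        by (rule finite_SigmaI[OF direct_sum_finite[OF f]]) (use direct_sum_finite[OF uci[OF f _ i]] in simp)
      fix p assume p: "p \<in> (SIGMA t:T. I t i)"
      show "(\<lambda>(t, s)\<in>(SIGMA t:T. I t i). u t (f t) i s) p \<in> carrier (V i)"
        using p direct_sum_closed[OF uci[OF f _ i]] by auto
    next
      fix p assume p: "p \<in> (SIGMA t:T. I t i) - (SIGMA t:{t \<in> T. f t \<noteq> \<zero>\<^bsub>M t\<^esub>}. {s \<in> I t i. u t (f t) i s \<noteq> \<zero>\<^bsub>V i\<^esub>})"
      then obtain t s where ts: "p = (t, s)" "t \<in> T" "s \<in> I t i" by auto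
      have "u t (f t) i s = \<zero>\<^bsub>V i\<^esub>"
      proof (cases "f t = \<zero>\<^bsub>M t\<^esub>")
        case True
        then have "u t (f t) = \<zero>\<^bsub>semisimple_sum (I t)\<^esub>" using rmod_morphism.zero[OF u_mor[OF ts(2)]] by simp
        then show ?thesis using i ts(3) by (simp add: copies_def)
      qed (use p ts in auto)
      then show "(\<lambda>(t, s)\<in>(SIGMA t:T. I t i). u t (f t) i s) p = \<zero>\<^bsub>V i\<^esub>" using ts by simp
    qed simp
    then show "?u f \<in> carrier ?W" by (intro direct_sumI[where A = "{1..k}"]) auto
  next
    fix f g assume f: "f \<in> carrier ?D" and g: "g \<in> carrier ?D"
    have "u t (f t \<oplus>\<^bsub>M t\<^esub> g t) i s = u t (f t) i s \<oplus>\<^bsub>V i\<^esub> u t (g t) i s" if "t \<in> T" "i \<in> {1..k}" "s \<in> I t i" for t i s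
      using rmod_hom_add[OF uh[OF that(1)] direct_sum_closed[OF f that(1)] direct_sum_closed[OF g that(1)]] that
      by (simp add: copies_def)
    then show "?u (f \<oplus>\<^bsub>?D\<^esub> g) = ?u f \<oplus>\<^bsub>?W\<^esub> ?u g"
      by (auto simp: copies_def fun_eq_iff restrict_def)
  next
    fix a f assume a: "a \<in> carrier R" and f: "f \<in> carrier ?D"
    have "u t (a \<odot>\<^bsub>M t\<^esub> f t) i s = a \<odot>\<^bsub>V i\<^esub> u t (f t) i s" if "t \<in> T" "i \<in> {1..k}" "s \<in> I t i" for t i s
      using rmod_hom_act[OF uh[OF that(1)] a direct_sum_closed[OF f that(1)]] that
      by (simp add: copies_def)
    then show "?u (a \<odot>\<^bsub>?D\<^esub> f) = a \<odot>\<^bsub>?W\<^esub> ?u f"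
      by (auto simp: copies_def fun_eq_iff restrict_def)
  qed
  interpret U: rmod_morphism R ?D ?W ?u by (rule rmod_morphismI[OF D semisimple_sum_module hom])
  have "w \<in> ?u ` carrier ?D" if w: "w \<in> carrier ?W" for w
  proof (rule semisimple_sum_submodule[OF U.submodule_image[OF U.M.submodule_carrier] _ w])
    fix i p v assume i: "i \<in> {1..k}" and p: "p \<in> (SIGMA t:T. I t i)" and v: "v \<in> carrier (V i)"
    then obtain t s where ts: "p = (t, s)" "t \<in> T" "s \<in> I t i" by auto
    have "ss_single (I t) i s v \<in> carrier (semisimple_sum (I t))"
      by (rule rmod_hom_closed[OF ss_single_hom[where I = "I t", OF i ts(3)] v])
    then obtain x where x: "x \<in> carrier (M t)" "u t x = ss_single (I t) i s v" using coverD(2)[OF u[OF ts(2)]] by (metis imageE)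
    have xs: "ds_single T M t x \<in> carrier ?D"
      by (rule rmod_hom_closed[OF rmod_hom_ds_single[where M = M, OF M ts(2)] x(1)])
    have "ss_single (\<lambda>i. SIGMA t:T. I t i) i p v = ?u (ds_single T M t x)"
    proof (rule direct_sum_eqI[of _ "{1..k}"])
      show "ss_single (\<lambda>i. SIGMA t:T. I t i) i p v \<in> carrier ?W"
        by (rule rmod_hom_closed[OF ss_single_hom[where I = "\<lambda>i. SIGMA t:T. I t i", OF i p] v])
      then have c1: "ss_single (\<lambda>i. SIGMA t:T. I t i) i p v j \<in> carrier (copies (SIGMA t:T. I t j) (V j))" if "j \<in> {1..k}" for j
        using direct_sum_closed that by fastforce
      show c2: "?u (ds_single T M t x) \<in> carrier ?W" by (rule U.closed[OF xs])
      fix j assume j: "j \<in> {1..k}"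
      show "ss_single (\<lambda>i. SIGMA t:T. I t i) i p v j = ?u (ds_single T M t x) j"
      proof (rule direct_sum_eqI[of _ "SIGMA t:T. I t j" "\<lambda>_. V j"])
        show "ss_single (\<lambda>i. SIGMA t:T. I t i) i p v j \<in> carrier (direct_sum (SIGMA t:T. I t j) (\<lambda>_. V j))"
          using c1[OF j] by (simp add: copies_def)
        show "?u (ds_single T M t x) j \<in> carrier (direct_sum (SIGMA t:T. I t j) (\<lambda>_. V j))"
          using direct_sum_closed[OF c2 j] by (simp add: copies_def)
        fix q assume q: "q \<in> (SIGMA t:T. I t j)"
        then obtain t' s' where q': "q = (t', s')" "t' \<in> T" "s' \<in> I t' j" by auto
        have "u t' (ds_single T M t x t') j s' = (if t' = t \<and> i = j \<and> s = s' then v else \<zero>\<^bsub>V j\<^esub>)"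
        proof (cases "t' = t")
          case True
          then show ?thesis using x(2) q' j ss_single_apply[where I = "I t", OF j] by (simp add: ds_single_apply)
        next
          case False
          then show ?thesis
            using rmod_morphism.zero[OF u_mor[OF q'(2)]] q' j by (simp add: ds_single_apply copies_def)
        qed
        then show "ss_single (\<lambda>i. SIGMA t:T. I t i) i p v j q = ?u (ds_single T M t x) j q"
          using ss_single_apply[where I = "\<lambda>i. SIGMA t:T. I t i", OF j q] q q' j ts by auto
      qed
    qed
    then show "ss_single (\<lambda>i. SIGMA t:T. I t i) i p v \<in> ?u ` carrier ?D" using xs by blast
  qed
  then have surj: "?u ` carrier ?D = carrier ?W" using U.closed by blast
  have ker: "?u f = \<zero>\<^bsub>?W\<^esub> \<longleftrightarrow> f \<in> mod_ideal_prod ?D J" if f: "f \<in> carrier ?D" for f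
  proof -
    \<comment> \<open>The kernel is computed coordinate by coordinate and reassembled by
      \<open>mod_ideal_prod_direct_sum\<close>.\<close>
    have "?u f = \<zero>\<^bsub>?W\<^esub> \<longleftrightarrow> (\<forall>t\<in>T. \<forall>i\<in>{1..k}. \<forall>s\<in>I t i. u t (f t) i s = \<zero>\<^bsub>V i\<^esub>)"
    proof
      assume *: "?u f = \<zero>\<^bsub>?W\<^esub>"
      show "\<forall>t\<in>T. \<forall>i\<in>{1..k}. \<forall>s\<in>I t i. u t (f t) i s = \<zero>\<^bsub>V i\<^esub>"
      proof (intro ballI)
        fix t i s assume "t \<in> T" "i \<in> {1..k}" "s \<in> I t i"
        moreover have "?u f i (t, s) = \<zero>\<^bsub>?W\<^esub> i (t, s)" unfolding * ..
        ultimately show "u t (f t) i s = \<zero>\<^bsub>V i\<^esub>" by (simp add: copies_def)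
      qed
    qed (auto simp: copies_def fun_eq_iff restrict_def)
    also have "\<dots> \<longleftrightarrow> (\<forall>t\<in>T. u t (f t) = \<zero>\<^bsub>semisimple_sum (I t)\<^esub>)"
    proof -
      have "u t (f t) = \<zero>\<^bsub>semisimple_sum (I t)\<^esub> \<longleftrightarrow> (\<forall>i\<in>{1..k}. \<forall>s\<in>I t i. u t (f t) i s = \<zero>\<^bsub>V i\<^esub>)" if t: "t \<in> T" for t
      proof
        assume *: "\<forall>i\<in>{1..k}. \<forall>s\<in>I t i. u t (f t) i s = \<zero>\<^bsub>V i\<^esub>"
        interpret W: right_module R "semisimple_sum (I t)" by (rule semisimple_sum_module)
        show "u t (f t) = \<zero>\<^bsub>semisimple_sum (I t)\<^esub>"
        proof (rule direct_sum_eqI[OF uc[OF f t] W.M.zero_closed])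
          fix i assume i: "i \<in> {1..k}"
          show "u t (f t) i = \<zero>\<^bsub>semisimple_sum (I t)\<^esub> i"
            using direct_sum_eqI[OF uci[OF f t i] direct_sum_closed[OF W.M.zero_closed i, unfolded copies_def]] * i
            by (auto simp: copies_def)
        qed
      qed (simp add: copies_def)
      then show ?thesis by blast
    qed
    also have "\<dots> \<longleftrightarrow> (\<forall>t\<in>T. f t \<in> mod_ideal_prod (M t) J)"
      using coverD(3)[OF u] direct_sum_closed[OF f] by blast
    also have "\<dots> \<longleftrightarrow> f \<in> mod_ideal_prod ?D J"
      using mod_ideal_prod_direct_sum[OF J_ideal M f] by blast
    finally show ?thesis .
  qed
  show ?thesis unfolding cover_def using hom surj ker by blast
qed

text \<open>The dimension of a sum is the cardinality of a disjoint union. This treats infinitely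
  many summands and infinite dimensions without summing in \<open>enat\<close>.\<close>

lemma dim_vec_direct_sum:
  fixes I :: "'t \<Rightarrow> nat set"
  assumes M: "\<And>t. t \<in> T \<Longrightarrow> right_module R (M t)" and T: "countable T"
    and cg: "\<And>t. t \<in> T \<Longrightarrow> countably_gen R (M t)"
    and I: "\<And>t. t \<in> T \<Longrightarrow> ecard (I t) = dim_vec R k V (M t) i" and i: "i \<in> {1..k}"
  shows "dim_vec R k V (direct_sum T M) i = ecard (SIGMA t:T. I t)"
proof -
  have "\<exists>K u. cover R J (M t) (semisimple_sum (K :: nat \<Rightarrow> nat set)) u \<and> ecard (K i) = dim_vec R k V (M t) i" if t: "t \<in> T" for t
  proof -
    obtain K :: "nat \<Rightarrow> nat set" and u where K: "cover R J (M t) (semisimple_sum K) u"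
      "dim_vec R k V (M t) = (\<lambda>i. if i \<in> {1..k} then ecard (K i) else 0)"
      by (rule dim_vec_cover[OF M[OF t] cg[OF t]])
    have "ecard (K i) = dim_vec R k V (M t) i" unfolding K(2) if_P[OF i] ..
    then show ?thesis using K(1) by blast
  qed
  \<comment> \<open>The index sets and the cover of a summand depend on each other and are chosen
    together as a pair.\<close>
  then have "\<forall>t\<in>T. \<exists>p. cover R J (M t) (semisimple_sum (fst p :: nat \<Rightarrow> nat set)) (snd p) \<and> ecard (fst p i) = dim_vec R k V (M t) i"
    by force
  from bchoice[OF this] obtain p where p: "\<forall>t\<in>T. cover R J (M t) (semisimple_sum (fst (p t) :: nat \<Rightarrow> nat set)) (snd (p t)) \<and>
      ecard (fst (p t) i) = dim_vec R k V (M t) i" ..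
  define K u where "K t = fst (p t)" and "u t = snd (p t)" for t
  have K: "\<And>t. t \<in> T \<Longrightarrow> cover R J (M t) (semisimple_sum (K t :: nat \<Rightarrow> nat set)) (u t)"
    "\<And>t. t \<in> T \<Longrightarrow> ecard (K t i) = dim_vec R k V (M t) i"
    using p by (simp_all add: K_def u_def del: One_nat_def)
  have "\<exists>f. bij_betw f (I t) (K t i)" if "t \<in> T" for t
    using ecard_eq_bij[of "I t" "K t i"] I[OF that] K(2)[OF that] by metis
  then obtain f where f: "\<And>t. t \<in> T \<Longrightarrow> bij_betw (f t) (I t) (K t i)" by metis
  have "bij_betw (\<lambda>(t, s). (t, f t s)) (SIGMA t:T. I t) (SIGMA t:T. K t i)"
    using f by (auto simp: bij_betw_def inj_on_def image_iff) blast+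
  then have "ecard (SIGMA t:T. I t) = ecard (SIGMA t:T. K t i)"
    using bij_betw_finite bij_betw_same_card by (fastforce simp: ecard_def)
  then show ?thesis
    using dim_vec_eqI[OF right_module_direct_sum[OF ring_axioms M]
        countably_gen_direct_sum[OF ring_axioms M T cg] i cover_direct_sum[OF M K(1)]] by simp
qed

end

subsection \<open>Trace ideals\<close>

context ring
begin

lemma trace_mem: "\<lbrakk>f \<in> rmod_hom R P (regular R); x \<in> carrier P\<rbrakk> \<Longrightarrow> f x \<in> trace_ideal R P"
  unfolding trace_ideal_def by (blast intro: generate.incl)

lemma trace_least:
  assumes H: "submodule H R (regular R)"
    and f: "\<And>f x. \<lbrakk>f \<in> rmod_hom R P (regular R); x \<in> carrier P\<rbrakk> \<Longrightarrow> f x \<in> H"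
  shows "trace_ideal R P \<subseteq> H"
proof
  fix x assume "x \<in> trace_ideal R P"
  then show "x \<in> H" unfolding trace_ideal_def
  proof induct
    case one
    then show ?case using right_ideal_zero[OF H] by simp
  next
    case (incl h)
    then show ?case using f by blast
  next
    case (inv h)
    then have "\<ominus> h \<in> H" using f right_ideal_neg[OF H] by blast
    then show ?case by (simp add: a_inv_def)
  next
    case (eng h1 h2)
    then show ?case using right_ideal_add[OF H] by simp
  qed
qed

text \<open>Right multiples come from the action on \<open>P\<close>, left multiples from composing
  a functional with a left multiplication of \<open>R\<close>, which is right linear.\<close>

lemma ideal_trace:
  assumes P: "right_module R P"
  shows "ideal (trace_ideal R P) R"
proof -
  let ?S = "\<Union>f\<in>rmod_hom R P (regular R). f ` carrier P"
  have Sc: "?S \<subseteq> carrier R" using rmod_hom_closed[of _ R P "regular R"] by auto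
  have sub: "subgroup (trace_ideal R P) (add_monoid R)"
    unfolding trace_ideal_def using add.generate_is_subgroup[OF Sc] .
  interpret T: additive_subgroup "trace_ideal R P" R using sub by (rule additive_subgroup.intro)
  have both: "x \<otimes> r \<in> trace_ideal R P \<and> r \<otimes> x \<in> trace_ideal R P" if x: "x \<in> trace_ideal R P" and r: "r \<in> carrier R" for x r
    using x unfolding trace_ideal_def
  proof induct
    case one
    have "\<zero> \<in> generate (add_monoid R) ?S" using T.zero_closed by (simp add: trace_ideal_def)
    then show ?case using r by simp
  next
    case (incl h)
    then obtain f p where f: "f \<in> rmod_hom R P (regular R)" "p \<in> carrier P" "h = f p" by blast
    have "h \<otimes> r = f (r \<odot>\<^bsub>P\<^esub> p)" using rmod_hom_act[OF f(1) r f(2)] f(3) by simp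
    then have 1: "h \<otimes> r \<in> trace_ideal R P" using trace_mem[OF f(1) right_module.act_closed[OF P r f(2)]] by simp
    have "(\<lambda>x. r \<otimes> x) \<in> rmod_hom R (regular R) (regular R)"
      using r by (intro rmod_homI) (auto simp: r_distr m_assoc)
    from trace_mem[OF rmod_hom_comp[OF f(1) this] f(2)] have "r \<otimes> h \<in> trace_ideal R P" using f(3) by simp
    then show ?case using 1 by (simp add: trace_ideal_def)
  next
    case (inv h)
    then obtain f p where f: "f \<in> rmod_hom R P (regular R)" "p \<in> carrier P" "h = f p" by blast
    have hc: "h \<in> carrier R" using rmod_hom_closed[OF f(1,2)] f(3) by simp
    have "h \<otimes> r = f (r \<odot>\<^bsub>P\<^esub> p)" using rmod_hom_act[OF f(1) r f(2)] f(3) by simp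
    then have 1: "h \<otimes> r \<in> trace_ideal R P" using trace_mem[OF f(1) right_module.act_closed[OF P r f(2)]] by simp
    have "(\<lambda>x. r \<otimes> x) \<in> rmod_hom R (regular R) (regular R)"
      using r by (intro rmod_homI) (auto simp: r_distr m_assoc)
    from trace_mem[OF rmod_hom_comp[OF f(1) this] f(2)] have 2: "r \<otimes> h \<in> trace_ideal R P" using f(3) by simp
    have "(\<ominus> h) \<otimes> r \<in> trace_ideal R P \<and> r \<otimes> (\<ominus> h) \<in> trace_ideal R P"
      using T.a_inv_closed[OF 1] T.a_inv_closed[OF 2] r hc by (simp add: l_minus r_minus)
    then show ?case by (simp add: trace_ideal_def a_inv_def)
  next
    case (eng h1 h2)
    have "h1 \<in> trace_ideal R P" "h2 \<in> trace_ideal R P" using eng by (simp_all add: trace_ideal_def)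
    then have c: "h1 \<in> carrier R" "h2 \<in> carrier R" by auto
    have "(h1 \<oplus> h2) \<otimes> r \<in> trace_ideal R P \<and> r \<otimes> (h1 \<oplus> h2) \<in> trace_ideal R P"
      using eng c r T.a_closed by (simp add: l_distr r_distr trace_ideal_def)
    then show ?case by (simp add: trace_ideal_def)
  qed
  show ?thesis by (rule idealI[OF ring_axioms sub]) (use both in auto)
qed

end

context dual_basis
begin

text \<open>The dual basis expansion writes \<open>x\<close> with coefficients in the trace ideal.
  In other words, \<open>M\<close> equals its product with its trace ideal.\<close>

lemma mem_trace_product:
  assumes x: "x \<in> carrier M" shows "x \<in> mod_ideal_prod M (trace_ideal R M)"
proof -
  interpret T: module_ideal R M "trace_ideal R M"
    by (intro module_ideal.intro right_module_axioms R.ideal_trace)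
  have "finsum M (\<lambda>b. \<phi> b x \<odot>\<^bsub>M\<^esub> y b) {b \<in> B. \<phi> b x \<noteq> \<zero>\<^bsub>R\<^esub>} \<in> mod_ideal_prod M (trace_ideal R M)"
    by (rule submodule_finsum[OF T.submodule_mod_ideal_prod])
      (use x in \<open>auto intro!: T.act_mem_mod_ideal_prod R.trace_mem \<phi>_hom y_closed\<close>)
  then show ?thesis using expand[OF x] by simp
qed

end

lemma hom_mod_ideal_prod_regular:
  assumes M: "right_module R M" and I: "ideal I R" and f: "f \<in> rmod_hom R M (regular R)"
    and x: "x \<in> mod_ideal_prod M I"
  shows "f x \<in> I"
proof -
  interpret I: ideal I R by (rule I)
  interpret reg: module_ideal R "regular R" I
    by (intro module_ideal.intro I I.reg)
  have "mod_ideal_prod (regular R) I \<subseteq> I"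
    by (rule reg.mod_ideal_prod_least[OF I.ideal_right_ideal[OF I]]) (auto intro: I.I_l_closed)
  then show ?thesis using rmod_hom_mod_ideal_prod[OF M I.reg I f x] by blast
qed

text \<open>Functionals map \<open>MI\<close> into \<open>I\<close>, and here \<open>MI\<close> is
  all of \<open>M\<close>.\<close>

lemma trace_subset_ideal:
  assumes M: "right_module R M" and I: "ideal I R" and MI: "\<And>x. x \<in> carrier M \<Longrightarrow> x \<in> mod_ideal_prod M I"
  shows "trace_ideal R M \<subseteq> I"
proof -
  interpret I: ideal I R by (rule I)
  show ?thesis
    by (rule I.trace_least[OF I.ideal_right_ideal[OF I]]) (rule hom_mod_ideal_prod_regular[OF M I _ MI])
qed

section \<open>Simple quotients and trace ideals of projective modules\<close>

context semilocal_ring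
begin

text \<open>The types of the simple quotients of \<open>M\<close>. Unlike the support of
  \<open>dim_vec\<close> this set makes sense without countable generation, and
  \<open>trace_ideals\<close> ranges over all projective modules of the universal type.\<close>

definition hom_supp :: "('a, 'b, 'm) module_scheme \<Rightarrow> nat set"
  where "hom_supp M = {i \<in> {1..k}. \<exists>h\<in>rmod_hom R M (V i). \<exists>x\<in>carrier M. h x \<noteq> \<zero>\<^bsub>V i\<^esub>}"

lemma hom_suppI: "\<lbrakk>i \<in> {1..k}; h \<in> rmod_hom R M (V i); x \<in> carrier M; h x \<noteq> \<zero>\<^bsub>V i\<^esub>\<rbrakk> \<Longrightarrow> i \<in> hom_supp M"
  unfolding hom_supp_def by blast

lemma hom_suppE:
  assumes "i \<in> hom_supp M"
  obtains h x where "i \<in> {1..k}" "h \<in> rmod_hom R M (V i)" "x \<in> carrier M" "h x \<noteq> \<zero>\<^bsub>V i\<^esub>"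
  using assms unfolding hom_supp_def by blast

lemma hom_supp_subset: "hom_supp M \<subseteq> {1..k}"
  unfolding hom_supp_def by blast

lemma hom_supp_dim_ge:
  assumes "i \<in> {1..k}" shows "i \<in> hom_supp M \<longleftrightarrow> dim_ge R M (V i) 1"
  using assms unfolding hom_supp_def dim_ge_def by auto

lemma hom_supp_dim_vec:
  assumes "right_module R M" "countably_gen R M"
  shows "hom_supp M = supp (dim_vec R k V M)"
proof -
  have "i \<in> hom_supp M \<longleftrightarrow> dim_vec R k V M i \<noteq> 0" for i
  proof (cases "i \<in> {1..k}")
    case True
    have h: "dim_vec R k V M i \<noteq> 0 \<longleftrightarrow> enat 1 \<le> dim_vec R k V M i"
      by (cases "dim_vec R k V M i") (auto simp: zero_enat_def)
    show ?thesis unfolding hom_supp_dim_ge[OF True] h by (rule dim_vec_ge[OF assms True, symmetric])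
  next
    case False
    then show ?thesis using dim_vec_outside[OF assms False] hom_supp_subset by blast
  qed
  then show ?thesis by (auto simp: supp_def)
qed

lemma hom_supp_iso:
  assumes "rmod_iso R M W" "right_module R M"
  shows "hom_supp M = hom_supp W"
proof -
  have "i \<in> hom_supp M \<longleftrightarrow> i \<in> hom_supp W" if i: "i \<in> {1..k}" for i
    unfolding hom_supp_dim_ge[OF i] by (rule dim_ge_iso[OF assms])
  then show ?thesis using hom_supp_subset[of M] hom_supp_subset[of W] by auto
qed

lemma hom_supp_direct_sum:
  assumes M: "\<And>t. t \<in> T \<Longrightarrow> right_module R (M t)"
  shows "hom_supp (direct_sum T M) = (\<Union>t\<in>T. hom_supp (M t))"
proof (intro equalityI subsetI)
  fix i assume "i \<in> hom_supp (direct_sum T M)"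
  then obtain h x where i: "i \<in> {1..k}" and h: "h \<in> rmod_hom R (direct_sum T M) (V i)"
    and x: "x \<in> carrier (direct_sum T M)" "h x \<noteq> \<zero>\<^bsub>V i\<^esub>" by (rule hom_suppE)
  have D: "right_module R (direct_sum T M)" by (rule right_module_direct_sum[OF ring_axioms M])
  interpret h: rmod_morphism R "direct_sum T M" "V i" h by (rule rmod_morphismI[OF D V_module[OF i] h])
  show "i \<in> (\<Union>t\<in>T. hom_supp (M t))"
  proof (rule ccontr)
    assume no: "i \<notin> (\<Union>t\<in>T. hom_supp (M t))"
    have "x \<in> {x \<in> carrier (direct_sum T M). h x = \<zero>\<^bsub>V i\<^esub>}"
    proof (rule direct_sum_submodule_eq[where M = M, OF ring_axioms M h.submodule_kernel _ x(1)])
      fix t z assume t: "t \<in> T" and z: "z \<in> carrier (M t)"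
      note s = rmod_hom_ds_single[where M = M, OF M t]
      have "h (ds_single T M t z) = \<zero>\<^bsub>V i\<^esub>"
        using no hom_suppI[OF i rmod_hom_comp[OF s h] z] t by blast
      then show "ds_single T M t z \<in> {x \<in> carrier (direct_sum T M). h x = \<zero>\<^bsub>V i\<^esub>}"
        using rmod_hom_closed[OF s z] by simp
    qed
    then show False using x(2) by simp
  qed
next
  fix i assume "i \<in> (\<Union>t\<in>T. hom_supp (M t))"
  then obtain t where t: "t \<in> T" "i \<in> hom_supp (M t)" by blast
  then obtain h x where i: "i \<in> {1..k}" and h: "h \<in> rmod_hom R (M t) (V i)"
    and x: "x \<in> carrier (M t)" "h x \<noteq> \<zero>\<^bsub>V i\<^esub>" by (elim hom_suppE)
  show "i \<in> hom_supp (direct_sum T M)"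
  proof (rule hom_suppI[OF i rmod_hom_comp[OF rmod_hom_proj[where M = M, OF t(1)] h]])
    show "ds_single T M t x \<in> carrier (direct_sum T M)"
      by (rule rmod_hom_closed[OF rmod_hom_ds_single[where M = M, OF M t(1)] x(1)])
    show "h (ds_single T M t x t) \<noteq> \<zero>\<^bsub>V i\<^esub>" using x(2) t(1) by (simp add: ds_single_apply)
  qed
qed

text \<open>A functional \<open>f\<close> followed by the action on a vector \<open>v\<close> is a
  homomorphism from \<open>P\<close> into \<open>V j\<close>, hence zero.\<close>

lemma trace_kills_simple:
  assumes P: "right_module R P" and j: "j \<in> {1..k}" "j \<notin> hom_supp P"
    and a: "a \<in> trace_ideal R P" and v: "v \<in> carrier (V j)"
  shows "a \<odot>\<^bsub>V j\<^esub> v = \<zero>\<^bsub>V j\<^esub>"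
proof -
  interpret Vj: right_module R "V j" by (rule V_module[OF j(1)])
  let ?K = "{a \<in> carrier R. \<forall>v\<in>carrier (V j). a \<odot>\<^bsub>V j\<^esub> v = \<zero>\<^bsub>V j\<^esub>}"
  have K: "submodule ?K R (regular R)"
    by (rule right_idealI) (auto simp: Vj.act_add_ring Vj.act_mult)
  have "trace_ideal R P \<subseteq> ?K"
  proof (rule trace_least[OF K])
    fix f x assume f: "f \<in> rmod_hom R P (regular R)" and x: "x \<in> carrier P"
    have "f x \<odot>\<^bsub>V j\<^esub> v = \<zero>\<^bsub>V j\<^esub>" if v: "v \<in> carrier (V j)" for v
      using j(2) hom_suppI[OF j(1) rmod_hom_comp[OF f rmod_hom_act_element[OF Vj.right_module_axioms v]] x] by blast
    then show "f x \<in> ?K" using rmod_hom_closed[OF f x] by simp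
  qed
  then show ?thesis using a v by blast
qed

text \<open>If the functionals took all their values in \<open>I + J\<close>, the coordinates of
  \<open>x\<close> would satisfy, modulo \<open>I\<close>, a system with coefficients in
  \<open>J\<close>, and \<open>x\<close> would lie in \<open>KI\<close>. So some value lies outside
  \<open>I + J\<close>; a simple module detects it, and \<open>K\<close> maps onto that
  module.\<close>

lemma projective_quotient_simple:
  assumes K: "projective R K" and I: "ideal I R" and x: "x \<in> carrier K" "x \<notin> mod_ideal_prod K I"
  obtains j where "j \<in> hom_supp K" "\<And>a v. \<lbrakk>a \<in> I; v \<in> carrier (V j)\<rbrakk> \<Longrightarrow> a \<odot>\<^bsub>V j\<^esub> v = \<zero>\<^bsub>V j\<^esub>"
proof -
  interpret I: ideal I R by (rule I)
  interpret J: ideal J R by (rule J_ideal)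
  obtain B :: "'b set" and y \<phi> where "dual_basis R K B y \<phi>" using projective_imp_dual_basis[OF K] by blast
  then interpret K: dual_basis R K B y \<phi> .
  interpret KI: module_ideal R K I by (intro module_ideal.intro K.right_module_axioms I)
  note K' = K.right_module_axioms
  let ?L = "{i \<oplus> a |i a. i \<in> I \<and> a \<in> J}"
  note Is = ideal_right_ideal[OF I]
  have L: "submodule ?L R (regular R)" by (rule right_ideal_sum[OF Is right_ideal_jacobson])
  note up = right_ideal_sum_upper[OF Is right_ideal_jacobson]
  have "\<exists>b\<in>B. \<exists>z\<in>carrier K. \<phi> b z \<notin> ?L"
  proof (rule ccontr)
    assume "\<not> ?thesis"
    then have all: "\<phi> b z \<in> ?L" if "b \<in> B" "z \<in> carrier K" for b z using that by blast
    \<comment> \<open>Applying \<open>\<phi> b\<close> to the expansion of \<open>x\<close>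
      expresses each nonzero coordinate by all of them, with coefficients
      \<open>\<phi> b (y c)\<close>. Each coefficient is split into a part in \<open>I\<close> and a
      part in \<open>J\<close>.\<close>
    define N where "N = {b \<in> B. \<phi> b x \<noteq> \<zero>}"
    have N: "finite N" "N \<subseteq> B" unfolding N_def using K.finite_support[OF x(1)] by auto
    have "\<forall>b\<in>N. \<forall>c\<in>N. \<exists>i a. i \<in> I \<and> a \<in> J \<and> \<phi> b (y c) = i \<oplus> a"
    proof (intro ballI)
      fix b c assume "b \<in> N" "c \<in> N"
      then have "\<phi> b (y c) \<in> ?L" using all N(2) K.y_closed by blast
      then show "\<exists>i a. i \<in> I \<and> a \<in> J \<and> \<phi> b (y c) = i \<oplus> a" by blast
    qed
    then obtain i A where iA: "\<And>b c. \<lbrakk>b \<in> N; c \<in> N\<rbrakk> \<Longrightarrow> i b c \<in> I" "\<And>b c. \<lbrakk>b \<in> N; c \<in> N\<rbrakk> \<Longrightarrow> A b c \<in> J"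
      "\<And>b c. \<lbrakk>b \<in> N; c \<in> N\<rbrakk> \<Longrightarrow> \<phi> b (y c) = i b c \<oplus> A b c" by metis
    have rc: "\<phi> c x \<in> carrier R" if "c \<in> N" for c using K.\<phi>_closed[OF _ x(1)] N(2) that by blast
    have yc: "y c \<in> carrier K" if "c \<in> N" for c using K.y_closed N(2) that by blast
    have ic: "i b c \<in> carrier R" "A b c \<in> carrier R" if "b \<in> N" "c \<in> N" for b c
      using iA(1,2)[OF that] I.a_Hcarr J.a_Hcarr by auto
    have "\<phi> b x \<in> I" if b: "b \<in> N" for b
    proof (rule jacobson_column_elimination[OF N(1) I, of A "\<lambda>c. \<phi> c x" "\<lambda>b. finsum R (\<lambda>c. i b c \<otimes> \<phi> c x) N"])
      show "finsum R (\<lambda>c. i b c \<otimes> \<phi> c x) N \<in> I" if "b \<in> N" for b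
        using right_module.submodule_finsum[OF reg Is, of N "\<lambda>c. i b c \<otimes> \<phi> c x"] iA(1)[OF that] rc
        by (simp add: finsum_regular I.I_r_closed)
      fix b assume b: "b \<in> N"
      then have bB: "b \<in> B" using N(2) by blast
      interpret f: rmod_morphism R K "regular R" "\<phi> b" by (rule rmod_morphismI[OF K' reg K.\<phi>_hom[OF bB]])
      have "\<phi> b x = \<phi> b (finsum K (\<lambda>c. \<phi> c x \<odot>\<^bsub>K\<^esub> y c) N)"
        using K.expand[OF x(1)] by (simp add: N_def)
      also have "\<dots> = finsum R (\<lambda>c. \<phi> b (\<phi> c x \<odot>\<^bsub>K\<^esub> y c)) N"
        using f.finsum[of "\<lambda>c. \<phi> c x \<odot>\<^bsub>K\<^esub> y c" N] rc yc by (simp add: Pi_iff K.act_closed finsum_regular)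
      also have "\<dots> = finsum R (\<lambda>c. i b c \<otimes> \<phi> c x \<oplus> A b c \<otimes> \<phi> c x) N"
        by (rule finsum_cong') (use b rc yc ic iA(3) f.act in \<open>auto simp: l_distr\<close>)
      also have "\<dots> = finsum R (\<lambda>c. i b c \<otimes> \<phi> c x) N \<oplus> finsum R (\<lambda>c. A b c \<otimes> \<phi> c x) N"
        by (rule finsum_addf) (use b rc ic in auto)
      finally show "\<phi> b x = finsum R (\<lambda>c. i b c \<otimes> \<phi> c x) N \<oplus> finsum R (\<lambda>c. A b c \<otimes> \<phi> c x) N" .
    qed (use iA(2) rc b in auto)
    then have "finsum K (\<lambda>b. \<phi> b x \<odot>\<^bsub>K\<^esub> y b) N \<in> mod_ideal_prod K I"
      by (intro K.submodule_finsum[OF KI.submodule_mod_ideal_prod] KI.act_mem_mod_ideal_prod yc)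
    then show False using K.expand[OF x(1)] x(2) by (simp add: N_def)
  qed
  then obtain b z where b: "b \<in> B" and z: "z \<in> carrier K" and nL: "\<phi> b z \<notin> ?L" by blast
  obtain j v where j: "j \<in> {1..k}" and v: "v \<in> carrier (V j)" and vL: "\<And>x. x \<in> ?L \<Longrightarrow> x \<odot>\<^bsub>V j\<^esub> v = \<zero>\<^bsub>V j\<^esub>"
    and vz: "\<phi> b z \<odot>\<^bsub>V j\<^esub> v \<noteq> \<zero>\<^bsub>V j\<^esub>"
    by (rule simple_separates[OF L up(2) K.\<phi>_closed[OF b z] nL]) blast
  interpret Vj: right_module R "V j" by (rule V_module[OF j])
  let ?h = "\<lambda>p. \<phi> b p \<odot>\<^bsub>V j\<^esub> v"
  have h: "?h \<in> rmod_hom R K (V j)"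
    by (rule rmod_hom_comp[OF K.\<phi>_hom[OF b] rmod_hom_act_element[OF Vj.right_module_axioms v]])
  have surj: "?h ` carrier K = carrier (V j)" by (rule simple_hom_surj[OF V_simple[OF j] K' h z vz])
  show ?thesis
  proof (rule that[of j])
    show "j \<in> hom_supp K" by (rule hom_suppI[OF j h z vz])
    fix a w assume a: "a \<in> I" and "w \<in> carrier (V j)"
    then obtain p where p: "p \<in> carrier K" "w = ?h p" using surj by blast
    have ac: "a \<in> carrier R" using I.a_Hcarr a .
    have "a \<odot>\<^bsub>V j\<^esub> w = ?h (a \<odot>\<^bsub>K\<^esub> p)" using rmod_hom_act[OF h ac p(1)] p(2) by simp
    \<comment> \<open>Functionals send \<open>KI\<close> into \<open>I\<close>, which kills
      \<open>v\<close>. So the surjection onto \<open>V j\<close> shows that \<open>a\<close> kills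
      all of \<open>V j\<close>.\<close>
    moreover have "\<phi> b (a \<odot>\<^bsub>K\<^esub> p) \<in> ?L"
      using K.functional_mod_ideal_prod[OF I b KI.act_mem_mod_ideal_prod[OF a p(1)]] up(1) by blast
    ultimately show "a \<odot>\<^bsub>V j\<^esub> w = \<zero>\<^bsub>V j\<^esub>" using vL by simp
  qed
qed

text \<open>\<open>P\<close> equals its product with its trace ideal, so a simple quotient
  annihilated by the trace ideal would be zero.\<close>

lemma hom_supp_trace_acts:
  assumes P: "projective R P" and j: "j \<in> hom_supp P"
  obtains a v where "a \<in> trace_ideal R P" "v \<in> carrier (V j)" "a \<odot>\<^bsub>V j\<^esub> v \<noteq> \<zero>\<^bsub>V j\<^esub>"
proof (rule ccontr)
  note found = that
  assume no: "\<not> thesis"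
  obtain h x where jk: "j \<in> {1..k}" and h: "h \<in> rmod_hom R P (V j)" and x: "x \<in> carrier P" "h x \<noteq> \<zero>\<^bsub>V j\<^esub>"
    using j by (rule hom_suppE)
  obtain B :: "'b set" and y \<phi> where "dual_basis R P B y \<phi>" using projective_imp_dual_basis[OF P] by blast
  then interpret P: dual_basis R P B y \<phi> .
  have "h x = \<zero>\<^bsub>V j\<^esub>"
    by (rule rmod_hom_kill[OF ideal_trace[OF P.right_module_axioms] P.right_module_axioms V_module[OF jk] h _ P.mem_trace_product[OF x(1)]])
      (use found no in blast)
  then show False using x(2) by simp
qed

text \<open>A failure yields a simple quotient of \<open>K\<close> annihilated by the trace ideal of
  \<open>P\<close>. By assumption it is also a quotient of \<open>P\<close>, and there the trace
  ideal acts nontrivially.\<close>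

lemma projective_eq_trace_product:
  assumes K: "projective R K" and P: "projective R P" and sub: "hom_supp K \<subseteq> hom_supp P" and x: "x \<in> carrier K"
  shows "x \<in> mod_ideal_prod K (trace_ideal R P)"
proof (rule ccontr)
  assume "x \<notin> mod_ideal_prod K (trace_ideal R P)"
  then obtain j where j: "j \<in> hom_supp K"
    and kill: "\<And>a v. \<lbrakk>a \<in> trace_ideal R P; v \<in> carrier (V j)\<rbrakk> \<Longrightarrow> a \<odot>\<^bsub>V j\<^esub> v = \<zero>\<^bsub>V j\<^esub>"
    using projective_quotient_simple[OF K ideal_trace[OF projective_right_module[OF P]] x] by metis
  have "j \<in> hom_supp P" using j sub by blast
  then obtain a v where "a \<in> trace_ideal R P" "v \<in> carrier (V j)" "a \<odot>\<^bsub>V j\<^esub> v \<noteq> \<zero>\<^bsub>V j\<^esub>"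
    by (rule hom_supp_trace_acts[OF P])
  then show False using kill by blast
qed

lemma trace_mono:
  assumes K: "projective R K" and P: "projective R P" and sub: "hom_supp K \<subseteq> hom_supp P"
  shows "trace_ideal R K \<subseteq> trace_ideal R P"
  by (rule trace_subset_ideal[OF projective_right_module[OF K] ideal_trace[OF projective_right_module[OF P]]])
    (rule projective_eq_trace_product[OF assms])

lemma hom_supp_mono_trace:
  assumes K: "projective R K" and P: "right_module R P" and sub: "trace_ideal R K \<subseteq> trace_ideal R P"
  shows "hom_supp K \<subseteq> hom_supp P"
proof
  fix j assume j: "j \<in> hom_supp K"
  show "j \<in> hom_supp P"
  proof (rule ccontr)
    assume no: "j \<notin> hom_supp P"
    obtain a v where a: "a \<in> trace_ideal R K" and v: "v \<in> carrier (V j)" "a \<odot>\<^bsub>V j\<^esub> v \<noteq> \<zero>\<^bsub>V j\<^esub>"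
      by (rule hom_supp_trace_acts[OF K j])
    have "j \<in> {1..k}" using j hom_supp_subset by blast
    from trace_kills_simple[OF P this no subsetD[OF sub a] v(1)] show False using v(2) by blast
  qed
qed

text \<open>One direction makes \<open>Phi\<close> well defined, the other makes it
  injective.\<close>

lemma trace_eq_iff:
  assumes K: "projective R K" and P: "projective R P"
  shows "trace_ideal R K = trace_ideal R P \<longleftrightarrow> hom_supp K = hom_supp P"
  using trace_mono[OF K P] trace_mono[OF P K] hom_supp_mono_trace[OF K projective_right_module[OF P]]
    hom_supp_mono_trace[OF P projective_right_module[OF K]]
  by auto

text \<open>\<open>Phi\<close> refers to modules of the universal type, so \<open>P\<close> is
  replaced by a copy there.\<close>

lemma Phi_trace:
  fixes P :: "('a, 'b, 'm) module_scheme"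
  assumes P: "projective R P" and cg: "countably_gen R P"
  shows "Phi R k V (trace_ideal R P) = hom_supp P"
proof -
  note P' = projective_right_module[OF P]
  obtain Q :: "'a univ_module" where Q: "right_module R Q" "rmod_iso R Q P"
    using countably_gen_univ_copy[OF P' cg] by blast
  note PQ = rmod_iso_sym[OF Q(2,1)]
  have pQ: "projective R Q" by (rule projective_iso[OF P PQ Q(1)])
  have cQ: "countably_gen R Q" using PQ countably_gen_image[OF P' Q(1) _ _ cg] unfolding rmod_iso_def bij_betw_def by blast
  have hs: "hom_supp Q = hom_supp P" by (rule hom_supp_iso[OF Q(2,1)])
  show ?thesis unfolding Phi_def
  proof (rule the_equality)
    show "\<exists>Q :: 'a univ_module. countably_gen R Q \<and> projective R Q \<and> trace_ideal R Q = trace_ideal R P \<and> hom_supp P = supp (dim_vec R k V Q)"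
      using cQ pQ trace_eq_iff[OF pQ P] hs hom_supp_dim_vec[OF Q(1) cQ] by blast
    fix X assume "\<exists>Q :: 'a univ_module. countably_gen R Q \<and> projective R Q \<and> trace_ideal R Q = trace_ideal R P \<and> X = supp (dim_vec R k V Q)"
    then obtain Q :: "'a univ_module" where Q: "countably_gen R Q" "projective R Q" "trace_ideal R Q = trace_ideal R P" "X = supp (dim_vec R k V Q)"
      by blast
    have "hom_supp Q = hom_supp P" using trace_eq_iff[OF Q(2) P] Q(3) by blast
    then show "X = hom_supp P" unfolding Q(4) using hom_supp_dim_vec[OF projective_right_module[OF Q(2)] Q(1)] by simp
  qed
qed

text \<open>A finite generating set meets finitely many coordinates. The coordinate map at a further
  position would vanish on the generators, hence everywhere, but it does not vanish on its own
  summand.\<close>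

lemma fin_gen_dim_vec:
  assumes M: "right_module R M" and fg: "fin_gen R M"
  shows "dim_vec R k V M i \<noteq> \<infinity>"
proof (cases "i \<in> {1..k}")
  case i: True
  obtain I :: "nat \<Rightarrow> nat set" and u where u: "cover R J M (semisimple_sum I) u"
    and D: "dim_vec R k V M = (\<lambda>i. if i \<in> {1..k} then ecard (I i) else 0)"
    by (rule dim_vec_cover[OF M fin_gen_imp_countably_gen[OF fg]])
  have "fin_gen R (semisimple_sum I)" by (rule fin_gen_image[OF M semisimple_sum_module coverD(1,2)[OF u] fg])
  then obtain S where S: "finite S" "generated_by R (semisimple_sum I) S" unfolding fin_gen_def by blast
  let ?F = "\<Union>w\<in>S. {s \<in> I i. w i s \<noteq> \<zero>\<^bsub>V i\<^esub>}"
  have Sc: "w \<in> carrier (semisimple_sum I)" if "w \<in> S" for w using S(2) that unfolding generated_by_def by blast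
  have "finite ?F"
  proof (rule finite_UN_I[OF S(1)])
    fix w assume "w \<in> S"
    then have "w i \<in> carrier (direct_sum (I i) (\<lambda>_. V i))" using direct_sum_closed[OF Sc i] by (simp add: copies_def)
    then show "finite {s \<in> I i. w i s \<noteq> \<zero>\<^bsub>V i\<^esub>}" by (rule direct_sum_finite)
  qed
  moreover have "I i \<subseteq> ?F"
  proof
    fix s assume s: "s \<in> I i"
    show "s \<in> ?F"
    proof (rule ccontr)
      assume no: "s \<notin> ?F"
      obtain v where v: "v \<in> carrier (V i)" "v \<noteq> \<zero>\<^bsub>V i\<^esub>" using simple_moduleD(2)[OF V_simple[OF i]] by blast
      interpret c: rmod_morphism R "semisimple_sum I" "V i" "\<lambda>w. w i s"
        by (rule rmod_morphismI[OF semisimple_sum_module V_module[OF i] coord_hom[where I = I, OF i s]])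
      have "ss_single I i s v \<in> {w \<in> carrier (semisimple_sum I). w i s = \<zero>\<^bsub>V i\<^esub>}"
        by (rule generated_byD[OF S(2) c.submodule_kernel])
          (use no s Sc in blast, rule rmod_hom_closed[OF ss_single_hom[where I = I, OF i s] v(1)])
      then have "ss_single I i s v i s = \<zero>\<^bsub>V i\<^esub>" by blast
      then show False using ss_single_apply[where I = I, OF i s, of i s v] v(2) by simp
    qed
  qed
  ultimately have "finite (I i)" by (rule rev_finite_subset)
  then show ?thesis unfolding D if_P[OF i] by (simp add: ecard_def)
next
  case False
  show ?thesis unfolding dim_vec_outside[OF M fin_gen_imp_countably_gen[OF fg] False] by simp
qed

text \<open>The convention of \<open>enat\<close> that zero times \<infinity> is zero agrees with
  the empty disjoint union.\<close>

lemma dim_vec_copies: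
  assumes M: "right_module R M" and cg: "countably_gen R M" and T: "countable T" and i: "i \<in> {1..k}"
  shows "dim_vec R k V (copies T M) i = ecard T * dim_vec R k V M i"
proof -
  obtain A :: "nat set" where A: "ecard A = dim_vec R k V M i"
  proof (cases "dim_vec R k V M i")
    case (enat n)
    then show ?thesis using that[of "{..<n}"] by (simp add: ecard_def)
  next
    case infinity
    then show ?thesis using that[of UNIV] by (simp add: ecard_def)
  qed
  have "dim_vec R k V (copies T M) i = ecard (SIGMA t:T. A)"
    unfolding copies_def by (rule dim_vec_direct_sum[OF M T cg A i])
  also have "\<dots> = ecard T * ecard A"
    by (cases "finite T"; cases "finite A"; cases "T = {}"; cases "A = {}")
      (auto simp: ecard_def finite_cartesian_product_iff zero_enat_def[symmetric])
  finally show ?thesis using A by simp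
qed

text \<open>A summand with index other than \<open>i\<close> has no quotient \<open>V i\<close>, so
  the disjoint union reduces to one block.\<close>

lemma dim_vec_diagonal:
  assumes M: "\<And>t. t \<in> {1..k} \<Longrightarrow> right_module R (M t)" and cg: "\<And>t. t \<in> {1..k} \<Longrightarrow> countably_gen R (M t)"
    and diag: "\<And>t. t \<in> {1..k} \<Longrightarrow> hom_supp (M t) \<subseteq> {t}" and i: "i \<in> {1..k}"
  shows "dim_vec R k V (direct_sum {1..k} M) i = dim_vec R k V (M i) i"
proof -
  have "\<exists>A :: nat set. ecard A = e" for e
  proof (cases e)
    case (enat n)
    then show ?thesis by (intro exI[of _ "{..<n}"]) (simp add: ecard_def)
  next
    case infinity
    then show ?thesis by (intro exI[of _ UNIV]) (simp add: ecard_def)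
  qed
  then obtain A :: "nat set" where A: "ecard A = dim_vec R k V (M i) i" by blast
  let ?A = "\<lambda>t. if t = i then A else {}"
  have "dim_vec R k V (direct_sum {1..k} M) i = ecard (SIGMA t:{1..k}. ?A t)"
  proof (rule dim_vec_direct_sum[OF M _ cg _ i])
    fix t assume t: "t \<in> {1..k}"
    show "ecard (?A t) = dim_vec R k V (M t) i"
    proof (cases "t = i")
      case False
      then have "i \<notin> hom_supp (M t)" using diag[OF t] by blast
      then have "dim_vec R k V (M t) i = 0"
        unfolding hom_supp_dim_vec[OF M[OF t] cg[OF t]] supp_def by simp
      then show ?thesis using False by (simp add: ecard_def zero_enat_def)
    qed (simp add: A)
  qed simp_all
  also have "(SIGMA t:{1..k}. ?A t) = Pair i ` A" using i by (auto split: if_splits)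
  also have "ecard (Pair i ` A) = ecard A"
    by (simp add: ecard_def card_image inj_on_def finite_image_iff)
  finally show ?thesis using A by simp
qed

end

subsection \<open>Restriction of scalars along a quotient map\<close>

text \<open>Modules over \<open>R/I\<close> are regarded as modules over \<open>R\<close>, so that
  quotients and the modules lifting them are discussed over one ring.\<close>

definition restrict_scalars :: "('a, 'r) ring_scheme \<Rightarrow> 'a set \<Rightarrow> ('a set, 'b, 'm) module_scheme \<Rightarrow> ('a, 'b) module"
  where "restrict_scalars R I M = \<lparr>carrier = carrier M, mult = undefined, one = undefined,
           zero = zero M, add = add M, smult = (\<lambda>a. smult M (I +>\<^bsub>R\<^esub> a))\<rparr>"

lemma restrict_scalars_simps [simp]:
  "carrier (restrict_scalars R I M) = carrier M" "add (restrict_scalars R I M) = add M"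
  "zero (restrict_scalars R I M) = zero M" "smult (restrict_scalars R I M) a x = (I +>\<^bsub>R\<^esub> a) \<odot>\<^bsub>M\<^esub> x"
  by (simp_all add: restrict_scalars_def)

lemma finsum_restrict_scalars: "finsum (restrict_scalars R I M) f A = finsum M f A"
  by (simp add: finsum_def finprod_def)

context ideal
begin

lemma quot_carrier: "carrier (R Quot I) = (\<lambda>a. I +> a) ` carrier R"
  by (auto simp: FactRing_def A_RCOSETS_def')

lemma quot_mem: "a \<in> carrier R \<Longrightarrow> I +> a \<in> carrier (R Quot I)"
  by (simp add: quot_carrier)

lemma quot_simps:
  "\<lbrakk>a \<in> carrier R; b \<in> carrier R\<rbrakk> \<Longrightarrow> (I +> a) \<oplus>\<^bsub>R Quot I\<^esub> (I +> b) = I +> (a \<oplus> b)"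
  "\<lbrakk>a \<in> carrier R; b \<in> carrier R\<rbrakk> \<Longrightarrow> (I +> a) \<otimes>\<^bsub>R Quot I\<^esub> (I +> b) = I +> (a \<otimes> b)"
  "\<zero>\<^bsub>R Quot I\<^esub> = I +> \<zero>" "\<one>\<^bsub>R Quot I\<^esub> = I +> \<one>"
  using a_subset by (simp_all add: FactRing_def a_rcos_sum rcoset_mult_add)

lemma right_module_restrict_scalars:
  assumes "right_module (R Quot I) M"
  shows "right_module R (restrict_scalars R I M)"
proof -
  interpret M: right_module "R Quot I" M by fact
  show ?thesis
    by (rule right_moduleI)
      (auto simp: quot_simps(1,2)[symmetric] quot_simps(3,4)[symmetric] quot_mem ring_axioms M.act_add_ring M.act_add M.act_mult M.act_one M.M.a_assoc
        intro: M.act_closed M.M.a_comm)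
qed

text \<open>The projection of \<open>R\<close> to \<open>R/I\<close> is onto, so linearity over
  either ring is the same condition.\<close>

lemma restrict_scalars_hom:
  "f \<in> rmod_hom R (restrict_scalars R I M) (restrict_scalars R I N) \<longleftrightarrow> f \<in> rmod_hom (R Quot I) M N"
  by (auto simp: rmod_hom_def hom_def quot_carrier)

lemma restrict_scalars_iso:
  "rmod_iso R (restrict_scalars R I M) (restrict_scalars R I N) \<longleftrightarrow> rmod_iso (R Quot I) M N"
  by (simp add: rmod_iso_def Bex_def restrict_scalars_hom)

lemma restrict_scalars_submodule:
  assumes "right_module (R Quot I) M" "submodule K (R Quot I) M"
  shows "submodule K R (restrict_scalars R I M)"
proof -
  interpret M: right_module "R Quot I" M by fact
  show ?thesis
    by (rule right_module.submoduleI[OF right_module_restrict_scalars[OF assms(1)]])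
      (use M.submodule_mem[OF assms(2)] M.submodule_zero[OF assms(2)] M.submodule_add[OF assms(2)]
        M.submodule_act[OF assms(2)] quot_mem in auto)
qed

section \<open>Reduction of modules modulo an ideal\<close>

context
  fixes A :: "('a, 'c, 'm) module_scheme"
  assumes A: "right_module R A"
begin

interpretation A: module_ideal R A I
  by (intro module_ideal.intro A ideal_axioms)

lemma reduce_mod_simps:
  "carrier (reduce_mod A I) = (\<lambda>x. mod_ideal_prod A I +>\<^bsub>A\<^esub> x) ` carrier A"
  "zero (reduce_mod A I) = mod_ideal_prod A I"
  "add (reduce_mod A I) = add (quot_module A (mod_ideal_prod A I))"
  by (auto simp: reduce_mod_def quot_module_def A_RCOSETS_def')

text \<open>The action is a union over representatives of the scalar and of the vector. Changing
  either of them alters the result by an element of \<open>AI\<close>.\<close>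

lemma reduce_mod_act:
  assumes a: "a \<in> carrier R" and x: "x \<in> carrier A"
  shows "(I +> a) \<odot>\<^bsub>reduce_mod A I\<^esub> (mod_ideal_prod A I +>\<^bsub>A\<^esub> x) = mod_ideal_prod A I +>\<^bsub>A\<^esub> (a \<odot>\<^bsub>A\<^esub> x)"
proof -
  let ?H = "mod_ideal_prod A I"
  note H = A.submodule_mod_ideal_prod
  interpret H: abelian_subgroup ?H A by (rule A.abelian_subgroup[OF H])
  have e: "?H +>\<^bsub>A\<^esub> (b \<odot>\<^bsub>A\<^esub> z) = ?H +>\<^bsub>A\<^esub> (a \<odot>\<^bsub>A\<^esub> x)" if b: "b \<in> I +> a" and z: "z \<in> ?H +>\<^bsub>A\<^esub> x" for b z
  proof -
    obtain i where i: "i \<in> I" "b = i \<oplus> a" using b by (auto simp: a_r_coset_def')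
    obtain h where h: "h \<in> ?H" "z = h \<oplus>\<^bsub>A\<^esub> x" using z by (auto simp: a_r_coset_def')
    have ic: "i \<in> carrier R" and hc: "h \<in> carrier A" using i(1) a_Hcarr A.submodule_mem[OF H h(1)] by auto
    have zc: "z \<in> carrier A" using h(2) hc x by simp
    have "a \<odot>\<^bsub>A\<^esub> z = a \<odot>\<^bsub>A\<^esub> h \<oplus>\<^bsub>A\<^esub> a \<odot>\<^bsub>A\<^esub> x" using h(2) a hc x by (simp add: A.act_add)
    moreover have "b \<odot>\<^bsub>A\<^esub> z = i \<odot>\<^bsub>A\<^esub> z \<oplus>\<^bsub>A\<^esub> a \<odot>\<^bsub>A\<^esub> z" unfolding i(2) by (rule A.act_add_ring[OF ic a zc])
    ultimately have "b \<odot>\<^bsub>A\<^esub> z = i \<odot>\<^bsub>A\<^esub> z \<oplus>\<^bsub>A\<^esub> (a \<odot>\<^bsub>A\<^esub> h \<oplus>\<^bsub>A\<^esub> a \<odot>\<^bsub>A\<^esub> x)" by simp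
    then have "b \<odot>\<^bsub>A\<^esub> z = (i \<odot>\<^bsub>A\<^esub> z \<oplus>\<^bsub>A\<^esub> a \<odot>\<^bsub>A\<^esub> h) \<oplus>\<^bsub>A\<^esub> a \<odot>\<^bsub>A\<^esub> x"
      using ic a hc x zc by (simp add: A.M.a_assoc A.act_closed)
    moreover have "i \<odot>\<^bsub>A\<^esub> z \<oplus>\<^bsub>A\<^esub> a \<odot>\<^bsub>A\<^esub> h \<in> ?H"
      by (rule A.submodule_add[OF H A.act_mem_mod_ideal_prod[OF i(1) zc] A.submodule_act[OF H a h(1)]])
    ultimately have "b \<odot>\<^bsub>A\<^esub> z \<in> ?H +>\<^bsub>A\<^esub> (a \<odot>\<^bsub>A\<^esub> x)" by (auto simp: a_r_coset_def')
    from H.a_repr_independence'[OF this A.act_closed[OF a x]] show ?thesis ..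
  qed
  have "a \<in> I +> a" "x \<in> ?H +>\<^bsub>A\<^esub> x" using a_rcos_self[OF a] H.a_rcos_self[OF x] by auto
  moreover have "(\<Union>b\<in>I +> a. \<Union>z\<in>?H +>\<^bsub>A\<^esub> x. ?H +>\<^bsub>A\<^esub> (b \<odot>\<^bsub>A\<^esub> z))
      = (\<Union>b\<in>I +> a. \<Union>z\<in>?H +>\<^bsub>A\<^esub> x. ?H +>\<^bsub>A\<^esub> (a \<odot>\<^bsub>A\<^esub> x))"
    by (intro SUP_cong refl e)
  ultimately have "(\<Union>b\<in>I +> a. \<Union>z\<in>?H +>\<^bsub>A\<^esub> x. ?H +>\<^bsub>A\<^esub> (b \<odot>\<^bsub>A\<^esub> z)) = ?H +>\<^bsub>A\<^esub> (a \<odot>\<^bsub>A\<^esub> x)"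
    by auto
  then show ?thesis by (simp add: reduce_mod_def)
qed

lemma right_module_reduce_mod: "right_module (R Quot I) (reduce_mod A I)"
proof -
  let ?H = "mod_ideal_prod A I" and ?M = "reduce_mod A I"
  note H = A.submodule_mod_ideal_prod
  have z: "zero ?M = ?H +>\<^bsub>A\<^esub> \<zero>\<^bsub>A\<^esub>" by (simp add: reduce_mod_simps A.coset_zero[OF H])
  have add: "(?H +>\<^bsub>A\<^esub> x) \<oplus>\<^bsub>?M\<^esub> (?H +>\<^bsub>A\<^esub> y) = ?H +>\<^bsub>A\<^esub> (x \<oplus>\<^bsub>A\<^esub> y)" if "x \<in> carrier A" "y \<in> carrier A" for x y
    using A.quot_module_add[OF H that] by (simp add: reduce_mod_simps)
  show ?thesis
  proof (rule right_moduleI)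
    show "ring (R Quot I)" by (rule quotient_is_ring)
    fix X Y assume "X \<in> carrier ?M" "Y \<in> carrier ?M"
    then obtain x y where "x \<in> carrier A" "y \<in> carrier A" "X = ?H +>\<^bsub>A\<^esub> x" "Y = ?H +>\<^bsub>A\<^esub> y"
      unfolding reduce_mod_simps by blast
    then show "X \<oplus>\<^bsub>?M\<^esub> Y = Y \<oplus>\<^bsub>?M\<^esub> X"
      using A.M.a_comm[of x y] by (simp add: add)
  qed (auto simp: z reduce_mod_simps(1) add quot_carrier quot_simps reduce_mod_act A.M.a_assoc
      A.act_closed A.act_add A.act_add_ring A.act_mult A.act_one)
qed

lemma cover_reduce_mod: "cover R I A (restrict_scalars R I (reduce_mod A I)) (\<lambda>x. mod_ideal_prod A I +>\<^bsub>A\<^esub> x)"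
proof -
  note H = A.submodule_mod_ideal_prod
  show ?thesis unfolding cover_def
  proof (intro conjI ballI)
    show "(\<lambda>x. mod_ideal_prod A I +>\<^bsub>A\<^esub> x) \<in> rmod_hom R A (restrict_scalars R I (reduce_mod A I))"
      by (rule rmod_homI) (simp_all add: reduce_mod_simps A.quot_module_add[OF H] reduce_mod_act)
    show "(\<lambda>x. mod_ideal_prod A I +>\<^bsub>A\<^esub> x) ` carrier A = carrier (restrict_scalars R I (reduce_mod A I))"
      by (simp add: reduce_mod_simps)
    show "mod_ideal_prod A I +>\<^bsub>A\<^esub> x = \<zero>\<^bsub>restrict_scalars R I (reduce_mod A I)\<^esub> \<longleftrightarrow> x \<in> mod_ideal_prod A I"
      if "x \<in> carrier A" for x
      using A.coset_eq_self_iff[OF H that] by (simp add: reduce_mod_simps)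
  qed
qed

text \<open>Turns an isomorphism over \<open>R/I\<close> into a map out of \<open>A\<close> over
  \<open>R\<close>, the form in which projective modules can be lifted.\<close>

lemma reduce_mod_iso_iff:
  assumes M: "right_module (R Quot I) M"
  shows "rmod_iso (R Quot I) M (reduce_mod A I) \<longleftrightarrow> (\<exists>p. cover R I A (restrict_scalars R I M) p)"
proof
  note rM = right_module_restrict_scalars[OF M] and rA = right_module_restrict_scalars[OF right_module_reduce_mod]
  {
    assume "rmod_iso (R Quot I) M (reduce_mod A I)"
    then have "rmod_iso R (restrict_scalars R I (reduce_mod A I)) (restrict_scalars R I M)"
      unfolding restrict_scalars_iso using rmod_iso_sym M by blast
    then show "\<exists>p. cover R I A (restrict_scalars R I M) p"
      by (rule cover_iso[OF cover_reduce_mod rA A _ rM])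
  next
    assume "\<exists>p. cover R I A (restrict_scalars R I M) p"
    then obtain p where "cover R I A (restrict_scalars R I M) p" ..
    from cover_unique[OF this cover_reduce_mod A rM rA]
    show "rmod_iso (R Quot I) M (reduce_mod A I)" unfolding restrict_scalars_iso .
  }
qed

end

text \<open>The functionals of a dual basis map \<open>AI\<close> into \<open>I\<close>, so the dual
  basis descends to the quotient.\<close>

lemma projective_reduce_mod:
  fixes A :: "('a, 'c, 'm) module_scheme"
  assumes "projective R A"
  shows "projective (R Quot I) (reduce_mod A I)"
proof -
  obtain B :: "'c set" and y \<phi> where "dual_basis R A B y \<phi>" using projective_imp_dual_basis[OF assms] by blast
  then interpret A: dual_basis R A B y \<phi> .
  let ?M = "reduce_mod A I" and ?u = "\<lambda>x. mod_ideal_prod A I +>\<^bsub>A\<^esub> x"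
  note A' = A.right_module_axioms
  have M: "right_module (R Quot I) ?M" by (rule right_module_reduce_mod[OF A'])
  interpret M: right_module "R Quot I" ?M by (rule M)
  note rM = right_module_restrict_scalars[OF M]
  have Q: "right_module (R Quot I) (regular (R Quot I))" by (rule right_module_regular[OF quotient_is_ring])
  note rQ = right_module_restrict_scalars[OF Q]
  note u = cover_reduce_mod[OF A']
  interpret u: rmod_morphism R A "restrict_scalars R I ?M" ?u by (rule rmod_morphismI[OF A' rM coverD(1)[OF u]])
  have selfI: "I +> a = I \<longleftrightarrow> a \<in> I" if "a \<in> carrier R" for a
    using a_rcos_const a_coset_join1[OF _ that a_subgroup] by blast
  have "\<exists>g. g \<in> rmod_hom (R Quot I) ?M (regular (R Quot I)) \<and> (\<forall>x\<in>carrier A. g (?u x) = I +> \<phi> b x)" if b: "b \<in> B" for b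
  proof -
    have h: "(\<lambda>x. I +> \<phi> b x) \<in> rmod_hom R A (restrict_scalars R I (regular (R Quot I)))"
      by (rule rmod_homI)
        (use A.\<phi>_closed[OF b] rmod_hom_add[OF A.\<phi>_hom[OF b]] rmod_hom_act[OF A.\<phi>_hom[OF b]] in
          \<open>auto simp: quot_mem quot_simps\<close>)
    have k: "I +> \<phi> b x = \<zero>\<^bsub>restrict_scalars R I (regular (R Quot I))\<^esub>"
      if x: "x \<in> carrier A" "?u x = \<zero>\<^bsub>restrict_scalars R I ?M\<^esub>" for x
      using A.functional_mod_ideal_prod[OF ideal_axioms b, of x] coverD(3)[OF u x(1)] x(2) selfI[OF A.\<phi>_closed[OF b x(1)]]
      by (simp add: FactRing_def)
    obtain g where g: "g \<in> rmod_hom R (restrict_scalars R I ?M) (restrict_scalars R I (regular (R Quot I)))"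
      "\<And>x. x \<in> carrier A \<Longrightarrow> g (?u x) = I +> \<phi> b x"
      using hom_factor[OF A' rM rQ coverD(1,2)[OF u] h k] by metis
    then show ?thesis unfolding restrict_scalars_hom by (intro exI[of _ g]) simp
  qed
  then obtain g where g: "\<And>b. b \<in> B \<Longrightarrow> g b \<in> rmod_hom (R Quot I) ?M (regular (R Quot I))"
    "\<And>b x. \<lbrakk>b \<in> B; x \<in> carrier A\<rbrakk> \<Longrightarrow> g b (?u x) = I +> \<phi> b x" by metis
  have "dual_basis (R Quot I) ?M B (\<lambda>b. ?u (y b)) g"
  proof (intro dual_basis.intro[OF M] dual_basis_axioms.intro g(1))
    show "?u (y b) \<in> carrier ?M" if "b \<in> B" for b using u.closed[OF A.y_closed[OF that]] by simp
    fix X assume "X \<in> carrier ?M"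
    then obtain x where x: "x \<in> carrier A" "X = ?u x" unfolding reduce_mod_simps[OF A'] by blast
    let ?S = "{b \<in> B. \<phi> b x \<noteq> \<zero>}"
    have zero: "I +> \<zero> = \<zero>\<^bsub>R Quot I\<^esub>" by (rule quot_simps(3)[symmetric])
    \<comment> \<open>Coordinates may become zero modulo \<open>I\<close>, so the support can
      shrink; the expansion is computed over the old support.\<close>
    have sub: "{b \<in> B. g b X \<noteq> \<zero>\<^bsub>R Quot I\<^esub>} \<subseteq> ?S" using g(2)[OF _ x(1)] x(2) zero by auto
    show "finite {b \<in> B. g b X \<noteq> \<zero>\<^bsub>R Quot I\<^esub>}" by (rule finite_subset[OF sub A.finite_support[OF x(1)]])
    have c: "g b X \<odot>\<^bsub>?M\<^esub> ?u (y b) \<in> carrier ?M" if "b \<in> B" for b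
      using M.act_closed[OF quot_mem[OF A.\<phi>_closed[OF that x(1)]], of "?u (y b)"] u.closed[OF A.y_closed[OF that]] g(2)[OF that x(1)] x(2)
      by simp
    have "finsum ?M (\<lambda>b. g b X \<odot>\<^bsub>?M\<^esub> ?u (y b)) {b \<in> B. g b X \<noteq> \<zero>\<^bsub>R Quot I\<^esub>} = finsum ?M (\<lambda>b. g b X \<odot>\<^bsub>?M\<^esub> ?u (y b)) ?S"
    proof (rule M.M.add.finprod_mono_neutral_cong_left[OF A.finite_support[OF x(1)] sub])
      fix b assume "b \<in> ?S - {b \<in> B. g b X \<noteq> \<zero>\<^bsub>R Quot I\<^esub>}"
      then have "g b X = \<zero>\<^bsub>R Quot I\<^esub>" "b \<in> B" by auto
      then show "g b X \<odot>\<^bsub>?M\<^esub> ?u (y b) = \<zero>\<^bsub>?M\<^esub>" using u.closed[OF A.y_closed] by simp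
    qed (use c in auto)
    also have "\<dots> = finsum ?M (\<lambda>b. ?u (\<phi> b x \<odot>\<^bsub>A\<^esub> y b)) ?S"
      by (rule M.M.finsum_cong')
        (use u.act[OF A.\<phi>_closed[OF _ x(1)] A.y_closed] u.closed[OF A.act_closed[OF A.\<phi>_closed[OF _ x(1)] A.y_closed]] g(2)[OF _ x(1)] x(2) in auto)
    also have "\<dots> = ?u (finsum A (\<lambda>b. \<phi> b x \<odot>\<^bsub>A\<^esub> y b) ?S)"
      using u.finsum[of "\<lambda>b. \<phi> b x \<odot>\<^bsub>A\<^esub> y b" ?S] A.act_closed[OF A.\<phi>_closed[OF _ x(1)] A.y_closed]
      by (simp add: finsum_restrict_scalars Pi_iff)
    also have "\<dots> = X" using A.expand[OF x(1)] x(2) by simp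
    finally show "finsum ?M (\<lambda>b. g b X \<odot>\<^bsub>?M\<^esub> ?u (y b)) {b \<in> B. g b X \<noteq> \<zero>\<^bsub>R Quot I\<^esub>} = X" .
  qed
  then show ?thesis by (rule dual_basis.projective)
qed

text \<open>The last assumption says that \<open>S\<close> and \<open>AI\<close> together generate
  \<open>A\<close>. Submodules of the reduction pull back to submodules containing
  \<open>AI\<close>.\<close>

lemma fin_gen_reduce_mod:
  assumes A: "right_module R A" and S: "finite S" "S \<subseteq> carrier A"
    and gen: "\<And>H x. \<lbrakk>submodule H R A; S \<subseteq> H; mod_ideal_prod A I \<subseteq> H; x \<in> carrier A\<rbrakk> \<Longrightarrow> x \<in> H"
  shows "fin_gen (R Quot I) (reduce_mod A I)"
proof -
  let ?M = "reduce_mod A I" and ?u = "\<lambda>x. mod_ideal_prod A I +>\<^bsub>A\<^esub> x"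
  interpret A: module_ideal R A I by (intro module_ideal.intro A ideal_axioms)
  note M = right_module_reduce_mod[OF A] and u = cover_reduce_mod[OF A]
  interpret u: rmod_morphism R A "restrict_scalars R I ?M" ?u
    by (rule rmod_morphismI[OF A right_module_restrict_scalars[OF M] coverD(1)[OF u]])
  have "generated_by (R Quot I) ?M (?u ` S)"
  proof (rule generated_byI)
    show "?u ` S \<subseteq> carrier ?M" using S(2) u.closed by auto
    fix K X assume K: "submodule K (R Quot I) ?M" "?u ` S \<subseteq> K" and X: "X \<in> carrier ?M"
    then obtain x where x: "x \<in> carrier A" "X = ?u x" unfolding reduce_mod_simps[OF A] by blast
    note K' = restrict_scalars_submodule[OF M K(1)]
    have "x \<in> {x \<in> carrier A. ?u x \<in> K}"
    proof (rule gen[OF u.submodule_vimage[OF K'] _ _ x(1)])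
      show "S \<subseteq> {x \<in> carrier A. ?u x \<in> K}" using S(2) K(2) by blast
      show "mod_ideal_prod A I \<subseteq> {x \<in> carrier A. ?u x \<in> K}"
      proof
        fix z assume z: "z \<in> mod_ideal_prod A I"
        then have zc: "z \<in> carrier A" by (rule A.submodule_mem[OF A.submodule_mod_ideal_prod])
        then have "?u z = \<zero>\<^bsub>restrict_scalars R I ?M\<^esub>" using coverD(3)[OF u zc] z by blast
        then show "z \<in> {x \<in> carrier A. ?u x \<in> K}" using zc u.N.submodule_zero[OF K'] by simp
      qed
    qed
    then show "X \<in> K" using x(2) by simp
  qed
  then show ?thesis using S(1) unfolding fin_gen_def by blast
qed

end

text \<open>An isomorphism and its inverse both respect the products with \<open>I\<close>, so the
  kernels correspond.\<close>

lemma cover_precompose: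
  assumes u: "cover R I A W u" and A: "right_module R A" and A': "right_module R A'" and I: "ideal I R"
    and iso: "rmod_iso R A' A"
  shows "\<exists>u'. cover R I A' W u'"
proof -
  obtain f g where f: "f \<in> rmod_hom R A' A" and g: "g \<in> rmod_hom R A A'"
    and gf: "\<And>x. x \<in> carrier A' \<Longrightarrow> g (f x) = x" and fg: "\<And>y. y \<in> carrier A \<Longrightarrow> f (g y) = y"
    by (rule rmod_isoE[OF iso A']) blast
  have "cover R I A' W (\<lambda>x. u (f x))" unfolding cover_def
  proof (intro conjI ballI)
    show "(\<lambda>x. u (f x)) \<in> rmod_hom R A' W" by (rule rmod_hom_comp[OF f coverD(1)[OF u]])
    have "f ` carrier A' = carrier A"
    proof (intro equalityI subsetI)
      fix y assume "y \<in> carrier A"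
      then show "y \<in> f ` carrier A'" using fg[of y] rmod_hom_closed[OF g, of y] by (intro image_eqI[of _ _ "g y"]) auto
    qed (use rmod_hom_closed[OF f] in auto)
    then show "(\<lambda>x. u (f x)) ` carrier A' = carrier W" using coverD(2)[OF u] by (metis image_image)
    fix x assume x: "x \<in> carrier A'"
    have fx: "f x \<in> carrier A" by (rule rmod_hom_closed[OF f x])
    have "f x \<in> mod_ideal_prod A I \<longleftrightarrow> x \<in> mod_ideal_prod A' I"
      using rmod_hom_mod_ideal_prod[OF A' A I f, of x] rmod_hom_mod_ideal_prod[OF A A' I g, of "f x"] gf[OF x] by auto
    then show "u (f x) = \<zero>\<^bsub>W\<^esub> \<longleftrightarrow> x \<in> mod_ideal_prod A' I" using coverD(3)[OF u fx] by simp
  qed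
  then show ?thesis by blast
qed

lemma mod_ideal_prod_module_sum:
  assumes I: "ideal I R" and A: "right_module R A" and B: "right_module R B" and p: "p \<in> carrier (module_sum A B)"
  shows "p \<in> mod_ideal_prod (module_sum A B) I \<longleftrightarrow> fst p \<in> mod_ideal_prod A I \<and> snd p \<in> mod_ideal_prod B I"
proof
  have AB: "right_module R (module_sum A B)" by (rule right_module_module_sum[OF A B])
  {
    assume "p \<in> mod_ideal_prod (module_sum A B) I"
    then show "fst p \<in> mod_ideal_prod A I \<and> snd p \<in> mod_ideal_prod B I"
      using rmod_hom_mod_ideal_prod[OF AB A I rmod_hom_fst] rmod_hom_mod_ideal_prod[OF AB B I rmod_hom_snd] by blast
  next
    assume *: "fst p \<in> mod_ideal_prod A I \<and> snd p \<in> mod_ideal_prod B I"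
    interpret AB: module_ideal R "module_sum A B" I by (intro module_ideal.intro AB I)
    interpret A: right_module R A by (rule A)
    interpret B: right_module R B by (rule B)
    have "(fst p, \<zero>\<^bsub>B\<^esub>) \<oplus>\<^bsub>module_sum A B\<^esub> (\<zero>\<^bsub>A\<^esub>, snd p) \<in> mod_ideal_prod (module_sum A B) I"
      using * rmod_hom_mod_ideal_prod[OF A AB I rmod_hom_inl[OF A B]] rmod_hom_mod_ideal_prod[OF B AB I rmod_hom_inr[OF A B]]
      by (intro AB.submodule_add[OF AB.submodule_mod_ideal_prod]) auto
    then show "p \<in> mod_ideal_prod (module_sum A B) I" using p by auto
  }
qed

lemma cover_module_sum:
  assumes I: "ideal I R" and A: "right_module R A" and B: "right_module R B"
    and u: "cover R I A W u" and v: "cover R I B W' v"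
  shows "cover R I (module_sum A B) (module_sum W W') (\<lambda>p. (u (fst p), v (snd p)))"
  unfolding cover_def
proof (intro conjI ballI)
  show "(\<lambda>p. (u (fst p), v (snd p))) \<in> rmod_hom R (module_sum A B) (module_sum W W')"
    by (rule rmod_hom_Pair[OF rmod_hom_comp[OF rmod_hom_fst coverD(1)[OF u]] rmod_hom_comp[OF rmod_hom_snd coverD(1)[OF v]]])
  show "(\<lambda>p. (u (fst p), v (snd p))) ` carrier (module_sum A B) = carrier (module_sum W W')"
  proof (intro equalityI subsetI)
    fix q assume "q \<in> carrier (module_sum W W')"
    then have "fst q \<in> u ` carrier A" "snd q \<in> v ` carrier B"
      unfolding coverD(2)[OF u] coverD(2)[OF v] by auto
    then obtain a b where "a \<in> carrier A" "b \<in> carrier B" "fst q = u a" "snd q = v b" by blast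
    then show "q \<in> (\<lambda>p. (u (fst p), v (snd p))) ` carrier (module_sum A B)"
      by (intro image_eqI[of _ _ "(a, b)"]) (auto simp: prod_eq_iff)
  qed (use rmod_hom_closed[OF coverD(1)[OF u]] rmod_hom_closed[OF coverD(1)[OF v]] in auto)
  fix p assume p: "p \<in> carrier (module_sum A B)"
  then show "(u (fst p), v (snd p)) = \<zero>\<^bsub>module_sum W W'\<^esub> \<longleftrightarrow> p \<in> mod_ideal_prod (module_sum A B) I"
    using mod_ideal_prod_module_sum[OF I A B p] coverD(3)[OF u, of "fst p"] coverD(3)[OF v, of "snd p"] by auto
qed

lemma restrict_scalars_module_sum:
  "restrict_scalars R I (module_sum M N) = module_sum (restrict_scalars R I M) (restrict_scalars R I N)"
  by (simp add: restrict_scalars_def module_sum_def fun_eq_iff split_beta)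

lemma rmod_iso_module_sum:
  assumes "rmod_iso R M M'" "rmod_iso R N N'" and M: "right_module R M" and N: "right_module R N"
  shows "rmod_iso R (module_sum M N) (module_sum M' N')"
proof -
  obtain f f' where f: "f \<in> rmod_hom R M M'" "f' \<in> rmod_hom R M' M"
    "\<And>x. x \<in> carrier M \<Longrightarrow> f' (f x) = x" "\<And>y. y \<in> carrier M' \<Longrightarrow> f (f' y) = y" by (rule rmod_isoE[OF assms(1) M]) blast
  obtain g g' where g: "g \<in> rmod_hom R N N'" "g' \<in> rmod_hom R N' N"
    "\<And>x. x \<in> carrier N \<Longrightarrow> g' (g x) = x" "\<And>y. y \<in> carrier N' \<Longrightarrow> g (g' y) = y" by (rule rmod_isoE[OF assms(2) N]) blast
  show ?thesis
    by (rule rmod_isoI[where f = "\<lambda>p. (f (fst p), g (snd p))" and g = "\<lambda>p. (f' (fst p), g' (snd p))"])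
      (auto simp: f(3,4) g(3,4) intro!: rmod_hom_Pair rmod_hom_comp[OF rmod_hom_fst] rmod_hom_comp[OF rmod_hom_snd] f(1,2) g(1,2))
qed

subsection \<open>Monoids of isomorphism classes\<close>

context ring
begin

lemma iso_class_cong:
  assumes "rmod_iso R P Q" "right_module R P"
  shows "iso_class R P = iso_class R Q"
proof -
  note sym = rmod_iso_sym[OF assms]
  show ?thesis unfolding iso_class_def
    using rmod_iso_trans[OF _ assms(1)] rmod_iso_trans[OF _ sym] by blast
qed

lemma mem_iso_class: "right_module R (M :: 'a univ_module) \<Longrightarrow> M \<in> iso_class R M"
  by (simp add: iso_class_def rmod_iso_refl)

lemma iso_class_eqD:
  fixes M :: "'a univ_module"
  assumes "iso_class R M = iso_class R P" "right_module R M"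
  shows "rmod_iso R M P"
proof -
  have "M \<in> iso_class R P" using mem_iso_class[OF assms(2)] assms(1) by simp
  then show ?thesis by (simp add: iso_class_def)
qed

text \<open>A module of the universal type belongs to its own class, so it can serve as the
  representative.\<close>

lemma iso_class_add_univ:
  fixes P Q :: "'a univ_module"
  assumes P: "right_module R P" and Q: "right_module R Q"
  shows "iso_class_add R (iso_class R P) (iso_class R Q) = iso_class R (module_sum P Q)"
proof (intro equalityI subsetI)
  fix M assume "M \<in> iso_class_add R (iso_class R P) (iso_class R Q)"
  then obtain P' Q' where M: "right_module R M" "rmod_iso R M (module_sum P' Q')" and P': "P' \<in> iso_class R P" and Q': "Q' \<in> iso_class R Q"
    unfolding iso_class_add_def by blast
  have "rmod_iso R (module_sum P' Q') (module_sum P Q)"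
    using P' Q' by (intro rmod_iso_module_sum) (auto simp: iso_class_def)
  from rmod_iso_trans[OF M(2) this] show "M \<in> iso_class R (module_sum P Q)" using M(1) by (simp add: iso_class_def)
next
  fix M assume "M \<in> iso_class R (module_sum P Q)"
  then show "M \<in> iso_class_add R (iso_class R P) (iso_class R Q)"
    unfolding iso_class_add_def using mem_iso_class[OF P] mem_iso_class[OF Q] by (auto simp: iso_class_def)
qed

text \<open>Gives access to isomorphism classes, whose members have the universal type, from modules
  of any type.\<close>

lemma univ_copy:
  assumes P: "right_module R P" "countably_gen R P"
  obtains M :: "'a univ_module" where "right_module R M" "rmod_iso R M P" "rmod_iso R P M" "countably_gen R M"
    "iso_class R P = iso_class R M"
proof -
  obtain M :: "'a univ_module" where M: "right_module R M" "rmod_iso R M P"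
    using countably_gen_univ_copy[OF P] by blast
  note PM = rmod_iso_sym[OF M(2,1)]
  have "countably_gen R M" using PM countably_gen_image[OF P(1) M(1) _ _ P(2)] unfolding rmod_iso_def bij_betw_def by blast
  then show ?thesis using that[OF M PM] iso_class_cong[OF PM P(1)] by blast
qed

lemma iso_class_add:
  assumes P: "right_module R P" "countably_gen R P" and Q: "right_module R Q" "countably_gen R Q"
  shows "iso_class_add R (iso_class R P) (iso_class R Q) = iso_class R (module_sum P Q)"
proof -
  obtain P' :: "'a univ_module" where P': "right_module R P'" "rmod_iso R P P'" "iso_class R P = iso_class R P'"
    by (rule univ_copy[OF P]) blast
  obtain Q' :: "'a univ_module" where Q': "right_module R Q'" "rmod_iso R Q Q'" "iso_class R Q = iso_class R Q'"
    by (rule univ_copy[OF Q]) blast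
  show ?thesis
    unfolding P'(3) Q'(3) iso_class_add_univ[OF P'(1) Q'(1)]
    by (rule iso_class_cong[OF rmod_iso_module_sum[OF P'(2) Q'(2) P(1) Q(1)] right_module_module_sum[OF P(1) Q(1)], symmetric])
qed

text \<open>The unit of the monoids is given as the set of all zero modules; this recognises it as
  an isomorphism class.\<close>

lemma iso_class_zero:
  assumes P: "right_module R P" "carrier P = {\<zero>\<^bsub>P\<^esub>}"
  shows "iso_class R P = {M. right_module R M \<and> carrier M = {\<zero>\<^bsub>M\<^esub>}}"
proof (intro equalityI subsetI)
  interpret P: right_module R P by (rule P(1))
  {
    fix M assume "M \<in> iso_class R P"
    then obtain f where M: "right_module R M" and f: "f \<in> rmod_hom R M P" "bij_betw f (carrier M) (carrier P)"
      by (auto simp: iso_class_def rmod_iso_def)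
    interpret f: rmod_morphism R M P f by (rule rmod_morphismI[OF M P(1) f(1)])
    have "x = \<zero>\<^bsub>M\<^esub>" if "x \<in> carrier M" for x
      using f(2) f.inj_iff f.closed[OF that] P(2) that by (auto simp: bij_betw_def)
    then show "M \<in> {M. right_module R M \<and> carrier M = {\<zero>\<^bsub>M\<^esub>}}" using M f.M.M.zero_closed by auto
  next
    fix M :: "'a univ_module" assume "M \<in> {M. right_module R M \<and> carrier M = {\<zero>\<^bsub>M\<^esub>}}"
    then have M: "right_module R M" "carrier M = {\<zero>\<^bsub>M\<^esub>}" by auto
    interpret M: right_module R M by (rule M(1))
    have "rmod_iso R M P"
      by (rule rmod_isoI[OF rmod_hom_zero[OF P(1)] rmod_hom_zero[OF M(1)]]) (use M(2) P(2) in auto)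
    then show "M \<in> iso_class R P" using M(1) by (simp add: iso_class_def)
  }
qed

lemma zero_module_projective:
  assumes P: "right_module R P" "carrier P = {\<zero>\<^bsub>P\<^esub>}"
  shows "projective R P" "fin_gen R P"
proof -
  interpret P: right_module R P by (rule P(1))
  have "dual_basis R P ({} :: nat set) (\<lambda>_. \<zero>\<^bsub>P\<^esub>) (\<lambda>_ _. \<zero>)"
    by (intro dual_basis.intro[OF P(1)] dual_basis_axioms.intro) (use P(2) in auto)
  then show "projective R P" by (rule dual_basis.projective)
  have "generated_by R P {}"
    by (rule generated_byI) (use P(2) P.submodule_zero in auto)
  then show "fin_gen R P" unfolding fin_gen_def by blast
qed

section \<open>Isomorphisms between direct sums\<close>

lemma direct_sum_insert_iso:
  assumes M: "\<And>i. i \<in> insert t T \<Longrightarrow> right_module R (M i)" and t: "t \<notin> T"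
  shows "rmod_iso R (direct_sum (insert t T) M) (module_sum (M t) (direct_sum T M))"
proof (rule rmod_isoI[where f = "\<lambda>f. (f t, \<lambda>i\<in>T. f i)" and g = "\<lambda>p. \<lambda>i\<in>insert t T. if i = t then fst p else snd p i"])
  show "(\<lambda>f. (f t, \<lambda>i\<in>T. f i)) \<in> rmod_hom R (direct_sum (insert t T) M) (module_sum (M t) (direct_sum T M))"
  proof (rule rmod_hom_Pair[OF rmod_hom_proj[where M = M]])
    show "(\<lambda>f. \<lambda>i\<in>T. f i) \<in> rmod_hom R (direct_sum (insert t T) M) (direct_sum T M)"
    proof (rule rmod_homI)
      fix f assume f: "f \<in> carrier (direct_sum (insert t T) M)"
      show "(\<lambda>i\<in>T. f i) \<in> carrier (direct_sum T M)"
        by (rule direct_sumI[OF _ _ direct_sum_finite[OF f]]) (use direct_sum_closed[OF f] in auto)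
    qed (auto simp: fun_eq_iff restrict_def)
  qed simp
  show "(\<lambda>p. \<lambda>i\<in>insert t T. if i = t then fst p else snd p i) \<in> rmod_hom R (module_sum (M t) (direct_sum T M)) (direct_sum (insert t T) M)"
  proof (rule rmod_homI)
    fix p assume "p \<in> carrier (module_sum (M t) (direct_sum T M))"
    then have p: "fst p \<in> carrier (M t)" "snd p \<in> carrier (direct_sum T M)" by auto
    show "(\<lambda>i\<in>insert t T. if i = t then fst p else snd p i) \<in> carrier (direct_sum (insert t T) M)"
      by (rule direct_sumI[where A = "insert t {i \<in> T. snd p i \<noteq> \<zero>\<^bsub>M i\<^esub>}"])
        (use p direct_sum_closed[OF p(2)] direct_sum_finite[OF p(2)] in auto)
  qed (use t in \<open>auto simp: fun_eq_iff restrict_def\<close>)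
  show "(\<lambda>i\<in>insert t T. if i = t then fst (f t, \<lambda>i\<in>T. f i) else snd (f t, \<lambda>i\<in>T. f i) i) = f"
    if "f \<in> carrier (direct_sum (insert t T) M)" for f
    by (rule extensionalityI[of _ "insert t T"]) (use that in \<open>auto simp: direct_sum_carrier PiE_iff\<close>)
  show "((\<lambda>i\<in>insert t T. if i = t then fst p else snd p i) t, \<lambda>j\<in>T. (\<lambda>i\<in>insert t T. if i = t then fst p else snd p i) j) = p"
    if "p \<in> carrier (module_sum (M t) (direct_sum T M))" for p
  proof (rule prod_eqI)
    have "snd p \<in> extensional T" using that by (auto simp: direct_sum_carrier PiE_iff)
    then show "snd ((\<lambda>i\<in>insert t T. if i = t then fst p else snd p i) t, \<lambda>j\<in>T. (\<lambda>i\<in>insert t T. if i = t then fst p else snd p i) j) = snd p"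
      using t by (auto simp: fun_eq_iff restrict_def extensional_def)
  qed simp
qed

lemma direct_sum_empty_carrier: "carrier (direct_sum {} M) = {\<zero>\<^bsub>direct_sum {} M\<^esub>}"
  by (auto simp: direct_sum_carrier restrict_def)

text \<open>The positions from \<open>m\<close> on are shifted down by \<open>m\<close>.\<close>

lemma copies_add_iso:
  assumes Q: "right_module R Q"
  shows "rmod_iso R (copies {..<m + n} Q) (module_sum (copies {..<m} Q) (copies {..<n :: nat} Q))"
proof (rule rmod_isoI[where f = "\<lambda>f. (\<lambda>i\<in>{..<m}. f i, \<lambda>i\<in>{..<n}. f (m + i))"
      and g = "\<lambda>p. \<lambda>i\<in>{..<m + n}. if i < m then fst p i else snd p (i - m)"])
  have fin: "f \<in> carrier (copies {..<n :: nat} Q) \<longleftrightarrow> f \<in> ({..<n} \<rightarrow>\<^sub>E carrier Q)" for f n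
    by (simp add: copies_def direct_sum_carrier)
  show "(\<lambda>f. (\<lambda>i\<in>{..<m}. f i, \<lambda>i\<in>{..<n}. f (m + i))) \<in> rmod_hom R (copies {..<m + n} Q) (module_sum (copies {..<m} Q) (copies {..<n} Q))"
    by (rule rmod_homI) (auto simp: fin PiE_iff, auto simp: copies_def fun_eq_iff restrict_def)
  show "(\<lambda>p. \<lambda>i\<in>{..<m + n}. if i < m then fst p i else snd p (i - m)) \<in> rmod_hom R (module_sum (copies {..<m} Q) (copies {..<n} Q)) (copies {..<m + n} Q)"
    by (rule rmod_homI) (auto simp: fin PiE_iff, auto simp: copies_def fun_eq_iff restrict_def)
  show "(\<lambda>i\<in>{..<m + n}. if i < m then fst (\<lambda>i\<in>{..<m}. f i, \<lambda>i\<in>{..<n}. f (m + i)) i else snd (\<lambda>i\<in>{..<m}. f i, \<lambda>i\<in>{..<n}. f (m + i)) (i - m)) = f"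
    if "f \<in> carrier (copies {..<m + n} Q)" for f
    using that by (auto simp: fin PiE_iff extensional_def fun_eq_iff restrict_def)
  show "(\<lambda>j\<in>{..<m}. (\<lambda>i\<in>{..<m + n}. if i < m then fst p i else snd p (i - m)) j, \<lambda>j\<in>{..<n}. (\<lambda>i\<in>{..<m + n}. if i < m then fst p i else snd p (i - m)) (m + j)) = p"
    if "p \<in> carrier (module_sum (copies {..<m} Q) (copies {..<n} Q))" for p
    using that by (intro prod_eqI) (auto simp: fin PiE_iff extensional_def fun_eq_iff restrict_def)
qed

lemma direct_sum_iso_cong:
  assumes M: "\<And>t. t \<in> T \<Longrightarrow> right_module R (M t)" and N: "\<And>t. t \<in> T \<Longrightarrow> right_module R (N t)"
    and iso: "\<And>t. t \<in> T \<Longrightarrow> rmod_iso R (M t) (N t)"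
  shows "rmod_iso R (direct_sum T M) (direct_sum T N)"
proof -
  have "\<exists>f g. f \<in> rmod_hom R (M t) (N t) \<and> g \<in> rmod_hom R (N t) (M t) \<and>
    (\<forall>x\<in>carrier (M t). g (f x) = x) \<and> (\<forall>y\<in>carrier (N t). f (g y) = y)" if t: "t \<in> T" for t
    by (rule rmod_isoE[OF iso[OF t] M[OF t]]) blast
  then obtain f g where fg: "\<And>t. t \<in> T \<Longrightarrow> f t \<in> rmod_hom R (M t) (N t)" "\<And>t. t \<in> T \<Longrightarrow> g t \<in> rmod_hom R (N t) (M t)"
    "\<And>t x. \<lbrakk>t \<in> T; x \<in> carrier (M t)\<rbrakk> \<Longrightarrow> g t (f t x) = x" "\<And>t y. \<lbrakk>t \<in> T; y \<in> carrier (N t)\<rbrakk> \<Longrightarrow> f t (g t y) = y" by metis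
  have ext: "h \<in> extensional T" if "h \<in> carrier (direct_sum T L)" for h and L :: "'c \<Rightarrow> ('a, 'x, 'y) module_scheme"
    using that by (simp add: direct_sum_carrier PiE_iff)
  have ext': "h \<in> extensional T" if "h \<in> carrier (direct_sum T L)" for h and L :: "'c \<Rightarrow> ('a, 'z, 'w) module_scheme"
    using that by (simp add: direct_sum_carrier PiE_iff)
  show ?thesis
  proof (rule rmod_isoI[OF rmod_hom_direct_sum_map[OF M N fg(1)] rmod_hom_direct_sum_map[OF N M fg(2)]])
    show "(\<lambda>i\<in>T. g i ((\<lambda>i\<in>T. f i (h i)) i)) = h" if h: "h \<in> carrier (direct_sum T M)" for h
      by (rule extensionalityI[of _ T]) (use h direct_sum_closed[OF h] in \<open>auto simp: fg direct_sum_carrier PiE_iff\<close>)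
    show "(\<lambda>i\<in>T. f i ((\<lambda>i\<in>T. g i (h i)) i)) = h" if h: "h \<in> carrier (direct_sum T N)" for h
      by (rule extensionalityI[of _ T]) (use h direct_sum_closed[OF h] in \<open>auto simp: fg direct_sum_carrier PiE_iff\<close>)
  qed
qed

lemma direct_sum_module_sum_iso:
  assumes M: "\<And>t. t \<in> T \<Longrightarrow> right_module R (M t)" and N: "\<And>t. t \<in> T \<Longrightarrow> right_module R (N t)"
  shows "rmod_iso R (direct_sum T (\<lambda>t. module_sum (M t) (N t))) (module_sum (direct_sum T M) (direct_sum T N))"
proof (rule rmod_isoI[where f = "\<lambda>f. (\<lambda>t\<in>T. fst (f t), \<lambda>t\<in>T. snd (f t))" and g = "\<lambda>p. \<lambda>t\<in>T. (fst p t, snd p t)"])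
  have MN: "right_module R (module_sum (M t) (N t))" if "t \<in> T" for t by (rule right_module_module_sum[OF M[OF that] N[OF that]])
  show "(\<lambda>f. (\<lambda>t\<in>T. fst (f t), \<lambda>t\<in>T. snd (f t))) \<in> rmod_hom R (direct_sum T (\<lambda>t. module_sum (M t) (N t))) (module_sum (direct_sum T M) (direct_sum T N))"
    by (rule rmod_hom_Pair[OF rmod_hom_direct_sum_map[where u = "\<lambda>_. fst", OF MN M rmod_hom_fst]
        rmod_hom_direct_sum_map[where u = "\<lambda>_. snd", OF MN N rmod_hom_snd]])
  show "(\<lambda>p. \<lambda>t\<in>T. (fst p t, snd p t)) \<in> rmod_hom R (module_sum (direct_sum T M) (direct_sum T N)) (direct_sum T (\<lambda>t. module_sum (M t) (N t)))"
  proof (rule rmod_homI)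
    fix p assume "p \<in> carrier (module_sum (direct_sum T M) (direct_sum T N))"
    then have p: "fst p \<in> carrier (direct_sum T M)" "snd p \<in> carrier (direct_sum T N)" by auto
    show "(\<lambda>t\<in>T. (fst p t, snd p t)) \<in> carrier (direct_sum T (\<lambda>t. module_sum (M t) (N t)))"
      by (rule direct_sumI[where A = "{t \<in> T. fst p t \<noteq> \<zero>\<^bsub>M t\<^esub>} \<union> {t \<in> T. snd p t \<noteq> \<zero>\<^bsub>N t\<^esub>}"])
        (use direct_sum_closed[OF p(1)] direct_sum_closed[OF p(2)] direct_sum_finite[OF p(1)] direct_sum_finite[OF p(2)] in auto)
  qed (auto simp: fun_eq_iff restrict_def)
  show "(\<lambda>t\<in>T. (fst (\<lambda>t\<in>T. fst (f t), \<lambda>t\<in>T. snd (f t)) t, snd (\<lambda>t\<in>T. fst (f t), \<lambda>t\<in>T. snd (f t)) t)) = f"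
    if "f \<in> carrier (direct_sum T (\<lambda>t. module_sum (M t) (N t)))" for f
    by (rule extensionalityI[of _ T]) (use that in \<open>auto simp: direct_sum_carrier PiE_iff\<close>)
  show "(\<lambda>t\<in>T. fst ((\<lambda>t\<in>T. (fst p t, snd p t)) t), \<lambda>t\<in>T. snd ((\<lambda>t\<in>T. (fst p t, snd p t)) t)) = p"
    if "p \<in> carrier (module_sum (direct_sum T M) (direct_sum T N))" for p
    using that by (intro prod_eqI) (auto simp: direct_sum_carrier PiE_iff extensional_def fun_eq_iff restrict_def)
qed

end

section \<open>One finitely generated projective module for each simple module\<close>

locale diagonal_projectives = semilocal_ring R k V
  for R :: "('a, 'r) ring_scheme" (structure) and k :: nat and V :: "nat \<Rightarrow> ('a, 'v) module" +
  fixes Ps :: "nat \<Rightarrow> ('a, 'p) module"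
  assumes Ps_fin_gen: "i \<in> {1..k} \<Longrightarrow> fin_gen R (Ps i)"
    and Ps_projective: "i \<in> {1..k} \<Longrightarrow> projective R (Ps i)"
    and Ps_Phi: "i \<in> {1..k} \<Longrightarrow> Phi R k V (trace_ideal R (Ps i)) = {i}"
begin

lemma Ps_module: "i \<in> {1..k} \<Longrightarrow> right_module R (Ps i)"
  by (rule projective_right_module[OF Ps_projective])

lemma Ps_countably_gen: "i \<in> {1..k} \<Longrightarrow> countably_gen R (Ps i)"
  by (rule fin_gen_imp_countably_gen[OF Ps_fin_gen])

lemma Ps_supp: "i \<in> {1..k} \<Longrightarrow> hom_supp (Ps i) = {i}"
  using Phi_trace[OF Ps_projective Ps_countably_gen] Ps_Phi by simp

lemma Ps_dim:
  assumes i: "i \<in> {1..k}"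
  obtains n where "n > 0" "dim_vec R k V (Ps i) i = enat n"
proof -
  have "dim_vec R k V (Ps i) i \<noteq> \<infinity>" by (rule fin_gen_dim_vec[OF Ps_module[OF i] Ps_fin_gen[OF i]])
  then obtain n where n: "dim_vec R k V (Ps i) i = enat n" by auto
  have "i \<in> hom_supp (Ps i)" unfolding Ps_supp[OF i] by simp
  then have "dim_vec R k V (Ps i) i \<noteq> 0"
    unfolding hom_supp_dim_vec[OF Ps_module[OF i] Ps_countably_gen[OF i]] supp_def by simp
  then have "n > 0" using n by (cases n) (simp_all add: zero_enat_def)
  then show ?thesis using n that by blast
qed

text \<open>These finite sums realise every subset of \<open>{1..k}\<close> as a set of simple
  quotients, hence as a value of \<open>Phi\<close>.\<close>

lemma Ps_sum:
  assumes X: "X \<subseteq> {1..k}"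
  shows "projective R (direct_sum X Ps)" "countably_gen R (direct_sum X Ps)" "hom_supp (direct_sum X Ps) = X"
proof -
  have X': "i \<in> {1..k}" if "i \<in> X" for i using X that by blast
  show "projective R (direct_sum X Ps)" by (rule projective_direct_sum[OF ring_axioms Ps_projective[OF X']])
  have cX: "countable X" by (rule countable_finite[OF finite_subset[OF X finite_atLeastAtMost]])
  show "countably_gen R (direct_sum X Ps)"
    by (rule countably_gen_direct_sum[OF ring_axioms Ps_module[OF X'] cX Ps_countably_gen[OF X']])
  have "hom_supp (direct_sum X Ps) = (\<Union>i\<in>X. hom_supp (Ps i))" by (rule hom_supp_direct_sum[OF Ps_module[OF X']])
  also have "\<dots> = (\<Union>i\<in>X. {i})" by (rule SUP_cong[OF refl Ps_supp[OF X']])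
  finally show "hom_supp (direct_sum X Ps) = X" by simp
qed

lemma trace_in_trace_ideals:
  assumes P: "projective R P" "countably_gen R P"
  shows "trace_ideal R P \<in> trace_ideals R"
proof -
  note P' = projective_right_module[OF P(1)]
  obtain Q :: "'a univ_module" where Q: "right_module R Q" "rmod_iso R Q P" "rmod_iso R P Q"
    by (rule univ_copy[OF P' P(2)])
  have pQ: "projective R Q" by (rule projective_iso[OF P(1) Q(3,1)])
  have "trace_ideal R Q = trace_ideal R P"
    unfolding trace_eq_iff[OF pQ P(1)] by (rule hom_supp_iso[OF Q(2,1)])
  then show ?thesis unfolding trace_ideals_def using pQ by blast
qed

lemma Ps_sum_trace:
  assumes X: "X \<subseteq> {1..k}"
  shows "trace_ideal R (direct_sum X Ps) \<in> trace_ideals R" "Phi R k V (trace_ideal R (direct_sum X Ps)) = X"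
  using trace_in_trace_ideals[OF Ps_sum(1,2)[OF X]] Phi_trace[OF Ps_sum(1,2)[OF X]] Ps_sum(3)[OF X] by simp_all

text \<open>The sum of the \<open>Ps i\<close> with the same simple quotients has the same trace. So
  every trace ideal, also one given by a module that is not countably generated, comes from a finite
  sum of the \<open>Ps i\<close>.\<close>

lemma trace_ideals_eq:
  assumes I: "I \<in> trace_ideals R"
  shows "I = trace_ideal R (direct_sum (Phi R k V I) Ps)" "Phi R k V I \<subseteq> {1..k}"
proof -
  obtain P :: "'a univ_module" where P: "projective R P" "I = trace_ideal R P"
    using I unfolding trace_ideals_def by blast
  have X: "hom_supp P \<subseteq> {1..k}" by (rule hom_supp_subset)
  have e: "I = trace_ideal R (direct_sum (hom_supp P) Ps)"
    unfolding P(2) trace_eq_iff[OF P(1) Ps_sum(1)[OF X]] Ps_sum(3)[OF X] ..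
  have Ph: "Phi R k V I = hom_supp P" unfolding e by (rule Ps_sum_trace(2)[OF X])
  show "I = trace_ideal R (direct_sum (Phi R k V I) Ps)" unfolding Ph by (rule e)
  show "Phi R k V I \<subseteq> {1..k}" unfolding Ph by (rule X)
qed

text \<open>\<open>Phi\<close> embeds the trace ideals into the power set of
  \<open>{1..k}\<close>.\<close>

lemma finite_trace_ideals: "finite (trace_ideals R)"
proof (rule inj_on_finite)
  show "inj_on (Phi R k V) (trace_ideals R)"
    by (rule inj_onI) (metis trace_ideals_eq(1))
  show "Phi R k V ` trace_ideals R \<subseteq> Pow {1..k}" using trace_ideals_eq(2) by blast
qed simp

text \<open>A common multiple \<open>N\<close> of the dimensions of the \<open>Ps i\<close> makes \<open>P\<^sup>N\<close> isomorphic to a direct sum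
  of copies of the \<open>Ps i\<close>, finitely many of them outside the trace ideal.\<close>

lemma quotient_trace_fin_gen:
  fixes P :: "('a, 'b, 'm) module_scheme"
  assumes P: "projective R P" "countably_gen R P" and I: "I \<in> trace_ideals R"
    and X: "Phi R k V I = inf_supp (dim_vec R k V P)"
  shows "\<exists>S. finite S \<and> S \<subseteq> carrier P \<and>
    (\<forall>H x. submodule H R P \<and> S \<subseteq> H \<and> mod_ideal_prod P I \<subseteq> H \<and> x \<in> carrier P \<longrightarrow> x \<in> H)"
proof -
  note P' = projective_right_module[OF P(1)]
  interpret P: right_module R P by (rule P')
  define X where "X = Phi R k V I"
  have Xk: "X \<subseteq> {1..k}" unfolding X_def by (rule trace_ideals_eq(2)[OF I])
  have I_eq: "I = trace_ideal R (direct_sum X Ps)" unfolding X_def by (rule trace_ideals_eq(1)[OF I])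
  have idI: "ideal I R" unfolding I_eq by (rule ideal_trace[OF projective_right_module[OF Ps_sum(1)[OF Xk]]])
  have "\<forall>i\<in>{1..k}. \<exists>n. n > 0 \<and> dim_vec R k V (Ps i) i = enat n"
  proof
    fix i assume "i \<in> {1..k}"
    then show "\<exists>n. n > 0 \<and> dim_vec R k V (Ps i) i = enat n" by (rule Ps_dim) blast
  qed
  from bchoice[OF this] obtain n where n: "\<And>i. i \<in> {1..k} \<Longrightarrow> n i > 0" "\<And>i. i \<in> {1..k} \<Longrightarrow> dim_vec R k V (Ps i) i = enat (n i)"
    by blast
  define N where "N = (\<Prod>i\<in>{1..k}. n i)"
  have N0: "N > 0" unfolding N_def using n(1) by (intro prod_pos) blast
  have nN: "n i dvd N" if "i \<in> {1..k}" for i unfolding N_def by (rule dvd_prodI) (use that in simp_all)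
  define m where "m i = the_enat (dim_vec R k V P i)" for i
  have m: "dim_vec R k V P i = enat (m i)" if "i \<notin> X" for i
    using that unfolding X_def X inf_supp_def m_def by (cases "dim_vec R k V P i") auto
  \<comment> \<open>The number of copies is chosen so that the \<open>i\<close>-th dimension becomes
    \<open>N\<close> times that of \<open>P\<close>. The division by \<open>n i\<close> is exact,
    and for \<open>i \<in> X\<close> infinitely many copies give \<infinity> on both sides.\<close>
  define C where "C i = (if i \<in> X then UNIV else {..<N div n i * m i} :: nat set)" for i
  let ?C = "\<lambda>i. copies (C i) (Ps i)"
  let ?E = "direct_sum {1..k} ?C"
  let ?PN = "copies {..<N} P"
  have Cp: "projective R (?C i)" if "i \<in> {1..k}" for i
    by (rule projective_copies[OF ring_axioms Ps_projective[OF that]])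
  note Cm = projective_right_module[OF Cp]
  have Ccg: "countably_gen R (?C i)" if "i \<in> {1..k}" for i
    unfolding copies_def by (rule countably_gen_direct_sum[OF ring_axioms Ps_module[OF that] _ Ps_countably_gen[OF that]]) simp
  have Cs: "hom_supp (?C i) \<subseteq> {i}" if "i \<in> {1..k}" for i
    unfolding copies_def hom_supp_direct_sum[OF Ps_module[OF that]] using Ps_supp[OF that] by blast
  have Ep: "projective R ?E" by (rule projective_direct_sum[OF ring_axioms Cp])
  note Em = projective_right_module[OF Ep]
  have Ecg: "countably_gen R ?E" by (rule countably_gen_direct_sum[OF ring_axioms Cm countable_finite[OF finite_atLeastAtMost] Ccg])
  have PNp: "projective R ?PN" by (rule projective_copies[OF ring_axioms P(1)])
  have PNcg: "countably_gen R ?PN"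
    unfolding copies_def by (rule countably_gen_direct_sum[OF ring_axioms P' _ P(2)]) simp
  have "rmod_iso R ?E ?PN"
  proof (rule projective_iso_of_dim_vec[OF Ep Ecg PNp PNcg])
    fix i assume i: "i \<in> {1..k}"
    have 1: "dim_vec R k V ?E i = ecard (C i) * enat (n i)"
      unfolding n(2)[OF i, symmetric]
    proof (rule trans)
      show "dim_vec R k V ?E i = dim_vec R k V (?C i) i" by (rule dim_vec_diagonal[where M = ?C, OF Cm Ccg Cs i])
      show "dim_vec R k V (?C i) i = ecard (C i) * dim_vec R k V (Ps i) i"
        by (rule dim_vec_copies[OF Ps_module[OF i] Ps_countably_gen[OF i] _ i]) simp
    qed
    have 2: "dim_vec R k V ?PN i = enat N * dim_vec R k V P i"
      unfolding dim_vec_copies[OF P' P(2) countable_finite[OF finite_lessThan] i] by (simp add: ecard_def)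
    show "dim_vec R k V ?E i = dim_vec R k V ?PN i"
    proof (cases "i \<in> X")
      case True
      then have inf: "dim_vec R k V P i = \<infinity>" unfolding X_def X inf_supp_def by blast
      have "enat (n i) \<noteq> 0" "enat N \<noteq> 0" using n(1)[OF i] N0 by (simp_all add: zero_enat_def)
      then show ?thesis using N0 unfolding 1 2 inf unfolding C_def if_P[OF True] by (simp add: ecard_def times_enat_def)
    next
      case False
      have "N div n i * m i * n i = N * m i" using nN[OF i] n(1)[OF i] by (auto simp: dvd_def)
      then show ?thesis unfolding 1 2 m[OF False] unfolding C_def if_not_P[OF False] by (simp add: ecard_def)
    qed
  qed
  then obtain g where g: "g \<in> rmod_hom R ?E ?PN" "g ` carrier ?E = carrier ?PN"
    unfolding rmod_iso_def bij_betw_def by blast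
  \<comment> \<open>Projecting \<open>P\<^sup>N\<close> to its first copy exhibits \<open>P\<close>
    as a quotient of the sum of the \<open>Ps i\<close>.\<close>
  define \<theta> where "\<theta> = (\<lambda>e. g e 0)"
  have pr: "(\<lambda>f. f 0) \<in> rmod_hom R ?PN P" unfolding copies_def
    by (rule rmod_hom_proj[where M = "\<lambda>_. P"]) (use N0 in simp)
  have \<theta>: "\<theta> \<in> rmod_hom R ?E P" unfolding \<theta>_def by (rule rmod_hom_comp[OF g(1) pr])
  interpret \<theta>: rmod_morphism R ?E P \<theta> by (rule rmod_morphismI[OF Em P' \<theta>])
  have surj: "\<exists>e\<in>carrier ?E. \<theta> e = x" if x: "x \<in> carrier P" for x
  proof -
    have "ds_single {..<N} (\<lambda>_. P) 0 x \<in> carrier ?PN" unfolding copies_def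
      by (rule rmod_hom_closed[OF rmod_hom_ds_single[where M = "\<lambda>_. P", OF P'] x]) (use N0 in simp)
    then obtain e where "e \<in> carrier ?E" "g e = ds_single {..<N} (\<lambda>_. P) 0 x" unfolding g(2)[symmetric] by force
    then show ?thesis using N0 by (intro bexI[of _ e]) (simp_all add: \<theta>_def ds_single_apply)
  qed
  define \<iota> where "\<iota> i c x = \<theta> (ds_single {1..k} ?C i (ds_single (C i) (\<lambda>_. Ps i) c x))" for i c x
  have \<iota>_hom: "\<iota> i c \<in> rmod_hom R (Ps i) P" if i: "i \<in> {1..k}" and c: "c \<in> C i" for i c
    unfolding \<iota>_def
    by (rule rmod_hom_comp[OF rmod_hom_comp[OF rmod_hom_ds_single[where M = "\<lambda>_. Ps i", OF Ps_module[OF i] c, folded copies_def]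
          rmod_hom_ds_single[where M = ?C, OF Cm i]] \<theta>])
  have "\<forall>i\<in>{1..k}. \<exists>S. finite S \<and> generated_by R (Ps i) S" using Ps_fin_gen unfolding fin_gen_def by blast
  from bchoice[OF this] obtain S where S: "\<And>i. i \<in> {1..k} \<Longrightarrow> finite (S i)" "\<And>i. i \<in> {1..k} \<Longrightarrow> generated_by R (Ps i) (S i)" by blast
  have Sc: "s \<in> carrier (Ps i)" if "i \<in> {1..k}" "s \<in> S i" for i s using S(2)[OF that(1)] that(2) unfolding generated_by_def by blast
  \<comment> \<open>Images of the generators of the finitely many copies outside \<open>X\<close>;
    the copies inside \<open>X\<close> are mapped into \<open>PI\<close>.\<close>
  let ?S = "\<Union>i\<in>{1..k} - X. \<Union>c\<in>C i. \<iota> i c ` S i"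
  have "finite ?S" using S(1) by (intro finite_UN_I) (auto simp: C_def)
  moreover have "?S \<subseteq> carrier P"
  proof
    fix z assume "z \<in> ?S"
    then obtain i c s where "i \<in> {1..k}" "c \<in> C i" "s \<in> S i" "z = \<iota> i c s" by blast
    then show "z \<in> carrier P" using rmod_hom_closed[OF \<iota>_hom Sc] by blast
  qed
  moreover have "x \<in> H" if H: "submodule H R P" "?S \<subseteq> H" "mod_ideal_prod P I \<subseteq> H" and x: "x \<in> carrier P" for H x
  proof -
    have \<iota>H: "\<iota> i c z \<in> H" if i: "i \<in> {1..k}" and c: "c \<in> C i" and z: "z \<in> carrier (Ps i)" for i c z
    proof (cases "i \<in> X")
      case True
      \<comment> \<open>The simple quotient \<open>V i\<close> of \<open>Ps i\<close> is shared by
        the module whose trace is \<open>I\<close>, so \<open>Ps i\<close> equals its product with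
        \<open>I\<close>.\<close>
      have "hom_supp (Ps i) \<subseteq> hom_supp (direct_sum X Ps)" unfolding Ps_supp[OF i] Ps_sum(3)[OF Xk] using True by simp
      then have "z \<in> mod_ideal_prod (Ps i) I"
        unfolding I_eq by (rule projective_eq_trace_product[OF Ps_projective[OF i] Ps_sum(1)[OF Xk] _ z])
      then show ?thesis using rmod_hom_mod_ideal_prod[OF Ps_module[OF i] P' idI \<iota>_hom[OF i c]] H(3) by blast
    next
      case False
      interpret \<iota>: rmod_morphism R "Ps i" P "\<iota> i c" by (rule rmod_morphismI[OF Ps_module[OF i] P' \<iota>_hom[OF i c]])
      have "z \<in> {z \<in> carrier (Ps i). \<iota> i c z \<in> H}"
        by (rule generated_byD[OF S(2)[OF i] \<iota>.submodule_vimage[OF H(1)] _ z])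
          (use False i c H(2) Sc[OF i] in blast)
      then show ?thesis by blast
    qed
    obtain e where e: "e \<in> carrier ?E" "\<theta> e = x" using surj[OF x] by blast
    note K = \<theta>.submodule_vimage[OF H(1)]
    have "e \<in> {e \<in> carrier ?E. \<theta> e \<in> H}"
    proof (rule direct_sum_submodule_eq[where M = ?C, OF ring_axioms Cm K _ e(1)])
      fix i f assume i: "i \<in> {1..k}" and f: "f \<in> carrier (?C i)"
      note s = rmod_hom_ds_single[where M = ?C, OF Cm i]
      interpret s: rmod_morphism R "?C i" ?E "ds_single {1..k} ?C i" by (rule rmod_morphismI[OF Cm[OF i] Em s])
      have "f \<in> {f \<in> carrier (?C i). ds_single {1..k} ?C i f \<in> {e \<in> carrier ?E. \<theta> e \<in> H}}"
      proof (rule direct_sum_submodule_eq[where M = "\<lambda>_. Ps i" and I = "C i", folded copies_def,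
            OF ring_axioms Ps_module[OF i] s.submodule_vimage[OF K] _ f])
        fix c z assume c: "c \<in> C i" and z: "z \<in> carrier (Ps i)"
        have a: "ds_single (C i) (\<lambda>_. Ps i) c z \<in> carrier (?C i)" unfolding copies_def
          by (rule rmod_hom_closed[OF rmod_hom_ds_single[where M = "\<lambda>_. Ps i", OF Ps_module[OF i] c] z])
        have b: "\<theta> (ds_single {1..k} ?C i (ds_single (C i) (\<lambda>_. Ps i) c z)) \<in> H"
          using \<iota>H[OF i c z] unfolding \<iota>_def .
        show "ds_single (C i) (\<lambda>_. Ps i) c z \<in> {f \<in> carrier (?C i). ds_single {1..k} ?C i f \<in> {e \<in> carrier ?E. \<theta> e \<in> H}}"
          using a b s.closed[OF a] by blast
      qed
      then show "ds_single {1..k} ?C i f \<in> {e \<in> carrier ?E. \<theta> e \<in> H}" by blast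
    qed
    then show "x \<in> H" using e(2) by blast
  qed
  ultimately show ?thesis by (intro exI[of _ ?S] conjI allI impI) (assumption, assumption, elim conjE)
qed

end

section \<open>Combinations of generators lifted from the quotient ring\<close>

definition combination :: "('a, 'g) module set \<Rightarrow> (('a, 'g) module \<Rightarrow> nat) \<Rightarrow> ('a, ('a, 'g) module \<Rightarrow> nat \<Rightarrow> 'g) module"
  where "combination T n = direct_sum T (\<lambda>Q. copies {..<n Q} Q)"

context ring
begin

context
  fixes T :: "('a, 'g) module set"
  assumes T: "\<And>Q. Q \<in> T \<Longrightarrow> right_module R Q"
begin

lemma copies_T_module: "Q \<in> T \<Longrightarrow> right_module R (copies {..<n :: nat} Q)"
  unfolding copies_def by (rule right_module_direct_sum[OF ring_axioms T])

lemma combination_module: "right_module R (combination T n)"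
  unfolding combination_def by (rule right_module_direct_sum[OF ring_axioms copies_T_module])

lemma combination_add:
  "rmod_iso R (combination T (\<lambda>Q. m Q + n Q)) (module_sum (combination T m) (combination T n))"
  unfolding combination_def
  by (rule rmod_iso_trans[OF direct_sum_iso_cong[where N = "\<lambda>Q. module_sum (copies {..<m Q} Q) (copies {..<n Q} Q)"]
        direct_sum_module_sum_iso])
    (use T in \<open>auto intro: copies_T_module right_module_module_sum copies_add_iso\<close>)

lemma combination_single:
  assumes Q: "Q \<in> T"
  shows "rmod_iso R (combination T (\<lambda>Q'. if Q' = Q then 1 else 0)) Q"
proof -
  let ?n = "\<lambda>Q'. if Q' = Q then 1 else 0 :: nat"
  let ?C = "\<lambda>Q'. copies {..<?n Q'} Q'"
  let ?e = "\<lambda>x. ds_single T ?C Q (ds_single {..<?n Q} (\<lambda>_. Q) 0 x)"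
  have 0: "0 \<in> {..<?n Q}" by simp
  have f: "(\<lambda>w. w Q 0) \<in> rmod_hom R (combination T ?n) Q"
    unfolding combination_def
    by (rule rmod_hom_comp[OF rmod_hom_proj[where M = ?C, OF Q] rmod_hom_proj[where M = "\<lambda>_. Q", OF 0, folded copies_def]])
  have e: "?e \<in> rmod_hom R Q (combination T ?n)"
    unfolding combination_def
    by (rule rmod_hom_comp[OF rmod_hom_ds_single[where M = "\<lambda>_. Q", OF T[OF Q] 0, folded copies_def]
          rmod_hom_ds_single[where M = ?C, OF copies_T_module Q]])
  show ?thesis
  proof (rule rmod_isoI[OF f e])
    show "?e x Q 0 = x" for x using Q by (simp add: ds_single_apply)
    fix w assume w: "w \<in> carrier (combination T ?n)"
    have wQ: "w Q 0 \<in> carrier Q" by (rule rmod_hom_closed[OF f w])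
    show "?e (w Q 0) = w"
    proof (rule direct_sum_eqI[of _ T ?C])
      show w': "w \<in> carrier (direct_sum T ?C)" using w by (simp add: combination_def)
      show e': "?e (w Q 0) \<in> carrier (direct_sum T ?C)" using rmod_hom_closed[OF e wQ] by (simp add: combination_def)
      fix Q' assume Q': "Q' \<in> T"
      show "?e (w Q 0) Q' = w Q'"
      proof (rule direct_sum_eqI[of _ "{..<?n Q'}" "\<lambda>_. Q'"])
        show "?e (w Q 0) Q' \<in> carrier (direct_sum {..<?n Q'} (\<lambda>_. Q'))"
          using direct_sum_closed[OF e' Q'] by (simp only: copies_def)
        show "w Q' \<in> carrier (direct_sum {..<?n Q'} (\<lambda>_. Q'))"
          using direct_sum_closed[OF w' Q'] by (simp only: copies_def)
        fix c assume "c \<in> {..<?n Q'}"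
        then have "Q' = Q" "c = 0" by (simp_all split: if_splits)
        then show "?e (w Q 0) Q' c = w Q' c" using Q by (simp add: ds_single_apply)
      qed
    qed
  qed
qed

text \<open>The classes of modules over the quotient ring that lift to a combination of elements of \<open>T\<close> form
  a submonoid containing the generators. Lifting is expressed by two covers of a common
  \<open>R\<close>-module, which avoids comparing isomorphism classes over different rings.\<close>

lemma reduce_mod_combination:
  assumes I: "ideal I R"
    and gen: "monoid_generated_by (V_monoid (R Quot I)) ((\<lambda>Q. iso_class (R Quot I) (reduce_mod Q I)) ` T)"
    and P: "right_module R P" "fin_gen (R Quot I) (reduce_mod P I)" "projective (R Quot I) (reduce_mod P I)"
  obtains n p q and W :: "('a, nat \<Rightarrow> 'a set) module" where "right_module R W" "cover R I P W p" "cover R I (combination T n) W q"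
proof -
  interpret I: ideal I R by (rule I)
  interpret Q: ring "R Quot I" by (rule I.quotient_is_ring)
  \<comment> \<open>The modules over \<open>R/I\<close> that are, up to isomorphism, the reduction
    of some combination.\<close>
  let ?good = "\<lambda>M :: 'a set univ_module. right_module (R Quot I) M \<and> fin_gen (R Quot I) M \<and> projective (R Quot I) M \<and>
     (\<exists>n q. cover R I (combination T n) (restrict_scalars R I M) q)"
  let ?H = "{iso_class (R Quot I) M |M :: 'a set univ_module. ?good M}"
  have "submonoid ?H (V_monoid (R Quot I))"
  proof
    show "?H \<subseteq> carrier (V_monoid (R Quot I))" unfolding V_monoid_def by auto
  next
    fix A B assume "A \<in> ?H" "B \<in> ?H"
    then obtain M N :: "'a set univ_module" where M: "?good M" "A = iso_class (R Quot I) M" and N: "?good N" "B = iso_class (R Quot I) N"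
      by blast
    let ?MN = "module_sum M N"
    from M(1) N(1) have Mm: "right_module (R Quot I) M" and Nm: "right_module (R Quot I) N" by blast+
    have MN: "right_module (R Quot I) ?MN" by (rule right_module_module_sum[OF Mm Nm])
    have fg: "fin_gen (R Quot I) ?MN" by (rule fin_gen_module_sum[OF Mm Nm]) (use M(1) N(1) in blast)+
    have pr: "projective (R Quot I) ?MN" by (rule projective_module_sum) (use M(1) N(1) in blast)+
    obtain K :: "'a set univ_module" where K: "right_module (R Quot I) K" "rmod_iso (R Quot I) K ?MN"
      "rmod_iso (R Quot I) ?MN K" "iso_class (R Quot I) ?MN = iso_class (R Quot I) K"
      by (rule Q.univ_copy[OF MN fin_gen_imp_countably_gen[OF fg]])
    have Kfg: "fin_gen (R Quot I) K"
      using K(3) fin_gen_image[OF MN K(1) _ _ fg] unfolding rmod_iso_def bij_betw_def by blast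
    have Kpr: "projective (R Quot I) K" by (rule projective_iso[OF pr K(3,1)])
    obtain m u where u: "cover R I (combination T m) (restrict_scalars R I M) u" using M(1) by blast
    obtain n v where v: "cover R I (combination T n) (restrict_scalars R I N) v" using N(1) by blast
    have uv: "cover R I (module_sum (combination T m) (combination T n)) (restrict_scalars R I ?MN) (\<lambda>p. (u (fst p), v (snd p)))"
      unfolding restrict_scalars_module_sum
      by (rule cover_module_sum[OF I combination_module combination_module u v])
    obtain w where w: "cover R I (module_sum (combination T m) (combination T n)) (restrict_scalars R I K) w"
      using cover_iso[OF uv I.right_module_restrict_scalars[OF MN] right_module_module_sum[OF combination_module combination_module]
          _ I.right_module_restrict_scalars[OF K(1)]] K(3) unfolding I.restrict_scalars_iso by blast
    obtain w' where w': "cover R I (combination T (\<lambda>Q. m Q + n Q)) (restrict_scalars R I K) w'"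
      using cover_precompose[OF w right_module_module_sum[OF combination_module combination_module] combination_module I combination_add]
      by blast
    have "?good K" using K(1) Kfg Kpr w' by blast
    moreover have "A \<otimes>\<^bsub>V_monoid (R Quot I)\<^esub> B = iso_class (R Quot I) K"
      unfolding M(2) N(2) K(4)[symmetric] using Q.iso_class_add_univ[OF Mm Nm] by (simp add: V_monoid_def)
    ultimately show "A \<otimes>\<^bsub>V_monoid (R Quot I)\<^esub> B \<in> ?H" by blast
  next
    \<comment> \<open>A zero module in the universal type, with \<open>undefined\<close> as its one
      element.\<close>
    let ?Z = "\<lparr>carrier = {undefined}, mult = undefined, one = undefined, zero = undefined, add = (\<lambda>_ _. undefined),
       smult = (\<lambda>_ _. undefined)\<rparr> :: 'a set univ_module"
    have Z: "right_module (R Quot I) ?Z" by (rule right_moduleI) (auto intro: Q.ring_axioms)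
    have Zc: "carrier ?Z = {\<zero>\<^bsub>?Z\<^esub>}" by simp
    let ?F = "combination T (\<lambda>_. 0)"
    interpret F: module_ideal R ?F I by (intro module_ideal.intro combination_module I)
    \<comment> \<open>With all coefficients zero, the combination has no coordinates inside its
      summands.\<close>
    have triv: "w = \<zero>\<^bsub>?F\<^esub>" if w: "w \<in> carrier ?F" for w
      using w unfolding combination_def
      by (intro direct_sum_eqI[OF _ F.M.zero_closed[unfolded combination_def]]) (auto simp: copies_def direct_sum_carrier PiE_iff dest!: direct_sum_closed)
    have "cover R I ?F (restrict_scalars R I ?Z) (\<lambda>_. undefined)"
      unfolding cover_def
    proof (intro conjI ballI)
      show "(\<lambda>_. undefined) \<in> rmod_hom R ?F (restrict_scalars R I ?Z)" by (rule rmod_homI) auto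
      show "(\<lambda>_. undefined) ` carrier ?F = carrier (restrict_scalars R I ?Z)" using F.M.zero_closed by auto
      fix w assume "w \<in> carrier ?F"
      then have "w \<in> mod_ideal_prod ?F I" using triv F.submodule_zero[OF F.submodule_mod_ideal_prod] by simp
      then show "undefined = \<zero>\<^bsub>restrict_scalars R I ?Z\<^esub> \<longleftrightarrow> w \<in> mod_ideal_prod ?F I" by simp
    qed
    then have "?good ?Z" using Z Q.zero_module_projective[OF Z Zc] by blast
    moreover have "\<one>\<^bsub>V_monoid (R Quot I)\<^esub> = iso_class (R Quot I) ?Z"
      unfolding Q.iso_class_zero[OF Z Zc] by (simp add: V_monoid_def)
    ultimately show "\<one>\<^bsub>V_monoid (R Quot I)\<^esub> \<in> ?H" by blast
  qed
  moreover have "(\<lambda>Q. iso_class (R Quot I) (reduce_mod Q I)) ` T \<subseteq> ?H"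
  proof
    fix A assume A: "A \<in> (\<lambda>Q. iso_class (R Quot I) (reduce_mod Q I)) ` T"
    then obtain Q where Q: "Q \<in> T" "A = iso_class (R Quot I) (reduce_mod Q I)" by blast
    have "A \<in> carrier (V_monoid (R Quot I))" using gen A unfolding monoid_generated_by_def by blast
    \<comment> \<open>The carrier of the reduction of \<open>Q\<close> lies in another type. Its
      class is an element of the monoid and is therefore the class of some \<open>M\<close> in the
      universal type.\<close>
    then obtain M :: "'a set univ_module" where M: "fin_gen (R Quot I) M" "projective (R Quot I) M" "A = iso_class (R Quot I) M"
      unfolding V_monoid_def by auto
    note Mm = projective_right_module[OF M(2)]
    have "rmod_iso (R Quot I) M (reduce_mod Q I)"
      by (rule Q.iso_class_eqD[OF _ Mm]) (use M(3) Q(2) in simp)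
    then obtain p where p: "cover R I Q (restrict_scalars R I M) p"
      unfolding I.reduce_mod_iso_iff[OF T[OF Q(1)] Mm] ..
    obtain q where "cover R I (combination T (\<lambda>Q'. if Q' = Q then 1 else 0)) (restrict_scalars R I M) q"
      using cover_precompose[OF p T[OF Q(1)] combination_module I combination_single[OF Q(1)]] by blast
    then have "?good M" using M Mm by blast
    then show "A \<in> ?H" using M(3) by blast
  qed
  ultimately have "submonoid ?H (V_monoid (R Quot I)) \<and> (\<lambda>Q. iso_class (R Quot I) (reduce_mod Q I)) ` T \<subseteq> ?H" by (rule conjI)
  then have H: "?H = carrier (V_monoid (R Quot I))"
    by (rule mp[OF spec[OF conjunct2[OF gen[unfolded monoid_generated_by_def]]]])
  note rP = projective_right_module[OF P(3)]
  obtain K :: "'a set univ_module" where K: "right_module (R Quot I) K" "rmod_iso (R Quot I) K (reduce_mod P I)"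
    "rmod_iso (R Quot I) (reduce_mod P I) K"
    by (rule Q.univ_copy[OF rP fin_gen_imp_countably_gen[OF P(2)]])
  have Kfg: "fin_gen (R Quot I) K"
    using K(3) fin_gen_image[OF rP K(1) _ _ P(2)] unfolding rmod_iso_def bij_betw_def by blast
  have Kpr: "projective (R Quot I) K" by (rule projective_iso[OF P(3) K(3,1)])
  have "iso_class (R Quot I) K \<in> ?H" unfolding H V_monoid_def using Kfg Kpr by auto
  then obtain M :: "'a set univ_module" where M: "?good M" "iso_class (R Quot I) K = iso_class (R Quot I) M" by blast
  then have Mm: "right_module (R Quot I) M" by blast
  have "rmod_iso (R Quot I) M K" by (rule Q.iso_class_eqD[OF M(2)[symmetric] Mm])
  then have "rmod_iso (R Quot I) M (reduce_mod P I)" by (rule rmod_iso_trans[OF _ K(2)])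
  then obtain p where "cover R I P (restrict_scalars R I M) p"
    unfolding I.reduce_mod_iso_iff[OF P(1) Mm] ..
  moreover obtain n q where "cover R I (combination T n) (restrict_scalars R I M) q" using M(1) by blast
  ultimately show ?thesis by (rule that[OF I.right_module_restrict_scalars[OF Mm]])
qed

end

end

section \<open>Equal multiplicities from a common quotient\<close>

context semilocal_ring
begin

text \<open>Projectivity lifts the identity of \<open>W\<close> to maps \<open>f\<close> and
  \<open>g\<close> in both directions. Their composite on \<open>P\<close> is the identity modulo
  \<open>PI\<close>, a difference that homomorphisms into a module killed by \<open>I\<close> do not
  see. So a triangular system on \<open>P\<close> is carried over to \<open>F\<close>.\<close>

lemma dim_ge_common_cover:
  fixes P :: "('a, 'b, 'm) module_scheme" and F :: "('a, 'c, 'n) module_scheme"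
  assumes P: "projective R P" and F: "projective R F" and W: "right_module R W" and I: "ideal I R"
    and p: "cover R I P W p" and q: "cover R I F W q" and j: "j \<in> {1..k}"
    and kill: "\<And>a v. \<lbrakk>a \<in> I; v \<in> carrier (V j)\<rbrakk> \<Longrightarrow> a \<odot>\<^bsub>V j\<^esub> v = \<zero>\<^bsub>V j\<^esub>"
    and dim: "dim_ge R P (V j) n"
  shows "dim_ge R F (V j) n"
proof -
  note P' = projective_right_module[OF P] and F' = projective_right_module[OF F]
  obtain B :: "'b set" and y \<phi> where "dual_basis R P B y \<phi>" using projective_imp_dual_basis[OF P] by blast
  then interpret P: dual_basis R P B y \<phi> .
  obtain C :: "'c set" and z \<psi> where "dual_basis R F C z \<psi>" using projective_imp_dual_basis[OF F] by blast
  then interpret F: dual_basis R F C z \<psi> .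
  obtain f where f: "f \<in> rmod_hom R P F" "\<And>x. x \<in> carrier P \<Longrightarrow> q (f x) = p x"
    using P.lifting[OF F' W coverD(1)[OF p] coverD(1,2)[OF q]] by blast
  obtain g where g: "g \<in> rmod_hom R F P" "\<And>x. x \<in> carrier F \<Longrightarrow> p (g x) = q x"
    using F.lifting[OF P' W coverD(1)[OF q] coverD(1,2)[OF p]] by blast
  obtain h x where h: "\<And>a. a < n \<Longrightarrow> h a \<in> rmod_hom R P (V j)" and x: "\<And>a. a < n \<Longrightarrow> x a \<in> carrier P"
    and hx: "\<And>a. a < n \<Longrightarrow> h a (x a) \<noteq> \<zero>\<^bsub>V j\<^esub>" "\<And>a b. \<lbrakk>a < n; b < a\<rbrakk> \<Longrightarrow> h b (x a) = \<zero>\<^bsub>V j\<^esub>"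
    by (rule dim_geE[OF dim]) blast
  have eq: "h a (g (f z)) = h a z" if a: "a < n" and z: "z \<in> carrier P" for a z
  proof -
    interpret h: rmod_morphism R P "V j" "h a" by (rule rmod_morphismI[OF P' V_module[OF j] h[OF a]])
    have fz: "f z \<in> carrier F" and gz: "g (f z) \<in> carrier P"
      using rmod_hom_closed[OF f(1) z] rmod_hom_closed[OF g(1)] by auto
    have "p (g (f z)) = p z" using g(2)[OF fz] f(2)[OF z] by simp
    then have d: "g (f z) \<ominus>\<^bsub>P\<^esub> z \<in> mod_ideal_prod P I" using cover_eq_iff[OF p P' W gz z] by simp
    have "h a (g (f z) \<ominus>\<^bsub>P\<^esub> z) = \<zero>\<^bsub>V j\<^esub>" by (rule rmod_hom_kill[OF I P' V_module[OF j] h[OF a] kill d])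
    then show ?thesis using h.minus[OF gz z] h.N.diff_eq_zero_iff[OF h.closed[OF gz] h.closed[OF z]] by simp
  qed
  show ?thesis
  proof (rule dim_geI[where h = "\<lambda>a y. h a (g y)" and x = "\<lambda>a. f (x a)"])
    fix a assume a: "a < n"
    show "(\<lambda>y. h a (g y)) \<in> rmod_hom R F (V j)" by (rule rmod_hom_comp[OF g(1) h[OF a]])
    show "f (x a) \<in> carrier F" by (rule rmod_hom_closed[OF f(1) x[OF a]])
    show "h a (g (f (x a))) \<noteq> \<zero>\<^bsub>V j\<^esub>" unfolding eq[OF a x[OF a]] by (rule hx(1)[OF a])
    fix b assume b: "b < a"
    then have bn: "b < n" using a by simp
    show "h b (g (f (x a))) = \<zero>\<^bsub>V j\<^esub>" unfolding eq[OF bn x[OF a]] by (rule hx(2)[OF a b])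
  qed
qed

text \<open>Homomorphisms into \<open>V j\<close> vanish on \<open>B\<close> and so depend on the
  second component alone.\<close>

lemma dim_ge_module_sum_trivial:
  assumes B: "right_module R B" and F: "right_module R F" and j: "j \<in> {1..k}" "j \<notin> hom_supp B"
  shows "dim_ge R (module_sum B F) (V j) n \<longleftrightarrow> dim_ge R F (V j) n"
proof
  interpret B: right_module R B by (rule B)
  interpret F: right_module R F by (rule F)
  assume "dim_ge R (module_sum B F) (V j) n"
  then obtain h x where h: "\<And>a. a < n \<Longrightarrow> h a \<in> rmod_hom R (module_sum B F) (V j)"
    and x: "\<And>a. a < n \<Longrightarrow> x a \<in> carrier (module_sum B F)"
    and hx: "\<And>a. a < n \<Longrightarrow> h a (x a) \<noteq> \<zero>\<^bsub>V j\<^esub>" "\<And>a b. \<lbrakk>a < n; b < a\<rbrakk> \<Longrightarrow> h b (x a) = \<zero>\<^bsub>V j\<^esub>"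
    by (rule dim_geE) blast
  interpret Vj: right_module R "V j" by (rule V_module[OF j(1)])
  have eq: "h a (\<zero>\<^bsub>B\<^esub>, snd p) = h a p" if a: "a < n" and p: "p \<in> carrier (module_sum B F)" for a p
  proof -
    from p have pc: "fst p \<in> carrier B" "snd p \<in> carrier F" by auto
    have "h a (fst p, \<zero>\<^bsub>F\<^esub>) = \<zero>\<^bsub>V j\<^esub>"
      using j(2) hom_suppI[OF j(1) rmod_hom_comp[OF rmod_hom_inl[OF B F] h[OF a]] pc(1)] by blast
    moreover have "h a ((fst p, \<zero>\<^bsub>F\<^esub>) \<oplus>\<^bsub>module_sum B F\<^esub> (\<zero>\<^bsub>B\<^esub>, snd p)) = h a (fst p, \<zero>\<^bsub>F\<^esub>) \<oplus>\<^bsub>V j\<^esub> h a (\<zero>\<^bsub>B\<^esub>, snd p)"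
      by (rule rmod_hom_add[OF h[OF a]]) (use pc in auto)
    moreover have "(fst p, \<zero>\<^bsub>F\<^esub>) \<oplus>\<^bsub>module_sum B F\<^esub> (\<zero>\<^bsub>B\<^esub>, snd p) = p" using pc by simp
    moreover have "h a (\<zero>\<^bsub>B\<^esub>, snd p) \<in> carrier (V j)" by (rule rmod_hom_closed[OF h[OF a]]) (use pc in simp)
    ultimately show ?thesis by simp
  qed
  show "dim_ge R F (V j) n"
  proof (rule dim_geI[where h = "\<lambda>a y. h a (\<zero>\<^bsub>B\<^esub>, y)" and x = "\<lambda>a. snd (x a)"])
    fix a assume a: "a < n"
    show "(\<lambda>y. h a (\<zero>\<^bsub>B\<^esub>, y)) \<in> rmod_hom R F (V j)" by (rule rmod_hom_comp[OF rmod_hom_inr[OF B F] h[OF a]])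
    show "snd (x a) \<in> carrier F" using x[OF a] by auto
    show "h a (\<zero>\<^bsub>B\<^esub>, snd (x a)) \<noteq> \<zero>\<^bsub>V j\<^esub>" unfolding eq[OF a x[OF a]] by (rule hx(1)[OF a])
    fix b assume b: "b < a"
    then have bn: "b < n" using a by simp
    show "h b (\<zero>\<^bsub>B\<^esub>, snd (x a)) = \<zero>\<^bsub>V j\<^esub>" unfolding eq[OF bn x[OF a]] by (rule hx(2)[OF a b])
  qed
next
  interpret B: right_module R B by (rule B)
  assume "dim_ge R F (V j) n"
  then show "dim_ge R (module_sum B F) (V j) n"
    by (rule dim_ge_surj[OF rmod_hom_snd, rotated]) (use B.M.zero_closed in force)
qed

end

section \<open>Decomposition of a countably generated projective module\<close>

context diagonal_projectives
begin

text \<open>Supplies the infinite part of the decomposition. The \<open>i\<close>-th dimension of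
  \<open>Ps i\<close> is positive, so it becomes infinite for \<open>i \<in> X\<close>, while the
  other dimensions stay zero.\<close>

lemma omega_sum:
  assumes X: "X \<subseteq> {1..k}"
  defines "B \<equiv> direct_sum X (\<lambda>i. copies (UNIV :: nat set) (Ps i))"
  shows "projective R B" "countably_gen R B" "hom_supp B \<subseteq> X" "i \<in> X \<Longrightarrow> dim_ge R B (V i) n"
proof -
  let ?C = "\<lambda>i. copies (UNIV :: nat set) (Ps i)"
  have X': "i \<in> {1..k}" if "i \<in> X" for i using X that by blast
  have Cp: "projective R (?C i)" if "i \<in> X" for i by (rule projective_copies[OF ring_axioms Ps_projective[OF X'[OF that]]])
  have Ccg: "countably_gen R (?C i)" if "i \<in> X" for i unfolding copies_def
    by (rule countably_gen_direct_sum[OF ring_axioms Ps_module[OF X'[OF that]] _ Ps_countably_gen[OF X'[OF that]]]) simp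
  note Cm = projective_right_module[OF Cp]
  show "projective R B" unfolding B_def by (rule projective_direct_sum[OF ring_axioms Cp])
  have cX: "countable X" by (rule countable_finite[OF finite_subset[OF X finite_atLeastAtMost]])
  show "countably_gen R B" unfolding B_def
    by (rule countably_gen_direct_sum[OF ring_axioms Cm cX Ccg])
  have "hom_supp (?C i) \<subseteq> {i}" if "i \<in> X" for i
    unfolding copies_def hom_supp_direct_sum[OF Ps_module[OF X'[OF that]]] using Ps_supp[OF X'[OF that]] by blast
  moreover have "hom_supp B = (\<Union>i\<in>X. hom_supp (?C i))" unfolding B_def by (rule hom_supp_direct_sum[where M = ?C, OF Cm])
  ultimately show "hom_supp B \<subseteq> X" by blast
  assume i: "i \<in> X"
  note ik = X'[OF i]
  obtain d where d: "d > 0" "dim_vec R k V (Ps i) i = enat d" by (rule Ps_dim[OF ik])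
  have "dim_vec R k V (?C i) i = ecard (UNIV :: nat set) * enat d"
    unfolding d(2)[symmetric] by (rule dim_vec_copies[OF Ps_module[OF ik] Ps_countably_gen[OF ik] _ ik]) simp
  also have "\<dots> = \<infinity>" using d(1) by (simp add: ecard_def times_enat_def zero_enat_def)
  finally have "dim_ge R (?C i) (V i) n" using dim_vec_ge[OF Cm[OF i] Ccg[OF i] ik, of n] by simp
  moreover have "(\<lambda>f. f i) ` carrier B = carrier (?C i)"
  proof (intro equalityI subsetI)
    fix c assume c: "c \<in> carrier (?C i)"
    have "ds_single X ?C i c \<in> carrier B" unfolding B_def
      by (rule rmod_hom_closed[OF rmod_hom_ds_single[where M = ?C, OF Cm i] c])
    then show "c \<in> (\<lambda>f. f i) ` carrier B" using i by (intro image_eqI[of _ _ "ds_single X ?C i c"]) (simp_all add: ds_single_apply)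
  qed (use rmod_hom_closed[OF rmod_hom_proj[where M = ?C, OF i]] in \<open>auto simp: B_def\<close>)
  ultimately show "dim_ge R B (V i) n"
    using dim_ge_surj[OF rmod_hom_proj[where M = ?C, OF i], folded B_def] by blast
qed

theorem projective_decomposition:
  fixes P :: "('a, 'b, 'm) module_scheme" and T :: "('a, 'g) module set"
  assumes P: "projective R P" "countably_gen R P" and I: "I \<in> trace_ideals R"
    and X: "Phi R k V I = inf_supp (dim_vec R k V P)"
    and T: "finite T" "\<And>Q. Q \<in> T \<Longrightarrow> projective R Q" "\<And>Q. Q \<in> T \<Longrightarrow> countably_gen R Q"
    and gen: "monoid_generated_by (V_monoid (R Quot I)) ((\<lambda>Q. iso_class (R Quot I) (reduce_mod Q I)) ` T)"
  shows "\<exists>n. rmod_iso R P (module_sum (direct_sum (Phi R k V I) (\<lambda>i. copies (UNIV :: nat set) (Ps i))) (combination T n))"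
proof -
  note P' = projective_right_module[OF P(1)]
  define X where "X = Phi R k V I"
  have Xk: "X \<subseteq> {1..k}" unfolding X_def by (rule trace_ideals_eq(2)[OF I])
  have I_eq: "I = trace_ideal R (direct_sum X Ps)" unfolding X_def by (rule trace_ideals_eq(1)[OF I])
  have idI: "ideal I R" unfolding I_eq by (rule ideal_trace[OF projective_right_module[OF Ps_sum(1)[OF Xk]]])
  interpret I: ideal I R by (rule idI)
  from quotient_trace_fin_gen[OF P I X] obtain S where S: "finite S \<and> S \<subseteq> carrier P \<and>
    (\<forall>H x. submodule H R P \<and> S \<subseteq> H \<and> mod_ideal_prod P I \<subseteq> H \<and> x \<in> carrier P \<longrightarrow> x \<in> H)" ..
  have gS: "x \<in> H" if "submodule H R P" "S \<subseteq> H" "mod_ideal_prod P I \<subseteq> H" "x \<in> carrier P" for H x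
    using S that by presburger
  have fg: "fin_gen (R Quot I) (reduce_mod P I)"
    by (rule I.fin_gen_reduce_mod[OF P' conjunct1[OF S] conjunct1[OF conjunct2[OF S]] gS])
  have Tm: "right_module R Q" if "Q \<in> T" for Q by (rule projective_right_module[OF T(2)[OF that]])
  obtain n p q and W :: "('a, nat \<Rightarrow> 'a set) module" where
    W: "right_module R W" and p: "cover R I P W p" and q: "cover R I (combination T n) W q"
    by (rule reduce_mod_combination[OF Tm idI gen P' fg I.projective_reduce_mod[OF P(1)]])
  let ?F = "combination T n" and ?B = "direct_sum X (\<lambda>i. copies (UNIV :: nat set) (Ps i))"
  have Fp: "projective R ?F" unfolding combination_def
    by (rule projective_direct_sum[OF ring_axioms projective_copies[OF ring_axioms T(2)]])
  have Fcg: "countably_gen R ?F" unfolding combination_def copies_def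
    by (rule countably_gen_direct_sum[OF ring_axioms right_module_direct_sum[OF ring_axioms Tm] countable_finite[OF T(1)]
          countably_gen_direct_sum[OF ring_axioms Tm _ T(3)]]) simp_all
  note Fm = projective_right_module[OF Fp]
  note B = omega_sum[OF Xk]
  note Bm = projective_right_module[OF B(1)]
  let ?BF = "module_sum ?B ?F"
  have BFm: "right_module R ?BF" by (rule right_module_module_sum[OF Bm Fm])
  have BFcg: "countably_gen R ?BF" by (rule countably_gen_module_sum[OF Bm Fm B(2) Fcg])
  have "rmod_iso R P ?BF"
  proof (rule projective_iso_of_dim_vec[OF P projective_module_sum[OF B(1) Fp] BFcg])
    fix i assume i: "i \<in> {1..k}"
    have "dim_ge R P (V i) d \<longleftrightarrow> dim_ge R ?BF (V i) d" for d
    proof (cases "i \<in> X")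
      \<comment> \<open>Both dimensions are infinite here: that of \<open>P\<close> by the choice of
        \<open>X\<close>, the other because of the infinite part.\<close>
      case True
      then have inf: "dim_vec R k V P i = \<infinity>" unfolding X_def X inf_supp_def by blast
      have "dim_ge R P (V i) d" using dim_vec_ge[OF P' P(2) i, of d] unfolding inf by simp
      moreover have "dim_ge R ?BF (V i) d"
      proof (rule dim_ge_surj[OF rmod_hom_fst _ B(4)[OF True]])
        interpret F: right_module R ?F by (rule Fm)
        show "fst ` carrier ?BF = carrier ?B" using F.M.zero_closed by force
      qed
      ultimately show ?thesis by blast
    next
      \<comment> \<open>Outside \<open>X\<close> the ideal \<open>I\<close> annihilates
        \<open>V i\<close>, so the common reduction modulo \<open>I\<close> determines the
        multiplicity, and the infinite part contributes nothing.\<close>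
      case False
      have nB: "i \<notin> hom_supp ?B" using B(3) False by blast
      have nX: "i \<notin> hom_supp (direct_sum X Ps)" unfolding Ps_sum(3)[OF Xk] by (rule False)
      have kill: "a \<odot>\<^bsub>V i\<^esub> v = \<zero>\<^bsub>V i\<^esub>" if "a \<in> I" "v \<in> carrier (V i)" for a v
        by (rule trace_kills_simple[OF projective_right_module[OF Ps_sum(1)[OF Xk]] i nX that[unfolded I_eq]])
      have "dim_ge R P (V i) d \<longleftrightarrow> dim_ge R ?F (V i) d"
        using dim_ge_common_cover[OF P(1) Fp W idI p q i kill] dim_ge_common_cover[OF Fp P(1) W idI q p i kill] by blast
      then show ?thesis unfolding dim_ge_module_sum_trivial[OF Bm Fm i nB] .
    qed
    then show "dim_vec R k V P i = dim_vec R k V ?BF i"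
      by (intro enat_eqI) (simp only: dim_vec_ge[OF P' P(2) i] dim_vec_ge[OF BFm BFcg i])
  qed
  then show ?thesis unfolding X_def by blast
qed

end

section \<open>Generators of the monoid of countably generated projective modules\<close>

context ring
begin

text \<open>Induction over \<open>T\<close>: the empty sum is the unit of the monoid, and each
  further summand is split off as a sum of two modules.\<close>

lemma Vstar_class_direct_sum:
  assumes H: "submonoid H (Vstar_monoid R)" and "finite T"
    and "\<And>t. t \<in> T \<Longrightarrow> right_module R (M t)" "\<And>t. t \<in> T \<Longrightarrow> countably_gen R (M t)" "\<And>t. t \<in> T \<Longrightarrow> iso_class R (M t) \<in> H"
  shows "iso_class R (direct_sum T M) \<in> H"
  using assms(2-)
proof (induct T)
  case empty
  have "right_module R (direct_sum {} M)" by (rule right_module_direct_sum[OF ring_axioms]) simp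
  from iso_class_zero[OF this direct_sum_empty_carrier] show ?case
    using submonoid.one_closed[OF H] by (simp add: Vstar_monoid_def)
next
  case (insert t T)
  note m = insert.prems(1) and cg = insert.prems(2)
  have T: "right_module R (direct_sum T M)" by (rule right_module_direct_sum[OF ring_axioms m]) simp
  have Tcg: "countably_gen R (direct_sum T M)"
    by (rule countably_gen_direct_sum[OF ring_axioms m countable_finite[OF insert.hyps(1)] cg]) simp_all
  have ins: "right_module R (direct_sum (insert t T) M)" by (rule right_module_direct_sum[OF ring_axioms m])
  have "iso_class R (direct_sum (insert t T) M) = iso_class R (module_sum (M t) (direct_sum T M))"
    by (rule iso_class_cong[OF direct_sum_insert_iso[OF m insert.hyps(2)] ins])
  also have "\<dots> = iso_class R (M t) \<otimes>\<^bsub>Vstar_monoid R\<^esub> iso_class R (direct_sum T M)"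
    using iso_class_add[OF m[OF insertI1] cg[OF insertI1] T Tcg] by (simp add: Vstar_monoid_def)
  also have "\<dots> \<in> H"
    by (rule submonoid.m_closed[OF H insert.prems(3)[OF insertI1] insert.hyps(3)]) (use insert.prems in auto)
  finally show ?case .
qed

lemma Vstar_class_carrier:
  assumes P: "projective R P" "countably_gen R P"
  shows "iso_class R P \<in> carrier (Vstar_monoid R)"
proof -
  obtain Q :: "'a univ_module" where Q: "right_module R Q" "rmod_iso R Q P" "rmod_iso R P Q" "countably_gen R Q" "iso_class R P = iso_class R Q"
    by (rule univ_copy[OF projective_right_module[OF P(1)] P(2)])
  have "projective R Q" by (rule projective_iso[OF P(1) Q(3,1)])
  then show ?thesis unfolding Q(5) Vstar_monoid_def using Q(4) by auto
qed

end

theorem theorem4p5: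
  fixes R :: "('a, 'r) ring_scheme"
    and k :: nat
    and V :: "nat \<Rightarrow> ('a, 'v) module"
    and Ps :: "nat \<Rightarrow> ('a, 'p) module"
    and G :: "'a set \<Rightarrow> ('a, 'g) module set"
  assumes "semi_semiperfect R"
    and "simple_representatives R k V"
    and "\<forall>i\<in>{1..k}. fin_gen R (Ps i) \<and> projective R (Ps i) \<and>
           Phi R k V (trace_ideal R (Ps i)) = {i}"
    and "\<forall>J\<in>trace_ideals R. finite (G J) \<and>
           (\<forall>Q\<in>G J. countably_gen R Q \<and> projective R Q) \<and>
           monoid_generated_by (V_monoid (R Quot J))
             ((\<lambda>Q. iso_class (R Quot J) (reduce_mod Q J)) ` G J)"
  shows "(\<forall>(P :: ('a, 'b) module) X I.
            countably_gen R P \<and> projective R P \<and> X = inf_supp (dim_vec R k V P) \<and>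
            I \<in> trace_ideals R \<and> Phi R k V I = X \<longrightarrow>
            (\<exists>n :: ('a, 'g) module \<Rightarrow> nat.
               rmod_iso R P
                 (module_sum (direct_sum X (\<lambda>i. copies (UNIV :: nat set) (Ps i)))
                       (direct_sum (G I) (\<lambda>Q. copies {..<n Q} Q))))) \<and>
         (let S = (\<lambda>i. iso_class R (copies (UNIV :: nat set) (Ps i))) ` {1..k} \<union>
                  (\<Union>I\<in>trace_ideals R. iso_class R ` G I)
          in finite S \<and> monoid_generated_by (Vstar_monoid R) S)"
proof -
  have sl: "semilocal R" using assms(1) by (simp add: semi_semiperfect_def)
  then interpret R: ring R by (simp add: semilocal_def)
  interpret diagonal_projectives R k V Ps
    by unfold_locales (use sl assms(2,3) in blast)+
  have G: "finite (G I)" "Q \<in> G I \<Longrightarrow> projective R Q" "Q \<in> G I \<Longrightarrow> countably_gen R Q"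
    "monoid_generated_by (V_monoid (R Quot I)) ((\<lambda>Q. iso_class (R Quot I) (reduce_mod Q I)) ` G I)"
    if "I \<in> trace_ideals R" for I Q
    using assms(4) that by blast+
  \<comment> \<open>Stated for modules of an arbitrary type, because it is applied to the given
    \<open>P\<close> and also to representatives in the universal type.\<close>
  have decomposition: "\<exists>n. rmod_iso R P (module_sum (direct_sum (Phi R k V I) (\<lambda>i. copies (UNIV :: nat set) (Ps i))) (combination (G I) n))"
    if "projective R P" "countably_gen R P" "I \<in> trace_ideals R" "Phi R k V I = inf_supp (dim_vec R k V P)"
    for P :: "('a, 'x) module" and I
    by (rule projective_decomposition[OF that G(1)[OF that(3)] G(2)[OF that(3)] G(3)[OF that(3)] G(4)[OF that(3)]])
  have omega: "projective R (copies (UNIV :: nat set) (Ps i))" "countably_gen R (copies (UNIV :: nat set) (Ps i))" if "i \<in> {1..k}" for i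
  proof -
    show "projective R (copies (UNIV :: nat set) (Ps i))" by (rule projective_copies[OF R.ring_axioms Ps_projective[OF that]])
    show "countably_gen R (copies (UNIV :: nat set) (Ps i))" unfolding copies_def
      by (rule countably_gen_direct_sum[OF R.ring_axioms Ps_module[OF that] _ Ps_countably_gen[OF that]]) simp
  qed
  let ?S = "(\<lambda>i. iso_class R (copies (UNIV :: nat set) (Ps i))) ` {1..k} \<union> (\<Union>I\<in>trace_ideals R. iso_class R ` G I)"
  have "finite ?S" using finite_trace_ideals G(1) by blast
  moreover have "monoid_generated_by (Vstar_monoid R) ?S"
    unfolding monoid_generated_by_def
  proof (intro conjI allI impI)
    show "?S \<subseteq> carrier (Vstar_monoid R)"
    proof
      fix A assume "A \<in> ?S"
      then consider i where "i \<in> {1..k}" "A = iso_class R (copies (UNIV :: nat set) (Ps i))"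
        | I Q where "I \<in> trace_ideals R" "Q \<in> G I" "A = iso_class R Q" by blast
      then show "A \<in> carrier (Vstar_monoid R)"
      proof cases
        case 1
        show ?thesis unfolding 1(2) by (rule R.Vstar_class_carrier[OF omega[OF 1(1)]])
      next
        case 2
        show ?thesis unfolding 2(3) by (rule R.Vstar_class_carrier[OF G(2,3)[OF 2(1,2)]])
      qed
    qed
    fix H assume "submonoid H (Vstar_monoid R) \<and> ?S \<subseteq> H"
    then have H: "submonoid H (Vstar_monoid R)" and SH: "?S \<subseteq> H" by blast+
    have "A \<in> H" if "A \<in> carrier (Vstar_monoid R)" for A
    proof -
      obtain P :: "'a univ_module" where P: "projective R P" "countably_gen R P" "A = iso_class R P"
        using \<open>A \<in> carrier (Vstar_monoid R)\<close> unfolding Vstar_monoid_def by auto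
      note P' = projective_right_module[OF P(1)]
      define X where "X = inf_supp (dim_vec R k V P)"
      have Xk: "X \<subseteq> {1..k}"
      proof
        fix i assume i: "i \<in> X"
        show "i \<in> {1..k}"
        proof (rule ccontr)
          assume "i \<notin> {1..k}"
          from dim_vec_outside[OF P' P(2) this] show False using i unfolding X_def inf_supp_def by simp
        qed
      qed
      \<comment> \<open>The trace of the sum of the \<open>Ps i\<close> over \<open>X\<close> is the
        trace ideal whose value under \<open>Phi\<close> is \<open>X\<close>.\<close>
      define I where "I = trace_ideal R (direct_sum X Ps)"
      have I: "I \<in> trace_ideals R" "Phi R k V I = X" unfolding I_def by (rule Ps_sum_trace[OF Xk])+
      let ?B = "direct_sum X (\<lambda>i. copies (UNIV :: nat set) (Ps i))"
      obtain n where n: "rmod_iso R P (module_sum ?B (combination (G I) n))"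
        using decomposition[OF P(1,2) I(1) I(2)[unfolded X_def]] unfolding I(2) by blast
      let ?F = "combination (G I) n"
      note Gm = projective_right_module[OF G(2)[OF I(1)]]
      have cm: "right_module R (copies {..<n Q} Q)" if "Q \<in> G I" for Q unfolding copies_def
        by (rule right_module_direct_sum[OF R.ring_axioms Gm[OF that]])
      have ccg: "countably_gen R (copies {..<n Q} Q)" if "Q \<in> G I" for Q unfolding copies_def
        by (rule countably_gen_direct_sum[OF R.ring_axioms Gm[OF that] _ G(3)[OF I(1) that]]) simp
      \<comment> \<open>The multiple of \<open>Q\<close> is a finite direct sum of copies of
        \<open>Q\<close>, whose class is one of the generators.\<close>
      have cH: "iso_class R (copies {..<n Q} Q) \<in> H" if "Q \<in> G I" for Q unfolding copies_def
        by (rule R.Vstar_class_direct_sum[OF H finite_lessThan Gm[OF that] G(3)[OF I(1) that]]) (use SH I(1) that in blast)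
      have FH: "iso_class R ?F \<in> H" unfolding combination_def
        by (rule R.Vstar_class_direct_sum[OF H G(1)[OF I(1)] cm ccg cH])
      have Fm: "right_module R ?F" unfolding combination_def by (rule right_module_direct_sum[OF R.ring_axioms cm])
      have Fcg: "countably_gen R ?F" unfolding combination_def
        by (rule countably_gen_direct_sum[OF R.ring_axioms cm countable_finite[OF G(1)[OF I(1)]] ccg])
      have Xi: "i \<in> {1..k}" if "i \<in> X" for i using Xk that by blast
      have BHi: "iso_class R (copies (UNIV :: nat set) (Ps i)) \<in> H" if "i \<in> X" for i
        using Xi[OF that] by (intro subsetD[OF SH] UnI1 imageI)
      have BH: "iso_class R ?B \<in> H"
        by (rule R.Vstar_class_direct_sum[OF H finite_subset[OF Xk finite_atLeastAtMost]
              projective_right_module[OF omega(1)[OF Xi]] omega(2)[OF Xi] BHi])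
      note B = omega_sum[OF Xk]
      have "A = iso_class R (module_sum ?B ?F)" unfolding P(3) by (rule R.iso_class_cong[OF n P'])
      also have "\<dots> = iso_class R ?B \<otimes>\<^bsub>Vstar_monoid R\<^esub> iso_class R ?F"
        using R.iso_class_add[OF projective_right_module[OF B(1)] B(2) Fm Fcg] by (simp add: Vstar_monoid_def)
      also have "\<dots> \<in> H" by (rule submonoid.m_closed[OF H BH FH])
      finally show ?thesis .
    qed
    then show "H = carrier (Vstar_monoid R)" using submonoid.subset[OF H] by blast
  qed
  ultimately have gen: "let S = ?S in finite S \<and> monoid_generated_by (Vstar_monoid R) S" unfolding Let_def by (rule conjI)
  show ?thesis
  proof (rule conjI[OF _ gen], intro allI impI, elim conjE)
    fix P :: "('a, 'b) module" and X I
    assume P: "countably_gen R P" "projective R P" and X: "X = inf_supp (dim_vec R k V P)"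
      and I: "I \<in> trace_ideals R" "Phi R k V I = X"
    show "\<exists>n :: ('a, 'g) module \<Rightarrow> nat. rmod_iso R P (module_sum (direct_sum X (\<lambda>i. copies (UNIV :: nat set) (Ps i)))
        (direct_sum (G I) (\<lambda>Q. copies {..<n Q} Q)))"
      using decomposition[OF P(2,1) I(1) I(2)[unfolded X]] unfolding combination_def I(2)[unfolded X] X .
  qed
qed

end
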